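(* Let $f(z)=\sum_{k=0}^\infty a_k z^k$ with $\{a_k\}_{k\ge 0}$ i.i.d. real standard Gaussian random variables, and for $n\ge 1$ let $\rho_n$ be the $n$-point correlation function of the real zeros of $f$ in $(-1,1)$. Then for every $n\ge 1$ and all $-1<t_1,\dots,t_n<1$, $$\rho_n(t_1,\dots,t_n)=\pi^{-n}\,\mathrm{Pf}\,(\mathbb{K}(t_i,t_j))_{i,j=1}^n .$$
   Context: The series $f$ converges almost surely on the open unit disc. The $n$-point correlation function of a point process on $(-1,1)$ is the density, with respect to Lebesgue measure on $(-1,1)^n$, of its $n$-th factorial moment measure; i.e. for pairwise disjoint Borel sets $B_1,\dots,B_n\subset(-1,1)$, $E[\prod_i N(B_i)]=\int_{B_1\times\cdots\times B_n}\rho_n$, where $N(B)$ is the number of points in $B$ (the continuous version is taken). The $2\times2$ matrix kernel $\mathbb{K}(s,t)=\begin{pmatrix}\mathbb{K}_{11}(s,t)&\mathbb{K}_{12}(s,t)\\ \mathbb{K}_{21}(s,t)&\mathbb{K}_{22}(s,t)\end{pmatrix}$, $-1<s,t<1$, is given by $\mathbb{K}_{11}(s,t)=\frac{s-t}{\sqrt{(1-s^2)(1-t^2)}\,(1-st)^2}$, $\mathbb{K}_{12}(s,t)=\sqrt{\frac{1-t^2}{1-s^2}}\,\frac{1}{1-st}$, $\mathbb{K}_{21}(s,t)=-\sqrt{\frac{1-s^2}{1-t^2}}\,\frac{1}{1-st}$, $\mathbb{K}_{22}(s,t)=\mathrm{sgn}(t-s)\arcsin c(s,t)$, where $c(s,t)=\frac{\sqrt{(1-s^2)(1-t^2)}}{1-st}$,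 $\mathrm{sgn}(x)=x/|x|$ for $x\ne0$ and $\mathrm{sgn}(0)=0$. The matrix $(\mathbb{K}(t_i,t_j))_{i,j=1}^n$ is the $2n\times 2n$ skew-symmetric matrix whose $(i,j)$ block of size $2\times 2$ is $\mathbb{K}(t_i,t_j)$. The Pfaffian of a $2n\times2n$ skew-symmetric matrix $B=(b_{ij})$ is $\mathrm{Pf}(B)=\sum_\eta\epsilon(\eta)\,b_{\eta(1)\eta(2)}\cdots b_{\eta(2n-1)\eta(2n)}$, summed over permutations $\eta$ of $\{1,\dots,2n\}$ with $\eta(2i-1)<\eta(2i)$ for all $i$ and $\eta(1)<\eta(3)<\cdots<\eta(2n-1)$, where $\epsilon(\eta)$ is the signature. *)

theory Defs
  imports "HOL-Probability.Probability" "HOL-Combinatorics.Permutations"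
begin

definition random_series :: "(nat \<Rightarrow> 'w \<Rightarrow> real) \<Rightarrow> 'w \<Rightarrow> complex \<Rightarrow> complex" where
  "random_series a \<omega> z = (\<Sum>k. of_real (a k \<omega>) * z ^ k)"

definition real_zeros :: "(nat \<Rightarrow> 'w \<Rightarrow> real) \<Rightarrow> 'w \<Rightarrow> real set" where
  "real_zeros a \<omega> = {x \<in> {-1<..<1}. random_series a \<omega> (of_real x) = 0}"

text \<open>The number of points is taken in the extended nonnegative reals, because a Borel set
  reaching the boundary of the interval may contain infinitely many points.\<close>

definition num_points :: "('w \<Rightarrow> real set) \<Rightarrow> real set \<Rightarrow> 'w \<Rightarrow> ennreal" where
  "num_points Z B \<omega> = emeasure (count_space UNIV) (Z \<omega> \<inter> B)"

text \<open>The cube is realised as a set of functions that are \<open>undefined\<close> off \<open>{1..n}\<close>, the points of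
  the product measure below; its topology as a subspace of \<^typ>\<open>nat \<Rightarrow> real\<close> is the usual one.\<close>

abbreviation open_cube :: "nat \<Rightarrow> (nat \<Rightarrow> real) set" where
  "open_cube n \<equiv> {1..n} \<rightarrow>\<^sub>E {-1<..<1}"

text \<open>\<open>\<rho>\<close> is the continuous version of the density, so it is determined on the whole cube and not
  only almost everywhere. The numbers of points are random variables up to null sets: nothing
  is required on the null set where the process may be ill behaved (for zeros of a random series,
  where the series diverges), hence the completion.\<close>

definition is_correlation_function ::
    "'w measure \<Rightarrow> ('w \<Rightarrow> real set) \<Rightarrow> nat \<Rightarrow> ((nat \<Rightarrow> real) \<Rightarrow> real) \<Rightarrow> bool" where
  "is_correlation_function M Z n \<rho> \<longleftrightarrow>
     (\<forall>B \<in> sets borel. B \<subseteq> {-1<..<1} \<longrightarrow> num_points Z B \<in> borel_measurable (completion M)) \<and>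
     continuous_on (open_cube n) \<rho> \<and>
     (\<forall>x \<in> open_cube n. 0 \<le> \<rho> x) \<and>
     (\<forall>B. (\<forall>i \<in> {1..n}. B i \<in> sets borel \<and> B i \<subseteq> {-1<..<1}) \<and> disjoint_family_on B {1..n} \<longrightarrow>
        (\<integral>\<^sup>+ \<omega>. (\<Prod>i = 1..n. num_points Z (B i) \<omega>) \<partial>M) =
        (\<integral>\<^sup>+ x \<in> Pi\<^sub>E {1..n} B. ennreal (\<rho> x) \<partial>(\<Pi>\<^sub>M i \<in> {1..n}. lborel)))"

definition c_fun :: "real \<Rightarrow> real \<Rightarrow> real" where
  "c_fun s t = sqrt ((1 - s\<^sup>2) * (1 - t\<^sup>2)) / (1 - s * t)"

definition kernel_K :: "real \<Rightarrow> real \<Rightarrow> real ^ 2 ^ 2" where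
  "kernel_K s t = vector
     [vector [(s - t) / (sqrt ((1 - s\<^sup>2) * (1 - t\<^sup>2)) * (1 - s * t)\<^sup>2),
              sqrt ((1 - t\<^sup>2) / (1 - s\<^sup>2)) * (1 / (1 - s * t))],
      vector [- sqrt ((1 - s\<^sup>2) / (1 - t\<^sup>2)) * (1 / (1 - s * t)),
              sgn (t - s) * arcsin (c_fun s t)]]"

text \<open>Square matrices of varying size are functions of two indices, with rows and columns
  numbered from 1. Row \<open>p\<close> of a matrix of \<open>2 \<times> 2\<close> blocks lies in block row \<open>(p + 1) div 2\<close>, and is
  the first or second row of that block according to the parity of \<open>p\<close>; likewise for columns.\<close>

definition block_matrix :: "(nat \<Rightarrow> nat \<Rightarrow> real ^ 2 ^ 2) \<Rightarrow> nat \<Rightarrow> nat \<Rightarrow> real" where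
  "block_matrix A p q =
     A ((p + 1) div 2) ((q + 1) div 2) $ (if odd p then 1 else 2) $ (if odd q then 1 else 2)"

definition pfaffian :: "nat \<Rightarrow> (nat \<Rightarrow> nat \<Rightarrow> real) \<Rightarrow> real" where
  "pfaffian n b =
     (\<Sum>\<eta> | \<eta> permutes {1..2 * n} \<and>
           (\<forall>i \<in> {1..n}. \<eta> (2 * i - 1) < \<eta> (2 * i)) \<and>
           (\<forall>i \<in> {1..<n}. \<eta> (2 * i - 1) < \<eta> (2 * i + 1)).
        of_int (sign \<eta>) * (\<Prod>i = 1..n. b (\<eta> (2 * i - 1)) (\<eta> (2 * i))))"

end

theory Submission
  imports Defs "HOL-Complex_Analysis.Complex_Analysis" "HOL-Real_Asymp.Real_Asymp"
begin

text \<open>On \<open>(-1, 1)\<close> the series \<open>f\<close> is a centred Gaussian process with covariance \<open>1/(1 - st)\<close>.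
  Conditioning on \<open>f x\<close> splits off a multiple of an independent normal variable and leaves a
  Blaschke multiple of \<open>f\<close>. This self-similarity gives differential equations for
  \<open>E (sgn f(s\<^sub>1) \<cdots> sgn f(s\<^sub>2\<^sub>n))\<close>, whose solution is, up to sign, \<open>(2/\<pi>)\<^sup>n\<close> times the Pfaffian of
  \<open>sgn(s\<^sub>j - s\<^sub>i) arcsin c(s\<^sub>i, s\<^sub>j)\<close>. The factor \<open>(1 - sgn f(t\<^sub>i) sgn f(u\<^sub>i))/2\<close> detects a sign change
  on a short interval from \<open>t\<^sub>i\<close> to \<open>u\<^sub>i\<close>; differentiating the Pfaffian once in each \<open>t\<^sub>i\<close> turns the
  arcsines into the entries of \<open>the kernel\<close> and yields the density. As almost surely all zeros are simple,
  the sign changes on finer and finer partitions count the zeros of disjoint intervals, and a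
  Dynkin argument passes to Borel sets.\<close>

section \<open>Pfaffians\<close>

text \<open>Differentiating a sign correlation in a point \<open>x\<close> localises at a zero
  there, where self-similarity turns the slope into a multiple of a fresh value \<open>f(x)\<close>.
  Gaussian integration by parts against the other signs spreads \<open>f(x)\<close> over the points
  \<open>k\<close>, each term localised at a zero at \<open>k\<close>; conditioning on that zero
  returns the correlation with \<open>x\<close> and \<open>k\<close> removed. This is the expansion
  of a Pfaffian along its first row, which is why Pfaffians are treated as recursive functions on
  lists. Integration constants come from the collapse of two equal points, where arcsin 1 cancels
  the jump, and from the decorrelation at -1. The kernel is one function with its derivatives:
  \<open>k12\<close> is the derivative of \<open>k22\<close> in the first variable,
  \<open>k11\<close> the mixed second derivative. The factor \<pi>^(-n) is (1/2)^n from the sign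
  change detectors times (2/\<pi>)^n. The diagonal is the obstacle throughout:
  \<open>arcsin c\<close> has a kink there and \<open>k22\<close> a jump. Hence derivatives are
  taken at interior points of disjoint cells whose order prescribes all signs, and coincident
  coordinates are reached only by continuity.\<close>

definition del :: "nat \<Rightarrow> 'a list \<Rightarrow> 'a list" where
  "del k xs = take k xs @ drop (Suc k) xs"

lemma length_del [simp]: "k < length xs \<Longrightarrow> length (del k xs) = length xs - 1"
  by (simp add: del_def)

lemma nth_del: "k < length xs \<Longrightarrow> i < length xs - 1 \<Longrightarrow> del k xs ! i = xs ! (if i < k then i else Suc i)"
  by (auto simp: del_def nth_append)

lemma set_del_subset: "set (del k xs) \<subseteq> set xs"
  using set_take_subset[of k xs] set_drop_subset[of "Suc k" xs] by (auto simp: del_def)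

lemma distinct_del: "distinct xs \<Longrightarrow> distinct (del k xs)"
  unfolding del_def distinct_append
  using set_take_disj_set_drop_if_distinct[of xs k "Suc k"] by simp

lemma set_del: "distinct xs \<Longrightarrow> k < length xs \<Longrightarrow> set (del k xs) = set xs - {xs ! k}"
proof -
  assume a: "distinct xs" "k < length xs"
  then have xs: "xs = take k xs @ xs ! k # drop (Suc k) xs" by (simp add: id_take_nth_drop)
  then have "distinct (take k xs @ xs ! k # drop (Suc k) xs)" "set xs = set (take k xs @ xs ! k # drop (Suc k) xs)"
    using a by simp_all
  then show ?thesis by (auto simp: del_def)
qed

lemma del_del:
  assumes "l < k" "k < length xs"
  shows "del l (del k xs) = del (k - 1) (del l xs)"
  using assms by (intro nth_equalityI) (auto simp: nth_del)

text \<open>The labels may be of any type, so that rows can be points, block indices or pairs of a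
  cell and a flag. Only entries of an earlier against a later label occur, and on a list of odd
  length the recursion yields 0.\<close>

function pfl :: "('i \<Rightarrow> 'i \<Rightarrow> real) \<Rightarrow> 'i list \<Rightarrow> real" where
  "pfl b [] = 1"
| "pfl b (x # xs) = (\<Sum>k<length xs. (-1) ^ k * b x (xs ! k) * pfl b (del k xs))"
  by pat_completeness auto
termination
  by (relation "Wellfounded.measure (\<lambda>(b, xs). length xs)") auto

text \<open>Compares label lists of different types; this is how rows given by points, by numbers
  and by pairs are identified with each other.\<close>

lemma pfl_cong_nth:
  assumes "length xs = length ys"
    and "\<And>i j. i < length xs \<Longrightarrow> j < length xs \<Longrightarrow> b (xs ! i) (xs ! j) = c (ys ! i) (ys ! j)"
  shows "pfl b xs = pfl c ys"
  using assms
proof (induction "length xs" arbitrary: xs ys rule: less_induct)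
  case less
  show ?case
  proof (cases xs)
    case Nil
    with less.prems show ?thesis by simp
  next
    case (Cons x xs')
    then obtain y ys' where ys: "ys = y # ys'" using less.prems(1) by (cases ys) auto
    have len: "length xs' = length ys'" using less.prems(1) Cons ys by simp
    have "pfl b (del k xs') = pfl c (del k ys')" if "k < length xs'" for k
    proof (rule less.hyps)
      fix i j assume ij: "i < length (del k xs')" "j < length (del k xs')"
      show "b (del k xs' ! i) (del k xs' ! j) = c (del k ys' ! i) (del k ys' ! j)"
        using ij that len less.prems(2)[of "Suc (if i < k then i else Suc i)" "Suc (if j < k then j else Suc j)"]
        by (auto simp: nth_del Cons ys split: if_splits)
    qed (use that len Cons in auto)
    moreover have "b x (xs' ! k) = c y (ys' ! k)" if "k < length xs'" for k
      using less.prems(2)[of 0 "Suc k"] that by (simp add: Cons ys)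
    ultimately show ?thesis by (simp add: Cons ys len cong: sum.cong_simp)
  qed
qed

lemma pfl_map: "pfl b (map g xs) = pfl (\<lambda>i j. b (g i) (g j)) xs"
  by (rule pfl_cong_nth) auto

text \<open>Expanding twice leaves a sum over ordered pairs of partners for the first two rows;
  exchanging the rows amounts to exchanging the partners.\<close>

lemma pfl_swap_hd:
  assumes "\<And>p q. b p q = - b q p"
  shows "pfl b (x # y # qs) = - pfl b (y # x # qs)"
proof -
  define N where "N = length qs"
  define T where "T x y = (\<Sum>(k,l)\<in>{..<N} \<times> {..<N - 1}. (-1) ^ (k + l) * b x (qs ! k) * b y (del k qs ! l) * pfl b (del l (del k qs)))" for x y
  have expand: "pfl b (x # y # qs) = b x y * pfl b qs - T x y" for x y
  proof -
    have "pfl b (x # y # qs) = b x y * pfl b qs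
        + (\<Sum>k<N. (-1) ^ Suc k * b x (qs ! k) * pfl b (y # del k qs))"
      by (subst pfl.simps) (simp add: sum.lessThan_Suc_shift del_def N_def del: pfl.simps sum.lessThan_Suc)
    also have "(\<Sum>k<N. (-1) ^ Suc k * b x (qs ! k) * pfl b (y # del k qs)) = - T x y"
      unfolding T_def sum.cartesian_product[symmetric] sum_negf[symmetric]
      by (intro sum.cong refl)
         (simp add: N_def sum_distrib_left sum_negf power_add mult_ac)
    finally show ?thesis by simp
  qed
  \<comment> \<open>\<open>l\<close> counts positions after the deletion at \<open>k\<close>, so
    exchanging the two partners shifts one index by one. This changes the parity of
    \<open>k + l\<close> and produces the sign.\<close>
  define f where "f = (\<lambda>(k,l). if l < k then (l, k - 1) else (Suc l, k :: nat))"
  have "T x y = - T y x"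
    unfolding T_def sum_negf[symmetric]
  proof (rule sum.reindex_bij_witness[of _ f f])
    fix p assume p: "p \<in> {..<N} \<times> {..<N - 1}"
    then obtain k l where kl: "p = (k, l)" "k < N" "l < N - 1" by auto
    show "f (f p) = p" "f (f p) = p" using kl by (auto simp: f_def)
    show "f p \<in> {..<N} \<times> {..<N - 1}" "f p \<in> {..<N} \<times> {..<N - 1}" using kl by (auto simp: f_def)
    show "- (case f p of (k, l) \<Rightarrow> (-1) ^ (k + l) * b y (qs ! k) * b x (del k qs ! l) * pfl b (del l (del k qs)))
        = (case p of (k, l) \<Rightarrow> (-1) ^ (k + l) * b x (qs ! k) * b y (del k qs ! l) * pfl b (del l (del k qs)))"
    proof (cases "l < k")
      case True
      then obtain k' where "k = Suc k'" by (cases k) auto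
      then show ?thesis using kl True del_del[of l k qs] by (auto simp: f_def nth_del N_def add.commute)
    next
      case False
      then show ?thesis using kl del_del[of k "Suc l" qs] by (auto simp: f_def nth_del N_def add.commute)
    qed
  qed
  then show ?thesis unfolding expand using assms[of x y] by simp
qed

lemma del_append:
  "del k (ps @ qs) = (if k < length ps then del k ps @ qs else ps @ del (k - length ps) qs)"
  by (auto simp: del_def Suc_diff_le)

text \<open>Expansion along the first row, reindexed by the transposition of the two positions: a
  term whose partner is neither of them changes sign by induction, while the two remaining terms
  trade places and their factors \<open>(-1) ^ k\<close> differ in sign.\<close>

lemma pfl_swap:
  assumes skew: "\<And>p q. b p q = - b q p"
  shows "pfl b (ps @ x # y # qs) = - pfl b (ps @ y # x # qs)"
proof (induction "length ps + length qs" arbitrary: ps qs rule: less_induct)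
  case less
  show ?case
  proof (cases ps)
    case Nil
    show ?thesis unfolding Nil append_Nil by (rule pfl_swap_hd[OF skew])
  next
    case (Cons p ps')
    define m where "m = length ps'"
    define L where "L = length (ps' @ x # y # qs)"
    define \<tau> where "\<tau> = Transposition.transpose m (Suc m)"
    let ?g = "\<lambda>x y k. (-1) ^ k * b p ((ps' @ x # y # qs) ! k) * pfl b (del k (ps' @ x # y # qs))"
    have "pfl b (p # ps' @ x # y # qs) = (\<Sum>k<L. ?g x y k)"
      by (simp only: L_def pfl.simps)
    also have "\<dots> = (\<Sum>k<L. - ?g y x k)"
    proof (rule sum.reindex_bij_witness[of _ \<tau> \<tau>])
      fix k assume k: "k \<in> {..<L}"
      show "\<tau> (\<tau> k) = k" "\<tau> (\<tau> k) = k" by (simp_all add: \<tau>_def)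
      show "\<tau> k \<in> {..<L}" "\<tau> k \<in> {..<L}" using k by (auto simp: \<tau>_def Transposition.transpose_def L_def m_def)
      consider "k < m" | "k = m" | "k = Suc m" | "k > Suc m" by linarith
      then show "- ?g y x (\<tau> k) = ?g x y k"
      proof cases
        case 1
        have \<tau>k: "\<tau> k = k" using 1 by (simp add: \<tau>_def Transposition.transpose_def)
        have del: "del k (ps' @ x # y # qs) = del k ps' @ x # y # qs" for x y
          using 1 by (simp add: m_def del_append)
        have nth: "(ps' @ x # y # qs) ! k = ps' ! k" for x y
          using 1 by (simp add: m_def nth_append)
        have "pfl b (del k ps' @ x # y # qs) = - pfl b (del k ps' @ y # x # qs)"
          using 1 by (intro less.hyps) (simp add: Cons m_def)
        then show ?thesis unfolding \<tau>k del nth by (simp del: pfl.simps)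
      next
        case 2
        have \<tau>k: "\<tau> k = Suc m" using 2 by (simp add: \<tau>_def)
        have "del k (ps' @ x # y # qs) = ps' @ y # qs" "del (Suc m) (ps' @ y # x # qs) = ps' @ y # qs"
          using 2 by (simp_all add: m_def del_append del_def)
        moreover have "(ps' @ x # y # qs) ! k = x" "(ps' @ y # x # qs) ! Suc m = x"
          using 2 by (simp_all add: m_def nth_append)
        ultimately show ?thesis unfolding \<tau>k using 2 by (simp del: pfl.simps)
      next
        case 3
        have \<tau>k: "\<tau> k = m" using 3 by (simp add: \<tau>_def)
        have "del k (ps' @ x # y # qs) = ps' @ x # qs" "del m (ps' @ y # x # qs) = ps' @ x # qs"
          using 3 by (simp_all add: m_def del_append del_def)
        moreover have "(ps' @ x # y # qs) ! k = y" "(ps' @ y # x # qs) ! m = y"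
          using 3 by (simp_all add: m_def nth_append)
        ultimately show ?thesis unfolding \<tau>k using 3 by (simp del: pfl.simps)
      next
        case 4
        have \<tau>k: "\<tau> k = k" using 4 by (simp add: \<tau>_def Transposition.transpose_def)
        obtain j where j: "k = Suc (Suc (m + j))"
          using 4 less_imp_Suc_add[OF 4] by auto
        have jq: "j < length qs" using k j by (simp add: L_def m_def)
        have del: "del k (ps' @ x # y # qs) = ps' @ x # y # del j qs" for x y
          unfolding j by (simp add: m_def del_append) (simp add: del_def)
        have nth: "(ps' @ x # y # qs) ! k = qs ! j" for x y
          unfolding j by (simp add: m_def nth_append)
        have "pfl b (ps' @ x # y # del j qs) = - pfl b (ps' @ y # x # del j qs)"
          using jq by (intro less.hyps) (simp add: Cons m_def)
        then show ?thesis unfolding \<tau>k del nth by (simp del: pfl.simps)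
      qed
    qed
    also have "\<dots> = - (\<Sum>k<L. ?g y x k)" by (rule sum_negf)
    also have "(\<Sum>k<L. ?g y x k) = pfl b (p # ps' @ y # x # qs)"
      by (simp add: L_def del: sum.lessThan_Suc)
    finally show ?thesis by (simp add: Cons)
  qed
qed

text \<open>Neighbouring exchanges carry \<open>y\<close> next to \<open>x\<close>; one further
  exchange leaves every entry as it was but changes the sign.\<close>

lemma pfl_eq_rows:
  assumes skew: "\<And>p q. b p q = - b q p" and eq: "\<And>r. b x r = b y r"
  shows "pfl b (ps @ x # qs @ y # rs) = 0"
proof (induction qs arbitrary: rs rule: rev_induct)
  case Nil
  have eq': "b r x = b r y" for r using skew[of r x] skew[of r y] eq[of r] by simp
  have "list_all2 (\<lambda>u v. \<forall>r. b u r = b v r \<and> b r u = b r v) (ps @ x # y # rs) (ps @ y # x # rs)"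
    by (intro list_all2_appendI list_all2_refl list.rel_intros) (auto simp: eq eq')
  then have "\<forall>i<length (ps @ x # y # rs). \<forall>r. b ((ps @ x # y # rs) ! i) r = b ((ps @ y # x # rs) ! i) r \<and>
      b r ((ps @ x # y # rs) ! i) = b r ((ps @ y # x # rs) ! i)"
    unfolding list_all2_conv_all_nth by blast
  then have "pfl b (ps @ x # y # rs) = pfl b (ps @ y # x # rs)"
    by (intro pfl_cong_nth) (simp, metis)
  with pfl_swap[where b = b and ps = ps and x = x and y = y and qs = rs, OF skew] show ?case by simp
next
  case (snoc q qs)
  have "pfl b (ps @ x # (qs @ [q]) @ y # rs) = - pfl b (ps @ x # qs @ y # q # rs)"
    using pfl_swap[where b = b and ps = "ps @ x # qs" and x = q and y = y and qs = rs, OF skew] by simp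
  with snoc show ?case by simp
qed

lemma pfl_eq_rows_distinct:
  assumes skew: "\<And>p q. b p q = - b q p" and eq: "\<And>r. b x r = b y r"
    and "x \<in> set xs" "y \<in> set xs" "x \<noteq> y"
  shows "pfl b xs = 0"
proof -
  obtain ps qs where xs: "xs = ps @ x # qs" using assms(3) by (meson split_list)
  then consider "y \<in> set ps" | "y \<in> set qs" using assms(4,5) by auto
  then show ?thesis
  proof cases
    case 1
    then obtain us vs where "ps = us @ y # vs" by (meson split_list)
    then show ?thesis using pfl_eq_rows[where b = b and x = y and y = x and ps = us and qs = vs and rs = qs, OF skew] eq xs by simp
  next
    case 2
    then obtain us vs where "qs = us @ y # vs" by (meson split_list)
    then show ?thesis using pfl_eq_rows[where b = b and x = x and y = y and ps = ps and qs = us and rs = vs, OF skew] eq xs by simp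
  qed
qed

section \<open>Limits, uniform bounds and derivatives of Pfaffians\<close>

lemma tendsto_pfl:
  assumes "\<And>p q. p \<in> set xs \<Longrightarrow> q \<in> set xs \<Longrightarrow> p \<noteq> q \<Longrightarrow> ((\<lambda>t. b t p q) \<longlongrightarrow> c p q) F" "distinct xs"
  shows "((\<lambda>t. pfl (b t) xs) \<longlongrightarrow> pfl c xs) F"
  using assms
proof (induction "length xs" arbitrary: xs rule: less_induct)
  case less
  show ?case
  proof (cases xs)
    case (Cons x xs')
    have "((\<lambda>t. pfl (b t) (del k xs')) \<longlongrightarrow> pfl c (del k xs')) F" if "k < length xs'" for k
      using that less.prems set_del_subset[of k xs']
      by (intro less.hyps) (auto simp: Cons distinct_del)
    moreover have "((\<lambda>t. b t x (xs' ! k)) \<longlongrightarrow> c x (xs' ! k)) F" if "k < length xs'" for k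
      using that less.prems by (intro less.prems) (auto simp: Cons)
    ultimately show ?thesis unfolding Cons pfl.simps by (intro tendsto_sum tendsto_mult tendsto_const) auto
  qed simp
qed

text \<open>The bound is chosen before the matrix: it depends on the labels and on \<open>C\<close>
  alone, so it can serve as a dominating constant for a whole family of matrices.\<close>

lemma pfl_bound:
  fixes C :: real
  assumes "C \<ge> 1"
  shows "\<exists>B. \<forall>b. (\<forall>p\<in>set xs. \<forall>q\<in>set xs. p \<noteq> q \<longrightarrow> \<bar>b p q\<bar> \<le> C) \<longrightarrow> distinct xs \<longrightarrow> \<bar>pfl b xs\<bar> \<le> B"
proof (induction "length xs" arbitrary: xs rule: less_induct)
  case less
  show ?case
  proof (cases xs)
    case Nil then show ?thesis by (intro exI[of _ 1]) auto
  next
    case (Cons x xs')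
    have "\<exists>B. \<forall>b. (\<forall>p\<in>set (del k xs'). \<forall>q\<in>set (del k xs'). p \<noteq> q \<longrightarrow> \<bar>b p q\<bar> \<le> C) \<longrightarrow> distinct (del k xs') \<longrightarrow> \<bar>pfl b (del k xs')\<bar> \<le> B"
      if "k < length xs'" for k
      using that by (intro less.hyps) (auto simp: Cons)
    then obtain B where B: "\<And>k b. k < length xs' \<Longrightarrow> (\<forall>p\<in>set (del k xs'). \<forall>q\<in>set (del k xs'). p \<noteq> q \<longrightarrow> \<bar>b p q\<bar> \<le> C) \<Longrightarrow> distinct (del k xs') \<Longrightarrow> \<bar>pfl b (del k xs')\<bar> \<le> B k"
      by metis
    show ?thesis
    proof (intro exI allI impI)
      fix b assume b: "\<forall>p\<in>set xs. \<forall>q\<in>set xs. p \<noteq> q \<longrightarrow> \<bar>b p q\<bar> \<le> C" "distinct xs"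
      have "\<bar>pfl b xs\<bar> \<le> (\<Sum>k<length xs'. \<bar>(-1) ^ k * b x (xs' ! k) * pfl b (del k xs')\<bar>)"
        unfolding Cons pfl.simps by (rule sum_abs)
      also have "\<dots> \<le> (\<Sum>k<length xs'. C * B k)"
      proof (rule sum_mono)
        fix k assume k: "k \<in> {..<length xs'}"
        have "\<bar>b x (xs' ! k)\<bar> \<le> C" using b k nth_mem[of k xs'] unfolding Cons
          by (metis distinct.simps(2) lessThan_iff list.set_intros)
        moreover have "\<bar>pfl b (del k xs')\<bar> \<le> B k"
          using k b set_del_subset[of k xs'] by (intro B) (auto simp: Cons distinct_del)
        ultimately show "\<bar>(-1) ^ k * b x (xs' ! k) * pfl b (del k xs')\<bar> \<le> C * B k"
          using assms by (auto simp: abs_mult intro!: mult_mono)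
      qed
      finally show "\<bar>pfl b xs\<bar> \<le> (\<Sum>k<length xs'. C * B k)" .
    qed
  qed
qed

text \<open>Every term of the expansion contains each index exactly once, so a derivative in the row
  and column \<open>j\<close> acts on a single factor.\<close>

lemma DERIV_pfl:
  assumes "distinct xs" "j \<in> set xs"
    and "\<And>q. q \<in> set xs \<Longrightarrow> q \<noteq> j \<Longrightarrow> ((\<lambda>t. b t j q) has_real_derivative b' j q) (at u)"
    and "\<And>q. q \<in> set xs \<Longrightarrow> q \<noteq> j \<Longrightarrow> ((\<lambda>t. b t q j) has_real_derivative b' q j) (at u)"
    and "\<And>p q t. p \<in> set xs \<Longrightarrow> q \<in> set xs \<Longrightarrow> p \<noteq> j \<Longrightarrow> q \<noteq> j \<Longrightarrow> p \<noteq> q \<Longrightarrow> b t p q = b' p q"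
  shows "((\<lambda>t. pfl (b t) xs) has_real_derivative pfl b' xs) (at u)"
  using assms
proof (induction "length xs" arbitrary: xs rule: less_induct)
  case less
  show ?case
  proof (cases xs)
    case Nil then show ?thesis using less.prems by simp
  next
    case (Cons x xs')
    have const: "pfl (b t) ys = pfl b' ys" if "set ys \<subseteq> set xs" "distinct ys" "j \<notin> set ys" for t ys
      using that
    proof (induction "length ys" arbitrary: ys rule: less_induct)
      case (less ys)
      show ?case
      proof (cases ys)
        case (Cons y zs)
        have "pfl (b t) (del k zs) = pfl b' (del k zs)" if "k < length zs" for k
          using that less.prems set_del_subset[of k zs]
          by (intro less.hyps) (auto simp: Cons distinct_del)
        moreover have "b t y (zs ! k) = b' y (zs ! k)" if "k < length zs" for k
          using that less.prems nth_mem[OF that]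
          by (intro \<open>\<And>p q t. \<lbrakk>p \<in> set xs; q \<in> set xs; p \<noteq> j; q \<noteq> j; p \<noteq> q\<rbrakk> \<Longrightarrow> b t p q = b' p q\<close>) (auto simp: Cons)
        ultimately show ?thesis by (simp add: Cons cong: sum.cong_simp)
      qed simp
    qed
    show ?thesis
    proof (cases "x = j")
      case True
      have "((\<lambda>t. b t x (xs' ! k) * pfl (b t) (del k xs')) has_real_derivative b' x (xs' ! k) * pfl b' (del k xs')) (at u)"
        if k: "k < length xs'" for k
      proof -
        have "pfl (b t) (del k xs') = pfl b' (del k xs')" for t
          using less.prems(1) set_del_subset[of k xs'] True
          by (intro const) (auto simp: Cons distinct_del)
        moreover have "((\<lambda>t. b t x (xs' ! k)) has_real_derivative b' x (xs' ! k)) (at u)"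
          using less.prems(1) k nth_mem[OF k] unfolding True[symmetric]
          by (intro less.prems(3)[unfolded True[symmetric]]) (auto simp: Cons)
        ultimately show ?thesis by (auto intro!: derivative_eq_intros)
      qed
      then show ?thesis unfolding Cons pfl.simps mult.assoc
        by (intro DERIV_sum DERIV_cmult) auto
    next
      case False
      have "((\<lambda>t. b t x (xs' ! k) * pfl (b t) (del k xs')) has_real_derivative b' x (xs' ! k) * pfl b' (del k xs')) (at u)"
        if k: "k < length xs'" for k
      proof (cases "xs' ! k = j")
        case jk: True
        have "j \<notin> set (del k xs')"
          using set_del[of xs' k] less.prems(1) k jk by (auto simp: Cons)
        then have "pfl (b t) (del k xs') = pfl b' (del k xs')" for t
          using less.prems(1) set_del_subset[of k xs']
          by (intro const) (auto simp: Cons distinct_del)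
        moreover have "((\<lambda>t. b t x j) has_real_derivative b' x j) (at u)"
          using False by (intro less.prems(4)) (auto simp: Cons)
        ultimately show ?thesis by (auto intro!: derivative_eq_intros simp: jk)
      next
        case jk: False
        have "b t x (xs' ! k) = b' x (xs' ! k)" for t
          using less.prems(1) k nth_mem[OF k] jk False
          by (intro less.prems(5)) (auto simp: Cons)
        moreover have "((\<lambda>t. pfl (b t) (del k xs')) has_real_derivative pfl b' (del k xs')) (at u)"
        proof (rule less.hyps)
          show "j \<in> set (del k xs')"
            using set_del[of xs' k] less.prems k jk False by (auto simp: Cons)
          show "length (del k xs') < length xs" using k by (simp add: Cons)
          show "distinct (del k xs')" using less.prems(1) by (simp add: Cons distinct_del)
          show "b t p q = b' p q" if "p \<in> set (del k xs')" "q \<in> set (del k xs')" "p \<noteq> j" "q \<noteq> j" "p \<noteq> q" for p q t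
            using that set_del_subset[of k xs'] by (intro less.prems(5)) (auto simp: Cons)
        qed (use less.prems(3,4) set_del_subset[of k xs'] Cons in auto)
        ultimately show ?thesis by (auto intro!: derivative_eq_intros)
      qed
      then show ?thesis unfolding Cons pfl.simps mult.assoc
        by (intro DERIV_sum DERIV_cmult) auto
    qed
  qed
qed

subsection \<open>Comparison with the sum over permutations\<close>

text \<open>A copy of the permutation two places higher, which leaves room for one new pair in
  front.\<close>

definition shift2 :: "(nat \<Rightarrow> nat) \<Rightarrow> nat \<Rightarrow> nat" where
  "shift2 \<eta> p = (if p < 3 then p else \<eta> (p - 2) + 2)"

text \<open>Makes \<open>k + 2\<close> the partner of 1 while keeping the order of all other values.
  It is a product of \<open>k\<close> neighbouring transpositions, whence the sign of the
  \<open>k\<close>-th term in the expansion.\<close>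

definition cyc :: "nat \<Rightarrow> nat \<Rightarrow> nat" where
  "cyc k p = (if p = 2 then k + 2 else if 3 \<le> p \<and> p \<le> k + 2 then p - 1 else p)"

lemma cyc_props: "cyc k permutes {2..k+2} \<and> sign (cyc k) = (-1) ^ k"
proof (induction k)
  case 0
  have "cyc 0 = id" by (auto simp: cyc_def fun_eq_iff)
  then show ?case by (simp only: permutes_id sign_id power_0)
next
  case (Suc k)
  have eq: "cyc (Suc k) = Transposition.transpose (k + 2) (k + 3) \<circ> cyc k"
    by (auto simp: cyc_def fun_eq_iff Transposition.transpose_def)
  have 1: "cyc k permutes {2..Suc k + 2}"
    using Suc by (auto intro: permutes_subset)
  have 2: "Transposition.transpose (k + 2) (k + 3) permutes {2..Suc k + 2}"
    by (rule permutes_swap_id) auto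
  have "permutation (cyc k)" using Suc permutation_permutes by blast
  then have "sign (cyc (Suc k)) = (-1) ^ Suc k"
    using Suc by (simp add: eq sign_compose permutation_swap_id sign_swap_id)
  with permutes_compose[OF 1 2] show ?case unfolding eq[symmetric] by (intro conjI)
qed

lemma shift2_props:
  assumes "\<eta> permutes {1..m}"
  shows "shift2 \<eta> permutes {3..m+2} \<and> sign (shift2 \<eta>) = sign \<eta>"
  using assms finite_atLeastAtMost[of 1 m]
proof (induction rule: permutes_induct)
  case id
  have "shift2 id = id" by (auto simp: shift2_def fun_eq_iff)
  then show ?case by (simp only: permutes_id)
next
  case (swap a b \<eta>)
  have eq: "shift2 (Transposition.transpose a b \<circ> \<eta>) = Transposition.transpose (a + 2) (b + 2) \<circ> shift2 \<eta>"
    using swap(1,2) by (auto simp: shift2_def fun_eq_iff Transposition.transpose_def)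
  have 2: "Transposition.transpose (a + 2) (b + 2) permutes {3..m+2}"
    using swap(1,2) by (intro permutes_swap_id) auto
  have "permutation \<eta>" "permutation (shift2 \<eta>)" using swap permutation_permutes by blast+
  then have "sign (shift2 (Transposition.transpose a b \<circ> \<eta>)) = sign (Transposition.transpose a b \<circ> \<eta>)"
    using swap by (simp add: eq sign_compose permutation_swap_id sign_swap_id)
  moreover have "shift2 (Transposition.transpose a b \<circ> \<eta>) permutes {3..m+2}"
    unfolding eq using swap by (intro permutes_compose[OF _ 2]) blast
  ultimately show ?case by (intro conjI)
qed

definition pf_perms :: "nat \<Rightarrow> (nat \<Rightarrow> nat) set" where
  "pf_perms n = {\<eta>. \<eta> permutes {1..2 * n} \<and>
           (\<forall>i \<in> {1..n}. \<eta> (2 * i - 1) < \<eta> (2 * i)) \<and>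
           (\<forall>i \<in> {1..<n}. \<eta> (2 * i - 1) < \<eta> (2 * i + 1))}"

text \<open>From 1 on this is the increasing enumeration of the labels left over once 1 and
  \<open>k + 2\<close> are paired.\<close>

definition skip :: "nat \<Rightarrow> nat \<Rightarrow> nat" where
  "skip k p = (if p \<le> k then p + 1 else p + 2)"

lemma skip_less_iff: "skip k p < skip k q \<longleftrightarrow> p < q"
  by (auto simp: skip_def)

lemma cyc_skip: "p \<ge> 1 \<Longrightarrow> cyc k (p + 2) = skip k p"
  by (auto simp: cyc_def skip_def)

text \<open>Relabelling by \<open>skip k\<close> is increasing, so both ordering conditions on the
  later pairs pass unchanged between \<open>\<eta>\<close> and its extension; the new pair satisfies
  them by itself because it starts with 1.\<close>

lemma pf_perms_extend:
  assumes \<eta>: "\<eta> permutes {1..2 * n}" and k: "k < 2 * n + 1"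
  defines "\<zeta> \<equiv> cyc k \<circ> shift2 \<eta>"
  shows "\<zeta> permutes {1..2 * Suc n}" "sign \<zeta> = (-1) ^ k * sign \<eta>" "\<zeta> (Suc 0) = 1" "\<zeta> 2 = k + 2"
    "\<And>p. p \<ge> 1 \<Longrightarrow> p \<le> 2 * n \<Longrightarrow> \<zeta> (p + 2) = skip k (\<eta> p)"
    "\<zeta> \<in> pf_perms (Suc n) \<longleftrightarrow> \<eta> \<in> pf_perms n"
proof -
  have c: "cyc k permutes {1..2 * Suc n}" using cyc_props[of k] k by (auto intro: permutes_subset)
  have s: "shift2 \<eta> permutes {1..2 * Suc n}" using shift2_props[OF \<eta>] by (auto intro: permutes_subset)
  show perm: "\<zeta> permutes {1..2 * Suc n}" unfolding \<zeta>_def by (rule permutes_compose[OF s c])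
  have "permutation (cyc k)" "permutation (shift2 \<eta>)" using c s permutation_permutes by blast+
  then show "sign \<zeta> = (-1) ^ k * sign \<eta>"
    using cyc_props[of k] shift2_props[OF \<eta>] by (simp add: \<zeta>_def sign_compose)
  show 1: "\<zeta> (Suc 0) = 1" and 2: "\<zeta> 2 = k + 2" by (simp_all add: \<zeta>_def cyc_def shift2_def)
  show 3: "\<zeta> (p + 2) = skip k (\<eta> p)" if "p \<ge> 1" "p \<le> 2 * n" for p
  proof -
    have "\<eta> p \<ge> 1" using permutes_in_image[OF \<eta>, of p] that by auto
    then show ?thesis using cyc_skip[of "\<eta> p" k] that by (simp add: \<zeta>_def shift2_def)
  qed
  have A: "(\<forall>i\<in>{1..Suc n}. \<zeta> (2 * i - 1) < \<zeta> (2 * i)) \<longleftrightarrow> (\<forall>i\<in>{1..n}. \<eta> (2 * i - 1) < \<eta> (2 * i))"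
  proof -
    have S: "{1..Suc n} = insert 1 (Suc ` {1..n})" by auto
    have "\<zeta> (2 * Suc i - 1) < \<zeta> (2 * Suc i) \<longleftrightarrow> \<eta> (2 * i - 1) < \<eta> (2 * i)" if "i \<in> {1..n}" for i
    proof -
      have e: "2 * Suc i - 1 = (2 * i - 1) + 2" "2 * Suc i = 2 * i + 2" using that by auto
      have "\<zeta> (2 * Suc i - 1) = skip k (\<eta> (2 * i - 1))"
        unfolding e(1) by (rule 3) (use that in auto)
      moreover have "\<zeta> (2 * Suc i) = skip k (\<eta> (2 * i))"
        unfolding e(2) by (rule 3) (use that in auto)
      ultimately show ?thesis by (simp only: skip_less_iff)
    qed
    moreover have "\<zeta> (2 * 1 - 1) < \<zeta> (2 * 1)" using 1 2 by simp
    ultimately show ?thesis by (simp only: S ball_simps) blast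
  qed
  have B: "(\<forall>i\<in>{1..<Suc n}. \<zeta> (2 * i - 1) < \<zeta> (2 * i + 1)) \<longleftrightarrow> (\<forall>i\<in>{1..<n}. \<eta> (2 * i - 1) < \<eta> (2 * i + 1))"
  proof (cases "n = 0")
    case False
    then have S: "{1..<Suc n} = insert 1 (Suc ` {1..<n})" by auto
    have "\<zeta> (2 * Suc i - 1) < \<zeta> (2 * Suc i + 1) \<longleftrightarrow> \<eta> (2 * i - 1) < \<eta> (2 * i + 1)" if "i \<in> {1..<n}" for i
    proof -
      have e: "2 * Suc i - 1 = (2 * i - 1) + 2" "2 * Suc i + 1 = (2 * i + 1) + 2" using that by auto
      have "\<zeta> (2 * Suc i - 1) = skip k (\<eta> (2 * i - 1))"
        unfolding e(1) by (rule 3) (use that in auto)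
      moreover have "\<zeta> (2 * Suc i + 1) = skip k (\<eta> (2 * i + 1))"
        unfolding e(2) by (rule 3) (use that in auto)
      ultimately show ?thesis by (simp only: skip_less_iff)
    qed
    moreover have "\<zeta> (2 * 1 - 1) < \<zeta> (2 * 1 + 1)"
    proof -
      have "\<eta> 1 \<ge> 1" using permutes_in_image[OF \<eta>, of 1] False by auto
      then show ?thesis using 3[of 1] 1 False by (simp add: skip_def numeral_3_eq_3)
    qed
    ultimately show ?thesis by (simp only: S ball_simps) blast
  qed simp
  show "\<zeta> \<in> pf_perms (Suc n) \<longleftrightarrow> \<eta> \<in> pf_perms n"
    using perm \<eta> A B by (simp add: pf_perms_def)
qed

text \<open>The two ordering conditions make the first value the smallest of all, hence 1. The value
  at 2 then determines \<open>k\<close>, and undoing the cycle leaves a permutation that fixes 1 and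
  2.\<close>

lemma pf_perms_decompose:
  assumes \<zeta>: "\<zeta> \<in> pf_perms (Suc n)"
  obtains k \<eta> where "k < 2 * n + 1" "\<eta> permutes {1..2 * n}" "\<zeta> = cyc k \<circ> shift2 \<eta>"
proof -
  have perm: "\<zeta> permutes {1..2 * Suc n}" using \<zeta> by (simp add: pf_perms_def)
  have odd1: "\<zeta> 1 \<le> \<zeta> (2 * i - 1)" if "i \<ge> 1" "i \<le> Suc n" for i
    using that
  proof (induction i rule: dec_induct)
    case (step i)
    then have "\<zeta> (2 * i - 1) < \<zeta> (2 * i + 1)" using \<zeta> by (simp add: pf_perms_def)
    then show ?case using step by simp
  qed simp
  have min1: "\<zeta> 1 \<le> \<zeta> p" if "p \<in> {1..2 * Suc n}" for p
  proof (cases "odd p")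
    case True
    then obtain i where "p = 2 * i + 1" by (auto elim: oddE)
    then show ?thesis using odd1[of "Suc i"] that by simp
  next
    case False
    then obtain i where i: "p = 2 * i" by (auto elim: evenE)
    then have "\<zeta> (2 * i - 1) < \<zeta> (2 * i)" using \<zeta> that by (auto simp: pf_perms_def)
    then show ?thesis using odd1[of i] i that by auto
  qed
  have "1 \<in> \<zeta> ` {1..2 * Suc n}" unfolding permutes_image[OF perm] by simp
  then obtain p where "p \<in> {1..2 * Suc n}" "\<zeta> p = 1" by (auto simp del: mult_Suc_right)
  then have z1: "\<zeta> 1 = 1" using min1[of p] permutes_in_image[OF perm, of 1] by auto
  have z2: "\<zeta> 2 \<in> {1..2 * Suc n}" using permutes_in_image[OF perm, of 2] by auto
  have "\<zeta> 2 \<noteq> 1" using z1 permutes_inj[OF perm] by (metis injD numeral_One numeral_eq_iff semiring_norm(85))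
  then have "\<zeta> 2 = (\<zeta> 2 - 2) + 2 \<and> \<zeta> 2 - 2 < 2 * n + 1" using z2 by auto
  then obtain k where k: "\<zeta> 2 = k + 2" "k < 2 * n + 1" by blast
  have c: "cyc k permutes {1..2 * Suc n}" using cyc_props[of k] k by (auto intro: permutes_subset)
  define \<theta> where "\<theta> = inv (cyc k) \<circ> \<zeta>"
  have th: "\<theta> permutes {1..2 * Suc n}"
    unfolding \<theta>_def by (rule permutes_compose[OF perm permutes_inv[OF c]])
  have th1: "\<theta> 1 = 1" "\<theta> 2 = 2"
    unfolding \<theta>_def o_def z1 k(1)
    by (auto intro!: inv_f_eq[OF permutes_inj[OF c]] simp: cyc_def)
  have inj: "inj \<theta>" using permutes_inj[OF th] .
  have ge3: "\<theta> p \<ge> 3" if "p \<in> {3..2 * Suc n}" for p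
  proof -
    have "\<theta> p \<in> {1..2 * Suc n}" using permutes_in_image[OF th, of p] that by auto
    moreover have "\<theta> p \<noteq> 1" "\<theta> p \<noteq> 2" using inj th1 that injD[OF inj, of p 1] injD[OF inj, of p 2] by auto
    ultimately show ?thesis by auto
  qed
  define \<eta> where "\<eta> p = (if p = 0 then 0 else \<theta> (p + 2) - 2)" for p
  have out: "\<eta> p = p" if "p \<notin> {1..2 * n}" for p
    using that permutes_not_in[OF th, of "p + 2"] by (auto simp: \<eta>_def)
  have im: "\<eta> p \<in> {1..2 * n}" if "p \<in> {1..2 * n}" for p
    using that ge3[of "p + 2"] permutes_in_image[OF th, of "p + 2"] by (auto simp: \<eta>_def)
  have "inj_on \<eta> {1..2 * n}"
  proof (rule inj_onI)
    fix p q assume pq: "p \<in> {1..2 * n}" "q \<in> {1..2 * n}" "\<eta> p = \<eta> q"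
    then have "\<theta> (p + 2) = \<theta> (q + 2)"
      using ge3[of "p + 2"] ge3[of "q + 2"] by (auto simp: \<eta>_def)
    then show "p = q" using injD[OF inj] by fastforce
  qed
  then have "bij_betw \<eta> {1..2 * n} {1..2 * n}"
    using im unfolding bij_betw_def by (intro conjI endo_inj_surj image_subsetI) auto
  then have eta: "\<eta> permutes {1..2 * n}" using out by (intro bij_imp_permutes) auto
  have "\<theta> = shift2 \<eta>"
  proof
    fix p
    consider "p = 0" | "p = 1" | "p = 2" | "p \<in> {3..2 * Suc n}" | "p > 2 * Suc n" by force
    then show "\<theta> p = shift2 \<eta> p"
    proof cases
      case 1 then show ?thesis using permutes_not_in[OF th, of 0] by (simp add: shift2_def)
    next
      case 4 
      then have "p - 2 + 2 = p" "p - 2 \<noteq> 0" by auto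
      then show ?thesis using ge3[OF 4] 4 by (simp add: shift2_def \<eta>_def)
    next
      case 5
      then have "p - 2 + 2 = p" "p - 2 \<noteq> 0" by auto
      then show ?thesis using permutes_not_in[OF th, of p] 5 by (simp add: shift2_def \<eta>_def)
    qed (use th1 in \<open>auto simp: shift2_def\<close>)
  qed
  then have "\<zeta> = cyc k \<circ> shift2 \<eta>"
    unfolding \<theta>_def using permutes_inv_o(1)[OF c] by (metis comp_assoc id_comp)
  with k(2) eta show ?thesis by (rule that)
qed

lemma pfaffian_0: "pfaffian 0 b = 1"
  by (simp add: pfaffian_def permutes_empty)

text \<open>The admissible permutations are sorted by the partner \<open>k + 2\<close> of 1, which
  gives the recursion of \<open>pfl\<close> for the sum over permutations.\<close>

lemma pfaffian_Suc:
  "pfaffian (Suc n) b =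
    (\<Sum>k<2 * n + 1. (-1) ^ k * b 1 (k + 2) * pfaffian n (\<lambda>p q. b (skip k p) (skip k q)))"
proof -
  let ?t = "\<lambda>n b \<eta>. of_int (sign \<eta>) * (\<Prod>i = 1..n. b (\<eta> (2 * i - 1)) (\<eta> (2 * i))) :: real"
  define f where "f = (\<lambda>(k, \<eta>). cyc k \<circ> shift2 \<eta>)"
  have inj: "inj_on f ({..<2 * n + 1} \<times> pf_perms n)"
  proof (rule inj_onI)
    fix x y assume xy: "x \<in> {..<2 * n + 1} \<times> pf_perms n" "y \<in> {..<2 * n + 1} \<times> pf_perms n" "f x = f y"
    obtain k \<eta> k' \<eta>' where x: "x = (k, \<eta>)" and y: "y = (k', \<eta>')" by (cases x, cases y)
    have "k \<in> {..<2 * n + 1}" "k' \<in> {..<2 * n + 1}" and e: "\<eta> \<in> pf_perms n" "\<eta>' \<in> pf_perms n"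
      and eq: "f (k, \<eta>) = f (k', \<eta>')" using xy x y by auto
    then have a: "k < 2 * n + 1" "k' < 2 * n + 1" by auto
    have p: "\<eta> permutes {1..2 * n}" "\<eta>' permutes {1..2 * n}" using e by (auto simp: pf_perms_def)
    have k: "k = k'" using fun_cong[OF eq, of 2] by (simp add: f_def cyc_def shift2_def)
    have "\<eta> q = \<eta>' q" for q
    proof (cases "q \<in> {1..2 * n}")
      case True
      then have "skip k (\<eta> q) = skip k (\<eta>' q)"
        using pf_perms_extend(5)[OF p(1) a(1), of q] pf_perms_extend(5)[OF p(2) a(2), of q] fun_cong[OF eq, of "q + 2"] k
        by (simp add: f_def)
      then show ?thesis by (auto simp: skip_def split: if_splits)
    next
      case False
      then show ?thesis using p permutes_not_in by metis
    qed
    with k show "x = y" using x y by auto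
  qed
  have im: "pf_perms (Suc n) = f ` ({..<2 * n + 1} \<times> pf_perms n)"
  proof (intro set_eqI iffI)
    fix \<zeta> assume z: "\<zeta> \<in> pf_perms (Suc n)"
    then obtain k \<eta> where h: "k < 2 * n + 1" "\<eta> permutes {1..2 * n}" "\<zeta> = cyc k \<circ> shift2 \<eta>"
      by (rule pf_perms_decompose)
    then have "\<eta> \<in> pf_perms n" using pf_perms_extend(6)[OF h(2,1)] z by simp
    then show "\<zeta> \<in> f ` ({..<2 * n + 1} \<times> pf_perms n)" using h by (auto simp: f_def image_iff)
  next
    fix \<zeta> assume "\<zeta> \<in> f ` ({..<2 * n + 1} \<times> pf_perms n)"
    then obtain k \<eta> where h: "k < 2 * n + 1" "\<eta> \<in> pf_perms n" "\<zeta> = cyc k \<circ> shift2 \<eta>"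
      by (auto simp: f_def)
    then show "\<zeta> \<in> pf_perms (Suc n)"
      using pf_perms_extend(6)[OF _ h(1), of \<eta>] by (simp add: pf_perms_def)
  qed
  have "pfaffian (Suc n) b = (\<Sum>\<zeta>\<in>pf_perms (Suc n). ?t (Suc n) b \<zeta>)"
    by (simp add: pfaffian_def pf_perms_def)
  also have "\<dots> = (\<Sum>(k, \<eta>)\<in>{..<2 * n + 1} \<times> pf_perms n. ?t (Suc n) b (cyc k \<circ> shift2 \<eta>))"
    unfolding im by (subst sum.reindex[OF inj]) (simp add: f_def case_prod_beta o_def)
  also have "\<dots> = (\<Sum>(k, \<eta>)\<in>{..<2 * n + 1} \<times> pf_perms n.
      (-1) ^ k * b 1 (k + 2) * ?t n (\<lambda>p q. b (skip k p) (skip k q)) \<eta>)"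
  proof (rule sum.cong[OF refl])
    fix x assume x: "x \<in> {..<2 * n + 1} \<times> pf_perms n"
    obtain k \<eta> where xk: "x = (k, \<eta>)" by (cases x)
    have k: "k \<in> {..<2 * n + 1}" and e: "\<eta> \<in> pf_perms n" using x xk by auto
    have \<eta>: "\<eta> permutes {1..2 * n}" using e by (simp add: pf_perms_def)
    have k': "k < 2 * n + 1" using k by simp
    note E = pf_perms_extend[OF \<eta> k']
    define \<zeta> where "\<zeta> = cyc k \<circ> shift2 \<eta>"
    have "(\<Prod>i = 1..Suc n. b (\<zeta> (2 * i - 1)) (\<zeta> (2 * i))) =
        b (\<zeta> 1) (\<zeta> 2) * (\<Prod>i = 1..n. b (\<zeta> (2 * Suc i - 1)) (\<zeta> (2 * Suc i)))"
      by (subst prod.atLeast_Suc_atMost) (simp_all only: prod.shift_bounds_cl_Suc_ivl, simp_all)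
    also have "(\<Prod>i = 1..n. b (\<zeta> (2 * Suc i - 1)) (\<zeta> (2 * Suc i))) =
        (\<Prod>i = 1..n. b (skip k (\<eta> (2 * i - 1))) (skip k (\<eta> (2 * i))))"
    proof (intro prod.cong refl)
      fix i assume i: "i \<in> {1..n}"
      have "2 * Suc i - 1 = (2 * i - 1) + 2" "2 * Suc i = 2 * i + 2" "1 \<le> 2 * i - 1" using i by auto
      moreover have "2 * i - 1 \<le> 2 * n" "1 \<le> 2 * i" "2 * i \<le> 2 * n" using i by auto
      ultimately show "b (\<zeta> (2 * Suc i - 1)) (\<zeta> (2 * Suc i)) = b (skip k (\<eta> (2 * i - 1))) (skip k (\<eta> (2 * i)))"
        using E(5)[of "2 * i - 1"] E(5)[of "2 * i"] by (simp only: \<zeta>_def)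
    qed
    finally have "?t (Suc n) b (cyc k \<circ> shift2 \<eta>) = (-1) ^ k * b 1 (k + 2) * ?t n (\<lambda>p q. b (skip k p) (skip k q)) \<eta>"
      using E(2,3,4) unfolding \<zeta>_def by simp
    then show "(case x of (k, \<eta>) \<Rightarrow> ?t (Suc n) b (cyc k \<circ> shift2 \<eta>)) =
        (case x of (k, \<eta>) \<Rightarrow> (-1) ^ k * b 1 (k + 2) * ?t n (\<lambda>p q. b (skip k p) (skip k q)) \<eta>)"
      unfolding xk by (simp only: prod.case)
  qed
  also have "\<dots> = (\<Sum>k<2 * n + 1. (-1) ^ k * b 1 (k + 2) * pfaffian n (\<lambda>p q. b (skip k p) (skip k q)))"
    by (subst sum.cartesian_product[symmetric]) (simp add: pfaffian_def pf_perms_def sum_distrib_left)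
  finally show ?thesis .
qed

lemma pfaffian_eq_pfl: "pfaffian n b = pfl b [1..<2 * n + 1]"
proof (induction n arbitrary: b)
  case 0 then show ?case by (simp add: pfaffian_0)
next
  case (Suc n)
  have split: "[1..<2 * Suc n + 1] = 1 # [2..<2 * n + 3]"
    by (subst upt_conv_Cons) (simp_all add: numeral_3_eq_3 numeral_2_eq_2 del: upt_Suc)
  have len: "length [2..<2 * n + 3] = 2 * n + 1" by simp
  have nth: "[2..<2 * n + 3] ! k = k + 2" if "k < 2 * n + 1" for k
    using that by (subst nth_upt) auto
  have del: "del k [2..<2 * n + 3] = map (skip k) [1..<2 * n + 1]" if k: "k < 2 * n + 1" for k
  proof (rule nth_equalityI)
    show "length (del k [2..<2 * n + 3]) = length (map (skip k) [1..<2 * n + 1])"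
      using k len by (simp del: upt_Suc)
    fix i assume "i < length (del k [2..<2 * n + 3])"
    then have i: "i < 2 * n" using k len by (simp del: upt_Suc)
    have "map (skip k) [1..<2 * n + 1] ! i = skip k (i + 1)"
      using i by (subst nth_map) (auto simp del: upt_Suc)
    moreover have "del k [2..<2 * n + 3] ! i = (if i < k then i else Suc i) + 2"
      using i k by (subst nth_del) (auto simp: nth simp del: upt_Suc)
    ultimately show "del k [2..<2 * n + 3] ! i = map (skip k) [1..<2 * n + 1] ! i"
      by (simp add: skip_def del: upt_Suc)
  qed
  have "pfl b [1..<2 * Suc n + 1] = (\<Sum>k<2 * n + 1. (-1) ^ k * b 1 (k + 2) * pfl b (del k [2..<2 * n + 3]))"
    unfolding split pfl.simps len by (intro sum.cong refl) (simp only: nth lessThan_iff)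
  also have "\<dots> = (\<Sum>k<2 * n + 1. (-1) ^ k * b 1 (k + 2) * pfaffian n (\<lambda>p q. b (skip k p) (skip k q)))"
    by (intro sum.cong refl) (simp only: del pfl_map Suc.IH lessThan_iff)
  finally show ?case unfolding pfaffian_Suc by (rule sym)
qed

section \<open>Calculus of the kernel\<close>

text \<open>The kernel entries are rewritten with one square root per variable, the form in which
  limits and derivatives are taken.\<close>

definition k11 :: "real \<Rightarrow> real \<Rightarrow> real" where
  "k11 s t = (s - t) / (sqrt (1 - s\<^sup>2) * sqrt (1 - t\<^sup>2) * (1 - s * t)\<^sup>2)"

definition k12 :: "real \<Rightarrow> real \<Rightarrow> real" where
  "k12 s t = sqrt (1 - t\<^sup>2) / sqrt (1 - s\<^sup>2) / (1 - s * t)"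

definition k22 :: "real \<Rightarrow> real \<Rightarrow> real" where
  "k22 s t = sgn (t - s) * arcsin (c_fun s t)"

lemma kernel_K_nth:
  "kernel_K s t $ 1 $ 1 = k11 s t" "kernel_K s t $ 1 $ 2 = k12 s t"
  "kernel_K s t $ 2 $ 1 = - k12 t s" "kernel_K s t $ 2 $ 2 = k22 s t"
  by (simp_all add: kernel_K_def k11_def k12_def k22_def real_sqrt_mult real_sqrt_divide mult.commute)

lemma abs_mult_less_1: "y \<in> {-1<..<1} \<Longrightarrow> z \<in> {-1<..<1} \<Longrightarrow> \<bar>y * z\<bar> < (1::real)"
  using mult_strict_mono[of "\<bar>y\<bar>" 1 "\<bar>z\<bar>" 1] by (auto simp: abs_mult)

lemma one_minus_mult_pos: "y \<in> {-1<..<1} \<Longrightarrow> z \<in> {-1<..<1} \<Longrightarrow> 0 < 1 - y * (z::real)"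
  using abs_mult_less_1[of y z] by auto

lemma one_minus_square_pos: "y \<in> {-1<..<1} \<Longrightarrow> 0 < 1 - (y::real)\<^sup>2"
  using one_minus_mult_pos[of y y] by (simp add: power2_eq_square)

lemma c_fun_alt: "c_fun s t = sqrt (1 - s\<^sup>2) * sqrt (1 - t\<^sup>2) / (1 - s * t)"
  by (simp add: c_fun_def real_sqrt_mult)

lemma c_fun_sym: "c_fun s t = c_fun t s"
  by (simp add: c_fun_def mult.commute)

lemma c_fun_pos: "s \<in> {-1<..<1} \<Longrightarrow> t \<in> {-1<..<1} \<Longrightarrow> 0 < c_fun s t"
  using one_minus_mult_pos[of s t] one_minus_square_pos[of s] one_minus_square_pos[of t]
  by (simp add: c_fun_alt)

text \<open>\<open>c_fun s t\<close> is the correlation coefficient of \<open>f s\<close> and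
  \<open>f t\<close>, and its complement is the square of the pseudo-hyperbolic distance. That it is
  a perfect square removes the root from the derivative of the arcsine.\<close>

lemma one_minus_c_fun:
  assumes "s \<in> {-1<..<1}" "t \<in> {-1<..<1}"
  shows "1 - (c_fun s t)\<^sup>2 = ((s - t) / (1 - s * t))\<^sup>2"
proof -
  have p: "1 - s * t \<noteq> 0" "0 \<le> 1 - s\<^sup>2" "0 \<le> 1 - t\<^sup>2"
    using one_minus_mult_pos[OF assms] one_minus_square_pos[OF assms(1)] one_minus_square_pos[OF assms(2)] by auto
  have "(c_fun s t)\<^sup>2 = (1 - s\<^sup>2) * (1 - t\<^sup>2) / (1 - s * t)\<^sup>2"
    using p by (simp add: c_fun_alt power_divide power_mult_distrib)
  then show ?thesis using p by (simp add: power_divide field_simps) algebra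
qed

lemma c_fun_le_1:
  assumes "s \<in> {-1<..<1}" "t \<in> {-1<..<1}"
  shows "c_fun s t \<le> 1"
proof -
  have "(c_fun s t)\<^sup>2 \<le> 1\<^sup>2" using one_minus_c_fun[OF assms] by (metis diff_ge_0_iff_ge one_power2 zero_le_power2)
  then show ?thesis by (rule power2_le_imp_le) simp
qed

lemma c_fun_less_1:
  assumes "s \<in> {-1<..<1}" "t \<in> {-1<..<1}" "s \<noteq> t"
  shows "c_fun s t < 1"
proof -
  have "(c_fun s t)\<^sup>2 < 1\<^sup>2"
    using one_minus_c_fun[OF assms(1,2)] assms(3) one_minus_mult_pos[OF assms(1,2)]
    by (metis diff_gt_0_iff_gt divide_eq_0_iff eq_iff_diff_eq_0 less_irrefl one_power2 zero_less_power2)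
  then show ?thesis by (rule power2_less_imp_less) simp
qed

lemma c_fun_self: "s \<in> {-1<..<1} \<Longrightarrow> c_fun s s = 1"
  using one_minus_square_pos[of s] by (simp add: c_fun_alt power2_eq_square)

lemma DERIV_c_fun:
  assumes s: "s \<in> {-1<..<1}" and t: "t \<in> {-1<..<1}"
  shows "((\<lambda>s. c_fun s t) has_real_derivative c_fun s t * (t - s) / ((1 - s\<^sup>2) * (1 - s * t))) (at s)"
proof -
  have p: "1 - s * t > 0" "0 < 1 - s\<^sup>2" "0 < 1 - t\<^sup>2"
    using one_minus_mult_pos[OF s t] one_minus_square_pos[OF s] one_minus_square_pos[OF t] by auto
  define q where "q = sqrt (1 - s\<^sup>2)"
  have q: "q > 0" "q * q = 1 - s\<^sup>2" using p by (auto simp: q_def)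
  define T where "T = sqrt (1 - t\<^sup>2)"
  have "((\<lambda>s. sqrt (1 - s\<^sup>2) * T / (1 - s * t)) has_real_derivative
     ((- s / q * T) * (1 - s * t) - q * T * (- t)) / ((1 - s * t) * (1 - s * t))) (at s)"
    unfolding q_def using p by (auto intro!: derivative_eq_intros simp: field_simps)
  also have "((- s / q * T) * (1 - s * t) - q * T * (- t)) / ((1 - s * t) * (1 - s * t)) =
     q * T / (1 - s * t) * (t - s) / ((1 - s\<^sup>2) * (1 - s * t))"
  proof -
    have "(- s / q * T) * (1 - s * t) - q * T * (- t) = (T / q) * (q * q * t - s * (1 - s * t))"
      using q(1) by (simp add: field_simps)
    also have "\<dots> = (T / q) * (t - s)" unfolding q(2) by (simp add: algebra_simps power2_eq_square)
    also have "\<dots> = q * T * (t - s) / (1 - s\<^sup>2)" unfolding q(2)[symmetric] using q(1) by (simp add: field_simps)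
    finally have eq: "(- s / q * T) * (1 - s * t) - q * T * (- t) = q * T * (t - s) / (1 - s\<^sup>2)" .
    show ?thesis unfolding eq by (simp only: times_divide_eq_left times_divide_eq_right divide_divide_eq_left mult_ac)
  qed
  finally show ?thesis by (simp add: c_fun_alt[abs_def] q_def T_def)
qed

text \<open>The root of \<open>1 - (c_fun s t)\<^sup>2\<close> cancels up to the sign of
  \<open>t - s\<close>; this sign is the kink of the arcsine on the diagonal.\<close>

lemma DERIV_arcsin_c:
  assumes s: "s \<in> {-1<..<1}" and t: "t \<in> {-1<..<1}" and st: "s \<noteq> t"
  shows "((\<lambda>s. arcsin (c_fun s t)) has_real_derivative sgn (t - s) * k12 s t) (at s)"
proof -
  have p: "1 - s * t > 0" "0 < 1 - s\<^sup>2" "0 < 1 - t\<^sup>2"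
    using one_minus_mult_pos[OF s t] one_minus_square_pos[OF s] one_minus_square_pos[OF t] by auto
  have c: "-1 < c_fun s t" "c_fun s t < 1" using c_fun_pos[OF s t] c_fun_less_1[OF s t st] by auto
  have "((\<lambda>s. arcsin (c_fun s t)) has_real_derivative
     inverse (sqrt (1 - (c_fun s t)\<^sup>2)) * (c_fun s t * (t - s) / ((1 - s\<^sup>2) * (1 - s * t)))) (at s)"
    by (rule DERIV_chain2[OF DERIV_arcsin[OF c] DERIV_c_fun[OF s t]])
  also have "sqrt (1 - (c_fun s t)\<^sup>2) = \<bar>t - s\<bar> / (1 - s * t)"
    unfolding one_minus_c_fun[OF s t] using p by (simp add: abs_minus_commute)
  also have "inverse (\<bar>t - s\<bar> / (1 - s * t)) * (c_fun s t * (t - s) / ((1 - s\<^sup>2) * (1 - s * t))) =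
      ((t - s) / \<bar>t - s\<bar>) * (c_fun s t / (1 - s\<^sup>2))"
  proof -
    have "inverse (A / e) * (c * d / (P * e)) = (d / A) * (c / P)" if "A \<noteq> 0" "e \<noteq> 0" "P \<noteq> 0" for A e c d P :: real
      using that by (simp add: field_simps)
    then show ?thesis using p st by simp
  qed
  also have "(t - s) / \<bar>t - s\<bar> = sgn (t - s)" by (simp add: real_sgn_eq)
  also have "c_fun s t / (1 - s\<^sup>2) = k12 s t"
  proof -
    have "sqrt (1 - s\<^sup>2) * sqrt (1 - s\<^sup>2) = 1 - s\<^sup>2" using p by simp
    then have "sqrt (1 - s\<^sup>2) / (1 - s\<^sup>2) = 1 / sqrt (1 - s\<^sup>2)"
      using p by (metis less_irrefl nonzero_divide_mult_cancel_left real_sqrt_eq_zero_cancel_iff)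
    moreover have "c_fun s t / (1 - s\<^sup>2) = (sqrt (1 - s\<^sup>2) / (1 - s\<^sup>2)) * sqrt (1 - t\<^sup>2) / (1 - s * t)"
      by (simp add: c_fun_alt)
    ultimately show ?thesis by (simp add: k12_def)
  qed
  finally show ?thesis .
qed

lemma eventually_sgn_eq: "s \<noteq> (t::real) \<Longrightarrow> eventually (\<lambda>z. sgn (t - z) = sgn (t - s)) (nhds s)"
proof (cases "s < t")
  case True
  then show ?thesis using eventually_nhds_in_open[of "{..<t}" s] by (auto elim!: eventually_mono)
next
  case False
  moreover assume "s \<noteq> t"
  ultimately show ?thesis using eventually_nhds_in_open[of "{t<..}" s] by (auto elim!: eventually_mono)
qed

text \<open>The factor \<open>sgn (t - s)\<close> is locally constant and cancels the sign in the
  derivative of the arcsine, so one formula serves on both sides of the diagonal.\<close>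

lemma DERIV_k22:
  assumes s: "s \<in> {-1<..<1}" and t: "t \<in> {-1<..<1}" and st: "s \<noteq> t"
  shows "((\<lambda>s. k22 s t) has_real_derivative k12 s t) (at s)"
proof -
  have "((\<lambda>z. sgn (t - s) * arcsin (c_fun z t)) has_real_derivative sgn (t - s) * (sgn (t - s) * k12 s t)) (at s)"
    by (intro DERIV_cmult DERIV_arcsin_c assms)
  moreover have "sgn (t - s) * (sgn (t - s) * k12 s t) = k12 s t" using st by (simp add: sgn_if)
  moreover have "eventually (\<lambda>z. k22 z t = sgn (t - s) * arcsin (c_fun z t)) (nhds s)"
    using eventually_sgn_eq[OF st] by eventually_elim (simp add: k22_def)
  ultimately show ?thesis 
    using st DERIV_cong_ev[of s s "\<lambda>z. k22 z t" "\<lambda>z. sgn (t - s) * arcsin (c_fun z t)" "k12 s t" "k12 s t"] by simp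
qed

lemma DERIV_k12:
  assumes s: "s \<in> {-1<..<1}" and t: "t \<in> {-1<..<1}"
  shows "((\<lambda>t. k12 s t) has_real_derivative k11 s t) (at t)"
proof -
  have p: "1 - s * t > 0" "0 < 1 - s\<^sup>2" "0 < 1 - t\<^sup>2"
    using one_minus_mult_pos[OF s t] one_minus_square_pos[OF s] one_minus_square_pos[OF t] by auto
  define q where "q = sqrt (1 - t\<^sup>2)"
  have q: "q > 0" "q * q = 1 - t\<^sup>2" using p by (auto simp: q_def)
  define T where "T = sqrt (1 - s\<^sup>2)"
  have T: "T > 0" using p by (simp add: T_def)
  have "((\<lambda>t. sqrt (1 - t\<^sup>2) / T / (1 - s * t)) has_real_derivative
     ((- t / q / T) * (1 - s * t) - q / T * (- s)) / ((1 - s * t) * (1 - s * t))) (at t)"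
    unfolding q_def using p T by (auto intro!: derivative_eq_intros simp: field_simps)
  also have "((- t / q / T) * (1 - s * t) - q / T * (- s)) / ((1 - s * t) * (1 - s * t)) =
     (s - t) / (T * q * (1 - s * t)\<^sup>2)"
  proof -
    have "(- t / q / T) * (1 - s * t) - q / T * (- s) = (q * q * s - t * (1 - s * t)) / (T * q)"
      using q(1) T by (simp add: field_simps)
    also have "\<dots> = (s - t) / (T * q)" unfolding q(2) by (simp add: algebra_simps power2_eq_square)
    finally show ?thesis by (simp add: power2_eq_square)
  qed
  finally show ?thesis by (simp add: k12_def[abs_def] k11_def q_def T_def)
qed

lemma k22_skew: "k22 s t = - k22 t s"
proof -
  have "sgn (t - s) = - sgn (s - t)" by (metis minus_diff_eq sgn_minus)
  then show ?thesis by (simp add: k22_def c_fun_sym[of t s])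
qed

lemma k11_skew: "k11 s t = - k11 t s"
proof -
  have "(s - t) / x = - ((t - s) / x)" for x :: real by (simp add: minus_divide_left)
  then show ?thesis by (simp only: k11_def mult.commute)
qed

lemma tendsto_k11:
  assumes "(f \<longlongrightarrow> s) F" "(g \<longlongrightarrow> t) F" "s \<in> {-1<..<1}" "t \<in> {-1<..<1}"
  shows "((\<lambda>x. k11 (f x) (g x)) \<longlongrightarrow> k11 s t) F"
  using assms one_minus_mult_pos[OF assms(3,4)] one_minus_square_pos[OF assms(3)] one_minus_square_pos[OF assms(4)]
  unfolding k11_def by (intro tendsto_intros) auto

lemma tendsto_k12:
  assumes "(f \<longlongrightarrow> s) F" "(g \<longlongrightarrow> t) F" "s \<in> {-1<..<1}" "t \<in> {-1<..<1}"
  shows "((\<lambda>x. k12 (f x) (g x)) \<longlongrightarrow> k12 s t) F"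
  using assms one_minus_mult_pos[OF assms(3,4)] one_minus_square_pos[OF assms(3)] one_minus_square_pos[OF assms(4)]
  unfolding k12_def by (intro tendsto_intros) auto

lemma tendsto_c_fun:
  assumes "(f \<longlongrightarrow> s) F" "(g \<longlongrightarrow> t) F" "1 - s * t \<noteq> 0"
  shows "((\<lambda>x. c_fun (f x) (g x)) \<longlongrightarrow> c_fun s t) F"
  using assms unfolding c_fun_alt by (intro tendsto_intros) auto

lemma tendsto_arcsin_c:
  assumes f: "(f \<longlongrightarrow> s) F" and g: "(g \<longlongrightarrow> t) F" and st: "s \<in> {-1..<1}" "t \<in> {-1<..<1}"
    and ev: "eventually (\<lambda>x. f x \<in> {-1<..<1} \<and> g x \<in> {-1<..<1}) F"
  shows "((\<lambda>x. arcsin (c_fun (f x) (g x))) \<longlongrightarrow> arcsin (c_fun s t)) F"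
proof -
  have "\<bar>s * t\<bar> < 1"
  proof (cases "s = -1")
    case True then show ?thesis using st by auto
  next
    case False then show ?thesis using st abs_mult_less_1[of s t] by auto
  qed
  then have "((\<lambda>x. c_fun (f x) (g x)) \<longlongrightarrow> c_fun s t) F" by (intro tendsto_c_fun f g) auto
  moreover have "c_fun s t \<in> {-1..1}"
  proof (cases "s = -1")
    case True then show ?thesis by (simp add: c_fun_alt)
  next
    case False
    then have "s \<in> {-1<..<1}" using st by auto
    then show ?thesis using c_fun_pos[of s t] c_fun_le_1[of s t] st by auto
  qed
  moreover have "eventually (\<lambda>x. c_fun (f x) (g x) \<in> {-1..1}) F"
    using ev
  proof eventually_elim
    case (elim x)
    then show ?case using c_fun_pos[of "f x" "g x"] c_fun_le_1[of "f x" "g x"] by auto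
  qed
  ultimately show ?thesis
    using continuous_on_arcsin' by (intro continuous_on_tendsto_compose[OF continuous_on_arcsin']) auto
qed

lemma tendsto_k22:
  assumes f: "(f \<longlongrightarrow> s) F" and g: "(g \<longlongrightarrow> t) F" and st: "s \<in> {-1<..<1}" "t \<in> {-1<..<1}" "s \<noteq> t"
  shows "((\<lambda>x. k22 (f x) (g x)) \<longlongrightarrow> k22 s t) F"
proof -
  have ef: "eventually (\<lambda>x. f x \<in> {-1<..<1}) F" using st by (intro topological_tendstoD[OF f]) auto
  have eg: "eventually (\<lambda>x. g x \<in> {-1<..<1}) F" using st by (intro topological_tendstoD[OF g]) auto
  have "((\<lambda>x. arcsin (c_fun (f x) (g x))) \<longlongrightarrow> arcsin (c_fun s t)) F"
    using st ef eg by (intro tendsto_arcsin_c f g) (auto elim: eventually_elim2)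
  moreover have "((\<lambda>x. sgn (g x - f x)) \<longlongrightarrow> sgn (t - s)) F"
    using st by (intro tendsto_sgn tendsto_diff f g) auto
  ultimately show ?thesis unfolding k22_def by (intro tendsto_mult)
qed

section \<open>Laws of finite vectors\<close>

text \<open>After division by the common mass \<open>m\<close> both sides are laws of real variables
  under changed measures, and the phases 0 and \<open>- pi/2\<close> recover the real and imaginary
  parts of the characteristic function, so that Levy's uniqueness theorem applies. Mass 0 is treated
  apart. The bound 2 is that of the weights \<open>1 + cos\<close> to which this is applied.\<close>

lemma weighted_law_unique:
  fixes X :: "'w \<Rightarrow> real" and Y :: "'v \<Rightarrow> real"
  assumes M: "prob_space M" and N: "prob_space N"
    and [measurable]: "X \<in> borel_measurable M" "h \<in> borel_measurable M" "Y \<in> borel_measurable N" "g \<in> borel_measurable N"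
    and h: "\<And>\<omega>. 0 \<le> h \<omega>" "\<And>\<omega>. h \<omega> \<le> (2::real)" and g: "\<And>\<omega>. 0 \<le> g \<omega>" "\<And>\<omega>. g \<omega> \<le> (2::real)"
    and eq: "\<And>t \<theta>. (\<integral>\<omega>. h \<omega> * cos (t * X \<omega> + \<theta>) \<partial>M) = (\<integral>\<omega>. g \<omega> * cos (t * Y \<omega> + \<theta>) \<partial>N)"
    and A[measurable]: "A \<in> sets borel"
  shows "(\<integral>\<omega>. h \<omega> * indicator A (X \<omega>) \<partial>M) = (\<integral>\<omega>. g \<omega> * indicator A (Y \<omega>) \<partial>N)"
proof -
  interpret M: prob_space M by fact
  interpret N: prob_space N by fact
  have ih: "integrable M h" by (rule M.integrable_const_bound[of _ 2]) (use h in auto)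
  have ig: "integrable N g" by (rule N.integrable_const_bound[of _ 2]) (use g in auto)
  define m where "m = (\<integral>\<omega>. h \<omega> \<partial>M)"
  have m': "m = (\<integral>\<omega>. g \<omega> \<partial>N)" using eq[of 0 0] by (simp add: m_def)
  have m0: "0 \<le> m" unfolding m_def using h by simp
  show ?thesis
  proof (cases "m = 0")
    case True
    then have "AE \<omega> in M. h \<omega> = 0" "AE \<omega> in N. g \<omega> = 0"
      using integral_nonneg_eq_0_iff_AE[OF ih] integral_nonneg_eq_0_iff_AE[OF ig] h g m' by (auto simp: m_def)
    then have "(\<integral>\<omega>. h \<omega> * indicator A (X \<omega>) \<partial>M) = (\<integral>\<omega>. 0 \<partial>M)" "(\<integral>\<omega>. g \<omega> * indicator A (Y \<omega>) \<partial>N) = (\<integral>\<omega>. 0 \<partial>N)"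
      by (intro integral_cong_AE; (auto elim: eventually_mono | measurable))+
    then show ?thesis by simp
  next
    case False
    with m0 have m: "0 < m" by simp
    have gen: "real_distribution (distr (density K (\<lambda>\<omega>. ennreal (k \<omega> / m))) borel Z) \<and>
       (\<forall>t. char (distr (density K (\<lambda>\<omega>. ennreal (k \<omega> / m))) borel Z) t =
          Complex (\<integral>\<omega>. k \<omega> * cos (t * Z \<omega> + 0) \<partial>K) (\<integral>\<omega>. k \<omega> * cos (t * Z \<omega> - pi/2) \<partial>K) / of_real m) \<and>
       measure (distr (density K (\<lambda>\<omega>. ennreal (k \<omega> / m))) borel Z) A = (\<integral>\<omega>. k \<omega> * indicator A (Z \<omega>) \<partial>K) / m"
      if K: "prob_space K" and [measurable]: "Z \<in> borel_measurable K" "k \<in> borel_measurable K"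
        and k: "\<And>\<omega>. 0 \<le> k \<omega>" "\<And>\<omega>. k \<omega> \<le> 2" and mk: "m = (\<integral>\<omega>. k \<omega> \<partial>K)" for K :: "'u measure" and k Z
    proof -
      interpret K: prob_space K by fact
      have ik: "integrable K k" by (rule K.integrable_const_bound[of _ 2]) (use k in auto)
      let ?D = "density K (\<lambda>\<omega>. ennreal (k \<omega> / m))"
      have "emeasure ?D (space ?D) = (\<integral>\<^sup>+\<omega>. ennreal (k \<omega> / m) \<partial>K)"
        by (simp add: emeasure_density)
      also have "\<dots> = ennreal (\<integral>\<omega>. k \<omega> / m \<partial>K)"
        using ik m k by (intro nn_integral_eq_integral) auto
      also have "\<dots> = 1" using m mk by simp
      finally interpret D: prob_space ?D by (rule prob_spaceI)
      have D: "real_distribution (distr ?D borel Z)" by (rule D.real_distribution_distr) simp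
      interpret DD: real_distribution "distr ?D borel Z" by fact
      have char: "char (distr ?D borel Z) t =
          Complex (\<integral>\<omega>. k \<omega> * cos (t * Z \<omega> + 0) \<partial>K) (\<integral>\<omega>. k \<omega> * cos (t * Z \<omega> - pi/2) \<partial>K) / of_real m" for t
      proof -
        have int: "integrable K (\<lambda>\<omega>. (k \<omega> / m) *\<^sub>R iexp (t * Z \<omega>))"
          using k m by (intro K.integrable_const_bound[of _ "2/m"]) (auto simp: divide_right_mono norm_mult)
        have "char (distr ?D borel Z) t = (\<integral>\<omega>. (k \<omega> / m) *\<^sub>R iexp (t * Z \<omega>) \<partial>K)"
          unfolding char_def using m k
          by (subst integral_distr) (auto intro!: integral_density)
        also have "\<dots> = Complex (\<integral>\<omega>. k \<omega> / m * cos (t * Z \<omega>) \<partial>K) (\<integral>\<omega>. k \<omega> / m * sin (t * Z \<omega>) \<partial>K)"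
          using integral_Re[OF int] integral_Im[OF int]
          by (intro complex_eqI) (simp_all add: Re_exp Im_exp)
        also have "\<dots> = Complex (\<integral>\<omega>. k \<omega> * cos (t * Z \<omega>) \<partial>K) (\<integral>\<omega>. k \<omega> * sin (t * Z \<omega>) \<partial>K) / of_real m"
          by (intro complex_eqI) (simp_all)
        finally show ?thesis by (simp add: cos_diff)
      qed
      have "measure (distr ?D borel Z) A = (\<integral>x. indicator A x \<partial>distr ?D borel Z)"
        by simp
      also have "\<dots> = (\<integral>\<omega>. indicator A (Z \<omega>) \<partial>?D)" by (subst integral_distr) auto
      also have "\<dots> = (\<integral>\<omega>. (k \<omega> / m) *\<^sub>R indicator A (Z \<omega>) \<partial>K)"
        using m k by (intro integral_density) auto
      also have "\<dots> = (\<integral>\<omega>. k \<omega> * indicator A (Z \<omega>) \<partial>K) / m" by simp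
      finally show ?thesis using D char by blast
    qed
    note G1 = gen[OF M, of X h, OF _ _ h m_def] and G2 = gen[OF N, of Y g, OF _ _ g m']
    let ?D1 = "distr (density M (\<lambda>\<omega>. ennreal (h \<omega> / m))) borel X"
    let ?D2 = "distr (density N (\<lambda>\<omega>. ennreal (g \<omega> / m))) borel Y"
    have "?D1 = ?D2"
    proof (rule Levy_uniqueness)
      show "char ?D1 = char ?D2"
        using G1 G2 eq[of _ 0] eq[of _ "- pi/2"] by (simp add: fun_eq_iff)
    qed (use G1 G2 in auto)
    then show ?thesis using G1 G2 m by simp
  qed
qed

text \<open>A uniqueness theorem of Cramer-Wold type, reduced to the one-dimensional case:
  coordinates are moved one at a time out of the cosine and into indicator functions.\<close>

lemma joint_law_unique:
  fixes X :: "'i \<Rightarrow> 'w \<Rightarrow> real" and Y :: "'i \<Rightarrow> 'v \<Rightarrow> real"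
  assumes M: "prob_space M" and N: "prob_space N" and fin: "finite I"
    and X[measurable]: "\<And>i. i \<in> I \<Longrightarrow> X i \<in> borel_measurable M"
    and Y[measurable]: "\<And>i. i \<in> I \<Longrightarrow> Y i \<in> borel_measurable N"
    and eq: "\<And>u \<theta>. (\<integral>\<omega>. cos ((\<Sum>i\<in>I. u i * X i \<omega>) + \<theta>) \<partial>M) = (\<integral>\<omega>. cos ((\<Sum>i\<in>I. u i * Y i \<omega>) + \<theta>) \<partial>N)"
  shows "distr M (PiM I (\<lambda>_. borel)) (\<lambda>\<omega>. \<lambda>i\<in>I. X i \<omega>) = distr N (PiM I (\<lambda>_. borel)) (\<lambda>\<omega>. \<lambda>i\<in>I. Y i \<omega>)"
proof -
  interpret M: prob_space M by fact
  interpret N: prob_space N by fact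
  have core: "(\<integral>\<omega>. (\<Prod>i\<in>J. indicator (A i) (X i \<omega>)) * cos ((\<Sum>i\<in>I - J. u i * X i \<omega>) + \<theta>) \<partial>M)
      = (\<integral>\<omega>. (\<Prod>i\<in>J. indicator (A i) (Y i \<omega>)) * cos ((\<Sum>i\<in>I - J. u i * Y i \<omega>) + \<theta>) \<partial>N)"
    if "J \<subseteq> I" "\<And>i. i \<in> J \<Longrightarrow> A i \<in> sets borel" for J A u \<theta>
  proof -
    have "finite J" using that(1) fin finite_subset by blast
    then show ?thesis using that
    proof (induction J arbitrary: u \<theta> rule: finite_induct)
      case empty
      then show ?case using eq by simp
    next
      case (insert m J)
      have mI: "m \<in> I" and JI: "J \<subseteq> I" and A[measurable]: "\<And>i. i \<in> J \<Longrightarrow> A i \<in> sets borel" and Am[measurable]: "A m \<in> sets borel"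
        using insert.prems by auto
      define R where "R = I - insert m J"
      have IJ: "I - J = insert m R" "m \<notin> R" "finite R" "R \<subseteq> I"
        using mI insert.hyps fin by (auto simp: R_def)
      note [measurable] = X[OF mI] Y[OF mI]
      have mX[measurable]: "\<And>i. i \<in> J \<Longrightarrow> X i \<in> borel_measurable M" "\<And>i. i \<in> R \<Longrightarrow> X i \<in> borel_measurable M"
       and mY[measurable]: "\<And>i. i \<in> J \<Longrightarrow> Y i \<in> borel_measurable N" "\<And>i. i \<in> R \<Longrightarrow> Y i \<in> borel_measurable N"
        using X Y JI IJ by auto
      define P where "P \<omega> = (\<Prod>i\<in>J. indicator (A i) (X i \<omega>) :: real)" for \<omega>
      define P' where "P' \<omega> = (\<Prod>i\<in>J. indicator (A i) (Y i \<omega>) :: real)" for \<omega>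
      have P[measurable]: "P \<in> borel_measurable M" "P' \<in> borel_measurable N" unfolding P_def P'_def by measurable
      have P01: "0 \<le> P \<omega>" "P \<omega> \<le> 1" "0 \<le> P' \<omega>'" "P' \<omega>' \<le> 1" for \<omega> \<omega>'
        unfolding P_def P'_def by (auto intro!: prod_nonneg prod_le_1 simp: indicator_def)
      have IH: "(\<integral>\<omega>. P \<omega> * cos ((\<Sum>i\<in>R. u i * X i \<omega>) + t * X m \<omega> + \<theta>) \<partial>M) =
            (\<integral>\<omega>. P' \<omega> * cos ((\<Sum>i\<in>R. u i * Y i \<omega>) + t * Y m \<omega> + \<theta>) \<partial>N)" for u t \<theta>
      proof -
        have "(\<Sum>i\<in>R. (if i = m then t else u i) * X i \<omega>) = (\<Sum>i\<in>R. u i * X i \<omega>)"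
          "(\<Sum>i\<in>R. (if i = m then t else u i) * Y i \<omega>') = (\<Sum>i\<in>R. u i * Y i \<omega>')" for \<omega> \<omega>'
          using IJ(2) by (auto intro!: sum.cong)
        then show ?thesis
          using insert.IH[OF JI, of "\<lambda>i. if i = m then t else u i" \<theta>] insert.prems(2) IJ
          by (simp add: P_def P'_def add_ac)
      qed
      have IH0: "(\<integral>\<omega>. P \<omega> * cos (t * X m \<omega> + \<theta>) \<partial>M) = (\<integral>\<omega>. P' \<omega> * cos (t * Y m \<omega> + \<theta>) \<partial>N)" for t \<theta>
        using IH[of "\<lambda>_. 0" t \<theta>] by simp
      have bM: "integrable M (\<lambda>\<omega>. P \<omega> * f \<omega>)" if [measurable]: "f \<in> borel_measurable M" and "\<And>\<omega>. \<bar>f \<omega>\<bar> \<le> 1" for f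
        using P01 that(2) by (intro M.integrable_const_bound[of _ 1]) (auto simp: abs_mult intro!: AE_I2 mult_le_one)
      have bN: "integrable N (\<lambda>\<omega>. P' \<omega> * f \<omega>)" if [measurable]: "f \<in> borel_measurable N" and "\<And>\<omega>. \<bar>f \<omega>\<bar> \<le> 1" for f
        using P01 that(2) by (intro N.integrable_const_bound[of _ 1]) (auto simp: abs_mult intro!: AE_I2 mult_le_one)
      \<comment> \<open>Adding 1 turns the cosine of the remaining coordinates into a nonnegative
        weight, as the one-dimensional result demands. The share of the 1 is known from the constant
        weight 2 and is subtracted afterwards.\<close>
      have step: "(\<integral>\<omega>. (P \<omega> * (1 + cos ((\<Sum>i\<in>R. u i * X i \<omega>) + \<theta>))) * indicator (A m) (X m \<omega>) \<partial>M)
          = (\<integral>\<omega>. (P' \<omega> * (1 + cos ((\<Sum>i\<in>R. u i * Y i \<omega>) + \<theta>))) * indicator (A m) (Y m \<omega>) \<partial>N)" for u \<theta>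
      proof (rule weighted_law_unique[OF M N])
        define S where "S \<omega> = (\<Sum>i\<in>R. u i * X i \<omega>)" for \<omega>
        define S' where "S' \<omega> = (\<Sum>i\<in>R. u i * Y i \<omega>)" for \<omega>
        have [measurable]: "S \<in> borel_measurable M" "S' \<in> borel_measurable N" unfolding S_def S'_def by measurable
        show "(\<lambda>\<omega>. P \<omega> * (1 + cos ((\<Sum>i\<in>R. u i * X i \<omega>) + \<theta>))) \<in> borel_measurable M"
          "(\<lambda>\<omega>. P' \<omega> * (1 + cos ((\<Sum>i\<in>R. u i * Y i \<omega>) + \<theta>))) \<in> borel_measurable N"
          unfolding S_def[symmetric] S'_def[symmetric] by measurable
        have c: "0 \<le> 1 + cos x" "1 + cos x \<le> 2" for x :: real
          using cos_ge_minus_one[of x] cos_le_one[of x] by linarith+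
        show "0 \<le> P \<omega> * (1 + cos ((\<Sum>i\<in>R. u i * X i \<omega>) + \<theta>))" for \<omega>
          using P01 c by (intro mult_nonneg_nonneg)
        show "0 \<le> P' \<omega> * (1 + cos ((\<Sum>i\<in>R. u i * Y i \<omega>) + \<theta>))" for \<omega>
          using P01 c by (intro mult_nonneg_nonneg)
        show "P \<omega> * (1 + cos ((\<Sum>i\<in>R. u i * X i \<omega>) + \<theta>)) \<le> 2" for \<omega>
          by (rule order_trans[OF mult_mono[OF P01(2) c(2)]]) (use c in auto)
        show "P' \<omega> * (1 + cos ((\<Sum>i\<in>R. u i * Y i \<omega>) + \<theta>)) \<le> 2" for \<omega>
          by (rule order_trans[OF mult_mono[OF P01(4) c(2)]]) (use c in auto)
        fix t \<phi>
        \<comment> \<open>A product of cosines becomes cosines of the sum and of the difference of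
          the arguments, which are again of the form covered by the induction hypothesis.\<close>
        have alg: "p * (1 + cos s) * cos w = p * cos w + (p * cos (s + w) + p * cos (s - w)) / 2" for p s w :: real
          by (simp add: cos_add cos_diff field_simps)
        have "(\<integral>\<omega>. P \<omega> * (1 + cos (S \<omega> + \<theta>)) * cos (t * X m \<omega> + \<phi>) \<partial>M) =
           (\<integral>\<omega>. P \<omega> * cos (t * X m \<omega> + \<phi>) \<partial>M) + ((\<integral>\<omega>. P \<omega> * cos (S \<omega> + \<theta> + (t * X m \<omega> + \<phi>)) \<partial>M) + (\<integral>\<omega>. P \<omega> * cos (S \<omega> + \<theta> - (t * X m \<omega> + \<phi>)) \<partial>M)) / 2"
          unfolding alg by (subst Bochner_Integration.integral_add Bochner_Integration.integral_divide_zero | (intro bM Bochner_Integration.integrable_add integrable_divide_zero; simp; fail) | simp; fail)+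
        also have "\<dots> = (\<integral>\<omega>. P' \<omega> * cos (t * Y m \<omega> + \<phi>) \<partial>N) + ((\<integral>\<omega>. P' \<omega> * cos (S' \<omega> + \<theta> + (t * Y m \<omega> + \<phi>)) \<partial>N) + (\<integral>\<omega>. P' \<omega> * cos (S' \<omega> + \<theta> - (t * Y m \<omega> + \<phi>)) \<partial>N)) / 2"
          using IH0[of t \<phi>] IH[of u t "\<theta> + \<phi>"] IH[of u "- t" "\<theta> - \<phi>"]
          by (simp add: S_def S'_def algebra_simps)
        also have "\<dots> = (\<integral>\<omega>. P' \<omega> * (1 + cos (S' \<omega> + \<theta>)) * cos (t * Y m \<omega> + \<phi>) \<partial>N)"
          unfolding alg by (subst Bochner_Integration.integral_add Bochner_Integration.integral_divide_zero | (intro bN Bochner_Integration.integrable_add integrable_divide_zero; simp; fail) | simp; fail)+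
        finally show "(\<integral>\<omega>. P \<omega> * (1 + cos ((\<Sum>i\<in>R. u i * X i \<omega>) + \<theta>)) * cos (t * X m \<omega> + \<phi>) \<partial>M) = (\<integral>\<omega>. P' \<omega> * (1 + cos ((\<Sum>i\<in>R. u i * Y i \<omega>) + \<theta>)) * cos (t * Y m \<omega> + \<phi>) \<partial>N)"
          by (simp add: S_def S'_def)
      qed measurable
      define S where "S \<omega> = (\<Sum>i\<in>R. u i * X i \<omega>)" for \<omega>
      define S' where "S' \<omega> = (\<Sum>i\<in>R. u i * Y i \<omega>)" for \<omega>
      have [measurable]: "S \<in> borel_measurable M" "S' \<in> borel_measurable N" unfolding S_def S'_def by measurable
      have one: "(\<integral>\<omega>. P \<omega> * indicator (A m) (X m \<omega>) \<partial>M) = (\<integral>\<omega>. P' \<omega> * indicator (A m) (Y m \<omega>) \<partial>N)"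
        using step[of "\<lambda>_. 0" 0] by (simp add: mult.assoc mult.left_commute[of _ 2])
      have "(\<integral>\<omega>. (P \<omega> * indicator (A m) (X m \<omega>)) + P \<omega> * (indicator (A m) (X m \<omega>) * cos (S \<omega> + \<theta>)) \<partial>M)
          = (\<integral>\<omega>. (P' \<omega> * indicator (A m) (Y m \<omega>)) + P' \<omega> * (indicator (A m) (Y m \<omega>) * cos (S' \<omega> + \<theta>)) \<partial>N)"
        using step[of u \<theta>] by (simp add: S_def S'_def algebra_simps)
      then have "(\<integral>\<omega>. P \<omega> * (indicator (A m) (X m \<omega>) * cos (S \<omega> + \<theta>)) \<partial>M)
          = (\<integral>\<omega>. P' \<omega> * (indicator (A m) (Y m \<omega>) * cos (S' \<omega> + \<theta>)) \<partial>N)"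
        using one
        by (subst (asm) (1 2) Bochner_Integration.integral_add) (auto intro!: bM bN simp: abs_mult indicator_def)
      then show ?case using insert.hyps
        by (simp add: P_def P'_def S_def S'_def R_def mult_ac)
    qed
  qed
  have mapM[measurable]: "(\<lambda>\<omega>. \<lambda>i\<in>I. X i \<omega>) \<in> measurable M (PiM I (\<lambda>_. borel))"
    by (intro measurable_restrict X)
  have mapN[measurable]: "(\<lambda>\<omega>. \<lambda>i\<in>I. Y i \<omega>) \<in> measurable N (PiM I (\<lambda>_. borel))"
    by (intro measurable_restrict Y)
  have meas: "emeasure (distr K (PiM I (\<lambda>_. borel)) (\<lambda>\<omega>. \<lambda>i\<in>I. Z i \<omega>)) (PiE I A) = ennreal (\<integral>\<omega>. (\<Prod>i\<in>I. indicator (A i) (Z i \<omega>)) \<partial>K)"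
    if K: "prob_space K" and Z[measurable]: "\<And>i. i \<in> I \<Longrightarrow> Z i \<in> borel_measurable K" and A[measurable]: "\<And>i. i \<in> I \<Longrightarrow> A i \<in> sets borel"
    for K :: "'u measure" and Z :: "'i \<Rightarrow> 'u \<Rightarrow> real" and A
  proof -
    interpret K: prob_space K by fact
    have [measurable]: "(\<lambda>\<omega>. \<lambda>i\<in>I. Z i \<omega>) \<in> measurable K (PiM I (\<lambda>_. borel))"
      by (intro measurable_restrict Z)
    have [measurable]: "PiE I A \<in> sets (PiM I (\<lambda>_. borel))"
      by (rule sets_PiM_I_finite[OF fin]) (use A in auto)
    let ?E = "(\<lambda>\<omega>. \<lambda>i\<in>I. Z i \<omega>) -` PiE I A \<inter> space K"
    have "emeasure (distr K (PiM I (\<lambda>_. borel)) (\<lambda>\<omega>. \<lambda>i\<in>I. Z i \<omega>)) (PiE I A) = emeasure K ?E"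
      by (simp add: emeasure_distr)
    also have "\<dots> = ennreal (measure K ?E)" by (rule K.emeasure_eq_measure)
    also have "measure K ?E = (\<integral>\<omega>. indicator ?E \<omega> \<partial>K)"
      by simp
    also have "\<dots> = (\<integral>\<omega>. (\<Prod>i\<in>I. indicator (A i) (Z i \<omega>)) \<partial>K)"
    proof (rule Bochner_Integration.integral_cong[OF refl])
      fix \<omega> assume w: "\<omega> \<in> space K"
      show "indicator ?E \<omega> = (\<Prod>i\<in>I. indicator (A i) (Z i \<omega>) :: real)"
      proof (cases "\<forall>i\<in>I. Z i \<omega> \<in> A i")
        case True then show ?thesis using w by (auto simp: indicator_def PiE_def)
      next
        case False
        then obtain i where "i \<in> I" "Z i \<omega> \<notin> A i" by blast
        then have "(\<Prod>i\<in>I. indicator (A i) (Z i \<omega>) :: real) = 0" using fin by (intro prod_zero bexI[of _ i]) (auto simp: indicator_def)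
        moreover have "\<omega> \<notin> ?E" using \<open>i \<in> I\<close> \<open>Z i \<omega> \<notin> A i\<close> by (auto simp: PiE_def Pi_def)
        ultimately show ?thesis by simp
      qed
    qed
    finally show ?thesis .
  qed
  show ?thesis
  proof (rule measure_eqI_PiM_finite[OF fin])
    fix A :: "'i \<Rightarrow> real set" assume A: "\<And>i. i \<in> I \<Longrightarrow> A i \<in> sets borel"
    show "emeasure (distr M (PiM I (\<lambda>_. borel)) (\<lambda>\<omega>. \<lambda>i\<in>I. X i \<omega>)) (PiE I A) = emeasure (distr N (PiM I (\<lambda>_. borel)) (\<lambda>\<omega>. \<lambda>i\<in>I. Y i \<omega>)) (PiE I A)"
      using core[of I A "\<lambda>_. 0" 0] A meas[OF M X A] meas[OF N Y A] by simp
  next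
    show "range (\<lambda>n::nat. PiE I (\<lambda>_. UNIV)) \<subseteq> prod_algebra I (\<lambda>_. borel)"
      using fin by (auto intro!: prod_algebraI_finite)
    show "(\<Union>n::nat. PiE I (\<lambda>_. UNIV)) = space (PiM I (\<lambda>_. borel))"
      by (simp add: space_PiM)
    have "prob_space (distr M (PiM I (\<lambda>_. borel)) (\<lambda>\<omega>. \<lambda>i\<in>I. X i \<omega>))" by (rule M.prob_space_distr) measurable
    then show "emeasure (distr M (PiM I (\<lambda>_. borel)) (\<lambda>\<omega>. \<lambda>i\<in>I. X i \<omega>)) (PiE I (\<lambda>_. UNIV)) \<noteq> \<infinity>" for n::nat
      using finite_measure.emeasure_finite prob_space.finite_measure by auto
  qed simp_all
qed

section \<open>The Gaussian power series\<close>

locale gaussian_series = prob_space M for M :: "'w measure" +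
  fixes a :: "nat \<Rightarrow> 'w \<Rightarrow> real"
  assumes indep: "indep_vars (\<lambda>_. borel) a UNIV"
    and normal: "\<And>k. distributed M lborel (a k) (\<lambda>x. ennreal (std_normal_density x))"
begin

definition gf :: "'w \<Rightarrow> real \<Rightarrow> real" where
  "gf \<omega> x = (\<Sum>k. a k \<omega> * x ^ k)"

lemma measurable_a [measurable]: "a k \<in> borel_measurable M"
  using distributed_measurable[OF normal[of k]] by simp

lemma measurable_gf [measurable]: "(\<lambda>\<omega>. gf \<omega> x) \<in> borel_measurable M"
  unfolding gf_def by measurable

lemma distr_a: "distr M borel (a k) = std_normal_distribution"
  using distributed_distr_eq_density[OF normal[of k]]
  by (metis distr_cong sets_lborel)

text \<open>The expectation of the sum is a finite multiple of a geometric series. Countably many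
  radii increasing to 1 then give one null set for all \<open>r\<close>.\<close>

lemma AE_summable: "AE \<omega> in M. \<forall>r. 0 \<le> r \<and> r < 1 \<longrightarrow> summable (\<lambda>k. \<bar>a k \<omega>\<bar> * r ^ k)"
proof -
  define C where "C = (\<integral>\<^sup>+x. ennreal \<bar>x\<bar> \<partial>std_normal_distribution)"
  have C: "C < \<infinity>"
    using integrable_std_normal_distribution_moment[of 1] by (simp add: C_def integrable_iff_bounded)
  have Ea: "(\<integral>\<^sup>+\<omega>. ennreal \<bar>a k \<omega>\<bar> \<partial>M) = C" for k
    unfolding C_def distr_a[of k, symmetric] by (subst nn_integral_distr) auto
  have main: "AE \<omega> in M. summable (\<lambda>k. \<bar>a k \<omega>\<bar> * r ^ k)" if r: "0 \<le> r" "r < 1" for r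
  proof -
    have "(\<integral>\<^sup>+\<omega>. (\<Sum>k. ennreal (\<bar>a k \<omega>\<bar> * r ^ k)) \<partial>M) = (\<Sum>k. \<integral>\<^sup>+\<omega>. ennreal (\<bar>a k \<omega>\<bar> * r ^ k) \<partial>M)"
      by (rule nn_integral_suminf) measurable
    also have "\<dots> = (\<Sum>k. C * ennreal (r ^ k))"
      using r by (simp add: ennreal_mult nn_integral_multc Ea)
    also have "\<dots> = C * (\<Sum>k. ennreal (r ^ k))" by (rule ennreal_suminf_cmult)
    also have "(\<Sum>k. ennreal (r ^ k)) = ennreal (\<Sum>k. r ^ k)"
      using r by (intro suminf_ennreal2) (auto intro: summable_geometric)
    also have "C * \<dots> < \<infinity>" using C by (simp add: ennreal_mult_less_top)
    finally have "AE \<omega> in M. (\<Sum>k. ennreal (\<bar>a k \<omega>\<bar> * r ^ k)) \<noteq> \<infinity>"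
      by (intro nn_integral_noteq_infinite) auto
    then show ?thesis
      by eventually_elim (rule summable_suminf_not_top, use r in auto)
  qed
  have "AE \<omega> in M. \<forall>m::nat. summable (\<lambda>k. \<bar>a k \<omega>\<bar> * (1 - 1 / real (m + 2)) ^ k)"
    unfolding AE_all_countable by (intro allI main) (auto simp: field_simps)
  then show ?thesis
  proof (eventually_elim, intro allI impI)
    fix \<omega> r assume s: "\<forall>m::nat. summable (\<lambda>k. \<bar>a k \<omega>\<bar> * (1 - 1 / real (m + 2)) ^ k)" and r: "0 \<le> r \<and> r < (1::real)"
    obtain m where m: "1 / real (Suc m) < 1 - r" using r nat_approx_posE[of "1 - r"] by auto
    have "1 / real (m + 2) \<le> 1 / real (Suc m)" by (intro divide_left_mono) auto
    with m have "r \<le> 1 - 1 / real (m + 2)" by linarith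
    then show "summable (\<lambda>k. \<bar>a k \<omega>\<bar> * r ^ k)"
      using r by (intro summable_comparison_test'[OF s[rule_format, of m], of 0])
        (auto simp: abs_mult intro!: mult_left_mono power_mono)
  qed
qed

text \<open>The sum is centred normal with variance \<open>\<Sum>j. (w j)\<^sup>2\<close>. A cosine
  with a free phase carries the information of the complex characteristic function in real
  integrals, the form that \<open>joint_law_unique\<close> takes.\<close>

lemma char_linear:
  assumes w: "summable (\<lambda>j. (w j)\<^sup>2)" and s: "AE \<omega> in M. summable (\<lambda>j. a j \<omega> * w j)"
  shows "(\<integral>\<omega>. cos ((\<Sum>j. a j \<omega> * w j) + \<theta>) \<partial>M) = cos \<theta> * exp (- (\<Sum>j. (w j)\<^sup>2) / 2)"
proof -
  have fin: "(\<integral>\<omega>. iexp (\<Sum>j<d. a j \<omega> * w j) \<partial>M) = complex_of_real (exp (- (\<Sum>j<d. (w j)\<^sup>2) / 2))" for d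
  proof -
    have ind: "indep_vars (\<lambda>_. borel) (\<lambda>j \<omega>. a j \<omega> * w j) {..<d}"
      by (rule indep_vars_compose2[where M' = "\<lambda>_. borel" and Y = "\<lambda>j x. x * w j"])
         (auto intro: indep_vars_subset[OF indep])
    have one: "char (distr M borel (\<lambda>\<omega>. a j \<omega> * w j)) 1 = complex_of_real (exp (- (w j)\<^sup>2 / 2))" for j
    proof -
      have "char (distr M borel (\<lambda>\<omega>. a j \<omega> * w j)) 1 = (\<integral>\<omega>. iexp (w j * a j \<omega>) \<partial>M)"
        unfolding char_def by (subst integral_distr) (auto simp: mult.commute)
      also have "\<dots> = char (distr M borel (a j)) (w j)"
        unfolding char_def by (subst integral_distr) auto
      finally show ?thesis by (simp add: distr_a char_std_normal_distribution)
    qed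
    have "(\<integral>\<omega>. iexp (\<Sum>j<d. a j \<omega> * w j) \<partial>M) = char (distr M borel (\<lambda>\<omega>. \<Sum>j<d. a j \<omega> * w j)) 1"
      unfolding char_def by (subst integral_distr) auto
    also have "\<dots> = (\<Prod>j<d. complex_of_real (exp (- (w j)\<^sup>2 / 2)))"
      unfolding char_distr_sum[OF ind] one ..
    also have "\<dots> = complex_of_real (exp (\<Sum>j<d. - (w j)\<^sup>2 / 2))"
      by (simp add: exp_sum)
    also have "(\<Sum>j<d. - (w j)\<^sup>2 / 2) = - (\<Sum>j<d. (w j)\<^sup>2) / 2"
      by (simp add: sum_negf sum_divide_distrib)
    finally show ?thesis .
  qed
  have "(\<lambda>d. \<integral>\<omega>. iexp (\<Sum>j<d. a j \<omega> * w j) \<partial>M) \<longlonglongrightarrow> (\<integral>\<omega>. iexp (\<Sum>j. a j \<omega> * w j) \<partial>M)"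
  proof (rule integral_dominated_convergence[where w = "\<lambda>_. 1"])
    show "AE \<omega> in M. (\<lambda>d. iexp (\<Sum>j<d. a j \<omega> * w j)) \<longlonglongrightarrow> iexp (\<Sum>j. a j \<omega> * w j)"
      using s
    proof eventually_elim
      case (elim \<omega>)
      then have "(\<lambda>d. \<Sum>j<d. a j \<omega> * w j) \<longlonglongrightarrow> (\<Sum>j. a j \<omega> * w j)" by (rule summable_LIMSEQ)
      then show ?case by (intro tendsto_intros)
    qed
  qed (auto)
  moreover have "(\<lambda>d. complex_of_real (exp (- (\<Sum>j<d. (w j)\<^sup>2) / 2))) \<longlonglongrightarrow> complex_of_real (exp (- (\<Sum>j. (w j)\<^sup>2) / 2))"
    using summable_LIMSEQ[OF w] by (intro tendsto_intros) auto
  ultimately have main: "(\<integral>\<omega>. iexp (\<Sum>j. a j \<omega> * w j) \<partial>M) = complex_of_real (exp (- (\<Sum>j. (w j)\<^sup>2) / 2))"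
    unfolding fin by (rule LIMSEQ_unique)
  define S where "S \<omega> = (\<Sum>j. a j \<omega> * w j)" for \<omega>
  have [measurable]: "S \<in> borel_measurable M" unfolding S_def by measurable
  have int: "integrable M (\<lambda>\<omega>. iexp (S \<omega>))" by (rule integrable_const_bound[of _ 1]) auto
  have c: "(\<integral>\<omega>. cos (S \<omega>) \<partial>M) = exp (- (\<Sum>j. (w j)\<^sup>2) / 2)"
    using main integral_Re[OF int] by (simp add: S_def Re_exp)
  have sn: "(\<integral>\<omega>. sin (S \<omega>) \<partial>M) = 0"
    using main integral_Im[OF int] by (simp add: S_def Im_exp)
  have ic: "integrable M (\<lambda>\<omega>. cos (S \<omega>))" "integrable M (\<lambda>\<omega>. sin (S \<omega>))"
    by (rule integrable_const_bound[of _ 1]; simp)+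
  have "(\<integral>\<omega>. cos (S \<omega> + \<theta>) \<partial>M) = cos \<theta> * (\<integral>\<omega>. cos (S \<omega>) \<partial>M) - sin \<theta> * (\<integral>\<omega>. sin (S \<omega>) \<partial>M)"
    unfolding cos_add using ic by (simp add: mult.commute)
  then show ?thesis using c sn by (simp add: S_def)
qed

text \<open>A combination of values of \<open>f\<close> is again a series in the \<open>a j\<close>,
  with coefficients \<open>w j\<close>. The squares of these coefficients sum up to geometric
  series, and this is where the covariance \<open>1 / (1 - y * z)\<close> comes from.\<close>

lemma char_gf:
  assumes I: "finite I" "I \<subseteq> {-1<..<1}"
  shows "(\<integral>\<omega>. cos ((\<Sum>y\<in>I. u y * gf \<omega> y) + \<theta>) \<partial>M) = cos \<theta> * exp (- (\<Sum>y\<in>I. \<Sum>z\<in>I. u y * u z / (1 - y * z)) / 2)"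
proof -
  define w where "w j = (\<Sum>y\<in>I. u y * y ^ j)" for j
  have sq: "(w j)\<^sup>2 = (\<Sum>y\<in>I. \<Sum>z\<in>I. u y * u z * (y * z) ^ j)" for j
    by (simp add: w_def power2_eq_square sum_product power_mult_distrib mult_ac)
  have geo: "(\<lambda>j. u y * u z * (y * z) ^ j) sums (u y * u z * (1 / (1 - y * z)))" if "y \<in> I" "z \<in> I" for y z
    using abs_mult_less_1[OF subsetD[OF I(2) that(1)] subsetD[OF I(2) that(2)]]
    by (intro sums_mult geometric_sums) simp
  have sums: "(\<lambda>j. (w j)\<^sup>2) sums (\<Sum>y\<in>I. \<Sum>z\<in>I. u y * u z * (1 / (1 - y * z)))"
    unfolding sq by (intro sums_sum geo)
  have AEs: "AE \<omega> in M. \<forall>y\<in>I. summable (\<lambda>j. a j \<omega> * y ^ j)"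
    using AE_summable
  proof (eventually_elim, intro ballI)
    fix \<omega> y assume s: "\<forall>r. 0 \<le> r \<and> r < 1 \<longrightarrow> summable (\<lambda>k. \<bar>a k \<omega>\<bar> * r ^ k)" and y: "y \<in> I"
    then have "\<bar>y\<bar> < 1" using subsetD[OF I(2) y] by (simp add: abs_less_iff)
    then have "summable (\<lambda>k. \<bar>a k \<omega> * y ^ k\<bar>)" using s[rule_format, of "\<bar>y\<bar>"] by (simp add: abs_mult power_abs)
    then show "summable (\<lambda>j. a j \<omega> * y ^ j)" by (rule summable_rabs_cancel)
  qed
  have tot: "AE \<omega> in M. summable (\<lambda>j. a j \<omega> * w j) \<and> (\<Sum>j. a j \<omega> * w j) = (\<Sum>y\<in>I. u y * gf \<omega> y)"
    using AEs
  proof eventually_elim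
    case (elim \<omega>)
    have "(\<lambda>j. \<Sum>y\<in>I. u y * (a j \<omega> * y ^ j)) sums (\<Sum>y\<in>I. u y * gf \<omega> y)"
      unfolding gf_def using elim by (intro sums_sum sums_mult summable_sums) auto
    moreover have "(\<lambda>j. \<Sum>y\<in>I. u y * (a j \<omega> * y ^ j)) = (\<lambda>j. a j \<omega> * w j)"
      by (auto simp: w_def sum_distrib_left mult_ac)
    ultimately show ?case by (auto simp: sums_iff)
  qed
  have "(\<integral>\<omega>. cos ((\<Sum>y\<in>I. u y * gf \<omega> y) + \<theta>) \<partial>M) = (\<integral>\<omega>. cos ((\<Sum>j. a j \<omega> * w j) + \<theta>) \<partial>M)"
    using tot by (intro integral_cong_AE) (auto elim: eventually_mono)
  also have "\<dots> = cos \<theta> * exp (- (\<Sum>j. (w j)\<^sup>2) / 2)"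
    using tot sums by (intro char_linear) (auto simp: sums_iff elim: eventually_mono)
  finally show ?thesis using sums by (simp add: sums_iff)
qed

end

text \<open>For every base point \<open>x\<close> the covariance splits as
  \<open>1/(1-yz) = cofac x y cofac x z + blaschke x y blaschke x z/(1-yz)\<close> with the Blaschke factor \<open>blaschke x\<close>, so that \<open>f\<close> has
  the law of \<open>\<xi> cofac x + blaschke x f\<close> with \<open>\<xi>\<close> an independent standard normal variable.\<close>

definition cofac :: "real \<Rightarrow> real \<Rightarrow> real" where
  "cofac x y = sqrt (1 - x\<^sup>2) / (1 - x * y)"

definition blaschke :: "real \<Rightarrow> real \<Rightarrow> real" where
  "blaschke x y = (y - x) / (1 - x * y)"

section \<open>Self-similarity: conditioning on the value at one point\<close>

lemma prob_space_std_normal: "prob_space std_normal_distribution"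
  using real_dist_normal_dist by (simp add: real_distribution_def)

lemma char_std_normal_cos:
  "(\<integral>\<xi>. cos (\<xi> * c + \<theta>) \<partial>std_normal_distribution) = cos \<theta> * exp (- c\<^sup>2 / 2)"
proof -
  interpret prob_space std_normal_distribution by (rule prob_space_std_normal)
  have int: "integrable std_normal_distribution (\<lambda>\<xi>. iexp (c * \<xi>))" by (rule integrable_const_bound[of _ 1]) auto
  have ch: "(\<integral>\<xi>. iexp (c * \<xi>) \<partial>std_normal_distribution) = complex_of_real (exp (- (c\<^sup>2) / 2))"
    using fun_cong[OF char_std_normal_distribution, of c] by (simp add: char_def)
  have c: "(\<integral>\<xi>. cos (c * \<xi>) \<partial>std_normal_distribution) = exp (- c\<^sup>2 / 2)"
    using ch integral_Re[OF int] by (simp add: Re_exp)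
  have sn: "(\<integral>\<xi>. sin (c * \<xi>) \<partial>std_normal_distribution) = 0"
    using ch integral_Im[OF int] by (simp add: Im_exp)
  have ic: "integrable std_normal_distribution (\<lambda>\<xi>. cos (c * \<xi>))" "integrable std_normal_distribution (\<lambda>\<xi>. sin (c * \<xi>))"
    by (rule integrable_const_bound[of _ 1]; simp)+
  have "(\<integral>\<xi>. cos (c * \<xi> + \<theta>) \<partial>std_normal_distribution) =
      cos \<theta> * (\<integral>\<xi>. cos (c * \<xi>) \<partial>std_normal_distribution) - sin \<theta> * (\<integral>\<xi>. sin (c * \<xi>) \<partial>std_normal_distribution)"
    unfolding cos_add using ic by (simp add: mult.commute)
  then show ?thesis using c sn by (simp add: mult.commute)
qed

lemma covariance_split:
  assumes "x \<in> {-1<..<1}" "y \<in> {-1<..<1}" "z \<in> {-1<..<1}"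
  shows "cofac x y * cofac x z + blaschke x y * blaschke x z / (1 - y * z) = 1 / (1 - y * z)"
proof -
  have p: "1 - x * y \<noteq> 0" "1 - x * z \<noteq> 0" "1 - y * z \<noteq> 0"
    using one_minus_mult_pos assms by (metis less_irrefl)+
  have s: "sqrt (1 - x\<^sup>2) * sqrt (1 - x\<^sup>2) = 1 - x\<^sup>2" using one_minus_square_pos[OF assms(1)] by simp
  have "cofac x y * cofac x z = (1 - x\<^sup>2) / ((1 - x * y) * (1 - x * z))"
    unfolding cofac_def times_divide_times_eq s ..
  moreover have "(1 - x\<^sup>2) / ((1 - x * y) * (1 - x * z)) + blaschke x y * blaschke x z / (1 - y * z) = 1 / (1 - y * z)"
    unfolding blaschke_def using p by (simp add: divide_simps) (simp add: algebra_simps power2_eq_square)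
  ultimately show ?thesis by simp
qed

context gaussian_series
begin

sublocale N: prob_space std_normal_distribution by (rule prob_space_std_normal)
sublocale NM: pair_prob_space std_normal_distribution M ..

text \<open>Both sides are centred Gaussian vectors, and \<open>covariance_split\<close> says that
  their covariances agree; the comparison is made through cosine transforms.\<close>

lemma transfer_law:
  assumes I: "finite I" "I \<subseteq> {-1<..<1}" and x: "x \<in> {-1<..<1}"
  shows "distr M (PiM I (\<lambda>_. borel)) (\<lambda>\<omega>. \<lambda>y\<in>I. gf \<omega> y) =
    distr (std_normal_distribution \<Otimes>\<^sub>M M) (PiM I (\<lambda>_. borel)) (\<lambda>p. \<lambda>y\<in>I. fst p * cofac x y + blaschke x y * gf (snd p) y)"
proof (rule joint_law_unique[OF prob_space_axioms NM.prob_space_axioms I(1)])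
  fix u \<theta>
  define c where "c = (\<Sum>y\<in>I. u y * cofac x y)"
  define v where "v y = u y * blaschke x y" for y
  have split: "(\<Sum>y\<in>I. u y * (\<xi> * cofac x y + blaschke x y * gf \<omega> y)) = \<xi> * c + (\<Sum>y\<in>I. v y * gf \<omega> y)" for \<xi> \<omega>
    by (simp add: c_def v_def sum.distrib sum_distrib_left algebra_simps)
  have "(\<integral>p. cos ((\<Sum>y\<in>I. u y * (fst p * cofac x y + blaschke x y * gf (snd p) y)) + \<theta>) \<partial>(std_normal_distribution \<Otimes>\<^sub>M M))
     = (\<integral>\<xi>. \<integral>\<omega>. cos ((\<Sum>y\<in>I. u y * (\<xi> * cofac x y + blaschke x y * gf \<omega> y)) + \<theta>) \<partial>M \<partial>std_normal_distribution)"
    by (subst NM.integral_fst'[symmetric]) (auto intro!: NM.P.integrable_const_bound[of _ 1])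
  also have "\<dots> = (\<integral>\<xi>. \<integral>\<omega>. cos ((\<Sum>y\<in>I. v y * gf \<omega> y) + (\<xi> * c + \<theta>)) \<partial>M \<partial>std_normal_distribution)"
    unfolding split by (simp add: add_ac)
  also have "\<dots> = (\<integral>\<xi>. cos (\<xi> * c + \<theta>) * exp (- (\<Sum>y\<in>I. \<Sum>z\<in>I. v y * v z / (1 - y * z)) / 2) \<partial>std_normal_distribution)"
    unfolding char_gf[OF I] ..
  also have "\<dots> = cos \<theta> * (exp (- c\<^sup>2 / 2) * exp (- (\<Sum>y\<in>I. \<Sum>z\<in>I. v y * v z / (1 - y * z)) / 2))"
    by (simp add: char_std_normal_cos)
  also have "exp (- c\<^sup>2 / 2) * exp (- (\<Sum>y\<in>I. \<Sum>z\<in>I. v y * v z / (1 - y * z)) / 2) =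
     exp (- (c\<^sup>2 + (\<Sum>y\<in>I. \<Sum>z\<in>I. v y * v z / (1 - y * z))) / 2)"
    by (simp add: exp_add[symmetric] add_divide_distrib)
  also have "c\<^sup>2 + (\<Sum>y\<in>I. \<Sum>z\<in>I. v y * v z / (1 - y * z)) = (\<Sum>y\<in>I. \<Sum>z\<in>I. u y * u z * (cofac x y * cofac x z + blaschke x y * blaschke x z / (1 - y * z)))"
    by (simp add: c_def v_def power2_eq_square sum_product sum.distrib[symmetric] algebra_simps)
  also have "\<dots> = (\<Sum>y\<in>I. \<Sum>z\<in>I. u y * u z / (1 - y * z))"
  proof (intro sum.cong refl)
    fix y z assume "y \<in> I" "z \<in> I"
    then have "y \<in> {-1<..<1}" "z \<in> {-1<..<1}" using I by auto
    then show "u y * u z * (cofac x y * cofac x z + blaschke x y * blaschke x z / (1 - y * z)) = u y * u z / (1 - y * z)"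
      by (simp only: covariance_split[OF x]) simp
  qed
  finally show "(\<integral>\<omega>. cos ((\<Sum>y\<in>I. u y * gf \<omega> y) + \<theta>) \<partial>M) =
     (\<integral>p. cos ((\<Sum>y\<in>I. u y * (fst p * cofac x y + blaschke x y * gf (snd p) y)) + \<theta>) \<partial>(std_normal_distribution \<Otimes>\<^sub>M M))"
    unfolding char_gf[OF I] by simp
qed measurable

text \<open>The form in which conditioning is used later. If \<open>x\<close> itself is among the
  points, its Blaschke factor vanishes there and only the multiple of the normal variable
  remains.\<close>

lemma transfer_prod:
  assumes I: "finite I" "I \<subseteq> {-1<..<1}" and x: "x \<in> {-1<..<1}"
    and g[measurable]: "\<And>y. y \<in> I \<Longrightarrow> g y \<in> borel_measurable borel"
  shows "(\<integral>\<omega>. (\<Prod>y\<in>I. g y (gf \<omega> y) :: real) \<partial>M) =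
    (\<integral>p. (\<Prod>y\<in>I. g y (fst p * cofac x y + blaschke x y * gf (snd p) y)) \<partial>(std_normal_distribution \<Otimes>\<^sub>M M))"
    and "integrable M (\<lambda>\<omega>. \<Prod>y\<in>I. g y (gf \<omega> y) :: real) \<longleftrightarrow>
     integrable (std_normal_distribution \<Otimes>\<^sub>M M) (\<lambda>p. \<Prod>y\<in>I. g y (fst p * cofac x y + blaschke x y * gf (snd p) y))"
proof -
  have m1[measurable]: "(\<lambda>\<omega>. \<lambda>y\<in>I. gf \<omega> y) \<in> measurable M (PiM I (\<lambda>_. borel))"
    by (intro measurable_restrict) simp
  have m2[measurable]: "(\<lambda>p. \<lambda>y\<in>I. fst p * cofac x y + blaschke x y * gf (snd p) y) \<in> measurable (std_normal_distribution \<Otimes>\<^sub>M M) (PiM I (\<lambda>_. borel))"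
    by (intro measurable_restrict) simp
  define \<Phi> where "\<Phi> v = (\<Prod>y\<in>I. g y (v y) :: real)" for v
  have [measurable]: "\<Phi> \<in> borel_measurable (PiM I (\<lambda>_. borel))"
    unfolding \<Phi>_def
    by (intro borel_measurable_prod measurable_compose[OF measurable_component_singleton[of _ I "\<lambda>_. borel"] g])
  have a: "(\<integral>\<omega>. (\<Prod>y\<in>I. g y (gf \<omega> y)) \<partial>M) = (\<integral>v. \<Phi> v \<partial>distr M (PiM I (\<lambda>_. borel)) (\<lambda>\<omega>. \<lambda>y\<in>I. gf \<omega> y))"
    by (subst integral_distr) (auto simp: \<Phi>_def)
  have b: "(\<integral>p. (\<Prod>y\<in>I. g y (fst p * cofac x y + blaschke x y * gf (snd p) y)) \<partial>(std_normal_distribution \<Otimes>\<^sub>M M)) =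
     (\<integral>v. \<Phi> v \<partial>distr (std_normal_distribution \<Otimes>\<^sub>M M) (PiM I (\<lambda>_. borel)) (\<lambda>p. \<lambda>y\<in>I. fst p * cofac x y + blaschke x y * gf (snd p) y))"
    by (subst integral_distr) (auto simp: \<Phi>_def)
  show "(\<integral>\<omega>. (\<Prod>y\<in>I. g y (gf \<omega> y) :: real) \<partial>M) =
    (\<integral>p. (\<Prod>y\<in>I. g y (fst p * cofac x y + blaschke x y * gf (snd p) y)) \<partial>(std_normal_distribution \<Otimes>\<^sub>M M))"
    unfolding a b transfer_law[OF I x] ..
  have "integrable M (\<lambda>\<omega>. \<Prod>y\<in>I. g y (gf \<omega> y) :: real) \<longleftrightarrow> integrable (distr M (PiM I (\<lambda>_. borel)) (\<lambda>\<omega>. \<lambda>y\<in>I. gf \<omega> y)) \<Phi>"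
    by (subst integrable_distr_eq) (auto simp: \<Phi>_def)
  also have "\<dots> \<longleftrightarrow> integrable (std_normal_distribution \<Otimes>\<^sub>M M) (\<lambda>p. \<Prod>y\<in>I. g y (fst p * cofac x y + blaschke x y * gf (snd p) y))"
    unfolding transfer_law[OF I x] by (subst integrable_distr_eq) (auto simp: \<Phi>_def)
  finally show "integrable M (\<lambda>\<omega>. \<Prod>y\<in>I. g y (gf \<omega> y) :: real) \<longleftrightarrow>
     integrable (std_normal_distribution \<Otimes>\<^sub>M M) (\<lambda>p. \<Prod>y\<in>I. g y (fst p * cofac x y + blaschke x y * gf (snd p) y))" .
qed

end

section \<open>Sign correlations\<close>

lemma gauss_density_le: "std_normal_density x \<le> std_normal_density 0"
  by (simp add: normal_density_def divide_right_mono)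

lemma continuous_std_normal_density: "isCont std_normal_density x"
  unfolding normal_density_def by (intro continuous_intros) auto

lemma tendsto_std_normal_density: "(f \<longlongrightarrow> l) F \<Longrightarrow> ((\<lambda>x. std_normal_density (f x)) \<longlongrightarrow> std_normal_density l) F"
  by (rule isCont_tendsto_compose[OF continuous_std_normal_density])

lemma abs_prod_sgn_le: "\<bar>\<Prod>x\<in>S. sgn (f x :: real)\<bar> \<le> 1"
  unfolding abs_prod by (intro prod_le_1) (auto simp: sgn_if)

text \<open>Almost everywhere the integrand is 2 or -2 between 0 and \<open>- c\<close> and vanishes
  elsewhere.\<close>

lemma integral_sgn_shift: "(\<integral>y. sgn (y + c) - sgn y \<partial>lborel) = 2 * (c :: real)"
proof (cases "c \<ge> 0")
  case True
  have "(\<integral>y. sgn (y + c) - sgn y \<partial>lborel) = (\<integral>y. 2 * indicator {-c..0} y \<partial>lborel)"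
  proof (rule integral_cong_AE)
    show "AE y in lborel. sgn (y + c) - sgn y = 2 * indicator {-c..0} y"
      using AE_lborel_singleton[of 0] AE_lborel_singleton[of "-c"]
      by eventually_elim (use True in \<open>auto simp: sgn_if indicator_def\<close>)
  qed auto
  then show ?thesis using True by simp
next
  case False
  have "(\<integral>y. sgn (y + c) - sgn y \<partial>lborel) = (\<integral>y. -2 * indicator {0..-c} y \<partial>lborel)"
  proof (rule integral_cong_AE)
    show "AE y in lborel. sgn (y + c) - sgn y = -2 * indicator {0..-c} y"
      using AE_lborel_singleton[of 0] AE_lborel_singleton[of "-c"]
      by eventually_elim (use False in \<open>auto simp: sgn_if indicator_def\<close>)
  qed auto
  then show ?thesis using False by simp
qed

lemma std_normal_density_at_top: "(std_normal_density \<longlongrightarrow> 0) at_top"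
  unfolding normal_density_def by real_asymp

lemma std_normal_density_at_bot: "(std_normal_density \<longlongrightarrow> 0) at_bot"
  unfolding normal_density_def by real_asymp

lemma DERIV_std_normal_density:
  "(std_normal_density has_real_derivative (- x * std_normal_density x)) (at x)"
  unfolding normal_density_def by (auto intro!: derivative_eq_intros simp: field_simps power2_eq_square)

text \<open>Stein's identity: the density satisfies \<phi>'(x) = -x \<phi>(x), and its product with
  the bounded \<open>h\<close> vanishes at both ends of the line.\<close>

lemma std_normal_ibp:
  fixes h h' :: "real \<Rightarrow> real"
  assumes d: "\<And>x. (h has_real_derivative h' x) (at x)" and c: "\<And>x. isCont h' x"
    and b: "\<And>x. \<bar>h x\<bar> \<le> C" "\<And>x. \<bar>h' x\<bar> \<le> C'"
  shows "(\<integral>x. x * h x \<partial>std_normal_distribution) = (\<integral>x. h' x \<partial>std_normal_distribution)"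
proof -
  interpret N: prob_space std_normal_distribution by (rule prob_space_std_normal)
  have ch: "isCont h x" for x using d by (rule DERIV_isCont)
  have [measurable]: "h \<in> borel_measurable borel" "h' \<in> borel_measurable borel"
    using ch c by (auto intro!: borel_measurable_continuous_onI simp: continuous_on_eq_continuous_at)
  have i1: "integrable std_normal_distribution (\<lambda>x. x * h x)"
  proof (rule Bochner_Integration.integrable_bound)
    show "integrable std_normal_distribution (\<lambda>x. C * x)"
      using integrable_std_normal_distribution_moment[of 1] by simp
    show "AE x in std_normal_distribution. norm (x * h x) \<le> norm (C * x)"
    proof (rule AE_I2)
      fix x show "norm (x * h x) \<le> norm (C * x)"
        using b(1)[of x] mult_left_mono[of "\<bar>h x\<bar>" "\<bar>C\<bar>" "\<bar>x\<bar>"] by (simp add: abs_mult mult.commute)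
    qed
  qed simp
  have i2: "integrable std_normal_distribution h'"
    by (rule N.integrable_const_bound[of _ C']) (use b in auto)
  have dens: "integrable lborel (\<lambda>x. std_normal_density x * (x * h x))" "integrable lborel (\<lambda>x. std_normal_density x * h' x)"
    using i1 i2 by (simp_all add: integrable_density)
  define G' where "G' x = std_normal_density x * h' x - std_normal_density x * (x * h x)" for x
  have int: "integrable lborel G'" unfolding G'_def using dens by (rule Bochner_Integration.integrable_diff[rotated])
  have "(LBINT x=-\<infinity>..\<infinity>. G' x) = 0 - 0"
  proof (rule interval_integral_FTC_integrable[where F = "\<lambda>x. std_normal_density x * h x"])
    show "((\<lambda>x. std_normal_density x * h x) has_vector_derivative G' x) (at x)" for x
      unfolding has_real_derivative_iff_has_vector_derivative[symmetric] G'_def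
      by (rule derivative_eq_intros DERIV_std_normal_density d refl | simp)+
    show "isCont G' x" for x
      unfolding G'_def by (intro continuous_intros continuous_std_normal_density c ch)
    show "set_integrable lborel (einterval (-\<infinity>) \<infinity>) G'"
      using int by (simp add: set_integrable_def)
    have lim: "((\<lambda>x. std_normal_density x * h x) \<longlongrightarrow> 0) F" if "(std_normal_density \<longlongrightarrow> 0) F" for F
    proof (rule Lim_null_comparison)
      show "((\<lambda>x. C * std_normal_density x) \<longlongrightarrow> 0) F" using tendsto_mult_right_zero[OF that] by simp
      show "eventually (\<lambda>x. norm (std_normal_density x * h x) \<le> C * std_normal_density x) F"
        using b(1) by (auto intro!: always_eventually mult_right_mono simp: abs_mult mult.commute)
    qed
    show "(((\<lambda>x. std_normal_density x * h x) \<circ> real_of_ereal) \<longlongrightarrow> 0) (at_right (-\<infinity>))"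
      unfolding ereal_tendsto_simps by (rule lim[OF std_normal_density_at_bot])
    show "(((\<lambda>x. std_normal_density x * h x) \<circ> real_of_ereal) \<longlongrightarrow> 0) (at_left \<infinity>)"
      unfolding ereal_tendsto_simps by (rule lim[OF std_normal_density_at_top])
  qed simp
  then have "(\<integral>x. G' x \<partial>lborel) = 0"
    by (simp add: interval_lebesgue_integral_def set_lebesgue_integral_def)
  then have "(\<integral>x. std_normal_density x * h' x \<partial>lborel) = (\<integral>x. std_normal_density x * (x * h x) \<partial>lborel)"
    unfolding G'_def using dens by simp
  then show ?thesis
    by (subst (1 2) integral_density) auto
qed

text \<open>A smooth stand-in for \<open>sgn\<close>, since Stein's identity needs a derivative.
  That derivative is a rescaled Cauchy kernel, and the factor \<open>2 / pi\<close> gives it total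
  mass 2, the jump of \<open>sgn\<close>.\<close>

definition ssgn :: "nat \<Rightarrow> real \<Rightarrow> real" where
  "ssgn n t = 2 / pi * arctan (real (Suc n) * t)"

definition ssgn' :: "nat \<Rightarrow> real \<Rightarrow> real" where
  "ssgn' n t = 2 / pi * (real (Suc n) / (1 + (real (Suc n) * t)\<^sup>2))"

lemma DERIV_ssgn: "(ssgn n has_real_derivative ssgn' n t) (at t)"
  unfolding ssgn_def ssgn'_def
  by (auto intro!: derivative_eq_intros simp: divide_inverse)

lemma abs_ssgn_le: "\<bar>ssgn n t\<bar> \<le> 1"
proof -
  have "\<bar>arctan (real (Suc n) * t)\<bar> \<le> pi / 2"
    by (intro abs_leI) (use arctan_bounded[of "real (Suc n) * t"] in linarith)+
  then have "2 / pi * \<bar>arctan (real (Suc n) * t)\<bar> \<le> 2 / pi * (pi / 2)" by (intro mult_left_mono) auto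
  then show ?thesis by (simp add: ssgn_def abs_mult)
qed

lemma ssgn'_bounds: "0 \<le> ssgn' n t" "ssgn' n t \<le> 2 / pi * real (Suc n)"
proof -
  show "0 \<le> ssgn' n t" by (simp add: ssgn'_def add_nonneg_nonneg)
  have "real (Suc n) / (1 + (real (Suc n) * t)\<^sup>2) \<le> real (Suc n) / 1"
    by (intro divide_left_mono) (auto intro: add_pos_nonneg)
  then show "ssgn' n t \<le> 2 / pi * real (Suc n)" unfolding ssgn'_def by (intro mult_left_mono) auto
qed

lemma isCont_ssgn': "isCont (ssgn' n) t"
proof -
  have "1 + (real (Suc n) * t)\<^sup>2 \<noteq> 0" using zero_le_power2[of "real (Suc n) * t"] by linarith
  then show ?thesis unfolding ssgn'_def by (intro continuous_intros) auto
qed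

lemma measurable_ssgn [measurable]: "ssgn n \<in> borel_measurable borel"
  by (intro borel_measurable_continuous_onI) (auto simp: continuous_on_eq_continuous_at intro: DERIV_isCont[OF DERIV_ssgn])

lemma measurable_ssgn' [measurable]: "ssgn' n \<in> borel_measurable borel"
  by (intro borel_measurable_continuous_onI) (auto simp: continuous_on_eq_continuous_at isCont_ssgn')

text \<open>Under the substitution that blows up the scale \<open>1 / real (Suc n)\<close>,
  arguments acquire a term \<open>c / real (Suc n)\<close>. Inside the arctangent it becomes the
  constant \<open>c\<close>, which a nonzero \<open>d\<close> outweighs in the limit.\<close>

lemma tendsto_ssgn_perturbed:
  assumes "d \<noteq> 0"
  shows "(\<lambda>n. ssgn n (c / real (Suc n) + d)) \<longlonglongrightarrow> sgn d"
proof -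
  have pos: "(\<lambda>n. ssgn n (c / real (Suc n) + d)) \<longlonglongrightarrow> 1" if d: "d > 0" for c d
  proof -
    have eq: "ssgn n (c / real (Suc n) + d) = 2 / pi * arctan (c + real (Suc n) * d)" for n
      unfolding ssgn_def by (simp add: distrib_left del: of_nat_Suc)
    have top: "filterlim (\<lambda>n. real (Suc n)) at_top sequentially"
      using filterlim_real_sequentially by (rule filterlim_compose) (rule filterlim_Suc)
    have "filterlim (\<lambda>n. c + real (Suc n) * d) at_top sequentially"
      by (intro filterlim_tendsto_add_at_top[OF tendsto_const] filterlim_at_top_mult_tendsto_pos[OF tendsto_const d top])
    then have "(\<lambda>n. arctan (c + real (Suc n) * d)) \<longlonglongrightarrow> pi / 2"
      by (rule filterlim_compose[OF tendsto_arctan_at_top])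
    from tendsto_mult_left[OF this, of "2 / pi"] show ?thesis unfolding eq by simp
  qed
  have odd: "ssgn n (c / real (Suc n) + d) = - ssgn n ((- c) / real (Suc n) + (- d))" for n
  proof -
    have "ssgn n (- t) = - ssgn n t" for t by (simp add: ssgn_def arctan_minus)
    moreover have "(- c) / real (Suc n) + (- d) = - (c / real (Suc n) + d)" by simp
    ultimately show ?thesis by (simp only: minus_minus)
  qed
  show ?thesis
  proof (cases "d > 0")
    case True then show ?thesis using pos[OF True] by simp
  next
    case False
    then have d: "d < 0" using assms by simp
    then show ?thesis unfolding odd using tendsto_minus[OF pos[of "- d" "- c"]] by simp
  qed
qed

lemma cauchy_integral:
  assumes k: "k > 0"
  shows "integrable lborel (\<lambda>y. 2 / pi / (1 + (k * y)\<^sup>2))" "(\<integral>y. 2 / pi / (1 + (k * y)\<^sup>2) \<partial>lborel) = 2 / k"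
proof -
  let ?F = "\<lambda>y. 2 / pi / k * arctan (k * y)"
  let ?f = "\<lambda>y. 2 / pi / (1 + (k * y)\<^sup>2)"
  have p: "0 < 1 + (k * y)\<^sup>2" for y :: real by (intro add_pos_nonneg) auto
  have 1: "(?F has_real_derivative ?f y) (at y)" for y
  proof -
    have "((\<lambda>y. arctan (k * y)) has_real_derivative k / (1 + (k * y)\<^sup>2)) (at y)"
      by (auto intro!: derivative_eq_intros simp: divide_inverse)
    from DERIV_cmult[OF this, of "2 / pi / k"] show ?thesis using k by simp
  qed
  have 2: "isCont ?f y" for y using p[of y] by (intro continuous_intros) auto
  have top: "(?F \<longlongrightarrow> 2 / pi / k * (pi / 2)) at_top"
    by (intro tendsto_mult_left filterlim_compose[OF tendsto_arctan_at_top] filterlim_tendsto_pos_mult_at_top[OF tendsto_const k] filterlim_ident)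
  have bot: "(?F \<longlongrightarrow> 2 / pi / k * (- (pi / 2))) at_bot"
    by (intro tendsto_mult_left filterlim_compose[OF tendsto_arctan_at_bot] filterlim_tendsto_pos_mult_at_bot[OF tendsto_const k] filterlim_ident)
  note ft = interval_integral_FTC_nonneg[of "-\<infinity>" "\<infinity>" ?F ?f, OF _ 1 2 _ bot[folded ereal_tendsto_simps1] top[folded ereal_tendsto_simps1]]
  show "integrable lborel ?f" using ft(1) p by (simp add: set_integrable_def less_imp_le)
  show "(\<integral>y. ?f y \<partial>lborel) = 2 / k"
    using ft(2) p by (simp add: interval_lebesgue_integral_def set_lebesgue_integral_def less_imp_le)
qed

section \<open>Regular paths, and the derivative of a sign correlation in one point\<close>

context gaussian_series
begin

definition good :: "'w \<Rightarrow> bool" where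
  "good \<omega> \<longleftrightarrow> (\<forall>r. 0 \<le> r \<and> r < 1 \<longrightarrow> summable (\<lambda>k. \<bar>a k \<omega>\<bar> * r ^ k))"

text \<open>A random bound for \<open>f\<close> on the interval of radius \<open>r\<close>; being
  integrable, it serves as a dominating function under the expectation.\<close>

definition maj :: "real \<Rightarrow> 'w \<Rightarrow> real" where
  "maj r \<omega> = (\<Sum>k. \<bar>a k \<omega>\<bar> * r ^ k)"

lemma AE_good: "AE \<omega> in M. good \<omega>"
  using AE_summable by (simp add: good_def)

lemma measurable_maj [measurable]: "maj r \<in> borel_measurable M"
  unfolding maj_def by measurable

lemma good_summable: "good \<omega> \<Longrightarrow> \<bar>x\<bar> < 1 \<Longrightarrow> summable (\<lambda>k. a k \<omega> * x ^ k)"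
proof -
  assume "good \<omega>" "\<bar>x\<bar> < 1"
  then have "summable (\<lambda>k. \<bar>a k \<omega> * x ^ k\<bar>)" by (simp add: good_def abs_mult power_abs)
  then show ?thesis by (rule summable_rabs_cancel)
qed

lemma DERIV_gf:
  assumes "good \<omega>" "\<bar>x\<bar> < 1"
  shows "(gf \<omega> has_real_derivative (\<Sum>k. diffs (\<lambda>k. a k \<omega>) k * x ^ k)) (at x)"
  unfolding gf_def[abs_def] using assms by (intro termdiffs_strong'[of 1] good_summable) auto

lemma isCont_gf: "good \<omega> \<Longrightarrow> \<bar>x\<bar> < 1 \<Longrightarrow> isCont (gf \<omega>) x"
  using DERIV_gf by (blast intro: DERIV_isCont)

lemma abs_gf_le:
  assumes g: "good \<omega>" and x: "\<bar>x\<bar> \<le> r" "r < 1"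
  shows "\<bar>gf \<omega> x\<bar> \<le> maj r \<omega>"
proof -
  have s: "summable (\<lambda>k. \<bar>a k \<omega> * x ^ k\<bar>)" using g x by (simp add: good_def abs_mult power_abs)
  have "\<bar>gf \<omega> x\<bar> \<le> (\<Sum>k. \<bar>a k \<omega> * x ^ k\<bar>)" unfolding gf_def by (rule summable_rabs[OF s])
  also have "\<dots> \<le> maj r \<omega>" unfolding maj_def
    using g x by (intro suminf_le s) (auto simp: abs_mult power_abs good_def intro!: mult_left_mono power_mono)
  finally show ?thesis .
qed

lemma maj_nonneg: "good \<omega> \<Longrightarrow> 0 \<le> r \<Longrightarrow> r < 1 \<Longrightarrow> 0 \<le> maj r \<omega>"
  unfolding maj_def good_def by (intro suminf_nonneg) auto

lemma integrable_maj: "0 \<le> r \<Longrightarrow> r < 1 \<Longrightarrow> integrable M (maj r)"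
proof -
  assume r: "0 \<le> r" "r < 1"
  define C where "C = (\<integral>x. \<bar>x\<bar> \<partial>std_normal_distribution)"
  have ia: "integrable M (\<lambda>\<omega>. \<bar>a k \<omega>\<bar>)" and Ea: "(\<integral>\<omega>. \<bar>a k \<omega>\<bar> \<partial>M) = C" for k
  proof -
    have "integrable (distr M borel (a k)) (\<lambda>x. \<bar>x\<bar>)"
      unfolding distr_a using integrable_std_normal_distribution_moment[of 1] by simp
    then show "integrable M (\<lambda>\<omega>. \<bar>a k \<omega>\<bar>)" by (subst (asm) integrable_distr_eq) auto
    show "(\<integral>\<omega>. \<bar>a k \<omega>\<bar> \<partial>M) = C"
      unfolding C_def distr_a[of k, symmetric] by (subst integral_distr) auto
  qed
  show ?thesis unfolding maj_def[abs_def]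
  proof (rule integrable_suminf)
    show "integrable M (\<lambda>\<omega>. \<bar>a k \<omega>\<bar> * r ^ k)" for k using ia by simp
    show "AE \<omega> in M. summable (\<lambda>k. norm (\<bar>a k \<omega>\<bar> * r ^ k))"
      using AE_good by eventually_elim (use r in \<open>simp add: good_def abs_mult\<close>)
    show "summable (\<lambda>k. \<integral>\<omega>. norm (\<bar>a k \<omega>\<bar> * r ^ k) \<partial>M)"
      using r by (simp add: abs_mult Ea summable_mult summable_geometric)
  qed
qed

lemma integrable_gf: "\<bar>x\<bar> < 1 \<Longrightarrow> integrable M (\<lambda>\<omega>. gf \<omega> x)"
  by (rule Bochner_Integration.integrable_bound[OF integrable_maj[of "\<bar>x\<bar>"]])
     (use AE_good in \<open>auto elim!: eventually_mono intro: order_trans[OF abs_gf_le abs_ge_self]\<close>)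

text \<open>The normal coordinate is integrated first and against Lebesgue measure, so that it can
  be rescaled path by path.\<close>

lemma fubini_lborel:
  assumes g: "integrable (std_normal_distribution \<Otimes>\<^sub>M M) (g :: real \<times> 'w \<Rightarrow> real)"
  shows "(\<integral>p. g p \<partial>(std_normal_distribution \<Otimes>\<^sub>M M)) = (\<integral>\<omega>. (\<integral>\<xi>. std_normal_density \<xi> * g (\<xi>, \<omega>) \<partial>lborel) \<partial>M)"
proof -
  have [measurable]: "g \<in> borel_measurable (borel \<Otimes>\<^sub>M M)"
    using borel_measurable_integrable[OF g] by (simp cong: measurable_cong_sets sets_pair_measure_cong)
  have "(\<integral>p. g p \<partial>(std_normal_distribution \<Otimes>\<^sub>M M)) = (\<integral>\<omega>. (\<integral>\<xi>. g (\<xi>, \<omega>) \<partial>std_normal_distribution) \<partial>M)"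
    using NM.integral_snd[of "\<lambda>\<xi> \<omega>. g (\<xi>, \<omega>)"] g by simp
  also have "\<dots> = (\<integral>\<omega>. (\<integral>\<xi>. std_normal_density \<xi> * g (\<xi>, \<omega>) \<partial>lborel) \<partial>M)"
  proof (rule Bochner_Integration.integral_cong[OF refl])
    fix \<omega> assume "\<omega> \<in> space M"
    then have [measurable]: "(\<lambda>\<xi>. g (\<xi>, \<omega>)) \<in> borel_measurable lborel" by simp
    show "(\<integral>\<xi>. g (\<xi>, \<omega>) \<partial>std_normal_distribution) = (\<integral>\<xi>. std_normal_density \<xi> * g (\<xi>, \<omega>) \<partial>lborel)"
      by (subst integral_density) auto
  qed
  finally show ?thesis .
qed

lemma cofac_pos: "x \<in> {-1<..<1} \<Longrightarrow> y \<in> {-1<..<1} \<Longrightarrow> 0 < cofac x y"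
  using one_minus_mult_pos[of x y] one_minus_square_pos[of x] by (simp add: cofac_def)

lemma blaschke_self [simp]: "blaschke x x = 0"
  by (simp add: blaschke_def)

lemma sgn_blaschke: "x \<in> {-1<..<1} \<Longrightarrow> y \<in> {-1<..<1} \<Longrightarrow> sgn (blaschke x y) = sgn (y - x)"
  using one_minus_mult_pos[of x y] by (simp add: blaschke_def sgn_divide)

text \<open>With \<open>x\<close> as its own base point, the value at \<open>x\<close> has the law
  of a positive multiple of the normal variable.\<close>

lemma AE_gf_nonzero:
  assumes x: "x \<in> {-1<..<1}"
  shows "AE \<omega> in M. gf \<omega> x \<noteq> 0"
proof -
  have "(\<integral>\<omega>. indicator {0} (gf \<omega> x) \<partial>M) = (\<integral>p. indicator {0::real} (fst p * cofac x x) \<partial>(std_normal_distribution \<Otimes>\<^sub>M M) :: real)"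
    using transfer_prod(1)[of "{x}" x "\<lambda>_. indicator {0}"] x by simp
  also have "\<dots> = (\<integral>\<omega>. (\<integral>\<xi>. std_normal_density \<xi> * indicator {0} (\<xi> * cofac x x) \<partial>lborel) \<partial>M)"
    by (subst fubini_lborel) (auto intro!: NM.P.integrable_const_bound[of _ 1])
  also have "(\<integral>\<xi>. std_normal_density \<xi> * indicator {0} (\<xi> * cofac x x) \<partial>lborel) = 0"
  proof (rule integral_eq_zero_AE)
    show "AE \<xi> in lborel. std_normal_density \<xi> * indicator {0} (\<xi> * cofac x x) = 0"
      using AE_lborel_singleton[of 0] by eventually_elim (use cofac_pos[OF x x] in \<open>auto simp: indicator_def\<close>)
  qed
  finally have z: "(\<integral>\<omega>. indicator {0} (gf \<omega> x) \<partial>M) = (0::real)" by simp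
  have "integrable M (\<lambda>\<omega>. indicator {0} (gf \<omega> x) :: real)" by (rule integrable_const_bound[of _ 1]) auto
  from integral_nonneg_eq_0_iff_AE[OF this] z have "AE \<omega> in M. indicator {0} (gf \<omega> x) = (0::real)" by simp
  then show ?thesis by eventually_elim (auto simp: indicator_def)
qed

lemma AE_good_nonzero:
  assumes "finite S" "S \<subseteq> {-1<..<1}"
  shows "AE \<omega> in M. good \<omega> \<and> (\<forall>y\<in>S. gf \<omega> y \<noteq> 0)"
proof -
  have "AE \<omega> in M. \<forall>y\<in>S. gf \<omega> y \<noteq> 0"
    using assms AE_gf_nonzero by (intro AE_finite_allI) auto
  with AE_good show ?thesis by eventually_elim simp
qed

text \<open>The argument is a set because the product of signs is symmetric; the order of the points
  enters only later, through \<open>dsgn\<close>.\<close>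

definition F :: "real set \<Rightarrow> real" where
  "F S = (\<integral>\<omega>. (\<Prod>x\<in>S. sgn (gf \<omega> x)) \<partial>M)"

lemma F_empty [simp]: "F {} = 1"
  by (simp add: F_def prob_space)

text \<open>Conditioned at \<open>x\<close>, the sign at \<open>x + h\<close> is that of
  \<open>\<xi> + h * (r * gf \<omega> (x + h))\<close>, so the increment lives on normal values of
  order \<open>h\<close>; blowing these up by \<open>\<xi> = h * y\<close> gives the difference
  quotient. In the limit the density contributes its value at 0, the integral of the shifted sign
  contributes \<open>2 * (r * gf \<omega> x)\<close>, and the Blaschke factors contribute the signs
  of \<open>y - x\<close>.\<close>

lemma DERIV_F_raw:
  assumes S: "finite S" "S \<subseteq> {-1<..<1}" and x: "x \<in> {-1<..<1}" "x \<notin> S"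
  shows "((\<lambda>z. F (insert z S)) has_real_derivative
    2 * std_normal_density 0 / sqrt (1 - x\<^sup>2) * (\<Prod>y\<in>S. sgn (y - x)) * (\<integral>\<omega>. gf \<omega> x * (\<Prod>y\<in>S. sgn (gf \<omega> y)) \<partial>M)) (at x)"
proof -
  define r where "r = 1 / sqrt (1 - x\<^sup>2)"
  have r: "r > 0" using one_minus_square_pos[OF x(1)] by (simp add: r_def)
  define \<rho> where "\<rho> = (1 + \<bar>x\<bar>) / 2"
  have \<rho>: "\<bar>x\<bar> < \<rho>" "\<rho> < 1" "0 \<le> \<rho>" using x by (auto simp: \<rho>_def)
  \<comment> \<open>Increments that stay within radius \<open>\<rho>\<close>, where
    \<open>maj \<rho>\<close> bounds the path, and that avoid \<open>S\<close>, so that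
    \<open>insert\<close> really adds a point.\<close>
  define U where "U = {-\<rho> - x<..<\<rho> - x} - (\<lambda>y. y - x) ` S"
  have U: "open U" "0 \<in> U" unfolding U_def using S \<rho> x by (auto intro!: open_Diff finite_imp_closed)
  define Q where "Q \<xi> \<omega> = (\<Prod>s\<in>S. sgn (\<xi> * cofac x s + blaschke x s * gf \<omega> s))" for \<xi> \<omega>
  have Qm[measurable]: "(\<lambda>p. Q (f p) (g p)) \<in> borel_measurable K" if [measurable]: "f \<in> borel_measurable K" "g \<in> measurable K M" for f g and K :: "'u measure"
    unfolding Q_def by measurable
  have Q1: "\<bar>Q \<xi> \<omega>\<bar> \<le> 1" for \<xi> \<omega> unfolding Q_def by (rule abs_prod_sgn_le)
  define D where "D h \<omega> = (\<integral>y. std_normal_density (h * y) * ((sgn (y + r * gf \<omega> (x + h)) - sgn y) * Q (h * y) \<omega>) \<partial>lborel)" for h \<omega>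
  have quot: "(F (insert (x + h) S) - F (insert x S)) / h = (\<integral>\<omega>. D h \<omega> \<partial>M)" if h: "h \<in> U - {0}" for h
  proof -
    define z where "z = x + h"
    have z: "z \<in> {-1<..<1}" "z \<notin> S" using h \<rho> x by (auto simp: z_def U_def image_iff)
    have Fz: "F (insert w S) = (\<integral>p. sgn (fst p * cofac x w + blaschke x w * gf (snd p) w) * Q (fst p) (snd p) \<partial>(std_normal_distribution \<Otimes>\<^sub>M M))"
      if "w \<in> {-1<..<1}" "w \<notin> S" for w
      unfolding F_def using transfer_prod(1)[of "insert w S" x "\<lambda>_. sgn"] S x that by (simp add: Q_def)
    have Bz: "blaschke x z = cofac x z * (h * r)"
      using one_minus_square_pos[OF x(1)] by (simp add: blaschke_def cofac_def r_def z_def)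
    have s1: "sgn (\<xi> * cofac x z + blaschke x z * gf \<omega> z) = sgn (\<xi> + h * (r * gf \<omega> z))" for \<xi> \<omega>
    proof -
      have "\<xi> * cofac x z + blaschke x z * gf \<omega> z = cofac x z * (\<xi> + h * (r * gf \<omega> z))" by (simp add: Bz algebra_simps)
      then show ?thesis using cofac_pos[OF x(1) z(1)] by (simp add: sgn_mult)
    qed
    have s2: "sgn (\<xi> * cofac x x + blaschke x x * gf \<omega> x) = sgn \<xi>" for \<xi> \<omega>
      using cofac_pos[OF x(1) x(1)] by (simp add: sgn_mult)
    have bd: "\<bar>sgn u * Q \<xi> \<omega>\<bar> \<le> 1" for u \<xi> \<omega>
      using Q1[of \<xi> \<omega>] by (auto simp: abs_mult sgn_if)
    have i1: "integrable (std_normal_distribution \<Otimes>\<^sub>M M) (\<lambda>p. sgn (fst p + h * (r * gf (snd p) z)) * Q (fst p) (snd p))"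
      by (rule NM.P.integrable_const_bound[of _ 1]) (use bd in auto)
    have i2: "integrable (std_normal_distribution \<Otimes>\<^sub>M M) (\<lambda>p. sgn (fst p) * Q (fst p) (snd p))"
      by (rule NM.P.integrable_const_bound[of _ 1]) (use bd in auto)
    have "F (insert z S) - F (insert x S) = (\<integral>p. sgn (fst p + h * (r * gf (snd p) z)) * Q (fst p) (snd p) - sgn (fst p) * Q (fst p) (snd p) \<partial>(std_normal_distribution \<Otimes>\<^sub>M M))"
      unfolding Fz[OF z] Fz[OF x] s1 s2 using i1 i2 by simp
    also have "\<dots> = (\<integral>\<omega>. (\<integral>\<xi>. std_normal_density \<xi> * (sgn (\<xi> + h * (r * gf \<omega> z)) * Q \<xi> \<omega> - sgn \<xi> * Q \<xi> \<omega>) \<partial>lborel) \<partial>M)"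
      by (subst fubini_lborel) (use i1 i2 in auto)
    also have "\<dots> = (\<integral>\<omega>. h * D h \<omega> \<partial>M)"
    proof (intro Bochner_Integration.integral_cong refl)
      fix \<omega>
      have "(\<integral>\<xi>. std_normal_density \<xi> * (sgn (\<xi> + h * (r * gf \<omega> z)) * Q \<xi> \<omega> - sgn \<xi> * Q \<xi> \<omega>) \<partial>lborel)
        = \<bar>h\<bar> * (\<integral>y. std_normal_density (h * y) * (sgn (h * y + h * (r * gf \<omega> z)) * Q (h * y) \<omega> - sgn (h * y) * Q (h * y) \<omega>) \<partial>lborel)"
        using lborel_integral_real_affine[of h "\<lambda>\<xi>. std_normal_density \<xi> * (sgn (\<xi> + h * (r * gf \<omega> z)) * Q \<xi> \<omega> - sgn \<xi> * Q \<xi> \<omega>)" 0] h by simp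
      also have "(\<lambda>y. std_normal_density (h * y) * (sgn (h * y + h * (r * gf \<omega> z)) * Q (h * y) \<omega> - sgn (h * y) * Q (h * y) \<omega>)) =
          (\<lambda>y. sgn h * (std_normal_density (h * y) * ((sgn (y + r * gf \<omega> (x + h)) - sgn y) * Q (h * y) \<omega>)))"
        unfolding distrib_left[symmetric] sgn_mult z_def by (simp add: algebra_simps)
      also have "\<bar>h\<bar> * (\<integral>y. sgn h * (std_normal_density (h * y) * ((sgn (y + r * gf \<omega> (x + h)) - sgn y) * Q (h * y) \<omega>)) \<partial>lborel) = (\<bar>h\<bar> * sgn h) * D h \<omega>"
        by (simp add: D_def)
      also have "\<bar>h\<bar> * sgn h = h" by (simp add: sgn_if)
      finally show "(\<integral>\<xi>. std_normal_density \<xi> * (sgn (\<xi> + h * (r * gf \<omega> z)) * Q \<xi> \<omega> - sgn \<xi> * Q \<xi> \<omega>) \<partial>lborel) = h * D h \<omega>" .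
    qed
    finally show ?thesis using h by (simp add: z_def)
  qed
  define L where "L \<omega> = std_normal_density 0 * (2 * (r * gf \<omega> x)) * (\<Prod>s\<in>S. sgn (blaschke x s * gf \<omega> s))" for \<omega>
  \<comment> \<open>Two nested dominated convergences: for a fixed path in the rescaled variable
    \<open>y\<close>, then over the paths with a multiple of \<open>maj \<rho>\<close>.\<close>
  have lim: "(\<lambda>n. \<integral>\<omega>. D (X n) \<omega> \<partial>M) \<longlonglongrightarrow> (\<integral>\<omega>. L \<omega> \<partial>M)" if X: "\<And>n. X n \<in> U - {0}" "X \<longlonglongrightarrow> 0" for X
  proof (rule integral_dominated_convergence[where w = "\<lambda>\<omega>. 4 * std_normal_density 0 * r * maj \<rho> \<omega>"])
    have fixw: "(\<lambda>n. D (X n) \<omega>) \<longlonglongrightarrow> L \<omega> \<and> (\<forall>n. norm (D (X n) \<omega>) \<le> 4 * std_normal_density 0 * r * maj \<rho> \<omega>)"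
      if g: "good \<omega>" and nz: "\<forall>y\<in>S. gf \<omega> y \<noteq> 0" for \<omega>
    proof -
      define c where "c = r * maj \<rho> \<omega>"
      have c0: "0 \<le> c" unfolding c_def using r maj_nonneg[OF g \<rho>(3,2)] by simp
      \<comment> \<open>\<open>c\<close> bounds the shift, so the two signs agree outside
        \<open>{-c..c}\<close> and differ by at most 2 inside.\<close>
      define w where "w y = 2 * std_normal_density 0 * indicator {-c..c} y" for y
      let ?s = "\<lambda>n y. std_normal_density (X n * y) * ((sgn (y + r * gf \<omega> (x + X n)) - sgn y) * Q (X n * y) \<omega>)"
      have "integrable lborel (indicator {-c..c} :: real \<Rightarrow> real)"
        using c0 by (intro integrable_real_indicator) auto
      then have iw: "integrable lborel w" unfolding w_def by simp
      have wI: "(\<integral>y. w y \<partial>lborel) = 4 * std_normal_density 0 * r * maj \<rho> \<omega>"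
        unfolding w_def using c0 by (simp add: c_def)
      have sw: "norm (?s n y) \<le> w y" for n y
      proof -
        have "\<bar>x + X n\<bar> \<le> \<rho>" using X(1)[of n] by (auto simp: U_def abs_le_iff)
        then have "r * \<bar>gf \<omega> (x + X n)\<bar> \<le> c"
          unfolding c_def using abs_gf_le[OF g _ \<rho>(2)] r by (intro mult_left_mono) auto
        then have le: "\<bar>r * gf \<omega> (x + X n)\<bar> \<le> c" using r by (simp add: abs_mult)
        have "\<bar>sgn (y + r * gf \<omega> (x + X n)) - sgn y\<bar> \<le> 2 * indicator {-c..c} y"
          using le by (auto simp: indicator_def sgn_if)
        then have "\<bar>sgn (y + r * gf \<omega> (x + X n)) - sgn y\<bar> * \<bar>Q (X n * y) \<omega>\<bar> \<le> (2 * indicator {-c..c} y) * 1"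
          using Q1 by (intro mult_mono) auto
        then have "std_normal_density (X n * y) * (\<bar>sgn (y + r * gf \<omega> (x + X n)) - sgn y\<bar> * \<bar>Q (X n * y) \<omega>\<bar>) \<le> std_normal_density 0 * ((2 * indicator {-c..c} y) * 1)"
          by (rule mult_mono[OF gauss_density_le]) auto
        then show ?thesis by (simp add: w_def abs_mult mult_ac)
      qed
      have gfX: "(\<lambda>n. gf \<omega> (x + X n)) \<longlonglongrightarrow> gf \<omega> x"
        using x tendsto_add[OF tendsto_const X(2), of x] by (intro isCont_tendsto_compose[OF isCont_gf[OF g]]) auto
      have "(\<lambda>n. \<integral>y. ?s n y \<partial>lborel) \<longlonglongrightarrow> (\<integral>y. std_normal_density 0 * ((sgn (y + r * gf \<omega> x) - sgn y) * (\<Prod>s\<in>S. sgn (blaschke x s * gf \<omega> s))) \<partial>lborel)"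
      proof (rule integral_dominated_convergence[OF _ _ iw])
        show "AE y in lborel. (\<lambda>n. ?s n y) \<longlonglongrightarrow> std_normal_density 0 * ((sgn (y + r * gf \<omega> x) - sgn y) * (\<Prod>s\<in>S. sgn (blaschke x s * gf \<omega> s)))"
          using AE_lborel_singleton[of "- r * gf \<omega> x"]
        proof eventually_elim
          case (elim y)
          have X0: "(\<lambda>n. X n * y) \<longlonglongrightarrow> 0" using tendsto_mult_left_zero[OF X(2)] by simp
          have B0: "blaschke x s * gf \<omega> s \<noteq> 0" if "s \<in> S" for s
          proof -
            have "s \<in> {-1<..<1}" "s \<noteq> x" using that S x by auto
            then show ?thesis using that nz one_minus_mult_pos[OF x(1), of s] by (auto simp: blaschke_def)
          qed
          have "(\<lambda>n. X n * y * cofac x s + blaschke x s * gf \<omega> s) \<longlonglongrightarrow> blaschke x s * gf \<omega> s" for s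
            using tendsto_add[OF tendsto_mult_left_zero[OF X0, of "cofac x s"] tendsto_const, of "blaschke x s * gf \<omega> s"] by simp
          then have "(\<lambda>n. Q (X n * y) \<omega>) \<longlonglongrightarrow> (\<Prod>s\<in>S. sgn (blaschke x s * gf \<omega> s))"
            unfolding Q_def using B0 by (intro tendsto_prod tendsto_sgn) auto
          moreover have "y + r * gf \<omega> x \<noteq> 0" using elim by auto
          ultimately show ?case
            using tendsto_std_normal_density[OF X0] gfX by (intro tendsto_intros) auto
        qed
        show "AE y in lborel. norm (?s n y) \<le> w y" for n using sw by simp
      qed (auto simp: Q_def)
      then have 1: "(\<lambda>n. D (X n) \<omega>) \<longlonglongrightarrow> L \<omega>"
        unfolding D_def L_def by (simp add: integral_sgn_shift mult_ac del: Bochner_Integration.integral_diff)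
      have 2: "norm (D (X n) \<omega>) \<le> (\<integral>y. w y \<partial>lborel)" for n
        unfolding D_def
      proof (rule Bochner_Integration.integral_norm_bound_integral[OF _ iw sw])
        show "integrable lborel (?s n)"
          by (rule Bochner_Integration.integrable_bound[OF iw]) (use sw in \<open>auto simp: Q_def intro: order_trans[OF _ abs_ge_self]\<close>)
      qed
      show ?thesis using 1 2 wI by simp
    qed
    show "AE \<omega> in M. (\<lambda>n. D (X n) \<omega>) \<longlonglongrightarrow> L \<omega>"
      using AE_good_nonzero[OF S] by eventually_elim (use fixw in blast)
    show "AE \<omega> in M. norm (D (X n) \<omega>) \<le> 4 * std_normal_density 0 * r * maj \<rho> \<omega>" for n
      using AE_good_nonzero[OF S] by eventually_elim (use fixw in blast)
    show "integrable M (\<lambda>\<omega>. 4 * std_normal_density 0 * r * maj \<rho> \<omega>)" using integrable_maj[OF \<rho>(3,2)] by simp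
    show "L \<in> borel_measurable M" unfolding L_def by measurable
    show "D (X n) \<in> borel_measurable M" for n unfolding D_def[abs_def] by measurable
  qed
  have "((\<lambda>h. (F (insert (x + h) S) - F (insert x S)) / h) \<longlongrightarrow> (\<integral>\<omega>. L \<omega> \<partial>M)) (at 0 within U)"
    unfolding tendsto_at_iff_sequentially
  proof (intro allI impI)
    fix X :: "nat \<Rightarrow> real" assume X: "\<forall>i. X i \<in> U - {0}" "X \<longlonglongrightarrow> 0"
    have "((\<lambda>h. (F (insert (x + h) S) - F (insert x S)) / h) \<circ> X) = (\<lambda>n. \<integral>\<omega>. D (X n) \<omega> \<partial>M)"
      using quot X by (auto simp: o_def)
    then show "((\<lambda>h. (F (insert (x + h) S) - F (insert x S)) / h) \<circ> X) \<longlonglongrightarrow> (\<integral>\<omega>. L \<omega> \<partial>M)"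
      using lim X by simp
  qed
  then have "((\<lambda>z. F (insert z S)) has_real_derivative (\<integral>\<omega>. L \<omega> \<partial>M)) (at x)"
    using at_within_open[OF U(2,1)] by (simp add: DERIV_def)
  also have "(\<integral>\<omega>. L \<omega> \<partial>M) = (\<integral>\<omega>. (2 * std_normal_density 0 / sqrt (1 - x\<^sup>2) * (\<Prod>y\<in>S. sgn (y - x))) * (gf \<omega> x * (\<Prod>y\<in>S. sgn (gf \<omega> y))) \<partial>M)"
  proof (intro Bochner_Integration.integral_cong refl)
    fix \<omega>
    have "(\<Prod>s\<in>S. sgn (blaschke x s * gf \<omega> s)) = (\<Prod>y\<in>S. sgn (y - x)) * (\<Prod>y\<in>S. sgn (gf \<omega> y))"
      unfolding prod.distrib[symmetric] using S x by (intro prod.cong) (auto simp: sgn_mult sgn_blaschke)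
    then show "L \<omega> = (2 * std_normal_density 0 / sqrt (1 - x\<^sup>2) * (\<Prod>y\<in>S. sgn (y - x))) * (gf \<omega> x * (\<Prod>y\<in>S. sgn (gf \<omega> y)))"
      by (simp add: L_def r_def)
  qed
  finally show ?thesis by simp
qed

end

lemma abs_prod_ssgn_le: "\<bar>\<Prod>x\<in>S. ssgn n (f x :: real)\<bar> \<le> 1"
  unfolding abs_prod by (intro prod_le_1) (auto simp: abs_ssgn_le)

lemma abs_mult_ssgn_le: "\<bar>u * (\<Prod>x\<in>S. ssgn n (f x))\<bar> \<le> \<bar>u :: real\<bar>"
  using abs_prod_ssgn_le[of n f S] by (simp add: abs_mult mult_left_le)

section \<open>Gaussian integration by parts with smoothed signs\<close>

context gaussian_series
begin

lemma fubini_normal: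
  assumes g: "integrable (std_normal_distribution \<Otimes>\<^sub>M M) (g :: real \<times> 'w \<Rightarrow> real)"
  shows "(\<integral>p. g p \<partial>(std_normal_distribution \<Otimes>\<^sub>M M)) = (\<integral>\<omega>. (\<integral>\<xi>. g (\<xi>, \<omega>) \<partial>std_normal_distribution) \<partial>M)"
  using NM.integral_snd[of "\<lambda>\<xi> \<omega>. g (\<xi>, \<omega>)"] g by simp

text \<open>As \<open>n\<close> grows, the factor \<open>ssgn'\<close> tends to twice a point mass
  at the event that \<open>f\<close> vanishes at \<open>k\<close>.\<close>

definition smoothed :: "real set \<Rightarrow> nat \<Rightarrow> real \<Rightarrow> real" where
  "smoothed S n k = (\<integral>\<omega>. ssgn' n (gf \<omega> k) * (\<Prod>y\<in>S - {k}. ssgn n (gf \<omega> y)) \<partial>M)"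

text \<open>With base point \<open>x\<close> the first factor is \<open>cofac x x\<close> times the
  normal variable, and Stein's identity differentiates the product of smoothed signs in that
  variable. The resulting constant \<open>cofac x x * cofac x k\<close> is the covariance
  \<open>1 / (1 - x * k)\<close>; returning from the conditioned to the original process gives
  \<open>smoothed\<close>.\<close>

lemma E_gf_ssgn:
  assumes S: "finite S" "S \<subseteq> {-1<..<1}" and x: "x \<in> {-1<..<1}" "x \<notin> S"
  shows "(\<integral>\<omega>. gf \<omega> x * (\<Prod>y\<in>S. ssgn n (gf \<omega> y)) \<partial>M) = (\<Sum>k\<in>S. 1 / (1 - x * k) * smoothed S n k)"
proof -
  have x1: "\<bar>x\<bar> < 1" using x by auto

    let ?g = "\<lambda>y. if y = x then (\<lambda>t. t) else ssgn n"
    have cong: "(\<Prod>y\<in>insert x S. ?g y (q y)) = q x * (\<Prod>y\<in>S. ssgn n (q y))" for q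
    proof -
      have "(\<Prod>y\<in>S. ?g y (q y)) = (\<Prod>y\<in>S. ssgn n (q y))" using x by (intro prod.cong) auto
      then show ?thesis using S x by simp
    qed
    define h where "h \<omega> \<xi> = (\<Prod>y\<in>S. ssgn n (\<xi> * cofac x y + blaschke x y * gf \<omega> y))" for \<omega> \<xi>
    define h' where "h' \<omega> \<xi> = (\<Sum>k\<in>S. (ssgn' n (\<xi> * cofac x k + blaschke x k * gf \<omega> k) * cofac x k) * (\<Prod>y\<in>S - {k}. ssgn n (\<xi> * cofac x y + blaschke x y * gf \<omega> y)))" for \<omega> \<xi>
    have [measurable]: "?g y \<in> borel_measurable borel" for y by auto
    note tr = transfer_prod[of "insert x S" x ?g, unfolded cong]
    have I: "finite (insert x S)" "insert x S \<subseteq> {-1<..<1}" using S x by auto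
    have "integrable M (\<lambda>\<omega>. gf \<omega> x * (\<Prod>y\<in>S. ssgn n (gf \<omega> y)))"
    proof (rule Bochner_Integration.integrable_bound[OF integrable_gf[OF x1]])
      show "AE \<omega> in M. norm (gf \<omega> x * (\<Prod>y\<in>S. ssgn n (gf \<omega> y))) \<le> norm (gf \<omega> x)"
        by (intro AE_I2) (simp only: real_norm_def abs_mult_ssgn_le)
    qed measurable
    then have int: "integrable (std_normal_distribution \<Otimes>\<^sub>M M) (\<lambda>p. (fst p * cofac x x) * h (snd p) (fst p))"
      using tr(2)[OF I x(1)] by (simp add: h_def)
    have "(\<integral>\<omega>. gf \<omega> x * (\<Prod>y\<in>S. ssgn n (gf \<omega> y)) \<partial>M) = (\<integral>p. (fst p * cofac x x) * h (snd p) (fst p) \<partial>(std_normal_distribution \<Otimes>\<^sub>M M))"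
      using tr(1)[OF I x(1)] by (simp add: h_def)
    also have "\<dots> = (\<integral>\<omega>. (\<integral>\<xi>. (\<xi> * cofac x x) * h \<omega> \<xi> \<partial>std_normal_distribution) \<partial>M)"
      by (subst fubini_normal[OF int]) simp
    also have "\<dots> = (\<integral>\<omega>. (\<integral>\<xi>. cofac x x * h' \<omega> \<xi> \<partial>std_normal_distribution) \<partial>M)"
    proof (rule Bochner_Integration.integral_cong[OF refl])
      fix \<omega>
      have "(\<integral>\<xi>. \<xi> * h \<omega> \<xi> \<partial>std_normal_distribution) = (\<integral>\<xi>. h' \<omega> \<xi> \<partial>std_normal_distribution)"
      proof (rule std_normal_ibp)
        fix \<xi>
        show "(h \<omega> has_real_derivative h' \<omega> \<xi>) (at \<xi>)"
          unfolding h_def[abs_def] h'_def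
          by (intro has_field_derivative_prod DERIV_chain2[OF DERIV_ssgn]) (auto intro!: derivative_eq_intros)
        have c1: "isCont (\<lambda>\<xi>. ssgn' n (\<xi> * cofac x k + blaschke x k * gf \<omega> k)) \<xi>" for k
          by (rule isCont_o2[OF _ isCont_ssgn']) (intro continuous_intros)
        have c2: "isCont (\<lambda>\<xi>. ssgn n (\<xi> * cofac x k + blaschke x k * gf \<omega> k)) \<xi>" for k
          by (rule isCont_o2[OF _ DERIV_isCont[OF DERIV_ssgn]]) (intro continuous_intros)
        show "isCont (h' \<omega>) \<xi>"
          unfolding h'_def[abs_def] by (intro continuous_intros c1 c2)
        show "\<bar>h \<omega> \<xi>\<bar> \<le> 1" unfolding h_def by (rule abs_prod_ssgn_le)
        have "\<bar>h' \<omega> \<xi>\<bar> \<le> (\<Sum>k\<in>S. \<bar>(ssgn' n (\<xi> * cofac x k + blaschke x k * gf \<omega> k) * cofac x k) * (\<Prod>y\<in>S - {k}. ssgn n (\<xi> * cofac x y + blaschke x y * gf \<omega> y))\<bar>)"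
          unfolding h'_def by (rule sum_abs)
        also have "\<dots> \<le> (\<Sum>k\<in>S. (2 / pi * real (Suc n) * \<bar>cofac x k\<bar>) * 1)"
        proof (rule sum_mono)
          fix k
          have "\<bar>ssgn' n (\<xi> * cofac x k + blaschke x k * gf \<omega> k)\<bar> \<le> 2 / pi * real (Suc n)"
            using ssgn'_bounds[of n "\<xi> * cofac x k + blaschke x k * gf \<omega> k"] by linarith
          then show "\<bar>(ssgn' n (\<xi> * cofac x k + blaschke x k * gf \<omega> k) * cofac x k) * (\<Prod>y\<in>S - {k}. ssgn n (\<xi> * cofac x y + blaschke x y * gf \<omega> y))\<bar>
              \<le> (2 / pi * real (Suc n) * \<bar>cofac x k\<bar>) * 1"
            unfolding abs_mult by (rule mult_mono[OF mult_right_mono abs_prod_ssgn_le]) auto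
        qed
        finally show "\<bar>h' \<omega> \<xi>\<bar> \<le> (\<Sum>k\<in>S. (2 / pi * real (Suc n) * \<bar>cofac x k\<bar>) * 1)" .
      qed
      moreover have "(\<integral>\<xi>. (\<xi> * cofac x x) * h \<omega> \<xi> \<partial>std_normal_distribution) = cofac x x * (\<integral>\<xi>. \<xi> * h \<omega> \<xi> \<partial>std_normal_distribution)"
        by (subst integral_mult_right_zero[symmetric]) (simp add: mult_ac)
      ultimately show "(\<integral>\<xi>. (\<xi> * cofac x x) * h \<omega> \<xi> \<partial>std_normal_distribution) = (\<integral>\<xi>. cofac x x * h' \<omega> \<xi> \<partial>std_normal_distribution)"
        by simp
    qed
    also have "\<dots> = (\<integral>\<omega>. (\<integral>\<xi>. (\<Sum>k\<in>S. cofac x x * cofac x k * (ssgn' n (\<xi> * cofac x k + blaschke x k * gf \<omega> k) * (\<Prod>y\<in>S - {k}. ssgn n (\<xi> * cofac x y + blaschke x y * gf \<omega> y)))) \<partial>std_normal_distribution) \<partial>M)"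
      by (simp add: h'_def sum_distrib_left mult_ac)
    also have "\<dots> = (\<integral>p. (\<Sum>k\<in>S. cofac x x * cofac x k * (ssgn' n (fst p * cofac x k + blaschke x k * gf (snd p) k) * (\<Prod>y\<in>S - {k}. ssgn n (fst p * cofac x y + blaschke x y * gf (snd p) y)))) \<partial>(std_normal_distribution \<Otimes>\<^sub>M M))"
    proof -
      have bd: "\<bar>ssgn' n u * (\<Prod>y\<in>S - {k}. ssgn n (q y))\<bar> \<le> 2 / pi * real (Suc n)" for u q k
      proof -
        have "\<bar>ssgn' n u\<bar> * \<bar>\<Prod>y\<in>S - {k}. ssgn n (q y)\<bar> \<le> (2 / pi * real (Suc n)) * 1"
          using ssgn'_bounds[of n u] abs_prod_ssgn_le by (intro mult_mono) auto
        then show ?thesis by (simp add: abs_mult)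
      qed
      have "integrable (std_normal_distribution \<Otimes>\<^sub>M M) (\<lambda>p. (\<Sum>k\<in>S. cofac x x * cofac x k * (ssgn' n (fst p * cofac x k + blaschke x k * gf (snd p) k) * (\<Prod>y\<in>S - {k}. ssgn n (fst p * cofac x y + blaschke x y * gf (snd p) y)))))"
        by (intro Bochner_Integration.integrable_sum integrable_mult_right NM.P.integrable_const_bound[of _ "2 / pi * real (Suc n)"]) (use bd in auto)
      then show ?thesis by (subst fubini_normal) simp_all
    qed
    also have "\<dots> = (\<Sum>k\<in>S. cofac x x * cofac x k * (\<integral>p. (ssgn' n (fst p * cofac x k + blaschke x k * gf (snd p) k) * (\<Prod>y\<in>S - {k}. ssgn n (fst p * cofac x y + blaschke x y * gf (snd p) y))) \<partial>(std_normal_distribution \<Otimes>\<^sub>M M)))"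
    proof -
      have bd: "\<bar>ssgn' n u * (\<Prod>y\<in>S - {k}. ssgn n (q y))\<bar> \<le> 2 / pi * real (Suc n)" for u q k
      proof -
        have "\<bar>ssgn' n u\<bar> * \<bar>\<Prod>y\<in>S - {k}. ssgn n (q y)\<bar> \<le> (2 / pi * real (Suc n)) * 1"
          using ssgn'_bounds[of n u] abs_prod_ssgn_le by (intro mult_mono) auto
        then show ?thesis by (simp add: abs_mult)
      qed
      have "integrable (std_normal_distribution \<Otimes>\<^sub>M M) (\<lambda>p. (ssgn' n (fst p * cofac x k + blaschke x k * gf (snd p) k) * (\<Prod>y\<in>S - {k}. ssgn n (fst p * cofac x y + blaschke x y * gf (snd p) y))))" for k
        by (intro NM.P.integrable_const_bound[of _ "2 / pi * real (Suc n)"]) (use bd in auto)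
      then show ?thesis by simp
    qed
    also have "\<dots> = (\<Sum>k\<in>S. 1 / (1 - x * k) * smoothed S n k)"
    proof (intro sum.cong refl)
      fix k assume k: "k \<in> S"
      have cong: "(\<Prod>y\<in>S. (if y = k then ssgn' n else ssgn n) (q y)) = ssgn' n (q k) * (\<Prod>y\<in>S - {k}. ssgn n (q y))" for q
        using prod.remove[OF S(1) k, of "\<lambda>y. (if y = k then ssgn' n else ssgn n) (q y)"] by simp
      have "smoothed S n k = (\<integral>p. (ssgn' n (fst p * cofac x k + blaschke x k * gf (snd p) k) * (\<Prod>y\<in>S - {k}. ssgn n (fst p * cofac x y + blaschke x y * gf (snd p) y))) \<partial>(std_normal_distribution \<Otimes>\<^sub>M M))"
        unfolding smoothed_def
        using transfer_prod(1)[OF S x(1), of "\<lambda>y. if y = k then ssgn' n else ssgn n", unfolded cong] by auto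
      moreover have "cofac x x * cofac x k = 1 / (1 - x * k)"
        using one_minus_square_pos[OF x(1)] by (simp add: cofac_def power2_eq_square)
      ultimately show "cofac x x * cofac x k * (\<integral>p. (ssgn' n (fst p * cofac x k + blaschke x k * gf (snd p) k) * (\<Prod>y\<in>S - {k}. ssgn n (fst p * cofac x y + blaschke x y * gf (snd p) y))) \<partial>(std_normal_distribution \<Otimes>\<^sub>M M)) = 1 / (1 - x * k) * smoothed S n k"
        by simp
    qed
    finally show ?thesis .
  qed

text \<open>Now \<open>k\<close> is the base point. The approximate point mass acts on the normal
  variable alone and leaves \<open>2 * std_normal_density 0 / cofac k k\<close>. At
  \<open>\<xi> = 0\<close> the other values are Blaschke multiples of \<open>f\<close>, whose signs
  factor into \<open>sgn (y - k)\<close> and the sign of an unconditioned value; hence the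
  correlation with \<open>k\<close> removed.\<close>

lemma smoothed_limit:
  assumes S: "finite S" "S \<subseteq> {-1<..<1}" and k: "k \<in> S"
  shows "(\<lambda>n. smoothed S n k) \<longlonglongrightarrow> 2 * std_normal_density 0 * sqrt (1 - k\<^sup>2) * ((\<Prod>y\<in>S - {k}. sgn (y - k)) * F (S - {k}))"
proof -

    have k1: "k \<in> {-1<..<1}" using k S by auto
    define \<kappa> where "\<kappa> = cofac k k"
    have \<kappa>: "\<kappa> > 0" unfolding \<kappa>_def by (rule cofac_pos[OF k1 k1])
    have \<kappa>': "2 / \<kappa> = 2 * sqrt (1 - k\<^sup>2)"
    proof -
      have "sqrt (1 - k\<^sup>2) * sqrt (1 - k\<^sup>2) = 1 - k\<^sup>2" using one_minus_square_pos[OF k1] by simp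
      then show ?thesis using one_minus_square_pos[OF k1]
        by (simp add: \<kappa>_def cofac_def power2_eq_square[symmetric] field_simps)
    qed
    define w where "w y = std_normal_density 0 * (2 / pi / (1 + (\<kappa> * y)\<^sup>2))" for y
    have iw: "integrable lborel w" unfolding w_def by (rule integrable_mult_right[OF cauchy_integral(1)[OF \<kappa>]])
    have w_int: "(\<integral>y. w y \<partial>lborel) = std_normal_density 0 * (2 / \<kappa>)"
      unfolding w_def by (simp only: integral_mult_right_zero cauchy_integral(2)[OF \<kappa>])
    \<comment> \<open>The rescaled integrand at base point \<open>k\<close>: its Cauchy kernel no
      longer depends on \<open>n\<close>, and all other factors are bounded by 1.\<close>
    define G where "G n \<omega> y = (2 / pi / (1 + (\<kappa> * y)\<^sup>2)) * (\<Prod>s\<in>S - {k}. ssgn n (y * cofac k s / real (Suc n) + blaschke k s * gf \<omega> s))" for n \<omega> y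
    define V where "V n \<omega> = (\<integral>y. std_normal_density (y / real (Suc n)) * G n \<omega> y \<partial>lborel)" for n \<omega>
    have pp: "0 \<le> 2 / pi / (1 + (\<kappa> * y)\<^sup>2)" for y by (intro divide_nonneg_nonneg add_nonneg_nonneg) auto
    have bG: "norm (std_normal_density (y / real (Suc n)) * G n \<omega> y) \<le> w y" for n \<omega> y
    proof -
      have "\<bar>G n \<omega> y\<bar> \<le> (2 / pi / (1 + (\<kappa> * y)\<^sup>2)) * 1"
        unfolding G_def abs_mult using pp[of y] by (intro mult_mono abs_prod_ssgn_le) auto
      then have "std_normal_density (y / real (Suc n)) * \<bar>G n \<omega> y\<bar> \<le> std_normal_density 0 * (2 / pi / (1 + (\<kappa> * y)\<^sup>2))"
        by (intro mult_mono[OF gauss_density_le]) auto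
      then show ?thesis by (simp add: w_def abs_mult)
    qed
    have TV: "smoothed S n k = (\<integral>\<omega>. V n \<omega> \<partial>M)" for n
    proof -
      have cong: "(\<Prod>y\<in>S. (if y = k then ssgn' n else ssgn n) (q y)) = ssgn' n (q k) * (\<Prod>y\<in>S - {k}. ssgn n (q y))" for q
        using prod.remove[OF S(1) k, of "\<lambda>y. (if y = k then ssgn' n else ssgn n) (q y)"] by simp
      have bd: "\<bar>ssgn' n u * (\<Prod>y\<in>S - {k}. ssgn n (q y))\<bar> \<le> 2 / pi * real (Suc n)" for u q
      proof -
        have "\<bar>ssgn' n u\<bar> * \<bar>\<Prod>y\<in>S - {k}. ssgn n (q y)\<bar> \<le> (2 / pi * real (Suc n)) * 1"
          using ssgn'_bounds[of n u] abs_prod_ssgn_le by (intro mult_mono) auto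
        then show ?thesis by (simp add: abs_mult)
      qed
      have "smoothed S n k = (\<integral>p. ssgn' n (fst p * cofac k k + blaschke k k * gf (snd p) k) * (\<Prod>y\<in>S - {k}. ssgn n (fst p * cofac k y + blaschke k y * gf (snd p) y)) \<partial>(std_normal_distribution \<Otimes>\<^sub>M M))"
        unfolding smoothed_def
        using transfer_prod(1)[OF S k1, of "\<lambda>y. if y = k then ssgn' n else ssgn n", unfolded cong] by auto
      also have "\<dots> = (\<integral>\<omega>. (\<integral>\<xi>. std_normal_density \<xi> * (ssgn' n (\<xi> * \<kappa>) * (\<Prod>y\<in>S - {k}. ssgn n (\<xi> * cofac k y + blaschke k y * gf \<omega> y))) \<partial>lborel) \<partial>M)"
        by (subst fubini_lborel) (use bd in \<open>auto intro!: NM.P.integrable_const_bound[of _ "2 / pi * real (Suc n)"] simp: \<kappa>_def\<close>)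
      also have "\<dots> = (\<integral>\<omega>. V n \<omega> \<partial>M)"
      proof (rule Bochner_Integration.integral_cong[OF refl])
        fix \<omega>
        \<comment> \<open>The scale of the substitution \<open>\<xi> = c * y\<close>; it is the
          width of the kernel \<open>ssgn' n\<close>.\<close>
        define c where "c = 1 / real (Suc n)"
        have c: "c > 0" "\<bar>c\<bar> = c" "c \<noteq> 0" by (auto simp: c_def)
        have cs: "c * ssgn' n (c * y * \<kappa>) = 2 / pi / (1 + (\<kappa> * y)\<^sup>2)" for y
        proof -
          have e: "real (Suc n) * (c * y * \<kappa>) = \<kappa> * y" "c * real (Suc n) = 1" by (simp_all add: c_def)
          have "c * ssgn' n (c * y * \<kappa>) = 2 / pi * ((c * real (Suc n)) / (1 + (real (Suc n) * (c * y * \<kappa>))\<^sup>2))"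
            unfolding ssgn'_def by (simp del: of_nat_Suc)
          then show ?thesis unfolding e by simp
        qed
        have "(\<integral>\<xi>. std_normal_density \<xi> * (ssgn' n (\<xi> * \<kappa>) * (\<Prod>y\<in>S - {k}. ssgn n (\<xi> * cofac k y + blaschke k y * gf \<omega> y))) \<partial>lborel) =
          c * (\<integral>y. std_normal_density (c * y) * (ssgn' n (c * y * \<kappa>) * (\<Prod>s\<in>S - {k}. ssgn n (c * y * cofac k s + blaschke k s * gf \<omega> s))) \<partial>lborel)"
          using lborel_integral_real_affine[OF c(3), of "\<lambda>\<xi>. std_normal_density \<xi> * (ssgn' n (\<xi> * \<kappa>) * (\<Prod>y\<in>S - {k}. ssgn n (\<xi> * cofac k y + blaschke k y * gf \<omega> y)))" 0] c(2)
          by simp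
        also have "\<dots> = (\<integral>y. std_normal_density (c * y) * ((c * ssgn' n (c * y * \<kappa>)) * (\<Prod>s\<in>S - {k}. ssgn n (c * y * cofac k s + blaschke k s * gf \<omega> s))) \<partial>lborel)"
          by (subst integral_mult_right_zero[symmetric]) (simp add: mult_ac)
        also have "\<dots> = V n \<omega>"
          unfolding V_def G_def cs by (simp add: c_def)
        finally show "(\<integral>\<xi>. std_normal_density \<xi> * (ssgn' n (\<xi> * \<kappa>) * (\<Prod>y\<in>S - {k}. ssgn n (\<xi> * cofac k y + blaschke k y * gf \<omega> y))) \<partial>lborel) = V n \<omega>" .
      qed
      finally show ?thesis .
    qed
    define L where "L \<omega> = std_normal_density 0 * (2 / \<kappa>) * (\<Prod>s\<in>S - {k}. sgn (blaschke k s * gf \<omega> s))" for \<omega>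
    have Vm: "V n \<in> borel_measurable M" for n unfolding V_def[abs_def] G_def by measurable
    have "(\<lambda>n. \<integral>\<omega>. V n \<omega> \<partial>M) \<longlonglongrightarrow> (\<integral>\<omega>. L \<omega> \<partial>M)"
    proof (rule integral_dominated_convergence[where w = "\<lambda>_. std_normal_density 0 * (2 / \<kappa>)"])
      show "L \<in> borel_measurable M" unfolding L_def by measurable
      show "AE \<omega> in M. (\<lambda>n. V n \<omega>) \<longlonglongrightarrow> L \<omega>"
        using AE_good_nonzero[OF S]
      proof eventually_elim
        case (elim \<omega>)
        have "(\<lambda>n. V n \<omega>) \<longlonglongrightarrow> (\<integral>y. std_normal_density 0 * ((2 / pi / (1 + (\<kappa> * y)\<^sup>2)) * (\<Prod>s\<in>S - {k}. sgn (blaschke k s * gf \<omega> s))) \<partial>lborel)"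
          unfolding V_def
        proof (rule integral_dominated_convergence[OF _ _ iw])
          show "AE y in lborel. (\<lambda>n. std_normal_density (y / real (Suc n)) * G n \<omega> y) \<longlonglongrightarrow> std_normal_density 0 * ((2 / pi / (1 + (\<kappa> * y)\<^sup>2)) * (\<Prod>s\<in>S - {k}. sgn (blaschke k s * gf \<omega> s)))"
          proof (rule AE_I2)
            fix y :: real
            have "(\<lambda>n. y / real (Suc n)) \<longlonglongrightarrow> 0" by real_asymp
            moreover have "(\<lambda>n. ssgn n (y * cofac k s / real (Suc n) + blaschke k s * gf \<omega> s)) \<longlonglongrightarrow> sgn (blaschke k s * gf \<omega> s)" if s: "s \<in> S - {k}" for s
            proof (rule tendsto_ssgn_perturbed)
              have "s \<in> {-1<..<1}" "s \<noteq> k" "gf \<omega> s \<noteq> 0" using s S elim by auto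
              then show "blaschke k s * gf \<omega> s \<noteq> 0" using one_minus_mult_pos[OF k1, of s] by (auto simp: blaschke_def)
            qed
            ultimately show "(\<lambda>n. std_normal_density (y / real (Suc n)) * G n \<omega> y) \<longlonglongrightarrow> std_normal_density 0 * ((2 / pi / (1 + (\<kappa> * y)\<^sup>2)) * (\<Prod>s\<in>S - {k}. sgn (blaschke k s * gf \<omega> s)))"
              unfolding G_def by (intro tendsto_mult tendsto_std_normal_density tendsto_prod tendsto_const)
          qed
        qed (use bG in \<open>auto simp: G_def\<close>)
        also have "(\<integral>y. std_normal_density 0 * ((2 / pi / (1 + (\<kappa> * y)\<^sup>2)) * (\<Prod>s\<in>S - {k}. sgn (blaschke k s * gf \<omega> s))) \<partial>lborel) = (\<integral>y. w y * (\<Prod>s\<in>S - {k}. sgn (blaschke k s * gf \<omega> s)) \<partial>lborel)"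
          by (simp add: w_def mult_ac)
        also have "\<dots> = L \<omega>" by (simp only: integral_mult_left_zero w_int L_def)
        finally show ?case .
      qed
      show "AE \<omega> in M. norm (V n \<omega>) \<le> std_normal_density 0 * (2 / \<kappa>)" for n
      proof (rule AE_I2)
        fix \<omega>
        show "norm (V n \<omega>) \<le> std_normal_density 0 * (2 / \<kappa>)"
          unfolding w_int[symmetric] V_def
        proof (rule Bochner_Integration.integral_norm_bound_integral[OF _ iw bG])
          show "integrable lborel (\<lambda>y. std_normal_density (y / real (Suc n)) * G n \<omega> y)"
          proof (rule Bochner_Integration.integrable_bound[OF iw])
            show "AE y in lborel. norm (std_normal_density (y / real (Suc n)) * G n \<omega> y) \<le> norm (w y)"
              by (intro AE_I2 order_trans[OF bG]) simp
          qed (simp add: G_def)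
        qed
      qed
    qed (use Vm in auto)
    moreover have "(\<integral>\<omega>. L \<omega> \<partial>M) = (\<integral>\<omega>. (std_normal_density 0 * (2 / \<kappa>) * (\<Prod>y\<in>S - {k}. sgn (y - k))) * (\<Prod>y\<in>S - {k}. sgn (gf \<omega> y)) \<partial>M)"
    proof (rule Bochner_Integration.integral_cong[OF refl])
      fix \<omega>
      have "(\<Prod>s\<in>S - {k}. sgn (blaschke k s * gf \<omega> s)) = (\<Prod>y\<in>S - {k}. sgn (y - k)) * (\<Prod>y\<in>S - {k}. sgn (gf \<omega> y))"
        unfolding prod.distrib[symmetric] using S k1 by (intro prod.cong) (auto simp: sgn_mult sgn_blaschke)
      then show "L \<omega> = (std_normal_density 0 * (2 / \<kappa>) * (\<Prod>y\<in>S - {k}. sgn (y - k))) * (\<Prod>y\<in>S - {k}. sgn (gf \<omega> y))"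
        by (simp add: L_def)
    qed
    ultimately show ?thesis unfolding TV[symmetric] by (simp add: F_def \<kappa>' mult_ac)
  qed

lemma E_gf_sgn:
  assumes S: "finite S" "S \<subseteq> {-1<..<1}" and x: "x \<in> {-1<..<1}" "x \<notin> S"
  shows "(\<integral>\<omega>. gf \<omega> x * (\<Prod>y\<in>S. sgn (gf \<omega> y)) \<partial>M) =
    (\<Sum>k\<in>S. 1 / (1 - x * k) * (2 * std_normal_density 0 * sqrt (1 - k\<^sup>2)) * (\<Prod>y\<in>S - {k}. sgn (y - k)) * F (S - {k}))"
proof -
  have x1: "\<bar>x\<bar> < 1" using x by auto
  have lim1: "(\<lambda>n. \<integral>\<omega>. gf \<omega> x * (\<Prod>y\<in>S. ssgn n (gf \<omega> y)) \<partial>M) \<longlonglongrightarrow> (\<integral>\<omega>. gf \<omega> x * (\<Prod>y\<in>S. sgn (gf \<omega> y)) \<partial>M)"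
  proof (rule integral_dominated_convergence[where w = "\<lambda>\<omega>. \<bar>gf \<omega> x\<bar>"])
    show "AE \<omega> in M. (\<lambda>n. gf \<omega> x * (\<Prod>y\<in>S. ssgn n (gf \<omega> y))) \<longlonglongrightarrow> gf \<omega> x * (\<Prod>y\<in>S. sgn (gf \<omega> y))"
      using AE_good_nonzero[OF S]
    proof eventually_elim
      case (elim \<omega>)
      then show ?case using tendsto_ssgn_perturbed[of _ 0] by (intro tendsto_intros) auto
    qed
    show "AE \<omega> in M. norm (gf \<omega> x * (\<Prod>y\<in>S. ssgn n (gf \<omega> y))) \<le> \<bar>gf \<omega> x\<bar>" for n
      by (intro AE_I2) (simp only: real_norm_def abs_mult_ssgn_le)
  qed (use integrable_gf[OF x1] in auto)
  have "(\<lambda>n. \<Sum>k\<in>S. 1 / (1 - x * k) * smoothed S n k) \<longlonglongrightarrow>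
     (\<Sum>k\<in>S. 1 / (1 - x * k) * (2 * std_normal_density 0 * sqrt (1 - k\<^sup>2) * ((\<Prod>y\<in>S - {k}. sgn (y - k)) * F (S - {k}))))"
    by (intro tendsto_sum tendsto_mult tendsto_const smoothed_limit[OF S])
  with lim1 have "(\<integral>\<omega>. gf \<omega> x * (\<Prod>y\<in>S. sgn (gf \<omega> y)) \<partial>M) =
     (\<Sum>k\<in>S. 1 / (1 - x * k) * (2 * std_normal_density 0 * sqrt (1 - k\<^sup>2) * ((\<Prod>y\<in>S - {k}. sgn (y - k)) * F (S - {k}))))"
    unfolding E_gf_ssgn[OF S x] by (rule LIMSEQ_unique)
  then show ?thesis by (simp add: mult.assoc)
qed

text \<open>One factor \<open>2 * std_normal_density 0\<close> comes from moving \<open>x\<close>,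
  the other from localising at \<open>k\<close>; their product is \<open>2 / pi\<close>. Only
  correlations with two points fewer remain on the right, so the system of equations closes.\<close>

lemma DERIV_F:
  assumes S: "finite S" "S \<subseteq> {-1<..<1}" and x: "x \<in> {-1<..<1}" "x \<notin> S"
  shows "((\<lambda>z. F (insert z S)) has_real_derivative
    (\<Sum>k\<in>S. 2 / pi * k12 x k * (\<Prod>y\<in>S. sgn (y - x)) * (\<Prod>y\<in>S - {k}. sgn (y - k)) * F (S - {k}))) (at x)"
proof -
  have phi: "std_normal_density 0 * std_normal_density 0 = 1 / (2 * pi)"
    by (simp add: normal_density_def)
  have "2 * std_normal_density 0 / sqrt (1 - x\<^sup>2) * P * (1 / (1 - x * k) * (2 * std_normal_density 0 * sqrt (1 - k\<^sup>2)) * Pk * Fk)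
      = 2 / pi * k12 x k * P * Pk * Fk" for P Pk Fk k :: real
  proof -
    have "2 * std_normal_density 0 / sqrt (1 - x\<^sup>2) * P * (1 / (1 - x * k) * (2 * std_normal_density 0 * sqrt (1 - k\<^sup>2)) * Pk * Fk)
      = 4 * (std_normal_density 0 * std_normal_density 0) * k12 x k * P * Pk * Fk"
      by (simp add: k12_def)
    then show ?thesis unfolding phi by simp
  qed
  then show ?thesis
    using DERIV_F_raw[OF S x] unfolding E_gf_sgn[OF S x] sum_distrib_left by simp
qed

end

text \<open>The sign of the permutation that sorts a list of distinct reals.\<close>

fun dsgn :: "real list \<Rightarrow> real" where
  "dsgn [] = 1"
| "dsgn (x # xs) = (\<Prod>y\<in>set xs. sgn (y - x)) * dsgn xs"

lemma prod_sgn_square: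
  assumes "finite S" "x \<notin> S"
  shows "(\<Prod>y\<in>S. sgn (y - x)) * (\<Prod>y\<in>S. sgn (y - x :: real)) = 1"
  unfolding prod.distrib[symmetric] using assms by (intro prod.neutral) (auto simp: sgn_if)

text \<open>Collecting all pairs of the entry at position \<open>k\<close> with one orientation
  reverses its pairs with the \<open>k\<close> entries before it.\<close>

lemma dsgn_del:
  assumes "distinct xs" "k < length xs"
  shows "dsgn xs = (-1) ^ k * (\<Prod>y\<in>set xs - {xs ! k}. sgn (y - xs ! k)) * dsgn (del k xs)"
  using assms
proof (induction xs arbitrary: k)
  case (Cons x zs)
  show ?case
  proof (cases k)
    case 0
    have "insert x (set zs) - {x} = set zs" using Cons.prems by auto
    then show ?thesis by (simp add: 0 del_def)
  next
    case (Suc j)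
    define z where "z = zs ! j"
    have j: "j < length zs" and d: "distinct zs" "x \<notin> set zs" using Cons.prems Suc by auto
    have z: "z \<in> set zs" "z \<noteq> x" using j d by (auto simp: z_def)
    have 1: "(\<Prod>y\<in>set zs. sgn (y - x)) = sgn (z - x) * (\<Prod>y\<in>set zs - {z}. sgn (y - x))"
      using z by (intro prod.remove) auto
    have "insert x (set zs) - {z} = insert x (set zs - {z})" using z by auto
    then have 2: "(\<Prod>y\<in>insert x (set zs) - {z}. sgn (y - z)) = sgn (x - z) * (\<Prod>y\<in>set zs - {z}. sgn (y - z))"
      using d by simp
    have 3: "del k (x # zs) = x # del j zs" by (simp add: Suc del_def)
    have 4: "set (del j zs) = set zs - {z}" using set_del[OF d(1) j] by (simp add: z_def)
    have 5: "sgn (z - x) = - sgn (x - z)" by (simp add: sgn_if)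
    have "dsgn (x # zs) = (sgn (z - x) * (\<Prod>y\<in>set zs - {z}. sgn (y - x))) * ((-1) ^ j * (\<Prod>y\<in>set zs - {z}. sgn (y - z)) * dsgn (del j zs))"
      using Cons.IH[OF d(1) j] 1 by (simp add: z_def)
    also have "\<dots> = (-1) ^ k * (sgn (x - z) * (\<Prod>y\<in>set zs - {z}. sgn (y - z))) * ((\<Prod>y\<in>set zs - {z}. sgn (y - x)) * dsgn (del j zs))"
      unfolding 5 Suc by simp
    also have "\<dots> = (-1) ^ k * (\<Prod>y\<in>set (x # zs) - {(x # zs) ! k}. sgn (y - (x # zs) ! k)) * dsgn (del k (x # zs))"
      using 2 3 4 by (simp add: Suc z_def)
    finally show ?thesis .
  qed
qed simp

text \<open>For \<open>s < t\<close> this is the correlation of the signs at the two points, by the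
  arcsine law for Gaussian pairs.\<close>

definition AA :: "real \<Rightarrow> real \<Rightarrow> real" where
  "AA s t = 2 / pi * k22 s t"

section \<open>Identification of the sign correlations with a Pfaffian\<close>

context gaussian_series
begin

text \<open>Paths are continuous and almost surely nonzero at \<open>x\<close>, so in the limit the
  two signs multiply to 1.\<close>

lemma F_collapse:
  assumes S: "finite S" "S \<subseteq> {-1<..<1}" and x: "x \<in> S"
    and X: "\<And>n. X n \<in> {-1<..<1} - S" "X \<longlonglongrightarrow> x"
  shows "(\<lambda>n. F (insert (X n) S)) \<longlonglongrightarrow> F (S - {x})"
  unfolding F_def
proof (rule integral_dominated_convergence[where w = "\<lambda>_. 1"])
  show "AE \<omega> in M. (\<lambda>n. \<Prod>y\<in>insert (X n) S. sgn (gf \<omega> y)) \<longlonglongrightarrow> (\<Prod>y\<in>S - {x}. sgn (gf \<omega> y))"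
    using AE_good_nonzero[OF S]
  proof eventually_elim
    case (elim \<omega>)
    have "\<bar>x\<bar> < 1" using subsetD[OF S(2) x] by (simp add: abs_less_iff)
    then have "(\<lambda>n. gf \<omega> (X n)) \<longlonglongrightarrow> gf \<omega> x"
      using elim X(2) by (intro isCont_tendsto_compose[OF isCont_gf]) auto
    then have "(\<lambda>n. sgn (gf \<omega> (X n)) * (sgn (gf \<omega> x) * (\<Prod>y\<in>S - {x}. sgn (gf \<omega> y)))) \<longlonglongrightarrow>
       sgn (gf \<omega> x) * (sgn (gf \<omega> x) * (\<Prod>y\<in>S - {x}. sgn (gf \<omega> y)))"
      using elim x by (intro tendsto_intros) auto
    moreover have "(\<Prod>y\<in>insert (X n) S. sgn (gf \<omega> y)) = sgn (gf \<omega> (X n)) * (sgn (gf \<omega> x) * (\<Prod>y\<in>S - {x}. sgn (gf \<omega> y)))" for n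
      using X(1)[of n] S prod.remove[OF S(1) x, of "\<lambda>y. sgn (gf \<omega> y)"] by simp
    moreover have "sgn (gf \<omega> x) * (sgn (gf \<omega> x) * u) = u" for u
      using elim x by (simp add: sgn_if)
    ultimately show ?case by (simp only:)
  qed
qed (auto simp: abs_prod_sgn_le)

text \<open>With base point \<open>X n\<close> the sign there is that of the normal variable. As
  \<open>X n\<close> tends to -1, \<open>cofac\<close> tends to 0 and \<open>blaschke\<close> to 1,
  so the other signs lose their dependence on this variable, whose sign has mean 0.\<close>

lemma F_boundary:
  assumes S: "finite S" "S \<subseteq> {-1<..<1}"
    and X: "\<And>n. X n \<in> {-1<..<1} - S" "X \<longlonglongrightarrow> -1"
  shows "(\<lambda>n. F (insert (X n) S)) \<longlonglongrightarrow> 0"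
proof -
  define Q where "Q n \<xi> \<omega> = (\<Prod>y\<in>S. sgn (\<xi> * cofac (X n) y + blaschke (X n) y * gf \<omega> y))" for n \<xi> \<omega>
  define V where "V n \<omega> = (\<integral>\<xi>. sgn \<xi> * Q n \<xi> \<omega> \<partial>std_normal_distribution)" for n \<omega>
  have b: "\<bar>sgn \<xi> * Q n \<xi> \<omega>\<bar> \<le> 1" for n \<xi> \<omega>
  proof -
    have "\<bar>sgn \<xi>\<bar> * \<bar>Q n \<xi> \<omega>\<bar> \<le> 1 * 1"
      unfolding Q_def by (intro mult_mono abs_prod_sgn_le) (auto simp: sgn_if)
    then show ?thesis by (simp add: abs_mult)
  qed
  have FV: "F (insert (X n) S) = (\<integral>\<omega>. V n \<omega> \<partial>M)" for n
  proof -
    have Xn: "X n \<in> {-1<..<1}" "X n \<notin> S" using X(1)[of n] by auto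
    have s: "sgn (\<xi> * cofac (X n) (X n)) = sgn \<xi>" for \<xi>
      using cofac_pos[OF Xn(1) Xn(1)] by (simp add: sgn_mult)
    have "F (insert (X n) S) = (\<integral>p. sgn (fst p) * Q n (fst p) (snd p) \<partial>(std_normal_distribution \<Otimes>\<^sub>M M))"
      unfolding F_def using transfer_prod(1)[of "insert (X n) S" "X n" "\<lambda>_. sgn"] S Xn by (simp add: Q_def s)
    also have "\<dots> = (\<integral>\<omega>. V n \<omega> \<partial>M)"
      unfolding V_def
      by (subst fubini_normal) (use b in \<open>auto intro!: NM.P.integrable_const_bound[of _ 1] simp: Q_def\<close>)
    finally show ?thesis .
  qed
  have odd: "(\<integral>\<xi>. sgn \<xi> \<partial>std_normal_distribution) = 0"
  proof -
    have "(\<integral>\<xi>. sgn \<xi> \<partial>std_normal_distribution) = (\<integral>\<xi>. std_normal_density \<xi> * sgn \<xi> \<partial>lborel)"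
      by (subst integral_density) auto
    moreover have "(\<integral>\<xi>. std_normal_density \<xi> * sgn \<xi> \<partial>lborel) = - (\<integral>\<xi>. std_normal_density \<xi> * sgn \<xi> \<partial>lborel)"
      using lborel_integral_real_affine[of "-1" "\<lambda>\<xi>. std_normal_density \<xi> * sgn \<xi>" 0]
      by (simp add: normal_density_def sgn_minus)
    ultimately show ?thesis by simp
  qed
  have "(\<lambda>n. \<integral>\<omega>. V n \<omega> \<partial>M) \<longlonglongrightarrow> (\<integral>\<omega>. 0 \<partial>M)"
  proof (rule integral_dominated_convergence[where w = "\<lambda>_. 1"])
    show "AE \<omega> in M. (\<lambda>n. V n \<omega>) \<longlonglongrightarrow> 0"
      using AE_good_nonzero[OF S]
    proof eventually_elim
      case (elim \<omega>)
      have "(\<lambda>n. V n \<omega>) \<longlonglongrightarrow> (\<integral>\<xi>. sgn \<xi> * (\<Prod>y\<in>S. sgn (gf \<omega> y)) \<partial>std_normal_distribution)"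
        unfolding V_def
      proof (rule integral_dominated_convergence[where w = "\<lambda>_. 1"])
        show "AE \<xi> in std_normal_distribution. (\<lambda>n. sgn \<xi> * Q n \<xi> \<omega>) \<longlonglongrightarrow> sgn \<xi> * (\<Prod>y\<in>S. sgn (gf \<omega> y))"
        proof (rule AE_I2)
          fix \<xi>
          have "(\<lambda>n. \<xi> * cofac (X n) y + blaschke (X n) y * gf \<omega> y) \<longlonglongrightarrow> gf \<omega> y" if y: "y \<in> S" for y
          proof -
            have y': "-1 < y" using y S by auto
            have "(\<lambda>n. \<xi> * cofac (X n) y + blaschke (X n) y * gf \<omega> y) \<longlonglongrightarrow>
               \<xi> * (sqrt (1 - (-1)\<^sup>2) / (1 - (-1) * y)) + (y - (-1)) / (1 - (-1) * y) * gf \<omega> y"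
              unfolding cofac_def blaschke_def using y' by (intro tendsto_intros X(2)) auto
            then show ?thesis using y' by (simp add: add.commute)
          qed
          then show "(\<lambda>n. sgn \<xi> * Q n \<xi> \<omega>) \<longlonglongrightarrow> sgn \<xi> * (\<Prod>y\<in>S. sgn (gf \<omega> y))"
            unfolding Q_def using elim by (intro tendsto_mult tendsto_const tendsto_prod tendsto_sgn) auto
        qed
        show "AE \<xi> in std_normal_distribution. norm (sgn \<xi> * Q n \<xi> \<omega>) \<le> 1" for n
          using b by (intro AE_I2) simp
      qed (auto simp: Q_def)
      then show ?case by (simp add: odd)
    qed
    show "AE \<omega> in M. norm (V n \<omega>) \<le> 1" for n
    proof (rule AE_I2)
      fix \<omega>
      have "norm (V n \<omega>) \<le> (\<integral>\<xi>. 1 \<partial>std_normal_distribution)"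
        unfolding V_def
        by (rule Bochner_Integration.integral_norm_bound_integral)
           (use b in \<open>auto intro!: N.integrable_const_bound[of _ 1] simp: Q_def\<close>)
      then show "norm (V n \<omega>) \<le> 1" by (simp add: N.prob_space[simplified])
    qed
    show "V n \<in> borel_measurable M" for n unfolding V_def[abs_def] Q_def by measurable
  qed auto
  then show ?thesis unfolding FV by simp
qed

text \<open>Both sides are compared as functions of the first point \<open>z\<close>. Off the other
  points they have the same derivative by \<open>DERIV_F\<close>, \<open>DERIV_k22\<close> and
  induction; at the other points their difference \<open>D\<close> is continuous; towards -1 it
  tends to 0. Lists of odd length are included, with value 0.\<close>

theorem sign_correlation:
  assumes "distinct xs" "set xs \<subseteq> {-1<..<1}"
  shows "dsgn xs * F (set xs) = pfl AA xs"
  using assms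
proof (induction "length xs" arbitrary: xs rule: less_induct)
  case less
  show ?case
  proof (cases xs)
    case Nil then show ?thesis by simp
  next
    case (Cons x zs)
    define S where "S = set zs"
    have S: "finite S" "S \<subseteq> {-1<..<1}" and x: "x \<in> {-1<..<1}" "x \<notin> S" and dz: "distinct zs"
      using less.prems by (auto simp: Cons S_def)
    define N where "N = length zs"
    define pk where "pk j = pfl AA (del j zs)" for j
    define D where "D z = dsgn (z # zs) * F (insert z S) - pfl AA (z # zs)" for z
    have zj: "zs ! j \<in> S" if "j < N" for j using that by (simp add: S_def N_def)
    have IH: "dsgn (del j zs) * F (S - {zs ! j}) = pk j" if j: "j < N" for j
    proof -
      have s: "set (del j zs) = S - {zs ! j}" using set_del[OF dz, of j] j by (simp add: N_def S_def)
      have "dsgn (del j zs) * F (set (del j zs)) = pfl AA (del j zs)"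
      proof (rule less.hyps)
        show "set (del j zs) \<subseteq> {-1<..<1}" unfolding s using S(2) by blast
      qed (use j dz in \<open>auto simp: Cons N_def distinct_del\<close>)
      then show ?thesis by (simp only: s pk_def)
    qed
    \<comment> \<open>The sign of the deletion turns the correlations in \<open>DERIV_F\<close> into
      the cofactors of the expansion along the first row.\<close>
    have key: "dsgn zs * (\<Prod>y\<in>S - {zs ! j}. sgn (y - zs ! j)) * F (S - {zs ! j}) = (-1) ^ j * pk j" if j: "j < N" for j
    proof -
      have "dsgn zs = (-1) ^ j * (\<Prod>y\<in>S - {zs ! j}. sgn (y - zs ! j)) * dsgn (del j zs)"
        using dsgn_del[OF dz, of j] j by (simp add: S_def N_def)
      then have "dsgn zs * (\<Prod>y\<in>S - {zs ! j}. sgn (y - zs ! j)) * F (S - {zs ! j}) =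
        (-1) ^ j * ((\<Prod>y\<in>S - {zs ! j}. sgn (y - zs ! j)) * (\<Prod>y\<in>S - {zs ! j}. sgn (y - zs ! j))) * (dsgn (del j zs) * F (S - {zs ! j}))"
        by simp
      then show ?thesis using prod_sgn_square[of "S - {zs ! j}" "zs ! j"] S IH[OF j] by simp
    qed
    have pfl_z: "pfl AA (z # zs) = (\<Sum>j<N. (-1) ^ j * AA z (zs ! j) * pk j)" for z
      by (simp add: N_def pk_def)
    have deriv: "(D has_real_derivative 0) (at z)" if z: "z \<in> {-1<..<1} - S" for z
    proof -
      define P where "P = (\<Prod>y\<in>S. sgn (y - z))"
      have z': "z \<in> {-1<..<1}" "z \<notin> S" using z by auto
      have "((\<lambda>w. (P * dsgn zs) * F (insert w S)) has_real_derivative (P * dsgn zs) *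
         (\<Sum>k\<in>S. 2 / pi * k12 z k * (\<Prod>y\<in>S. sgn (y - z)) * (\<Prod>y\<in>S - {k}. sgn (y - k)) * F (S - {k}))) (at z)"
        by (intro DERIV_cmult DERIV_F S z')
      also have "(P * dsgn zs) * (\<Sum>k\<in>S. 2 / pi * k12 z k * (\<Prod>y\<in>S. sgn (y - z)) * (\<Prod>y\<in>S - {k}. sgn (y - k)) * F (S - {k}))
         = (\<Sum>k\<in>S. (P * P) * (2 / pi * k12 z k) * (dsgn zs * (\<Prod>y\<in>S - {k}. sgn (y - k)) * F (S - {k})))"
        unfolding sum_distrib_left P_def by (intro sum.cong refl) (simp only: mult_ac)
      also have "P * P = 1" unfolding P_def by (rule prod_sgn_square[OF S(1) z'(2)])
      also have "(\<Sum>k\<in>S. 1 * (2 / pi * k12 z k) * (dsgn zs * (\<Prod>y\<in>S - {k}. sgn (y - k)) * F (S - {k})))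
        = (\<Sum>j<N. 1 * (2 / pi * k12 z (zs ! j)) * (dsgn zs * (\<Prod>y\<in>S - {zs ! j}. sgn (y - zs ! j)) * F (S - {zs ! j})))"
        by (rule sum.reindex_bij_betw[symmetric]) (rule bij_betw_nth[OF dz], auto simp: N_def S_def)
      also have "\<dots> = (\<Sum>j<N. (-1) ^ j * (2 / pi * k12 z (zs ! j)) * pk j)"
        by (intro sum.cong refl) (use key in \<open>simp add: mult_ac\<close>)
      finally have 1: "((\<lambda>w. (P * dsgn zs) * F (insert w S)) has_real_derivative (\<Sum>j<N. (-1) ^ j * (2 / pi * k12 z (zs ! j)) * pk j)) (at z)" .
      have 2: "((\<lambda>w. \<Sum>j<N. (-1) ^ j * AA w (zs ! j) * pk j) has_real_derivative (\<Sum>j<N. (-1) ^ j * (2 / pi * k12 z (zs ! j)) * pk j)) (at z)"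
      proof (intro DERIV_sum DERIV_cmult_right DERIV_cmult)
        fix j assume "j \<in> {..<N}"
        then have "zs ! j \<in> {-1<..<1}" "z \<noteq> zs ! j" using zj[of j] S z' by auto
        then show "((\<lambda>w. AA w (zs ! j)) has_real_derivative 2 / pi * k12 z (zs ! j)) (at z)"
          unfolding AA_def by (intro DERIV_cmult DERIV_k22 z')
      qed
      have "eventually (\<lambda>w. \<forall>y\<in>S. sgn (y - w) = sgn (y - z)) (nhds z)"
        using S z' by (intro eventually_ball_finite ballI eventually_sgn_eq) auto
      then have ev: "eventually (\<lambda>w. D w = (P * dsgn zs) * F (insert w S) - (\<Sum>j<N. (-1) ^ j * AA w (zs ! j) * pk j)) (nhds z)"
        by eventually_elim (simp add: D_def P_def pfl_z S_def del: pfl.simps cong: prod.cong)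
      show ?thesis
        using DERIV_diff[OF 1 2] DERIV_cong_ev[OF refl ev refl, of 0] by simp
    qed
    \<comment> \<open>At \<open>z0\<close> only the factor \<open>sgn (z0 - z)\<close> jumps, and
      what it multiplies, \<open>Br\<close>, tends to 0: the collapse of \<open>F\<close> is matched
      by \<open>2 / pi * arcsin 1 = 1\<close>.\<close>
    have cont: "isCont D z0" if z0: "z0 \<in> S" for z0
    proof -
      obtain k where k: "k < N" "zs ! k = z0" using z0 by (auto simp: S_def N_def in_set_conv_nth)
      have z01: "z0 \<in> {-1<..<1}" using z0 S by auto
      define U where "U = {-1<..<1} - (S - {z0})"
      have U: "open U" "z0 \<in> U" unfolding U_def using S z01 by (auto intro!: open_Diff finite_imp_closed)
      define R where "R z = (\<Sum>j\<in>{..<N} - {k}. (-1) ^ j * AA z (zs ! j) * pk j)" for z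
      define Br where "Br z = (\<Prod>y\<in>S - {z0}. sgn (y - z)) * dsgn zs * F (insert z S) - (-1) ^ k * (2 / pi * arcsin (c_fun z z0)) * pk k" for z
      have Dz: "D z = sgn (z0 - z) * Br z - R z" for z
      proof -
        have "(\<Sum>j<N. (-1) ^ j * AA z (zs ! j) * pk j) = (-1) ^ k * AA z z0 * pk k + R z"
          unfolding R_def using k by (subst sum.remove[of _ k]) auto
        moreover have "(\<Prod>y\<in>S. sgn (y - z)) = sgn (z0 - z) * (\<Prod>y\<in>S - {z0}. sgn (y - z))"
          by (rule prod.remove[OF S(1) z0])
        ultimately show ?thesis
          by (simp add: D_def pfl_z Br_def AA_def k22_def S_def[symmetric] algebra_simps del: pfl.simps)
      qed
      have "(D \<longlongrightarrow> D z0) (at z0 within U)"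
        unfolding tendsto_at_iff_sequentially
      proof (intro allI impI)
        fix X :: "nat \<Rightarrow> real" assume X: "\<forall>i. X i \<in> U - {z0}" "X \<longlonglongrightarrow> z0"
        have XS: "X n \<in> {-1<..<1} - S" for n using X by (auto simp: U_def)
        have "(\<lambda>n. Br (X n)) \<longlonglongrightarrow> (\<Prod>y\<in>S - {z0}. sgn (y - z0)) * dsgn zs * F (S - {z0}) - (-1) ^ k * (2 / pi * arcsin (c_fun z0 z0)) * pk k"
          unfolding Br_def using XS z01
          by (intro tendsto_intros F_collapse[OF S z0 XS] X(2) tendsto_arcsin_c[OF X(2) tendsto_const]) auto
        also have "(\<Prod>y\<in>S - {z0}. sgn (y - z0)) * dsgn zs * F (S - {z0}) - (-1) ^ k * (2 / pi * arcsin (c_fun z0 z0)) * pk k = 0"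
          using key[OF k(1)] by (simp add: k(2) c_fun_self[OF z01] mult_ac)
        finally have Br0: "(\<lambda>n. Br (X n)) \<longlonglongrightarrow> 0" .
        have "(\<lambda>n. sgn (z0 - X n) * Br (X n)) \<longlonglongrightarrow> 0"
          by (rule Lim_null_comparison[OF _ tendsto_norm_zero[OF Br0]]) (auto simp: abs_mult sgn_if)
        moreover have "(\<lambda>n. R (X n)) \<longlonglongrightarrow> R z0"
          unfolding R_def AA_def
        proof (intro tendsto_intros tendsto_k22[OF X(2) tendsto_const])
          fix j assume j: "j \<in> {..<N} - {k}"
          then show "z0 \<noteq> zs ! j" using k dz by (auto simp: N_def nth_eq_iff_index_eq)
          show "zs ! j \<in> {-1<..<1}" using j zj[of j] S by auto
        qed (rule z01)
        ultimately have "(\<lambda>n. D (X n)) \<longlonglongrightarrow> 0 - R z0" unfolding Dz by (intro tendsto_diff)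
        then show "(D \<circ> X) \<longlonglongrightarrow> D z0" by (simp add: o_def Dz[of z0])
      qed
      then show ?thesis using at_within_open[OF U(2,1)] by (simp add: isCont_def)
    qed
    \<comment> \<open>The points of \<open>S\<close> form a finite exceptional set, at which
      continuity is enough.\<close>
    have const: "D z = D x" if z: "z \<in> {-1<..<1}" for z
    proof (rule has_derivative_zero_unique_strong_connected[of "{-1<..<1}" S D x])
      show "continuous_on {-1<..<1} D"
        unfolding continuous_on_eq_continuous_at[OF open_greaterThanLessThan]
        using cont deriv DERIV_isCont by blast
      show "(D has_derivative (\<lambda>h. 0)) (at z within {-1<..<1})" if "z \<in> {-1<..<1} - S" for z
      proof -
        have "(*) 0 = (\<lambda>h::real. 0)" by auto
        then show ?thesis
          using has_derivative_at_withinI[OF deriv[OF that, unfolded has_field_derivative_def]] by simp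
      qed
    qed (use S x z in auto)
    \<comment> \<open>At most half the distance from -1 to any point of \<open>S\<close>, so the
      sequence \<open>X\<close> below avoids \<open>S\<close>.\<close>
    define \<epsilon> where "\<epsilon> = Min (insert 1 ((\<lambda>y. (y + 1) / 2) ` S))"
    have \<epsilon>3: "\<epsilon> \<le> (y + 1) / 2" if "y \<in> S" for y
      unfolding \<epsilon>_def using S that by (intro Min_le) auto
    have \<epsilon>: "0 < \<epsilon>" "\<epsilon> \<le> 1"
      unfolding \<epsilon>_def using S by (auto simp: Min_gr_iff)
    define X where "X n = -1 + \<epsilon> / real (Suc n)" for n
    have Xle: "0 < \<epsilon> / real (Suc n)" "\<epsilon> / real (Suc n) \<le> \<epsilon>" for n
      using \<epsilon>(1) by (auto simp: field_simps)
    have XS: "X n \<in> {-1<..<1} - S" for n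
    proof -
      have "X n \<notin> S"
      proof
        assume a: "X n \<in> S"
        then have "-1 < X n" using S by auto
        moreover have "2 * \<epsilon> \<le> X n + 1" using \<epsilon>3[OF a] by simp
        moreover have "X n + 1 \<le> \<epsilon>" using Xle(2)[of n] by (simp add: X_def)
        ultimately show False using \<epsilon>(1) by linarith
      qed
      then show ?thesis using Xle[of n] \<epsilon> by (auto simp: X_def)
    qed
    have X: "X \<longlonglongrightarrow> -1"
    proof -
      have "(\<lambda>n. \<epsilon> / real (Suc n)) \<longlonglongrightarrow> 0" by (rule LIMSEQ_Suc[OF lim_const_over_n])
      from tendsto_add[OF tendsto_const this, of "-1"] show ?thesis unfolding X_def[abs_def] by simp
    qed
    have "(\<lambda>n. D (X n)) \<longlonglongrightarrow> 0"
    proof -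
      have bd: "\<bar>dsgn (z # zs)\<bar> \<le> 1" for z
      proof -
        have "\<bar>dsgn ys\<bar> \<le> 1" for ys
          by (induction ys) (auto simp: abs_mult intro!: mult_le_one abs_prod_sgn_le)
        then show ?thesis .
      qed
      have "(\<lambda>n. dsgn (X n # zs) * F (insert (X n) S)) \<longlonglongrightarrow> 0"
      proof (rule Lim_null_comparison[OF _ tendsto_norm_zero[OF F_boundary[OF S XS X]]])
        show "eventually (\<lambda>n. norm (dsgn (X n # zs) * F (insert (X n) S)) \<le> norm (F (insert (X n) S))) sequentially"
          unfolding real_norm_def abs_mult using bd by (intro always_eventually allI mult_left_le_one_le) auto
      qed
      moreover have "(\<lambda>n. \<Sum>j<N. (-1) ^ j * AA (X n) (zs ! j) * pk j) \<longlonglongrightarrow> (\<Sum>j<N. (-1) ^ j * 0 * pk j)"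
      proof (intro tendsto_sum tendsto_mult tendsto_const)
        fix j assume j: "j \<in> {..<N}"
        have z: "zs ! j \<in> {-1<..<1}" using j zj[of j] S by auto
        have "(\<lambda>n. arcsin (c_fun (X n) (zs ! j))) \<longlonglongrightarrow> arcsin (c_fun (-1) (zs ! j))"
          using XS z by (intro tendsto_arcsin_c X tendsto_const) auto
        then have a0: "(\<lambda>n. arcsin (c_fun (X n) (zs ! j))) \<longlonglongrightarrow> 0" by (simp add: c_fun_alt)
        have "(\<lambda>n. k22 (X n) (zs ! j)) \<longlonglongrightarrow> 0"
          unfolding k22_def
          by (rule Lim_null_comparison[OF _ tendsto_norm_zero[OF a0]]) (auto simp: abs_mult sgn_if)
        from tendsto_mult_right_zero[OF this, of "2 / pi"] show "(\<lambda>n. AA (X n) (zs ! j)) \<longlonglongrightarrow> 0"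
          unfolding AA_def by simp
      qed
      ultimately have "(\<lambda>n. D (X n)) \<longlonglongrightarrow> 0 - (\<Sum>j<N. (-1) ^ j * 0 * pk j)"
        unfolding D_def pfl_z by (intro tendsto_diff)
      then show ?thesis by simp
    qed
    moreover have "(\<lambda>n. D (X n)) = (\<lambda>n. D x)" using const XS by auto
    ultimately have "D x = 0" using LIMSEQ_unique[OF tendsto_const] by metis
    then show ?thesis by (simp add: D_def Cons S_def del: pfl.simps)
  qed
qed

end

section \<open>Sign changes in small boxes\<close>

lemma pfl_scale: "length xs = 2 * m \<Longrightarrow> pfl (\<lambda>p q. c * b p q) xs = c ^ m * pfl b xs"
proof (induction m arbitrary: xs)
  case (Suc m)
  then obtain x zs where xs: "xs = x # zs" by (cases xs) auto
  have "pfl (\<lambda>p q. c * b p q) (del k zs) = c ^ m * pfl b (del k zs)" if "k < length zs" for k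
    using that Suc.prems by (intro Suc.IH) (auto simp: xs)
  then show ?case by (simp add: xs sum_distrib_left mult_ac cong: sum.cong_simp)
qed simp

text \<open>Two rows per cell, in the order of the blocks of the kernel matrix; the flag
  \<open>True\<close> marks the first row of a block.\<close>

definition pf_rows :: "nat \<Rightarrow> (nat \<times> bool) list" where
  "pf_rows n = concat (map (\<lambda>i. [(i, True), (i, False)]) [1..<n + 1])"

lemma set_rows: "set (pf_rows n) = {1..n} \<times> UNIV"
  by (auto simp: pf_rows_def UNIV_bool)

lemma length_rows: "length (pf_rows n) = 2 * n"
  by (induction n) (auto simp: pf_rows_def)

lemma distinct_rows: "distinct (pf_rows n)"
proof -
  have "card (set (pf_rows n)) = length (pf_rows n)"
    unfolding set_rows by (simp add: length_rows card_cartesian_product card_UNIV_bool)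
  then show ?thesis by (rule card_distinct)
qed

definition pt :: "(nat \<Rightarrow> real) \<Rightarrow> (nat \<Rightarrow> real) \<Rightarrow> nat \<times> bool \<Rightarrow> real" where
  "pt e u p = (if snd p then e (fst p) else u (fst p))"

text \<open>The sign of the difference of the two points as far as the order of the cells dictates
  it. Within a cell the moving point counts as lying to the left of the endpoint even where the two
  coincide.\<close>

definition psign :: "(nat \<Rightarrow> nat \<Rightarrow> real) \<Rightarrow> nat \<times> bool \<Rightarrow> nat \<times> bool \<Rightarrow> real" where
  "psign \<sigma> p q = (if fst p = fst q then (if snd p \<and> \<not> snd q then 1 else if \<not> snd p \<and> snd q then -1 else 0)
     else \<sigma> (fst p) (fst q))"

text \<open>Row \<open>(i, True)\<close> belongs to the moving point \<open>e i\<close> and is differentiated if \<open>i \<in> D\<close>; row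
  \<open>(i, False)\<close> belongs to the fixed right endpoint \<open>u i\<close>. The signs are prescribed
  by the order of the cells, so that all entries stay continuous up to the endpoints.\<close>

definition ent :: "(nat \<Rightarrow> nat \<Rightarrow> real) \<Rightarrow> nat set \<Rightarrow> (nat \<Rightarrow> real) \<Rightarrow> (nat \<Rightarrow> real) \<Rightarrow> nat \<times> bool \<Rightarrow> nat \<times> bool \<Rightarrow> real" where
  "ent \<sigma> D e u p q =
    (if snd p \<and> fst p \<in> D then
       (if snd q \<and> fst q \<in> D then k11 (pt e u p) (pt e u q) else k12 (pt e u p) (pt e u q))
     else if snd q \<and> fst q \<in> D then - k12 (pt e u q) (pt e u p)
     else psign \<sigma> p q * arcsin (c_fun (pt e u p) (pt e u q)))"

text \<open>No entry jumps: the signs are constants and the arcsine is continuous even on the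
  diagonal, so the limits may have coincident points.\<close>

lemma tendsto_pfl_ent:
  assumes e: "\<And>k. k \<in> {1..n} \<Longrightarrow> ((\<lambda>x. e x k) \<longlongrightarrow> e' k) Fl" and u: "\<And>k. k \<in> {1..n} \<Longrightarrow> ((\<lambda>x. u x k) \<longlongrightarrow> u' k) Fl"
    and eu: "\<And>k. k \<in> {1..n} \<Longrightarrow> e' k \<in> {-1<..<1} \<and> u' k \<in> {-1<..<1}"
  shows "((\<lambda>x. pfl (ent \<sigma> D (e x) (u x)) (pf_rows n)) \<longlongrightarrow> pfl (ent \<sigma> D e' u') (pf_rows n)) Fl"
proof (rule tendsto_pfl[OF _ distinct_rows])
  fix p q assume pq: "p \<in> set (pf_rows n)" "q \<in> set (pf_rows n)"
  have P: "((\<lambda>x. pt (e x) (u x) p) \<longlongrightarrow> pt e' u' p) Fl \<and> pt e' u' p \<in> {-1<..<1}" if "p \<in> set (pf_rows n)" for p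
    using that e u eu by (auto simp: set_rows pt_def mem_Times_iff)
  note P1 = P[OF pq(1)] P[OF pq(2)]
  have ev: "eventually (\<lambda>x. pt (e x) (u x) p \<in> {-1<..<1} \<and> pt (e x) (u x) q \<in> {-1<..<1}) Fl"
    using P1 by (intro eventually_conj topological_tendstoD[of _ "pt e' u' p" Fl] topological_tendstoD[of _ "pt e' u' q" Fl]) auto
  have A: "((\<lambda>x. arcsin (c_fun (pt (e x) (u x) p) (pt (e x) (u x) q))) \<longlongrightarrow> arcsin (c_fun (pt e' u' p) (pt e' u' q))) Fl"
    using P1 ev by (intro tendsto_arcsin_c) auto
  show "((\<lambda>x. ent \<sigma> D (e x) (u x) p q) \<longlongrightarrow> ent \<sigma> D e' u' p q) Fl"
    unfolding ent_def using P1
    by (cases "snd p \<and> fst p \<in> D"; cases "snd q \<and> fst q \<in> D")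
       (auto intro!: tendsto_k11 tendsto_k12 tendsto_minus tendsto_mult tendsto_const A)
qed

section \<open>Mixed differences of Pfaffians over disjoint cells\<close>

locale cells =
  fixes n :: nat and t u :: "nat \<Rightarrow> real" and \<sigma> :: "nat \<Rightarrow> nat \<Rightarrow> real"
  assumes cell: "\<And>i. i \<in> {1..n} \<Longrightarrow> -1 < t i \<and> t i < u i \<and> u i < 1"
    and order: "\<And>i j. i \<in> {1..n} \<Longrightarrow> j \<in> {1..n} \<Longrightarrow> i \<noteq> j \<Longrightarrow> (u i \<le> t j \<and> \<sigma> i j = 1) \<or> (u j \<le> t i \<and> \<sigma> i j = -1)"
begin

text \<open>Cells may touch; the last hypothesis keeps the two points from both sitting at a common
  endpoint.\<close>

lemma sgn_sigma:
  assumes "i \<in> {1..n}" "j \<in> {1..n}" "i \<noteq> j" "t i < x" "x \<le> u i" "t j \<le> y" "y \<le> u j" "x < u i \<or> t j < y"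
  shows "sgn (y - x) = \<sigma> i j"
  using order[OF assms(1-3)] assms(4-) by auto

lemma sigma_skew: "i \<in> {1..n} \<Longrightarrow> j \<in> {1..n} \<Longrightarrow> i \<noteq> j \<Longrightarrow> \<sigma> j i = - \<sigma> i j"
  using order[of i j] order[of j i] cell[of i] cell[of j] by auto

text \<open>Only the row and column of \<open>(i, True)\<close> move. Against an undifferentiated
  row the arcsine becomes \<open>k12\<close>, the prescribed sign cancelling the one in its
  derivative; against a differentiated row \<open>k12\<close> becomes \<open>k11\<close>.\<close>

lemma DERIV_pfl_ent:
  assumes i: "i \<in> {1..n}" "i \<notin> D" and D: "D \<subseteq> {1..n}"
    and e: "\<And>k. k \<in> {1..n} \<Longrightarrow> t k \<le> e k \<and> e k \<le> u k" "\<And>k. k \<in> D \<Longrightarrow> t k < e k \<and> e k < u k"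
    and v: "t i < v" "v < u i"
  shows "((\<lambda>v. pfl (ent \<sigma> D (e(i := v)) u) (pf_rows n)) has_real_derivative pfl (ent \<sigma> (insert i D) (e(i := v)) u) (pf_rows n)) (at v)"
proof (rule DERIV_pfl[OF distinct_rows])
  let ?r = "(i, True)"
  show "?r \<in> set (pf_rows n)" using i by (simp add: set_rows)
  have v1: "v \<in> {-1<..<1}" using v cell[OF i(1)] by auto
  fix q assume q: "q \<in> set (pf_rows n)" "q \<noteq> ?r"
  obtain k b where kb: "q = (k, b)" by (cases q)
  have k: "k \<in> {1..n}" using q by (auto simp: kb set_rows)
  define y where "y = (if b then e k else u k)"
  have pq: "pt (e(i := w)) u q = y" for w using q by (auto simp: pt_def kb y_def)
  have pr: "pt (e(i := w)) u ?r = w" for w by (simp add: pt_def)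
  have y: "t k \<le> y" "y \<le> u k" using e(1)[OF k] cell[OF k] by (auto simp: y_def)
  then have y1: "y \<in> {-1<..<1}" using cell[OF k] by auto
  have sg: "psign \<sigma> ?r q = sgn (y - v) \<and> psign \<sigma> q ?r = - sgn (y - v) \<and> v \<noteq> y"
  proof (cases "k = i")
    case True
    then have "\<not> b" using q kb by auto
    then show ?thesis using True v by (simp add: psign_def kb y_def)
  next
    case False
    have "sgn (y - v) = \<sigma> i k" using y v k i False by (intro sgn_sigma) auto
    moreover have "v \<noteq> y" using order[OF i(1) k] False v y by auto
    ultimately show ?thesis using sigma_skew[OF i(1) k] False by (auto simp: psign_def kb)
  qed
  have as: "((\<lambda>w. arcsin (c_fun w y)) has_real_derivative sgn (y - v) * k12 v y) (at v)"
    using sg by (intro DERIV_arcsin_c v1 y1) simp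
  have ss: "sgn (y - v) * sgn (y - v) = 1" using sg by (auto simp: sgn_if)
  have qD: "(snd q \<and> fst q \<in> insert i D) = (snd q \<and> fst q \<in> D)" using q by (auto simp: kb)
  show "((\<lambda>w. ent \<sigma> D (e(i := w)) u ?r q) has_real_derivative ent \<sigma> (insert i D) (e(i := v)) u ?r q) (at v)"
  proof (cases "snd q \<and> fst q \<in> D")
    case True
    have "ent \<sigma> D (e(i := w)) u ?r q = - k12 y w" for w
      using True i(2) unfolding ent_def pq pr by simp
    moreover have "ent \<sigma> (insert i D) (e(i := v)) u ?r q = k11 v y"
      using True qD unfolding ent_def pq pr by simp
    moreover have "((\<lambda>w. - k12 y w) has_real_derivative - k11 y v) (at v)"
      by (intro DERIV_minus DERIV_k12 v1 y1)
    ultimately show ?thesis using k11_skew[of v y] by simp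
  next
    case False
    have "ent \<sigma> D (e(i := w)) u ?r q = sgn (y - v) * arcsin (c_fun w y)" for w
      using False i(2) sg unfolding ent_def pq pr by auto
    moreover have "ent \<sigma> (insert i D) (e(i := v)) u ?r q = k12 v y"
      using False qD unfolding ent_def pq pr by auto
    moreover have "((\<lambda>w. sgn (y - v) * arcsin (c_fun w y)) has_real_derivative sgn (y - v) * (sgn (y - v) * k12 v y)) (at v)"
      by (intro DERIV_cmult as)
    ultimately show ?thesis using ss by (simp add: mult.assoc[symmetric])
  qed
  show "((\<lambda>w. ent \<sigma> D (e(i := w)) u q ?r) has_real_derivative ent \<sigma> (insert i D) (e(i := v)) u q ?r) (at v)"
  proof (cases "snd q \<and> fst q \<in> D")
    case True
    have "ent \<sigma> D (e(i := w)) u q ?r = k12 y w" for w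
      using True i(2) unfolding ent_def pq pr by simp
    moreover have "ent \<sigma> (insert i D) (e(i := v)) u q ?r = k11 y v"
      using True qD unfolding ent_def pq pr by simp
    ultimately show ?thesis using DERIV_k12[OF y1 v1] by simp
  next
    case False
    have "ent \<sigma> D (e(i := w)) u q ?r = - sgn (y - v) * arcsin (c_fun w y)" for w
      using False i(2) sg unfolding ent_def pq pr by (auto simp: c_fun_sym[of y])
    moreover have "ent \<sigma> (insert i D) (e(i := v)) u q ?r = - k12 v y"
      using False qD unfolding ent_def pq pr by auto
    moreover have "((\<lambda>w. - sgn (y - v) * arcsin (c_fun w y)) has_real_derivative - sgn (y - v) * (sgn (y - v) * k12 v y)) (at v)"
      by (intro DERIV_cmult as)
    moreover have "- sgn (y - v) * (sgn (y - v) * k12 v y) = - k12 v y"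
      using ss by (simp add: mult.assoc[symmetric])
    ultimately show ?thesis by (simp only:)
  qed
next
  fix p q w assume "p \<in> set (pf_rows n)" "q \<in> set (pf_rows n)" "p \<noteq> (i, True)" "q \<noteq> (i, True)" "p \<noteq> q"
  moreover from this have "pt (e(i := w)) u p = pt (e(i := v)) u p" "pt (e(i := w)) u q = pt (e(i := v)) u q"
    by (auto simp: pt_def prod_eq_iff)
  ultimately show "ent \<sigma> D (e(i := w)) u p q = ent \<sigma> (insert i D) (e(i := v)) u p q"
    unfolding ent_def by (auto simp: prod_eq_iff)
qed

lemma tendsto_pfl_ent_upd:
  assumes "\<And>k. k \<in> {1..n} \<Longrightarrow> t k \<le> e k \<and> e k \<le> u k" "t i \<le> v" "v \<le> u i" "i \<in> {1..n}"
  shows "isCont (\<lambda>v. pfl (ent \<sigma> D (e(i := v)) u) (pf_rows n)) v"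
  unfolding isCont_def
proof (rule tendsto_pfl_ent)
  fix k assume k: "k \<in> {1..n}"
  show "((\<lambda>x. (e(i := x)) k) \<longlongrightarrow> (e(i := v)) k) (at v)" by (cases "k = i") auto
  show "(e(i := v)) k \<in> {-1<..<1} \<and> u k \<in> {-1<..<1}"
    using assms(1)[OF k] assms(2,3) cell[OF k] cell[OF assms(4)] by auto
qed auto

text \<open>The mixed difference over a box, that is, the alternating sum of \<open>\<Phi>\<close>
  over the corners in the listed coordinates.\<close>

fun MD :: "nat list \<Rightarrow> ((nat \<Rightarrow> real) \<Rightarrow> real) \<Rightarrow> (nat \<Rightarrow> real) \<Rightarrow> real" where
  "MD [] \<Phi> e = \<Phi> e"
| "MD (i # is) \<Phi> e = MD is \<Phi> (e(i := u i)) - MD is \<Phi> (e(i := t i))"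

lemma MD_cong:
  assumes "\<And>e'. (\<forall>k. k \<notin> set is \<longrightarrow> e' k = e k) \<Longrightarrow> (\<forall>k\<in>set is. e' k = t k \<or> e' k = u k) \<Longrightarrow> \<Phi> e' = \<Psi> e'"
    and "distinct is"
  shows "MD is \<Phi> e = MD is \<Psi> e"
  using assms
proof (induction "is" arbitrary: e)
  case (Cons i "is")
  have "MD is \<Phi> (e(i := w)) = MD is \<Psi> (e(i := w))" if w: "w = t i \<or> w = u i" for w
  proof (rule Cons.IH)
    fix e' assume e': "\<forall>k. k \<notin> set is \<longrightarrow> e' k = (e(i := w)) k" "\<forall>k\<in>set is. e' k = t k \<or> e' k = u k"
    have "i \<notin> set is" using Cons.prems(2) by simp
    then have "e' i = w" using e'(1) by simp
    then show "\<Phi> e' = \<Psi> e'" using e' w by (intro Cons.prems(1)) (auto simp: fun_upd_apply split: if_splits)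
  qed (use Cons.prems in simp)
  then show ?case by simp
qed simp

text \<open>The mean value theorem, one coordinate at a time. Once coordinate \<open>i\<close> has
  been replaced by its derivative at an intermediate point, the remaining mixed difference is of the
  same kind with \<open>i\<close> added to \<open>D\<close>; the generality in \<open>D\<close> and
  \<open>e\<close> serves this induction.\<close>

lemma MD_mean_value:
  assumes "distinct is" "set is \<subseteq> {1..n}" "D \<subseteq> {1..n}" "D \<inter> set is = {}"
    and "\<And>k. k \<in> {1..n} \<Longrightarrow> t k \<le> e k \<and> e k \<le> u k" "\<And>k. k \<in> D \<Longrightarrow> t k < e k \<and> e k < u k"
  shows "\<exists>\<xi>. (\<forall>k\<in>set is. t k < \<xi> k \<and> \<xi> k < u k) \<and> (\<forall>k. k \<notin> set is \<longrightarrow> \<xi> k = e k) \<and>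
     MD is (\<lambda>e. pfl (ent \<sigma> D e u) (pf_rows n)) e = (\<Prod>k\<in>set is. u k - t k) * pfl (ent \<sigma> (D \<union> set is) \<xi> u) (pf_rows n)"
  using assms
proof (induction "is" arbitrary: D e)
  case Nil
  then show ?case by auto
next
  case (Cons i "is")
  let ?\<Phi> = "\<lambda>D e. pfl (ent \<sigma> D e u) (pf_rows n)"
  have i: "i \<in> {1..n}" "i \<notin> D" "i \<notin> set is" and ds: "distinct is" "set is \<subseteq> {1..n}" using Cons.prems by auto
  define \<Psi> where "\<Psi> v = MD is (?\<Phi> D) (e(i := v))" for v
  \<comment> \<open>Differentiation in coordinate \<open>i\<close> commutes with differences in the
    other coordinates.\<close>
  have gen: "((\<lambda>v. MD js (?\<Phi> D) (e(i := v))) has_real_derivative MD js (?\<Phi> (insert i D)) (e(i := v))) (at v)"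
    if "set js \<subseteq> {1..n}" "D \<inter> set js = {}" "i \<notin> set js" "\<And>k. k \<in> {1..n} \<Longrightarrow> t k \<le> e k \<and> e k \<le> u k" "\<And>k. k \<in> D \<Longrightarrow> t k < e k \<and> e k < u k"
      and v: "t i < v" "v < u i" for js e v
    using that(1-5)
  proof (induction js arbitrary: e)
    case Nil
    then show ?case unfolding MD.simps by (intro DERIV_pfl_ent i(1,2) Cons.prems(3) v) auto
  next
    case (Cons j js)
    have ij: "(e(i := v))(j := w) = (e(j := w))(i := v)" for v w using Cons.prems(3) by (auto simp: fun_upd_twist)
    have j: "j \<in> {1..n}" "j \<notin> D" using Cons.prems by auto
    have b: "((\<lambda>v. MD js (?\<Phi> D) ((e(j := w))(i := v))) has_real_derivative MD js (?\<Phi> (insert i D)) ((e(j := w))(i := v))) (at v)"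
      if w: "t j \<le> w" "w \<le> u j" for w
      using Cons.prems w j by (intro Cons.IH) auto
    show ?case unfolding MD.simps ij using cell[OF j(1)] by (intro DERIV_diff b) auto
  qed
  have cgen: "isCont (\<lambda>v. MD js (?\<Phi> D) (e(i := v))) v"
    if "set js \<subseteq> {1..n}" "i \<notin> set js" "\<And>k. k \<in> {1..n} \<Longrightarrow> t k \<le> e k \<and> e k \<le> u k"
      and v: "t i \<le> v" "v \<le> u i" for js e v
    using that(1-3)
  proof (induction js arbitrary: e)
    case Nil
    then show ?case unfolding MD.simps by (intro tendsto_pfl_ent_upd v i(1)) auto
  next
    case (Cons j js)
    have ij: "(e(i := v))(j := w) = (e(j := w))(i := v)" for v w using Cons.prems(2) by (auto simp: fun_upd_twist)
    have j: "j \<in> {1..n}" using Cons.prems by auto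
    have b: "isCont (\<lambda>v. MD js (?\<Phi> D) ((e(j := w))(i := v))) v"
      if w: "t j \<le> w" "w \<le> u j" for w
      using Cons.prems w j by (intro Cons.IH) auto
    show ?case unfolding MD.simps ij using cell[OF j(1)] by (intro continuous_diff b) auto
  qed
  have deriv: "(\<Psi> has_real_derivative MD is (?\<Phi> (insert i D)) (e(i := v))) (at v)" if "t i < v" "v < u i" for v
    unfolding \<Psi>_def using that Cons.prems by (intro gen) auto
  have cont: "continuous_on {t i..u i} \<Psi>"
    unfolding \<Psi>_def using Cons.prems ds i by (intro continuous_at_imp_continuous_on ballI cgen) auto
  obtain l z where z: "t i < z" "z < u i" "(\<Psi> has_real_derivative l) (at z)" "\<Psi> (u i) - \<Psi> (t i) = (u i - t i) * l"
    using MVT[OF _ cont] cell[OF i(1)] deriv real_differentiable_def by metis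
  have l: "l = MD is (?\<Phi> (insert i D)) (e(i := z))" using DERIV_unique[OF z(3) deriv[OF z(1,2)]] .
  have "\<exists>\<xi>. (\<forall>k\<in>set is. t k < \<xi> k \<and> \<xi> k < u k) \<and> (\<forall>k. k \<notin> set is \<longrightarrow> \<xi> k = (e(i := z)) k) \<and>
     MD is (?\<Phi> (insert i D)) (e(i := z)) = (\<Prod>k\<in>set is. u k - t k) * pfl (ent \<sigma> (insert i D \<union> set is) \<xi> u) (pf_rows n)"
    using Cons.prems i z by (intro Cons.IH) auto
  then obtain \<xi> where \<xi>: "\<forall>k\<in>set is. t k < \<xi> k \<and> \<xi> k < u k" "\<forall>k. k \<notin> set is \<longrightarrow> \<xi> k = (e(i := z)) k"
     "MD is (?\<Phi> (insert i D)) (e(i := z)) = (\<Prod>k\<in>set is. u k - t k) * pfl (ent \<sigma> (insert i D \<union> set is) \<xi> u) (pf_rows n)" by blast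
  show ?case
  proof (intro exI conjI)
    show "\<forall>k\<in>set (i # is). t k < \<xi> k \<and> \<xi> k < u k" using \<xi>(1,2) i z by auto
    show "\<forall>k. k \<notin> set (i # is) \<longrightarrow> \<xi> k = e k" using \<xi>(2) by auto
    have "MD (i # is) (?\<Phi> D) e = \<Psi> (u i) - \<Psi> (t i)" by (simp add: \<Psi>_def)
    also have "\<dots> = (u i - t i) * ((\<Prod>k\<in>set is. u k - t k) * pfl (ent \<sigma> (insert i D \<union> set is) \<xi> u) (pf_rows n))"
      using z(4) l \<xi>(3) by simp
    finally show "MD (i # is) (?\<Phi> D) e = (\<Prod>k\<in>set (i # is). u k - t k) * pfl (ent \<sigma> (D \<union> set (i # is)) \<xi> u) (pf_rows n)"
      using i(3) by simp
  qed
qed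

end

section \<open>Expected sign changes in a family of cells\<close>

locale gaussian_cells = gaussian_series M a + cells n t u \<sigma>
  for M :: "'w measure" and a :: "nat \<Rightarrow> 'w \<Rightarrow> real" and n t u \<sigma>
begin

text \<open>The two points of a cell lie on the same side of every point of another cell, so their
  signs cancel in pairs, whatever the order of the cells.\<close>

lemma dsgn_blocks:
  assumes e: "\<And>k. k \<in> {1..n} \<Longrightarrow> t k < e k \<and> e k < u k"
    and "distinct is" "set is \<subseteq> {1..n}"
  shows "dsgn (concat (map (\<lambda>i. [e i, u i]) is)) = 1"
  using assms(2,3)
proof (induction "is")
  case (Cons i "is")
  define L where "L = concat (map (\<lambda>i. [e i, u i]) is)"
  define R where "R = set L"
  have i: "i \<in> {1..n}" "i \<notin> set is" using Cons.prems by auto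
  have "(\<Prod>y\<in>R. sgn (y - e i)) * (\<Prod>y\<in>R. sgn (y - u i)) = (\<Prod>y\<in>R. sgn (y - e i) * sgn (y - u i))"
    by (rule prod.distrib[symmetric])
  also have "\<dots> = 1"
  proof (intro prod.neutral ballI)
    fix y assume "y \<in> R"
    then obtain j where j: "j \<in> set is" "y = e j \<or> y = u j" by (auto simp: R_def L_def)
    have jn: "j \<in> {1..n}" "i \<noteq> j" using j Cons.prems by auto
    have yj: "t j < y" "y \<le> u j" using j(2) e[OF jn(1)] cell[OF jn(1)] by auto
    have "sgn (y - e i) = \<sigma> i j" "sgn (y - u i) = \<sigma> i j"
      using yj e[OF i(1)] cell[OF i(1)] jn i by (auto intro!: sgn_sigma)
    then show "sgn (y - e i) * sgn (y - u i) = 1" using order[OF i(1) jn] by auto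
  qed
  finally have 1: "(\<Prod>y\<in>R. sgn (y - e i)) * (\<Prod>y\<in>R. sgn (y - u i)) = 1" .
  have uR: "u i \<notin> R"
  proof
    assume "u i \<in> R"
    then obtain j where j: "j \<in> set is" "u i = e j \<or> u i = u j" by (auto simp: R_def L_def)
    have jn: "j \<in> {1..n}" "i \<noteq> j" using j Cons.prems by auto
    then show False using order[OF i(1) jn] j(2) e[OF jn(1)] e[OF i(1)] cell[OF jn(1)] cell[OF i(1)] by auto
  qed
  have "finite R" by (simp add: R_def)
  then have "(\<Prod>y\<in>insert (u i) R. sgn (y - e i)) = (\<Prod>y\<in>R. sgn (y - e i))"
    using uR e[OF i(1)] by simp
  moreover have "concat (map (\<lambda>i. [e i, u i]) (i # is)) = e i # u i # L" by (simp add: L_def)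
  moreover have "dsgn L = 1" using Cons by (simp add: L_def)
  ultimately show ?case using 1 by (simp only: dsgn.simps list.set R_def[symmetric] mult_1_right)
qed simp

lemma prod_list_blocks:
  "prod_list (map g (concat (map (\<lambda>i. [e i, u i]) is))) = prod_list (map (\<lambda>i. g (e i) * g (u i) :: real) is)"
  by (induction "is") (simp_all add: mult.assoc)

lemma map_pt_rows: "map (pt e u) (pf_rows n) = concat (map (\<lambda>i. [e i, u i]) [1..<n + 1])"
  unfolding pf_rows_def map_concat by (simp add: pt_def o_def)

text \<open>Strictly inside the cells all 2n points are distinct, so \<open>sign_correlation\<close>
  applies, and its sorting sign is 1 by \<open>dsgn_blocks\<close>.\<close>

lemma sign_moment_interior:
  assumes e: "\<And>k. k \<in> {1..n} \<Longrightarrow> t k < e k \<and> e k < u k"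
  shows "(\<integral>\<omega>. (\<Prod>i\<in>{1..n}. sgn (gf \<omega> (e i)) * sgn (gf \<omega> (u i))) \<partial>M) = (2 / pi) ^ n * pfl (ent \<sigma> {} e u) (pf_rows n)"
proof -
  define xs where "xs = map (pt e u) (pf_rows n)"
  have ptc: "t (fst p) < pt e u p \<and> pt e u p \<le> u (fst p)" if "p \<in> set (pf_rows n)" for p
    using that e cell by (auto simp: set_rows pt_def mem_Times_iff less_imp_le)
  have sg: "sgn (pt e u q - pt e u p) = psign \<sigma> p q" if pq: "p \<in> set (pf_rows n)" "q \<in> set (pf_rows n)" for p q
  proof (cases "fst p = fst q")
    case True
    have "fst q \<in> {1..n}" using pq by (auto simp: set_rows)
    then show ?thesis using True e[of "fst q"] by (auto simp: psign_def pt_def)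
  next
    case False
    have "fst p \<in> {1..n}" "fst q \<in> {1..n}" using pq by (auto simp: set_rows)
    then have "sgn (pt e u q - pt e u p) = \<sigma> (fst p) (fst q)"
      using ptc[OF pq(1)] ptc[OF pq(2)] False by (intro sgn_sigma) auto
    then show ?thesis using False by (simp add: psign_def)
  qed
  have nz: "psign \<sigma> p q \<noteq> 0" if "p \<in> set (pf_rows n)" "q \<in> set (pf_rows n)" "p \<noteq> q" for p q
  proof (cases "fst p = fst q")
    case True
    then show ?thesis using that(3) by (cases p; cases q) (auto simp: psign_def)
  next
    case False
    then show ?thesis using that order[of "fst p" "fst q"] by (auto simp: psign_def set_rows)
  qed
  have dist: "distinct xs"
    unfolding xs_def distinct_map using distinct_rows
  proof (intro conjI inj_onI)
    fix p q assume pq: "p \<in> set (pf_rows n)" "q \<in> set (pf_rows n)" "pt e u p = pt e u q"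
    then show "p = q" using sg[OF pq(1,2)] nz[OF pq(1,2)] by auto
  qed
  have sub: "set xs \<subseteq> {-1<..<1}"
  proof -
    have "pt e u p \<in> {-1<..<1}" if p: "p \<in> set (pf_rows n)" for p
    proof -
      have "fst p \<in> {1..n}" using p by (auto simp: set_rows)
      then show ?thesis using ptc[OF p] cell[of "fst p"] by auto
    qed
    then show ?thesis by (auto simp: xs_def)
  qed
  have "dsgn xs = 1"
    unfolding xs_def map_pt_rows by (rule dsgn_blocks[OF e]) auto
  then have "F (set xs) = pfl AA xs" using sign_correlation[OF dist sub] by simp
  also have "pfl AA xs = pfl (\<lambda>p q. 2 / pi * ent \<sigma> {} e u p q) (pf_rows n)"
    unfolding xs_def
  proof (rule pfl_cong_nth)
    fix i j assume ij: "i < length (map (pt e u) (pf_rows n))" "j < length (map (pt e u) (pf_rows n))"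
    then have "pf_rows n ! i \<in> set (pf_rows n)" "pf_rows n ! j \<in> set (pf_rows n)" by auto
    then show "AA (map (pt e u) (pf_rows n) ! i) (map (pt e u) (pf_rows n) ! j) = 2 / pi * ent \<sigma> {} e u (pf_rows n ! i) (pf_rows n ! j)"
      using ij sg by (simp add: AA_def k22_def ent_def)
  qed simp
  also have "\<dots> = (2 / pi) ^ n * pfl (ent \<sigma> {} e u) (pf_rows n)"
    by (rule pfl_scale[OF length_rows])
  also have "F (set xs) = (\<integral>\<omega>. (\<Prod>i\<in>{1..n}. sgn (gf \<omega> (e i)) * sgn (gf \<omega> (u i))) \<partial>M)"
    unfolding F_def
  proof (rule Bochner_Integration.integral_cong[OF refl])
    fix \<omega>
    have "(\<Prod>x\<in>set xs. sgn (gf \<omega> x)) = prod_list (map (\<lambda>x. sgn (gf \<omega> x)) xs)"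
      by (rule prod.distinct_set_conv_list[OF dist])
    also have "\<dots> = prod_list (map (\<lambda>i. sgn (gf \<omega> (e i)) * sgn (gf \<omega> (u i))) [1..<n + 1])"
      unfolding xs_def map_pt_rows by (rule prod_list_blocks)
    also have "\<dots> = (\<Prod>i\<in>set [1..<n + 1]. sgn (gf \<omega> (e i)) * sgn (gf \<omega> (u i)))"
      by (rule prod.distinct_set_conv_list[symmetric]) simp
    also have "set [1..<n + 1] = {1..n}" by auto
    finally show "(\<Prod>x\<in>set xs. sgn (gf \<omega> x)) = (\<Prod>i\<in>{1..n}. sgn (gf \<omega> (e i)) * sgn (gf \<omega> (u i)))" .
  qed
  finally show ?thesis .
qed

lemma abs_prod_sgn2_le: "\<bar>\<Prod>i\<in>I. sgn (f i) * sgn (g i :: real)\<bar> \<le> 1"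
  unfolding abs_prod by (intro prod_le_1) (auto simp: sgn_if)

text \<open>On the boundary of the box points may coincide, either with the right endpoint of the
  same cell or with that of a touching cell, and \<open>sign_correlation\<close> is out of reach.
  Both sides extend there by continuity.\<close>

lemma sign_moment:
  assumes e: "\<And>k. k \<in> {1..n} \<Longrightarrow> t k \<le> e k \<and> e k \<le> u k"
  shows "(\<integral>\<omega>. (\<Prod>i\<in>{1..n}. sgn (gf \<omega> (e i)) * sgn (gf \<omega> (u i))) \<partial>M) = (2 / pi) ^ n * pfl (ent \<sigma> {} e u) (pf_rows n)"
proof -
  \<comment> \<open>Moves each point towards the midpoint of its cell by the fraction
    \<open>1 / real (m + 2)\<close>, which keeps it strictly inside.\<close>
  define E' where "E' m k = e k + ((t k + u k) / 2 - e k) / real (m + 2)" for m k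
  have E': "t k < E' m k \<and> E' m k < u k" if k: "k \<in> {1..n}" for m k
  proof -
    define c where "c = 1 / real (m + 2)"
    have c: "0 < c" "c < 1" by (auto simp: c_def)
    have eq: "E' m k = (1 - c) * e k + c * ((t k + u k) / 2)" by (simp add: E'_def c_def algebra_simps diff_divide_distrib)
    have tu: "t k < u k" "t k \<le> e k" "e k \<le> u k" using cell[OF k] e[OF k] by auto
    have "(1 - c) * t k + c * t k < E' m k" unfolding eq using c tu by (intro add_le_less_mono mult_left_mono mult_strict_left_mono) auto
    moreover have "E' m k < (1 - c) * u k + c * u k" unfolding eq using c tu by (intro add_le_less_mono mult_left_mono mult_strict_left_mono) auto
    ultimately show ?thesis by (simp add: algebra_simps)
  qed
  have lim: "(\<lambda>m. E' m k) \<longlonglongrightarrow> e k" for k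
    unfolding E'_def by real_asymp
  have in1: "e k \<in> {-1<..<1} \<and> u k \<in> {-1<..<1}" if "k \<in> {1..n}" for k
    using e[OF that] cell[OF that] by auto
  have "(\<lambda>m. (2 / pi) ^ n * pfl (ent \<sigma> {} (E' m) u) (pf_rows n)) \<longlonglongrightarrow> (2 / pi) ^ n * pfl (ent \<sigma> {} e u) (pf_rows n)"
    by (intro tendsto_mult tendsto_const tendsto_pfl_ent lim in1)
  moreover have "(\<lambda>m. \<integral>\<omega>. (\<Prod>i\<in>{1..n}. sgn (gf \<omega> (E' m i)) * sgn (gf \<omega> (u i))) \<partial>M) \<longlonglongrightarrow> (\<integral>\<omega>. (\<Prod>i\<in>{1..n}. sgn (gf \<omega> (e i)) * sgn (gf \<omega> (u i))) \<partial>M)"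
  proof (rule integral_dominated_convergence[where w = "\<lambda>_. 1"])
    have "AE \<omega> in M. good \<omega> \<and> (\<forall>y\<in>e ` {1..n}. gf \<omega> y \<noteq> 0)"
      using in1 by (intro AE_good_nonzero) auto
    then show "AE \<omega> in M. (\<lambda>m. \<Prod>i\<in>{1..n}. sgn (gf \<omega> (E' m i)) * sgn (gf \<omega> (u i))) \<longlonglongrightarrow> (\<Prod>i\<in>{1..n}. sgn (gf \<omega> (e i)) * sgn (gf \<omega> (u i)))"
    proof eventually_elim
      case (elim \<omega>)
      show ?case
      proof (intro tendsto_prod tendsto_mult tendsto_const tendsto_sgn)
        fix i assume i: "i \<in> {1..n}"
        have "\<bar>e i\<bar> < 1" using in1[OF i] by (simp add: abs_less_iff)
        then show "(\<lambda>m. gf \<omega> (E' m i)) \<longlonglongrightarrow> gf \<omega> (e i)"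
          using elim by (intro isCont_tendsto_compose[OF isCont_gf lim]) auto
        show "gf \<omega> (e i) \<noteq> 0" using elim i by auto
      qed
    qed
  qed (auto simp: abs_prod_sgn2_le)
  moreover have "(\<integral>\<omega>. (\<Prod>i\<in>{1..n}. sgn (gf \<omega> (E' m i)) * sgn (gf \<omega> (u i))) \<partial>M) = (2 / pi) ^ n * pfl (ent \<sigma> {} (E' m) u) (pf_rows n)" for m
    by (rule sign_moment_interior) (rule E')
  ultimately show ?thesis using LIMSEQ_unique by (simp only:) blast
qed

text \<open>The bounded factor \<open>Z\<close> collects the coordinates already treated, which is
  what the induction on the list needs.\<close>

lemma MD_expectation:
  assumes "distinct is" and [measurable]: "Z \<in> borel_measurable M" and Z: "\<And>\<omega>. \<bar>Z \<omega>\<bar> \<le> C"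
  shows "MD is (\<lambda>e. \<integral>\<omega>. Z \<omega> * (\<Prod>i\<in>set is. sgn (gf \<omega> (e i)) * sgn (gf \<omega> (u i))) \<partial>M) e =
    (\<integral>\<omega>. Z \<omega> * (\<Prod>i\<in>set is. (sgn (gf \<omega> (u i)) - sgn (gf \<omega> (t i))) * sgn (gf \<omega> (u i))) \<partial>M)"
  using assms
proof (induction "is" arbitrary: Z e C)
  case (Cons i "is")
  note [measurable] = Cons.prems(2)
  have i: "i \<notin> set is" "distinct is" using Cons.prems by auto
  define W where "W w \<omega> = Z \<omega> * (sgn (gf \<omega> w) * sgn (gf \<omega> (u i)))" for w \<omega>
  have [measurable]: "W w \<in> borel_measurable M" for w unfolding W_def by measurable
  have W: "\<bar>W w \<omega>\<bar> \<le> C" for w \<omega>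
  proof -
    have "\<bar>Z \<omega>\<bar> * \<bar>sgn (gf \<omega> w) * sgn (gf \<omega> (u i))\<bar> \<le> C * 1"
      using Cons.prems(3)[of \<omega>] order_trans[OF abs_ge_zero Cons.prems(3)] by (intro mult_mono) (auto simp: abs_mult sgn_if)
    then show ?thesis by (simp add: W_def abs_mult)
  qed
  define P where "P \<omega> = (\<Prod>k\<in>set is. (sgn (gf \<omega> (u k)) - sgn (gf \<omega> (t k))) * sgn (gf \<omega> (u k)))" for \<omega>
  have [measurable]: "P \<in> borel_measurable M" unfolding P_def by measurable
  have P: "\<bar>P \<omega>\<bar> \<le> 2 ^ card (set is)" for \<omega>
    unfolding P_def abs_prod
    by (rule order_trans[OF prod_mono[of _ _ "\<lambda>_. 2"]]) (auto simp: abs_mult sgn_if)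
  have step: "MD is (\<lambda>e. \<integral>\<omega>. Z \<omega> * (\<Prod>k\<in>set (i # is). sgn (gf \<omega> (e k)) * sgn (gf \<omega> (u k))) \<partial>M) (e(i := w)) = (\<integral>\<omega>. W w \<omega> * P \<omega> \<partial>M)" for w
  proof -
    have "MD is (\<lambda>e. \<integral>\<omega>. Z \<omega> * (\<Prod>k\<in>set (i # is). sgn (gf \<omega> (e k)) * sgn (gf \<omega> (u k))) \<partial>M) (e(i := w)) =
       MD is (\<lambda>e. \<integral>\<omega>. W w \<omega> * (\<Prod>k\<in>set is. sgn (gf \<omega> (e k)) * sgn (gf \<omega> (u k))) \<partial>M) (e(i := w))"
      using i by (intro MD_cong) (auto simp: W_def mult_ac)
    also have "\<dots> = (\<integral>\<omega>. W w \<omega> * P \<omega> \<partial>M)" unfolding P_def by (rule Cons.IH[OF i(2) _ W]) measurable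
    finally show ?thesis .
  qed
  have int: "integrable M (\<lambda>\<omega>. W w \<omega> * P \<omega>)" for w
  proof (rule integrable_const_bound[of _ "C * 2 ^ card (set is)"])
    show "AE \<omega> in M. norm (W w \<omega> * P \<omega>) \<le> C * 2 ^ card (set is)"
      using W P order_trans[OF abs_ge_zero W] by (intro AE_I2) (auto simp: abs_mult intro!: mult_mono)
  qed measurable
  show ?case
    unfolding MD.simps(2) step using i
    by (subst Bochner_Integration.integral_diff[symmetric, OF int int])
       (auto intro!: Bochner_Integration.integral_cong simp: W_def P_def algebra_simps)
qed simp

text \<open>Almost surely the sign at \<open>u i\<close> squares to 1, so the factor produced by the
  difference in coordinate \<open>i\<close> is twice the detector of a sign change. The constants
  1/2 and \<open>2 / pi\<close> combine to \<open>1 / pi\<close>.\<close>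

lemma box_sign_changes:
  obtains \<xi> where "\<And>k. k \<in> {1..n} \<Longrightarrow> t k < \<xi> k \<and> \<xi> k < u k"
    "(\<integral>\<omega>. (\<Prod>i\<in>{1..n}. (1 - sgn (gf \<omega> (t i)) * sgn (gf \<omega> (u i))) / 2) \<partial>M) =
      (\<Prod>k\<in>{1..n}. u k - t k) * ((1 / pi) ^ n * pfl (ent \<sigma> {1..n} \<xi> u) (pf_rows n))"
proof -
  define ix where "ix = [1..<n + 1]"
  have ix: "distinct ix" "set ix = {1..n}" by (auto simp: ix_def)
  \<comment> \<open>The starting vector \<open>u\<close> is arbitrary on \<open>{1..n}\<close>: the
    mixed difference overwrites all of these coordinates.\<close>
  obtain \<xi> where \<xi>: "\<forall>k\<in>set ix. t k < \<xi> k \<and> \<xi> k < u k"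
    "MD ix (\<lambda>e. pfl (ent \<sigma> {} e u) (pf_rows n)) u = (\<Prod>k\<in>set ix. u k - t k) * pfl (ent \<sigma> ({} \<union> set ix) \<xi> u) (pf_rows n)"
    using MD_mean_value[of ix "{}" u] ix cell by (auto simp: less_imp_le)
  have MD_scale: "MD js (\<lambda>e. c * \<Phi> e) e = c * MD js \<Phi> e" for js c \<Phi> e
    by (induction js arbitrary: e) (auto simp: algebra_simps)
  have "AE \<omega> in M. good \<omega> \<and> (\<forall>y\<in>u ` {1..n}. gf \<omega> y \<noteq> 0)"
    using cell by (intro AE_good_nonzero) force+
  then have ae: "AE \<omega> in M. (\<Prod>i\<in>{1..n}. (1 - sgn (gf \<omega> (t i)) * sgn (gf \<omega> (u i))) / 2) =
     (1 / 2) ^ n * (1 * (\<Prod>i\<in>set ix. (sgn (gf \<omega> (u i)) - sgn (gf \<omega> (t i))) * sgn (gf \<omega> (u i))))"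
  proof eventually_elim
    case (elim \<omega>)
    have "(1 / 2) ^ n * (1 * (\<Prod>i\<in>set ix. (sgn (gf \<omega> (u i)) - sgn (gf \<omega> (t i))) * sgn (gf \<omega> (u i)))) =
      (\<Prod>i\<in>{1..n}. 1 / 2 * ((sgn (gf \<omega> (u i)) - sgn (gf \<omega> (t i))) * sgn (gf \<omega> (u i))))"
      by (simp only: prod.distrib prod_constant ix mult_1_left card_atLeastAtMost diff_Suc_1)
    also have "\<dots> = (\<Prod>i\<in>{1..n}. (1 - sgn (gf \<omega> (t i)) * sgn (gf \<omega> (u i))) / 2)"
      using elim by (intro prod.cong) (auto simp: sgn_if)
    finally show ?case by simp
  qed
  have "(\<integral>\<omega>. (\<Prod>i\<in>{1..n}. (1 - sgn (gf \<omega> (t i)) * sgn (gf \<omega> (u i))) / 2) \<partial>M) =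
     (\<integral>\<omega>. (1 / 2) ^ n * (1 * (\<Prod>i\<in>set ix. (sgn (gf \<omega> (u i)) - sgn (gf \<omega> (t i))) * sgn (gf \<omega> (u i)))) \<partial>M)"
    by (rule integral_cong_AE[OF _ _ ae]) measurable
  also have "\<dots> = (1 / 2) ^ n * (\<integral>\<omega>. 1 * (\<Prod>i\<in>set ix. (sgn (gf \<omega> (u i)) - sgn (gf \<omega> (t i))) * sgn (gf \<omega> (u i))) \<partial>M)"
    by (rule integral_mult_right_zero)
  also have "(\<integral>\<omega>. 1 * (\<Prod>i\<in>set ix. (sgn (gf \<omega> (u i)) - sgn (gf \<omega> (t i))) * sgn (gf \<omega> (u i))) \<partial>M) =
     MD ix (\<lambda>e. \<integral>\<omega>. 1 * (\<Prod>i\<in>set ix. sgn (gf \<omega> (e i)) * sgn (gf \<omega> (u i))) \<partial>M) u"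
    by (rule MD_expectation[symmetric, OF ix(1), of _ 1]) auto
  also have "\<dots> = MD ix (\<lambda>e. (2 / pi) ^ n * pfl (ent \<sigma> {} e u) (pf_rows n)) u"
  proof (rule MD_cong[OF _ ix(1)])
    fix e' assume a: "\<forall>k\<in>set ix. e' k = t k \<or> e' k = u k"
    have "t k \<le> e' k \<and> e' k \<le> u k" if k: "k \<in> {1..n}" for k
    proof -
      have "e' k = t k \<or> e' k = u k" using a k unfolding ix(2) by blast
      then show ?thesis using cell[OF k] by auto
    qed
    then show "(\<integral>\<omega>. 1 * (\<Prod>i\<in>set ix. sgn (gf \<omega> (e' i)) * sgn (gf \<omega> (u i))) \<partial>M) = (2 / pi) ^ n * pfl (ent \<sigma> {} e' u) (pf_rows n)"
      using sign_moment[of e'] by (simp add: ix)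
  qed
  also have "\<dots> = (2 / pi) ^ n * ((\<Prod>k\<in>set ix. u k - t k) * pfl (ent \<sigma> ({} \<union> set ix) \<xi> u) (pf_rows n))"
    unfolding MD_scale \<xi>(2) ..
  finally have "(\<integral>\<omega>. (\<Prod>i\<in>{1..n}. (1 - sgn (gf \<omega> (t i)) * sgn (gf \<omega> (u i))) / 2) \<partial>M) =
      ((1 / 2) ^ n * (2 / pi) ^ n) * ((\<Prod>k\<in>{1..n}. u k - t k) * pfl (ent \<sigma> {1..n} \<xi> u) (pf_rows n))"
    by (simp add: ix)
  also have "(1 / 2) ^ n * (2 / pi) ^ n = (1 / pi) ^ n" unfolding power_mult_distrib[symmetric] by simp
  finally show ?thesis using \<xi>(1) ix by (intro that) (auto simp: mult_ac)
qed

end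

section \<open>Simple zeros\<close>

text \<open>The derivative extends to a holomorphic function on the unit disc. If it is not
  constant, its zeros are countable; if it is a constant other than 0, there are none; if it
  vanishes identically, the series has a single value.\<close>

lemma countable_critical_values:
  fixes c :: "nat \<Rightarrow> real"
  assumes c: "\<And>r. 0 \<le> r \<Longrightarrow> r < 1 \<Longrightarrow> summable (\<lambda>k. \<bar>c k\<bar> * r ^ k)"
  shows "countable ((\<lambda>x. \<Sum>k. c k * x ^ k) ` {x \<in> {-1<..<1}. (\<Sum>k. diffs c k * x ^ k) = 0})"
proof -
  have sm: "summable (\<lambda>k. c k * x ^ k)" if "\<bar>x\<bar> < 1" for x :: real
  proof -
    have "summable (\<lambda>k. \<bar>c k * x ^ k\<bar>)" using c[of "\<bar>x\<bar>"] that by (simp add: abs_mult power_abs)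
    then show ?thesis by (rule summable_rabs_cancel)
  qed
  have smd: "summable (\<lambda>k. diffs c k * x ^ k)" if "\<bar>x\<bar> < 1" for x :: real
    by (rule termdiff_converges[of _ 1]) (use that sm in auto)
  define C where "C k = complex_of_real (c k)" for k
  have smC: "summable (\<lambda>k. C k * z ^ k)" if "norm z < 1" for z
  proof (rule summable_norm_cancel)
    show "summable (\<lambda>k. norm (C k * z ^ k))" using c[of "norm z"] that by (simp add: C_def norm_mult norm_power)
  qed
  have smdC: "summable (\<lambda>k. diffs C k * z ^ k)" if "norm z < 1" for z
    by (rule termdiff_converges[of _ 1]) (use that smC in auto)
  define h where "h z = (\<Sum>k. diffs C k * z ^ k)" for z
  have "(h has_field_derivative (\<Sum>k. diffs (diffs C) k * z ^ k)) (at z)" if "norm z < 1" for z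
    unfolding h_def[abs_def] by (rule termdiffs_strong'[of 1]) (use that smdC in auto)
  then have hol: "h holomorphic_on ball 0 1"
    unfolding holomorphic_on_def field_differentiable_def by (meson has_field_derivative_at_within mem_ball_0)
  have hr: "h (of_real x) = of_real (\<Sum>k. diffs c k * x ^ k)" if "\<bar>x\<bar> < 1" for x
    unfolding h_def using suminf_of_real[OF smd[OF that], where 'a = complex] by (simp add: C_def diffs_def)
  show ?thesis
  proof (cases "h constant_on ball 0 1")
    case False
    \<comment> \<open>The result on countably many zeros takes a domain that is a countable union of
      compact sets, here of closed discs.\<close>
    have "fsigma (ball (0::complex) 1)"
      unfolding fsigma_Union_compact
    proof (intro exI conjI)
      show "range (\<lambda>n. cball (0::complex) (1 - 1 / real (Suc n))) \<subseteq> Collect compact" by auto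
      have "\<exists>n. norm z \<le> 1 - 1 / real (Suc n)" if z: "norm z < 1" for z :: complex
      proof -
        have "0 < 1 - norm z" using z by simp
        then obtain n where "1 / real (Suc n) < 1 - norm z" by (rule nat_approx_posE)
        then show ?thesis by (intro exI[of _ n]) linarith
      qed
      moreover have "norm z < 1" if "norm z \<le> 1 - 1 / real (Suc n)" for n and z :: complex
      proof -
        have "0 < 1 / real (Suc n)" by simp
        with that show ?thesis by linarith
      qed
      ultimately show "ball (0::complex) 1 = \<Union> (range (\<lambda>n. cball (0::complex) (1 - 1 / real (Suc n))))"
        by (auto simp del: of_nat_Suc)
    qed
    then have "countable {z \<in> ball 0 1. h z = 0}"
      by (intro holomorphic_countable_zeros[OF hol]) (use False in auto)
    moreover have "complex_of_real ` {x \<in> {-1<..<1}. (\<Sum>k. diffs c k * x ^ k) = 0} \<subseteq> {z \<in> ball 0 1. h z = 0}"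
      using hr by (auto simp: abs_less_iff)
    ultimately have "countable (complex_of_real ` {x \<in> {-1<..<1}. (\<Sum>k. diffs c k * x ^ k) = 0})"
      by (rule countable_subset[rotated])
    then have "countable {x \<in> {-1<..<1}. (\<Sum>k. diffs c k * x ^ k) = 0}"
      by (rule countable_image_inj_on) (simp add: inj_on_def)
    then show ?thesis by (rule countable_image)
  next
    case True
    then obtain d where d: "\<And>z. z \<in> ball 0 1 \<Longrightarrow> h z = d" by (auto simp: constant_on_def)
    show ?thesis
    proof (cases "{x \<in> {-1<..<1}. (\<Sum>k. diffs c k * x ^ k) = 0} = {}")
      case False
      then obtain x0 where "x0 \<in> {-1<..<1}" "(\<Sum>k. diffs c k * x0 ^ k) = 0" by blast
      then have "d = 0" using d[of "of_real x0"] hr[of x0] by (auto simp: abs_less_iff)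
      then have z: "(\<Sum>k. diffs c k * x ^ k) = 0" if "\<bar>x\<bar> < 1" for x
        using d[of "of_real x"] hr[OF that] that by simp
      have d0: "((\<lambda>x. \<Sum>k. c k * x ^ k) has_real_derivative 0) (at x)" if "\<bar>x\<bar> < 1" for x
      proof -
        have "((\<lambda>x. \<Sum>k. c k * x ^ k) has_real_derivative (\<Sum>k. diffs c k * x ^ k)) (at x)"
          by (rule termdiffs_strong'[of 1]) (use sm that in auto)
        then show ?thesis unfolding z[OF that] .
      qed
      have "\<exists>w. \<forall>x\<in>{-1<..<1}. (\<Sum>k. c k * x ^ k) = w"
      proof (intro has_field_derivative_zero_constant)
        fix x :: real assume "x \<in> {-1<..<1}"
        then have "\<bar>x\<bar> < 1" by (auto simp: abs_less_iff)
        then show "((\<lambda>x. \<Sum>k. c k * x ^ k) has_real_derivative 0) (at x within {-1<..<1})"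
          by (rule has_field_derivative_at_within[OF d0])
      qed simp
      then obtain w where "\<forall>x\<in>{-1<..<1}. (\<Sum>k. c k * x ^ k) = w" by blast
      then have "(\<lambda>x. \<Sum>k. c k * x ^ k) ` {x \<in> {-1<..<1}. (\<Sum>k. diffs c k * x ^ k) = 0} \<subseteq> {w}" by auto
      then show ?thesis by (rule countable_subset) simp
    next
      case True
      then show ?thesis by (simp only: image_empty countable_empty)
    qed
  qed
qed

lemma AE_std_normal_countable: "countable C \<Longrightarrow> AE y in std_normal_distribution. y \<notin> C"
proof -
  assume C: "countable C"
  then have "C \<in> null_sets lborel" by (rule countable_imp_null_set_lborel)
  then have "AE y in lborel. y \<notin> C" by (rule AE_not_in)
  then show ?thesis by (subst AE_density) auto
qed

context gaussian_series
begin

definition gfd :: "'w \<Rightarrow> real \<Rightarrow> real" where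
  "gfd \<omega> x = (\<Sum>k. diffs (\<lambda>k. a k \<omega>) k * x ^ k)"

lemma DERIV_gf': "good \<omega> \<Longrightarrow> \<bar>x\<bar> < 1 \<Longrightarrow> (gf \<omega> has_real_derivative gfd \<omega> x) (at x)"
  unfolding gfd_def by (rule DERIV_gf)

lemma isCont_gfd: "good \<omega> \<Longrightarrow> \<bar>x\<bar> < 1 \<Longrightarrow> isCont (gfd \<omega>) x"
proof -
  assume g: "good \<omega>" "\<bar>x\<bar> < 1"
  have "summable (\<lambda>k. diffs (\<lambda>k. a k \<omega>) k * y ^ k)" if "norm y < 1" for y
    by (rule termdiff_converges[of _ 1]) (use g that good_summable in auto)
  then show ?thesis
    unfolding gfd_def[abs_def] using g(2) by (intro DERIV_isCont[OF termdiffs_strong'[of 1]]) auto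
qed

text \<open>Given the coefficients of positive index, a multiple zero forces \<open>-a 0\<close> to be a critical
  value of the remaining series, of which there are only countably many.\<close>

lemma AE_simple_zeros: "AE \<omega> in M. \<forall>x\<in>{-1<..<1}. gf \<omega> x = 0 \<longrightarrow> gfd \<omega> x \<noteq> 0"
proof -
  let ?N = "PiM {1..} (\<lambda>_. borel :: real measure)"
  define R where "R \<omega> = restrict (\<lambda>k. a k \<omega>) {1..}" for \<omega>
  define cf where "cf \<gamma> k = (if k = 0 then 0 else \<gamma> k :: real)" for \<gamma> and k :: nat
  define rr where "rr m = 1 - 1 / real (m + 2)" for m
  have rr: "0 < rr m" "rr m < 1" for m by (auto simp: rr_def field_simps)
  \<comment> \<open>Convergence on all smaller discs, expressed by extended sums so that it is
    visibly measurable.\<close>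
  define Gd where "Gd \<gamma> \<longleftrightarrow> (\<forall>m. (\<Sum>k. ennreal (\<bar>cf \<gamma> k\<bar> * rr m ^ k)) \<noteq> top)" for \<gamma>
  \<comment> \<open>A measurable substitute for a multiple zero in the interval of radius
    \<open>rr m\<close>: at rational points, value and derivative are together arbitrarily small.
    Compactness turns this back into a multiple zero in the closed interval.\<close>
  define Bad where "Bad m \<gamma> y \<longleftrightarrow> (\<forall>j::nat. \<exists>q::rat. \<bar>of_rat q\<bar> < rr m \<and>
      \<bar>y + (\<Sum>k. cf \<gamma> k * of_rat q ^ k)\<bar> + \<bar>\<Sum>k. diffs (cf \<gamma>) k * of_rat q ^ k\<bar> < 1 / real (Suc j))" for m \<gamma> y
  have cfm[measurable]: "(\<lambda>\<gamma>. cf \<gamma> k) \<in> borel_measurable ?N" for k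
    unfolding cf_def by (cases "k = 0") (auto intro: measurable_component_singleton)
  have R: "R \<in> measurable M ?N" unfolding R_def by (intro measurable_restrict) simp
  let ?K = "PiM {0} (\<lambda>_. borel :: real measure)"
  define A0 where "A0 \<omega> = restrict (\<lambda>k. a k \<omega>) {0}" for \<omega>
  have A0: "A0 \<in> measurable M ?K" unfolding A0_def by (intro measurable_restrict) simp
  \<comment> \<open>Independence of the constant coefficient from the others makes their joint law a
    product, so that the others can be frozen.\<close>
  have "indep_var ?N R ?K A0"
    unfolding R_def[abs_def] A0_def[abs_def] by (rule indep_var_restrict[OF indep]) auto
  then have dist: "distr M (?N \<Otimes>\<^sub>M ?K) (\<lambda>\<omega>. (R \<omega>, A0 \<omega>)) = distr M ?N R \<Otimes>\<^sub>M distr M ?K A0"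
    unfolding indep_var_distribution_eq by simp
  have AE_A0: "AE v in distr M ?K A0. v 0 \<notin> C" if C: "countable C" for C
  proof -
    have [measurable]: "C \<in> sets borel" using countable_imp_null_set_lborel[OF C] by (auto dest: null_setsD2)
    have "AE y in distr M borel (a 0). y \<notin> C" unfolding distr_a by (rule AE_std_normal_countable[OF C])
    then have "AE \<omega> in M. a 0 \<omega> \<notin> C" by (rule AE_distrD[rotated]) simp
    then show ?thesis using A0 by (subst AE_distr_iff) (auto simp: A0_def)
  qed
  interpret D0: prob_space "distr M ?K A0" by (rule prob_space_distr[OF A0])
  interpret DR: prob_space "distr M ?N R" by (rule prob_space_distr[OF R])
  interpret P: pair_sigma_finite "distr M ?N R" "distr M ?K A0" ..
  have GdD: "summable (\<lambda>k. \<bar>cf \<gamma> k\<bar> * r ^ k)" if "Gd \<gamma>" "0 \<le> r" "r < 1" for \<gamma> r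
  proof -
    have "0 < 1 - r" using that by simp
    then obtain m where m: "1 / real (Suc m) < 1 - r" by (rule nat_approx_posE)
    have "1 / real (m + 2) \<le> 1 / real (Suc m)" by (intro divide_left_mono) auto
    with m have le: "r \<le> rr m" by (simp add: rr_def)
    have "summable (\<lambda>k. \<bar>cf \<gamma> k\<bar> * rr m ^ k)"
      using that rr[of m] by (intro summable_suminf_not_top) (auto simp: Gd_def less_imp_le)
    then show ?thesis
      by (rule summable_comparison_test'[of _ 0]) (use that le in \<open>auto simp: abs_mult intro!: mult_left_mono power_mono\<close>)
  qed
  have main: "AE p in distr M ?N R \<Otimes>\<^sub>M distr M ?K A0. Gd (fst p) \<longrightarrow> (\<forall>m. \<not> Bad m (fst p) (snd p 0))"
  proof (rule P.AE_pair_measure)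
    show "{p \<in> space (distr M ?N R \<Otimes>\<^sub>M distr M ?K A0). Gd (fst p) \<longrightarrow> (\<forall>m. \<not> Bad m (fst p) (snd p 0))} \<in> sets (distr M ?N R \<Otimes>\<^sub>M distr M ?K A0)"
      unfolding Gd_def Bad_def diffs_def by measurable
    show "AE \<gamma> in distr M ?N R. AE v in distr M ?K A0. Gd (fst (\<gamma>, v)) \<longrightarrow> (\<forall>m. \<not> Bad m (fst (\<gamma>, v)) (snd (\<gamma>, v) 0))"
    proof (rule AE_I2)
      fix \<gamma>
      show "AE v in distr M ?K A0. Gd (fst (\<gamma>, v)) \<longrightarrow> (\<forall>m. \<not> Bad m (fst (\<gamma>, v)) (snd (\<gamma>, v) 0))"
      proof (cases "Gd \<gamma>")
        case True
        define g where "g x = (\<Sum>k. cf \<gamma> k * x ^ k)" for x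
        define g' where "g' x = (\<Sum>k. diffs (cf \<gamma>) k * x ^ k)" for x
        have sm: "summable (\<lambda>k. cf \<gamma> k * x ^ k)" if "norm x < 1" for x
        proof -
          have "summable (\<lambda>k. \<bar>cf \<gamma> k * x ^ k\<bar>)" using GdD[OF True, of "\<bar>x\<bar>"] that by (simp add: abs_mult power_abs)
          then show ?thesis by (rule summable_rabs_cancel)
        qed
        have smd: "summable (\<lambda>k. diffs (cf \<gamma>) k * x ^ k)" if "norm x < 1" for x
          by (rule termdiff_converges[of _ 1]) (use that sm in auto)
        have cg: "isCont g x" "isCont g' x" if "\<bar>x\<bar> < 1" for x
          unfolding g_def[abs_def] g'_def[abs_def]
          using that sm smd by (auto intro!: DERIV_isCont[OF termdiffs_strong'[of 1]])
        have "countable (g ` {x \<in> {-1<..<1}. g' x = 0})"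
          unfolding g_def[abs_def] g'_def by (rule countable_critical_values) (use GdD True in auto)
        then have "countable (uminus ` g ` {x \<in> {-1<..<1}. g' x = 0})" by (rule countable_image)
        then have "AE v in distr M ?K A0. v 0 \<notin> uminus ` g ` {x \<in> {-1<..<1}. g' x = 0}"
          by (rule AE_A0)
        then show ?thesis
        proof eventually_elim
          case (elim v)
          define y where "y = v 0"
          have "\<not> Bad m \<gamma> y" for m
          proof
            assume bad: "Bad m \<gamma> y"
            \<comment> \<open>Continuous on a compact interval, this function attains its infimum,
              which \<open>bad\<close> forces to be 0.\<close>
            define \<phi> where "\<phi> x = \<bar>y + g x\<bar> + \<bar>g' x\<bar>" for x
            have "continuous_on {-rr m..rr m} \<phi>"
              unfolding \<phi>_def using rr[of m]
              by (intro continuous_intros continuous_at_imp_continuous_on ballI cg) auto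
            moreover have "{-rr m..rr m} \<noteq> {}" using rr[of m] by auto
            ultimately obtain x where x: "x \<in> {-rr m..rr m}" "\<And>z. z \<in> {-rr m..rr m} \<Longrightarrow> \<phi> x \<le> \<phi> z"
              using continuous_attains_inf[OF compact_Icc] by metis
            have lt: "\<phi> x < 1 / real (Suc j)" for j
            proof -
              obtain q :: rat where q: "\<bar>of_rat q\<bar> < rr m" "\<phi> (of_rat q) < 1 / real (Suc j)"
                using bad unfolding Bad_def \<phi>_def g_def g'_def by blast
              have "real_of_rat q \<in> {-rr m..rr m}"
                using abs_le_D1[OF less_imp_le[OF q(1)]] abs_le_D2[OF less_imp_le[OF q(1)]] by simp
              from x(2)[OF this] q(2) show ?thesis by (rule order_le_less_trans)
            qed
            have "\<phi> x \<le> 0"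
            proof (rule ccontr)
              assume "\<not> \<phi> x \<le> 0"
              then have "0 < \<phi> x" by simp
              then obtain j where "1 / real (Suc j) < \<phi> x" by (rule nat_approx_posE)
              with lt[of j] show False by simp
            qed
            then have "y = - g x" "g' x = 0" by (auto simp: \<phi>_def)
            moreover have "x \<in> {-1<..<1}" using x(1) rr[of m] by auto
            ultimately show False using elim unfolding y_def by blast
          qed
          then show ?case by (simp add: y_def)
        qed
      qed simp
    qed
  qed
  have meas: "(\<lambda>\<omega>. (R \<omega>, A0 \<omega>)) \<in> measurable M (?N \<Otimes>\<^sub>M ?K)" using R A0 by simp
  have "AE \<omega> in M. Gd (R \<omega>) \<longrightarrow> (\<forall>m. \<not> Bad m (R \<omega>) (a 0 \<omega>))"
  proof -
    have "AE p in distr M (?N \<Otimes>\<^sub>M ?K) (\<lambda>\<omega>. (R \<omega>, A0 \<omega>)). Gd (fst p) \<longrightarrow> (\<forall>m. \<not> Bad m (fst p) (snd p 0))"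
      unfolding dist by (rule main)
    from AE_distrD[OF meas this] show ?thesis by (simp add: A0_def)
  qed
  with AE_good show ?thesis
  proof eventually_elim
    case (elim \<omega>)
    have cfR: "cf (R \<omega>) k = (if k = 0 then 0 else a k \<omega>)" for k by (simp add: cf_def R_def)
    have "Gd (R \<omega>)"
      unfolding Gd_def
    proof
      fix m
      have s: "summable (\<lambda>k. \<bar>a k \<omega>\<bar> * rr m ^ k)" using elim(1) rr[of m] by (auto simp: good_def)
      have "summable (\<lambda>k. \<bar>cf (R \<omega>) k\<bar> * rr m ^ k)"
        by (rule summable_comparison_test'[OF s, of 0]) (use rr[of m] in \<open>auto simp: cfR abs_mult\<close>)
      then show "(\<Sum>k. ennreal (\<bar>cf (R \<omega>) k\<bar> * rr m ^ k)) \<noteq> top"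
        using rr[of m] by (intro ennreal_suminf_neq_top) auto
    qed
    then have nb: "\<not> Bad m (R \<omega>) (a 0 \<omega>)" for m using elim by blast
    have gfeq: "a 0 \<omega> + (\<Sum>k. cf (R \<omega>) k * x ^ k) = gf \<omega> x" if x: "\<bar>x\<bar> < 1" for x
    proof -
      have s: "summable (\<lambda>k. a k \<omega> * x ^ k)" using elim(1) x by (rule good_summable)
      have "summable (\<lambda>k. cf (R \<omega>) (Suc k) * x ^ Suc k)"
        using iffD2[OF summable_Suc_iff[of "\<lambda>k. a k \<omega> * x ^ k"] s] by (simp add: cfR)
      then have s2: "summable (\<lambda>k. cf (R \<omega>) k * x ^ k)"
        using summable_Suc_iff[of "\<lambda>k. cf (R \<omega>) k * x ^ k"] by blast
      show ?thesis
        unfolding gf_def using suminf_split_head[OF s] suminf_split_head[OF s2] by (simp add: cfR)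
    qed
    have gfdeq: "(\<Sum>k. diffs (cf (R \<omega>)) k * x ^ k) = gfd \<omega> x" for x
      by (simp add: gfd_def diffs_def cfR)
    show ?case
    proof (intro ballI impI notI)
      fix x assume x: "x \<in> {-1<..<1}" and z: "gf \<omega> x = 0" "gfd \<omega> x = 0"
      have x1: "\<bar>x\<bar> < 1" using x by (auto simp: abs_less_iff)
      have "0 < 1 - \<bar>x\<bar>" using x1 by simp
      then obtain m where m: "1 / real (Suc m) < 1 - \<bar>x\<bar>" by (rule nat_approx_posE)
      have "1 / real (m + 2) < 1 / real (Suc m)" by (intro divide_strict_left_mono) auto
      with m have xm: "\<bar>x\<bar> < rr m" by (simp add: rr_def)
      have "Bad m (R \<omega>) (a 0 \<omega>)"
        unfolding Bad_def
      proof
        fix j :: nat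
        define \<phi> where "\<phi> z = \<bar>gf \<omega> z\<bar> + \<bar>gfd \<omega> z\<bar>" for z
        have "isCont \<phi> x" unfolding \<phi>_def[abs_def] using elim(1) x1 by (intro continuous_intros isCont_gf isCont_gfd)
        then have "(\<phi> \<longlongrightarrow> \<phi> x) (nhds x)" unfolding isCont_def tendsto_at_iff_tendsto_nhds .
        moreover have "\<phi> x < 1 / real (Suc j)" by (simp add: \<phi>_def z)
        ultimately have "\<forall>\<^sub>F z in nhds x. \<phi> z < 1 / real (Suc j)" by (rule order_tendstoD(2))
        then obtain S where S: "open S" "x \<in> S" "\<And>z. z \<in> S \<Longrightarrow> \<phi> z < 1 / real (Suc j)"
          unfolding eventually_nhds by blast
        have "open (S \<inter> {-rr m<..<rr m})" "x \<in> S \<inter> {-rr m<..<rr m}"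
          using S xm by (auto simp: abs_less_iff)
        then obtain e where e: "e > 0" "ball x e \<subseteq> S \<inter> {-rr m<..<rr m}" by (meson open_contains_ball)
        obtain q :: rat where q: "x < of_rat q" "of_rat q < x + e" using of_rat_dense[of x "x + e"] e(1) by auto
        have "real_of_rat q \<in> ball x e" using q by (simp add: dist_real_def)
        then have "real_of_rat q \<in> S \<inter> {-rr m<..<rr m}" using e(2) by blast
        then have qS: "real_of_rat q \<in> S" "\<bar>real_of_rat q\<bar> < rr m" unfolding abs_less_iff by auto
        then have q1: "\<bar>real_of_rat q\<bar> < 1" using rr[of m] by linarith
        show "\<exists>q::rat. \<bar>of_rat q\<bar> < rr m \<and> \<bar>a 0 \<omega> + (\<Sum>k. cf (R \<omega>) k * of_rat q ^ k)\<bar> + \<bar>\<Sum>k. diffs (cf (R \<omega>)) k * of_rat q ^ k\<bar> < 1 / real (Suc j)"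
          using qS S(3)[OF qS(1)] by (intro exI[of _ q]) (simp add: gfeq[OF q1] gfdeq \<phi>_def)
      qed
      with nb show False by blast
    qed
  qed
qed

end

subsection \<open>Counting zeros by sign changes\<close>

text \<open>At an accumulation point of zeros the difference quotients along these zeros vanish, and
  so does the derivative.\<close>

lemma finite_simple_zeros:
  fixes f :: "real \<Rightarrow> real"
  assumes d: "\<And>x. x \<in> {\<alpha>..\<beta>} \<Longrightarrow> (f has_real_derivative f' x) (at x)"
    and s: "\<And>x. x \<in> {\<alpha>..\<beta>} \<Longrightarrow> f x = 0 \<Longrightarrow> f' x \<noteq> 0"
  shows "finite {x \<in> {\<alpha>..\<beta>}. f x = 0}"
proof (rule ccontr)
  let ?Z = "{x \<in> {\<alpha>..\<beta>}. f x = 0}"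
  assume "infinite ?Z"
  then have "\<exists>x\<in>{\<alpha>..\<beta>}. x islimpt ?Z"
    by (intro Heine_Borel_imp_Bolzano_Weierstrass) auto
  then obtain x where x: "x \<in> {\<alpha>..\<beta>}" "x islimpt ?Z" by blast
  obtain X where X: "\<And>n. X n \<in> ?Z - {x}" "X \<longlonglongrightarrow> x" using x(2) unfolding islimpt_sequential by blast
  have "(\<lambda>n. f (X n)) \<longlonglongrightarrow> f x" by (rule isCont_tendsto_compose[OF DERIV_isCont[OF d[OF x(1)]] X(2)])
  moreover have "(\<lambda>n. f (X n)) = (\<lambda>n. 0)" using X(1) by auto
  ultimately have fx: "f x = 0" using LIMSEQ_unique[OF tendsto_const] by metis
  have "((\<lambda>y. (f y - f x) / (y - x)) \<longlongrightarrow> f' x) (at x)"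
    using d[OF x(1)] by (simp add: has_field_derivative_iff)
  then have "((\<lambda>y. (f y - f x) / (y - x)) \<circ> X) \<longlonglongrightarrow> f' x"
    using X unfolding tendsto_at_iff_sequentially by blast
  moreover have "((\<lambda>y. (f y - f x) / (y - x)) \<circ> X) = (\<lambda>n. 0)" using X(1) fx by (auto simp: o_def)
  ultimately have "f' x = 0" using LIMSEQ_unique[OF tendsto_const] by metis
  with s[OF x(1) fx] show False ..
qed

lemma sgn_change_imp_zero:
  fixes f :: "real \<Rightarrow> real"
  assumes "s < t" "continuous_on {s..t} f" "sgn (f s) * sgn (f t) = -1"
  shows "\<exists>z. s < z \<and> z < t \<and> f z = 0"
proof -
  have nz: "f s \<noteq> 0" "f t \<noteq> 0" using assms(3) by auto
  have "(f s < 0 \<and> 0 < f t) \<or> (0 < f s \<and> f t < 0)" using assms(3) by (auto simp: sgn_if split: if_splits)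
  then obtain z where "s \<le> z" "z \<le> t" "f z = 0"
    using IVT'[of f s 0 t] IVT2'[of f t 0 s] assms by force
  then show ?thesis using nz by (metis order_le_less)
qed

text \<open>Close to \<open>z\<close> the nonzero slope fixes the sign on either side; in the
  absence of further zeros the intermediate value theorem carries these signs to the
  endpoints.\<close>

lemma simple_zero_imp_sgn_change:
  fixes f :: "real \<Rightarrow> real"
  assumes z: "s < z" "z < t" and c: "continuous_on {s..t} f" and d: "(f has_real_derivative l) (at z)" "l \<noteq> 0"
    and u: "\<And>x. x \<in> {s..t} \<Longrightarrow> f x = 0 \<Longrightarrow> x = z" and fz: "f z = 0"
  shows "sgn (f s) * sgn (f t) = -1"
proof -
  have gen: "g s < 0 \<and> 0 < g t" if g: "continuous_on {s..t} g" "(g has_real_derivative k) (at z)" "k > 0"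
    "\<And>x. x \<in> {s..t} \<Longrightarrow> g x = 0 \<Longrightarrow> x = z" "g z = 0" for g k
  proof
    obtain e where e: "e > 0" "\<And>h. h > 0 \<Longrightarrow> h < e \<Longrightarrow> g (z - h) < g z" using DERIV_pos_inc_left[OF g(2,3)] by blast
    define \<eta> where "\<eta> = min (e / 2) ((z - s) / 2)"
    define p where "p = z - \<eta>"
    have \<eta>: "0 < \<eta>" "\<eta> < e" "\<eta> < z - s" using e(1) z by (auto simp: \<eta>_def min_less_iff_disj)
    then have p: "s < p" "p < z" "g p < 0" using e(2)[of \<eta>] z g(5) by (auto simp: p_def)
    show "g s < 0"
    proof (rule ccontr)
      assume "\<not> g s < 0"
      then obtain x where "s \<le> x" "x \<le> p" "g x = 0"
        using IVT2'[of g p 0 s] p z continuous_on_subset[OF g(1), of "{s..p}"] by force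
      then show False using g(4)[of x] p z by auto
    qed
    obtain e' where e': "e' > 0" "\<And>h. h > 0 \<Longrightarrow> h < e' \<Longrightarrow> g z < g (z + h)" using DERIV_pos_inc_right[OF g(2,3)] by blast
    define \<theta> where "\<theta> = min (e' / 2) ((t - z) / 2)"
    define q where "q = z + \<theta>"
    have \<theta>: "0 < \<theta>" "\<theta> < e'" "\<theta> < t - z" using e'(1) z by (auto simp: \<theta>_def min_less_iff_disj)
    then have q: "z < q" "q < t" "0 < g q" using e'(2)[of \<theta>] z g(5) by (auto simp: q_def)
    show "0 < g t"
    proof (rule ccontr)
      assume "\<not> 0 < g t"
      then obtain x where "q \<le> x" "x \<le> t" "g x = 0"
        using IVT2'[of g t 0 q] q z continuous_on_subset[OF g(1), of "{q..t}"] by force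
      then show False using g(4)[of x] q z by auto
    qed
  qed
  show ?thesis
  proof (cases "l > 0")
    case True
    have "f s < 0 \<and> 0 < f t" by (rule gen[OF c d(1) True u fz])
    then show ?thesis by simp
  next
    case False
    then have "- l > 0" using d(2) by simp
    have "- f s < 0 \<and> 0 < - f t"
    proof (rule gen[OF continuous_on_minus[OF c] DERIV_minus[OF d(1)] \<open>- l > 0\<close>])
      show "x = z" if "x \<in> {s..t}" "- f x = 0" for x using u[OF that(1)] that(2) by simp
    qed (simp add: fz)
    then show ?thesis by simp
  qed
qed

text \<open>The number of sign changes along the points, provided that no value is 0. It is written
  through products of signs because their expectations are the quantities known.\<close>

definition changes :: "(real \<Rightarrow> real) \<Rightarrow> (nat \<Rightarrow> real) \<Rightarrow> nat \<Rightarrow> real" where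
  "changes f \<tau> k = (\<Sum>j<k. (1 - sgn (f (\<tau> j)) * sgn (f (\<tau> (Suc j)))) / 2)"

lemma card_split:
  fixes \<tau> :: "nat \<Rightarrow> real"
  assumes \<tau>: "\<And>j. \<tau> j < \<tau> (Suc j)" and Z: "finite Z"
  shows "card (Z \<inter> {\<tau> 0<..\<tau> k}) = (\<Sum>j<k. card (Z \<inter> {\<tau> j<..\<tau> (Suc j)}))"
proof (induction k)
  case (Suc k)
  have mono: "\<tau> 0 \<le> \<tau> k"
  proof (rule lift_Suc_mono_le)
    show "\<tau> m \<le> \<tau> (Suc m)" for m using \<tau>[of m] by simp
  qed simp
  have e: "Z \<inter> {\<tau> 0<..\<tau> (Suc k)} = (Z \<inter> {\<tau> 0<..\<tau> k}) \<union> (Z \<inter> {\<tau> k<..\<tau> (Suc k)})"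
    using mono \<tau>[of k] by auto
  have "card (Z \<inter> {\<tau> 0<..\<tau> (Suc k)}) = card (Z \<inter> {\<tau> 0<..\<tau> k}) + card (Z \<inter> {\<tau> k<..\<tau> (Suc k)})"
    unfolding e using Z by (intro card_Un_disjoint) auto
  then show ?case unfolding Suc by simp
qed simp

lemma piece_change:
  fixes f :: "real \<Rightarrow> real"
  assumes st: "s < t" and c: "continuous_on {s..t} f" and nz: "f s \<noteq> 0" "f t \<noteq> 0" and Z: "finite {x \<in> {s..t}. f x = 0}"
  shows "0 \<le> (1 - sgn (f s) * sgn (f t)) / 2" "(1 - sgn (f s) * sgn (f t)) / 2 \<le> real (card ({x. f x = 0} \<inter> {s<..t}))"
proof -
  have fin: "finite ({x. f x = 0} \<inter> {s<..t})" by (rule finite_subset[OF _ Z]) auto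
  have "sgn (f s) * sgn (f t) = -1 \<or> sgn (f s) * sgn (f t) = 1" using nz by (auto simp: sgn_if)
  then consider "sgn (f s) * sgn (f t) = -1" | "sgn (f s) * sgn (f t) = 1" by blast
  then show "0 \<le> (1 - sgn (f s) * sgn (f t)) / 2" "(1 - sgn (f s) * sgn (f t)) / 2 \<le> real (card ({x. f x = 0} \<inter> {s<..t}))"
  proof (atomize(full), cases)
    case 1
    then obtain z where "s < z" "z < t" "f z = 0" using sgn_change_imp_zero[OF st c] by blast
    then have "{x. f x = 0} \<inter> {s<..t} \<noteq> {}" by force
    then have "card ({x. f x = 0} \<inter> {s<..t}) \<ge> 1" using fin by (simp add: Suc_le_eq card_gt_0_iff)
    then have "1 \<le> real (card ({x. f x = 0} \<inter> {s<..t}))" by simp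
    then show "0 \<le> (1 - sgn (f s) * sgn (f t)) / 2 \<and> (1 - sgn (f s) * sgn (f t)) / 2 \<le> real (card ({x. f x = 0} \<inter> {s<..t}))"
      unfolding 1 by simp
  next
    case 2
    show "0 \<le> (1 - sgn (f s) * sgn (f t)) / 2 \<and> (1 - sgn (f s) * sgn (f t)) / 2 \<le> real (card ({x. f x = 0} \<inter> {s<..t}))"
      unfolding 2 by simp
  qed
qed

definition part :: "real \<Rightarrow> real \<Rightarrow> nat \<Rightarrow> nat \<Rightarrow> real" where
  "part \<alpha> \<beta> k j = \<alpha> + (\<beta> - \<alpha>) * real j / real k"

lemma part_ends: "k > 0 \<Longrightarrow> part \<alpha> \<beta> k 0 = \<alpha> \<and> part \<alpha> \<beta> k k = \<beta>"
  by (simp add: part_def)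

lemma part_step: "k > 0 \<Longrightarrow> part \<alpha> \<beta> k (Suc j) - part \<alpha> \<beta> k j = (\<beta> - \<alpha>) / real k"
  by (simp add: part_def field_simps)

lemma part_less: "\<alpha> < \<beta> \<Longrightarrow> k > 0 \<Longrightarrow> part \<alpha> \<beta> k j < part \<alpha> \<beta> k (Suc j)"
proof -
  assume a: "\<alpha> < \<beta>" "k > 0"
  then have "0 < (\<beta> - \<alpha>) / real k" by simp
  then show ?thesis using part_step[OF a(2), of \<alpha> \<beta> j] by linarith
qed

lemma part_bounds: "\<alpha> < \<beta> \<Longrightarrow> k > 0 \<Longrightarrow> j \<le> k \<Longrightarrow> \<alpha> \<le> part \<alpha> \<beta> k j \<and> part \<alpha> \<beta> k j \<le> \<beta>"
proof -
  assume a: "\<alpha> < \<beta>" "k > 0" "j \<le> k"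
  have "0 \<le> real j / real k" "real j / real k \<le> 1" using a by auto
  then have "0 \<le> (\<beta> - \<alpha>) * (real j / real k)" "(\<beta> - \<alpha>) * (real j / real k) \<le> (\<beta> - \<alpha>) * 1"
    using a by (simp, intro mult_left_mono) auto
  then show ?thesis by (simp add: part_def)
qed

text \<open>A piece with a sign change contains a zero, whence the upper bound. Once the mesh is
  below the least distance \<open>\<delta>\<close> of two zeros, a piece holds at most one zero,
  which is simple and therefore does change the sign.\<close>

lemma changes_count:
  fixes f :: "real \<Rightarrow> real"
  assumes \<alpha>\<beta>: "\<alpha> < \<beta>"
    and d: "\<And>x. x \<in> {\<alpha>..\<beta>} \<Longrightarrow> (f has_real_derivative f' x) (at x)"
    and s: "\<And>x. x \<in> {\<alpha>..\<beta>} \<Longrightarrow> f x = 0 \<Longrightarrow> f' x \<noteq> 0"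
    and nz: "\<And>k j. k > 0 \<Longrightarrow> j \<le> k \<Longrightarrow> f (part \<alpha> \<beta> k j) \<noteq> 0"
  shows "\<And>k. k > 0 \<Longrightarrow> 0 \<le> changes f (part \<alpha> \<beta> k) k \<and> changes f (part \<alpha> \<beta> k) k \<le> real (card ({x. f x = 0} \<inter> {\<alpha><..\<beta>}))"
    and "\<forall>\<^sub>F k in sequentially. changes f (part \<alpha> \<beta> k) k = real (card ({x. f x = 0} \<inter> {\<alpha><..\<beta>}))"
proof -
  define Z where "Z = {x \<in> {\<alpha>..\<beta>}. f x = 0}"
  have Z: "finite Z" unfolding Z_def by (rule finite_simple_zeros[OF d s])
  have cont: "continuous_on {\<alpha>..\<beta>} f"
    using d DERIV_isCont by (intro continuous_at_imp_continuous_on) blast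
  have split: "card ({x. f x = 0} \<inter> {\<alpha><..\<beta>}) = (\<Sum>j<k. card ({x. f x = 0} \<inter> {part \<alpha> \<beta> k j<..part \<alpha> \<beta> k (Suc j)}))" if k: "k > 0" for k
  proof -
    have "{x. f x = 0} \<inter> {\<alpha><..\<beta>} = Z \<inter> {part \<alpha> \<beta> k 0<..part \<alpha> \<beta> k k}" using part_ends[OF k] by (auto simp: Z_def)
    also have "card \<dots> = (\<Sum>j<k. card (Z \<inter> {part \<alpha> \<beta> k j<..part \<alpha> \<beta> k (Suc j)}))"
      by (rule card_split[where \<tau> = "part \<alpha> \<beta> k", OF part_less[OF \<alpha>\<beta> k] Z])
    also have "\<dots> = (\<Sum>j<k. card ({x. f x = 0} \<inter> {part \<alpha> \<beta> k j<..part \<alpha> \<beta> k (Suc j)}))"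
    proof (intro sum.cong refl arg_cong[where f = card])
      fix j assume "j \<in> {..<k}"
      then show "Z \<inter> {part \<alpha> \<beta> k j<..part \<alpha> \<beta> k (Suc j)} = {x. f x = 0} \<inter> {part \<alpha> \<beta> k j<..part \<alpha> \<beta> k (Suc j)}"
        using part_bounds[OF \<alpha>\<beta> k, of j] part_bounds[OF \<alpha>\<beta> k, of "Suc j"] by (auto simp: Z_def)
    qed
    finally show ?thesis .
  qed
  have sub: "{part \<alpha> \<beta> k j..part \<alpha> \<beta> k (Suc j)} \<subseteq> {\<alpha>..\<beta>}" if "k > 0" "j < k" for k j
    using part_bounds[OF \<alpha>\<beta> that(1), of j] part_bounds[OF \<alpha>\<beta> that(1), of "Suc j"] that by auto
  have piece: "0 \<le> (1 - sgn (f (part \<alpha> \<beta> k j)) * sgn (f (part \<alpha> \<beta> k (Suc j)))) / 2 \<and>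
      (1 - sgn (f (part \<alpha> \<beta> k j)) * sgn (f (part \<alpha> \<beta> k (Suc j)))) / 2 \<le> real (card ({x. f x = 0} \<inter> {part \<alpha> \<beta> k j<..part \<alpha> \<beta> k (Suc j)}))"
    if k: "k > 0" "j < k" for k j
  proof -
    have fin: "finite {x \<in> {part \<alpha> \<beta> k j..part \<alpha> \<beta> k (Suc j)}. f x = 0}"
      by (rule finite_subset[OF _ Z]) (use sub[OF k] in \<open>auto simp: Z_def\<close>)
    show ?thesis
      using piece_change[OF part_less[OF \<alpha>\<beta> k(1)] continuous_on_subset[OF cont sub[OF k]] nz[OF k(1)] nz[OF k(1)] fin] k by auto
  qed
  show "0 \<le> changes f (part \<alpha> \<beta> k) k \<and> changes f (part \<alpha> \<beta> k) k \<le> real (card ({x. f x = 0} \<inter> {\<alpha><..\<beta>}))" if k: "k > 0" for k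
    unfolding split[OF k] changes_def of_nat_sum using piece[OF k] by (auto intro!: sum_nonneg sum_mono)
  obtain \<delta> where \<delta>: "\<delta> > 0" "\<And>x y. x \<in> Z \<Longrightarrow> y \<in> Z \<Longrightarrow> x \<noteq> y \<Longrightarrow> \<delta> \<le> \<bar>x - y\<bar>"
  proof -
    \<comment> \<open>The element 1 keeps the set nonempty when there are fewer than two
      zeros.\<close>
    define P where "P = insert 1 ((\<lambda>(x, y). \<bar>x - y\<bar>) ` {(x, y) \<in> Z \<times> Z. x \<noteq> y})"
    have P: "finite P" unfolding P_def using Z by (auto intro: finite_subset[of _ "Z \<times> Z"])
    show ?thesis
    proof (rule that[of "Min P"])
      show "0 < Min P" using P by (subst Min_gr_iff) (auto simp: P_def)
      show "Min P \<le> \<bar>x - y\<bar>" if "x \<in> Z" "y \<in> Z" "x \<noteq> y" for x y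
        using P that by (intro Min_le) (auto simp: P_def)
    qed
  qed
  have "(\<lambda>k. (\<beta> - \<alpha>) / real k) \<longlonglongrightarrow> 0" by (rule lim_const_over_n)
  then have "\<forall>\<^sub>F k in sequentially. (\<beta> - \<alpha>) / real k < \<delta>" using \<delta>(1) by (rule order_tendstoD)
  moreover have "\<forall>\<^sub>F k in sequentially. k > (0::nat)" by (rule eventually_gt_at_top)
  ultimately show "\<forall>\<^sub>F k in sequentially. changes f (part \<alpha> \<beta> k) k = real (card ({x. f x = 0} \<inter> {\<alpha><..\<beta>}))"
  proof eventually_elim
    case (elim k)
    show ?case
      unfolding split[OF elim(2)] changes_def of_nat_sum
    proof (rule sum.cong[OF refl])
      fix j assume j: "j \<in> {..<k}"
      define p where "p = part \<alpha> \<beta> k j"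
      define q where "q = part \<alpha> \<beta> k (Suc j)"
      have pq: "p < q" unfolding p_def q_def by (rule part_less[OF \<alpha>\<beta> elim(2)])
      have len: "q - p < \<delta>" using part_step[OF elim(2)] elim(1) by (simp add: p_def q_def)
      have s: "{p..q} \<subseteq> {\<alpha>..\<beta>}" using sub[OF elim(2)] j by (simp add: p_def q_def)
      have n0: "f p \<noteq> 0" "f q \<noteq> 0" using nz[OF elim(2)] j by (auto simp: p_def q_def)
      let ?W = "{x. f x = 0} \<inter> {p<..q}"
      have WZ: "?W \<subseteq> Z" using s by (auto simp: Z_def)
      have one: "x = y" if "x \<in> ?W" "y \<in> ?W" for x y
        using \<delta>(2)[OF subsetD[OF WZ that(1)] subsetD[OF WZ that(2)]] that len by (cases "x = y") auto
      show "(1 - sgn (f (part \<alpha> \<beta> k j)) * sgn (f (part \<alpha> \<beta> k (Suc j)))) / 2 = real (card ({x. f x = 0} \<inter> {part \<alpha> \<beta> k j<..part \<alpha> \<beta> k (Suc j)}))"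
        unfolding p_def[symmetric] q_def[symmetric]
      proof (cases "?W = {}")
        case True
        then show "(1 - sgn (f p) * sgn (f q)) / 2 = real (card ?W)"
          using piece[OF elim(2), of j] j by (simp add: p_def q_def)
      next
        case False
        then obtain z where z: "z \<in> ?W" by blast
        then have W: "?W = {z}" using one by blast
        have zq: "p < z" "z < q" "f z = 0" using z n0 by (auto simp: less_le)
        have "sgn (f p) * sgn (f q) = -1"
        proof (rule simple_zero_imp_sgn_change[OF zq(1,2) continuous_on_subset[OF cont s]])
          have zr: "z \<in> {\<alpha>..\<beta>}" using s zq(1,2) by auto
          show "(f has_real_derivative f' z) (at z)" by (rule d[OF zr])
          show "f' z \<noteq> 0" by (rule assms(3)[OF zr zq(3)])
          show "x = z" if "x \<in> {p..q}" "f x = 0" for x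
            using that n0 by (intro one z) (auto simp: less_le)
        qed (rule zq)
        then show "(1 - sgn (f p) * sgn (f q)) / 2 = real (card ?W)" unfolding W by simp
      qed
    qed
  qed
qed

section \<open>Factorial moments of disjoint cells\<close>

lemma Ioc_cover:
  fixes \<tau> :: "nat \<Rightarrow> real"
  shows "x \<in> {\<tau> 0<..\<tau> k} \<Longrightarrow> \<exists>j<k. x \<in> {\<tau> j<..\<tau> (Suc j)}"
proof (induction k)
  case (Suc k)
  show ?case
  proof (cases "x \<le> \<tau> k")
    case True
    then obtain j where "j < k" "x \<in> {\<tau> j<..\<tau> (Suc j)}" using Suc by auto
    then show ?thesis by (intro exI[of _ j]) auto
  next
    case False
    then show ?thesis using Suc.prems by (intro exI[of _ k]) auto
  qed
qed simp

lemma Ioc_cover_unique: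
  fixes \<tau> :: "nat \<Rightarrow> real"
  assumes \<tau>: "\<And>j. \<tau> j < \<tau> (Suc j)" and x: "x \<in> {\<tau> i<..\<tau> (Suc i)}" "x \<in> {\<tau> j<..\<tau> (Suc j)}"
  shows "i = j"
proof -
  have le: "\<tau> (Suc i) \<le> \<tau> j" if "i < j" for i j
  proof (rule lift_Suc_mono_le)
    show "\<tau> m \<le> \<tau> (Suc m)" for m using \<tau>[of m] by simp
  qed (use that in simp)
  show ?thesis
  proof (rule linorder_cases[of i j])
    assume "i < j" then show ?thesis using le[of i j] x by auto
  next
    assume "j < i" then show ?thesis using le[of j i] x by auto
  qed
qed

text \<open>Continuity on a compact square. The bound is made at least 2 so that it also covers the
  arcsine entries, which do not exceed \<open>pi / 2\<close>.\<close>

lemma kernel_bound: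
  assumes r: "0 \<le> r" "r < 1"
  shows "\<exists>C\<ge>2. \<forall>x y. \<bar>x\<bar> \<le> r \<longrightarrow> \<bar>y\<bar> \<le> r \<longrightarrow> \<bar>k11 x y\<bar> \<le> C \<and> \<bar>k12 x y\<bar> \<le> C"
proof -
  let ?S = "{-r..r} \<times> {-r..r}"
  have S1: "fst p \<in> {-1<..<1}" "snd p \<in> {-1<..<1}" if "p \<in> ?S" for p using that r by (auto simp: mem_Times_iff)
  have c11: "continuous_on ?S (\<lambda>p. k11 (fst p) (snd p))"
    unfolding continuous_on_def using S1 by (intro ballI tendsto_k11 tendsto_fst tendsto_snd tendsto_ident_at)
  have c12: "continuous_on ?S (\<lambda>p. k12 (fst p) (snd p))"
    unfolding continuous_on_def using S1 by (intro ballI tendsto_k12 tendsto_fst tendsto_snd tendsto_ident_at)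
  have cS: "compact ?S" by (intro compact_Times) auto
  obtain C1 where C1: "\<And>p. p \<in> ?S \<Longrightarrow> \<bar>k11 (fst p) (snd p)\<bar> \<le> C1"
    using compact_imp_bounded[OF compact_continuous_image[OF c11 cS]] unfolding bounded_iff real_norm_def by blast
  obtain C2 where C2: "\<And>p. p \<in> ?S \<Longrightarrow> \<bar>k12 (fst p) (snd p)\<bar> \<le> C2"
    using compact_imp_bounded[OF compact_continuous_image[OF c12 cS]] unfolding bounded_iff real_norm_def by blast
  show ?thesis
  proof (intro exI[of _ "max 2 (max C1 C2)"] conjI allI impI)
    fix x y :: real assume xy: "\<bar>x\<bar> \<le> r" "\<bar>y\<bar> \<le> r"
    have p: "(x, y) \<in> ?S" using xy by (auto simp: abs_le_iff)
    show "\<bar>k11 x y\<bar> \<le> max 2 (max C1 C2)" "\<bar>k12 x y\<bar> \<le> max 2 (max C1 C2)" using C1[OF p] C2[OF p] by auto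
  qed simp
qed

lemma changes_term_bounds: "0 \<le> (1 - sgn (x::real) * sgn y) / 2" "(1 - sgn x * sgn y) / 2 \<le> 1"
  by (auto simp: sgn_if)

lemma changes_nonneg: "0 \<le> changes f \<tau> k"
  unfolding changes_def by (intro sum_nonneg changes_term_bounds)

lemma changes_le: "changes f \<tau> k \<le> real k"
  unfolding changes_def
  using sum_bounded_above[of "{..<k}" "\<lambda>j. (1 - sgn (f (\<tau> j)) * sgn (f (\<tau> (Suc j)))) / 2" 1, OF changes_term_bounds(2)] by simp

context gaussian_series
begin

lemma real_zeros_eq:
  assumes "good \<omega>"
  shows "real_zeros a \<omega> = {x \<in> {-1<..<1}. gf \<omega> x = 0}"
proof -
  have "random_series a \<omega> (of_real x) = of_real (gf \<omega> x)" if "x \<in> {-1<..<1}" for x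
  proof -
    have "summable (\<lambda>k. a k \<omega> * x ^ k)" using assms that by (intro good_summable) (auto simp: abs_less_iff)
    from suminf_of_real[OF this, where 'a = complex] show ?thesis
      by (simp add: random_series_def gf_def)
  qed
  then show ?thesis by (auto simp: real_zeros_def)
qed

text \<open>All partitions together have countably many points, so almost surely none of these is a
  zero; with all zeros simple, the deterministic count applies path by path.\<close>

lemma AE_cell_count:
  assumes \<alpha>\<beta>: "-1 < \<alpha>" "\<alpha> < \<beta>" "\<beta> < 1"
  shows "AE \<omega> in M. (\<exists>N::nat. num_points (real_zeros a) {\<alpha><..\<beta>} \<omega> = ennreal (real N) \<and>
     (\<forall>m. changes (gf \<omega>) (part \<alpha> \<beta> (Suc m)) (Suc m) \<le> real N) \<and>
     (\<forall>\<^sub>F m in sequentially. changes (gf \<omega>) (part \<alpha> \<beta> (Suc m)) (Suc m) = real N))"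
proof -
  have pin: "part \<alpha> \<beta> k j \<in> {-1<..<1}" if "k > 0" "j \<le> k" for k j
    using part_bounds[OF \<alpha>\<beta>(2) that] \<alpha>\<beta> by auto
  have "AE \<omega> in M. \<forall>k j. k > 0 \<and> j \<le> k \<longrightarrow> gf \<omega> (part \<alpha> \<beta> k j) \<noteq> 0"
    unfolding AE_all_countable
  proof (intro allI)
    fix k j :: nat
    show "AE \<omega> in M. k > 0 \<and> j \<le> k \<longrightarrow> gf \<omega> (part \<alpha> \<beta> k j) \<noteq> 0"
    proof (cases "k > 0 \<and> j \<le> k")
      case True
      then have "AE \<omega> in M. gf \<omega> (part \<alpha> \<beta> k j) \<noteq> 0" using pin by (intro AE_gf_nonzero) auto
      then show ?thesis by eventually_elim simp
    qed auto
  qed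
  with AE_good AE_simple_zeros show ?thesis
  proof eventually_elim
    case (elim \<omega>)
    have sub: "{\<alpha>..\<beta>} \<subseteq> {-1<..<1}" using \<alpha>\<beta> by auto
    have d: "(gf \<omega> has_real_derivative gfd \<omega> x) (at x)" if "x \<in> {\<alpha>..\<beta>}" for x
      using that \<alpha>\<beta> by (intro DERIV_gf' elim(1)) (auto simp: abs_less_iff)
    have s: "gfd \<omega> x \<noteq> 0" if "x \<in> {\<alpha>..\<beta>}" "gf \<omega> x = 0" for x using elim(2) that sub by blast
    have nz: "gf \<omega> (part \<alpha> \<beta> k j) \<noteq> 0" if "k > 0" "j \<le> k" for k j using elim(3) that by blast
    define N where "N = card ({x. gf \<omega> x = 0} \<inter> {\<alpha><..\<beta>})"
    have fin: "finite ({x. gf \<omega> x = 0} \<inter> {\<alpha><..\<beta>})"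
      by (rule finite_subset[OF _ finite_simple_zeros[OF d s]]) auto
    have eq: "real_zeros a \<omega> \<inter> {\<alpha><..\<beta>} = {x. gf \<omega> x = 0} \<inter> {\<alpha><..\<beta>}"
      unfolding real_zeros_eq[OF elim(1)] using \<alpha>\<beta> by auto
    have "num_points (real_zeros a) {\<alpha><..\<beta>} \<omega> = ennreal (real N)"
      unfolding num_points_def eq N_def using fin by (simp add: ennreal_of_nat_eq_real_of_nat)
    moreover have "changes (gf \<omega>) (part \<alpha> \<beta> (Suc m)) (Suc m) \<le> real N" for m
      unfolding N_def by (rule changes_count(1)[OF \<alpha>\<beta>(2) d s nz, THEN conjunct2]) simp_all
    moreover have "\<forall>\<^sub>F m in sequentially. changes (gf \<omega>) (part \<alpha> \<beta> (Suc m)) (Suc m) = real N"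
      using changes_count(2)[OF \<alpha>\<beta>(2) d s nz] unfolding N_def
      by (subst eventually_sequentially_Suc)
    ultimately show ?case by (intro exI[of _ N]) blast
  qed
qed

lemma measurable_changes [measurable]: "(\<lambda>\<omega>. changes (gf \<omega>) \<tau> k) \<in> borel_measurable M"
  unfolding changes_def by measurable

end

interpretation lborel_prod: product_sigma_finite "\<lambda>_::nat. lborel :: real measure" ..

section \<open>Moments of disjoint cells by refinement into subcells\<close>

context gaussian_cells
begin

text \<open>Every cell is differentiated, and the moving points and the right endpoints are merged:
  the limit of the mean value formula as the cells shrink to \<open>x\<close>.\<close>

definition dens :: "(nat \<Rightarrow> real) \<Rightarrow> real" where
  "dens x = (1 / pi) ^ n * pfl (ent \<sigma> {1..n} x x) (pf_rows n)"

abbreviation Box :: "(nat \<Rightarrow> real) set" where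
  "Box \<equiv> PiE {1..n} (\<lambda>i. {t i<..u i})"

abbreviation \<Lambda> :: "(nat \<Rightarrow> real) measure" where
  "\<Lambda> \<equiv> PiM {1..n} (\<lambda>_. lborel)"

definition sub :: "nat \<Rightarrow> nat \<Rightarrow> nat \<Rightarrow> real" where
  "sub m i j = part (t i) (u i) (Suc m) j"

definition idx :: "nat \<Rightarrow> (nat \<Rightarrow> nat) set" where
  "idx m = PiE {1..n} (\<lambda>_. {..<Suc m})"

definition J :: "nat \<Rightarrow> (nat \<Rightarrow> nat) \<Rightarrow> (nat \<Rightarrow> real) set" where
  "J m \<phi> = PiE {1..n} (\<lambda>i. {sub m i (\<phi> i)<..sub m i (Suc (\<phi> i))})"

lemma sub_bounds: "i \<in> {1..n} \<Longrightarrow> j \<le> Suc m \<Longrightarrow> t i \<le> sub m i j \<and> sub m i j \<le> u i"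
  unfolding sub_def using cell[of i] by (intro part_bounds) auto

lemma sub_less: "i \<in> {1..n} \<Longrightarrow> sub m i j < sub m i (Suc j)"
  unfolding sub_def using cell[of i] by (intro part_less) auto

lemma sub_step: "sub m i (Suc j) - sub m i j = (u i - t i) / real (Suc m)"
  unfolding sub_def by (rule part_step) simp

lemma finite_idx: "finite (idx m)"
  unfolding idx_def by (intro finite_PiE) auto

lemma idx_le: "\<phi> \<in> idx m \<Longrightarrow> i \<in> {1..n} \<Longrightarrow> \<phi> i \<le> Suc m \<and> Suc (\<phi> i) \<le> Suc m"
  by (auto simp: idx_def PiE_def Pi_def less_Suc_eq_le)

lemma J_subset: "\<phi> \<in> idx m \<Longrightarrow> J m \<phi> \<subseteq> Box"
  unfolding J_def
proof (intro PiE_mono)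
  fix i assume \<phi>: "\<phi> \<in> idx m" and i: "i \<in> {1..n}"
  show "{sub m i (\<phi> i)<..sub m i (Suc (\<phi> i))} \<subseteq> {t i<..u i}"
    using sub_bounds[OF i, of "\<phi> i" m] sub_bounds[OF i, of "Suc (\<phi> i)" m] idx_le[OF \<phi> i] by auto
qed

lemma sets_J [measurable]: "J m \<phi> \<in> sets \<Lambda>"
  unfolding J_def by (intro sets_PiM_I_finite) auto

lemma sets_Box [measurable]: "Box \<in> sets \<Lambda>"
  by (intro sets_PiM_I_finite) auto

lemma emeasure_J: "emeasure \<Lambda> (J m \<phi>) = ennreal (\<Prod>i\<in>{1..n}. sub m i (Suc (\<phi> i)) - sub m i (\<phi> i))"
proof -
  have "emeasure \<Lambda> (J m \<phi>) = (\<Prod>i\<in>{1..n}. emeasure lborel {sub m i (\<phi> i)<..sub m i (Suc (\<phi> i))})"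
    unfolding J_def by (rule lborel_prod.emeasure_PiM) auto
  also have "\<dots> = (\<Prod>i\<in>{1..n}. ennreal (sub m i (Suc (\<phi> i)) - sub m i (\<phi> i)))"
    using sub_less by (intro prod.cong refl) (auto simp: less_imp_le)
  also have "\<dots> = ennreal (\<Prod>i\<in>{1..n}. sub m i (Suc (\<phi> i)) - sub m i (\<phi> i))"
    using sub_less by (intro prod_ennreal) (auto simp: less_imp_le)
  finally show ?thesis .
qed

lemma emeasure_Box: "emeasure \<Lambda> Box < \<infinity>"
proof -
  have "emeasure \<Lambda> Box = (\<Prod>i\<in>{1..n}. emeasure lborel {t i<..u i})"
    by (rule lborel_prod.emeasure_PiM) auto
  also have "\<dots> = (\<Prod>i\<in>{1..n}. ennreal (u i - t i))"
    using cell by (intro prod.cong refl) (auto simp: less_imp_le)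
  also have "\<dots> = ennreal (\<Prod>i\<in>{1..n}. u i - t i)"
    using cell by (intro prod_ennreal) (auto simp: less_imp_le)
  finally show ?thesis by simp
qed

lemma Box_index:
  assumes "x \<in> Box"
  shows "\<exists>\<phi>\<in>idx m. x \<in> J m \<phi>"
proof -
  have "\<forall>i\<in>{1..n}. \<exists>j<Suc m. x i \<in> {sub m i j<..sub m i (Suc j)}"
  proof
    fix i assume i: "i \<in> {1..n}"
    have "x i \<in> {sub m i 0<..sub m i (Suc m)}"
      using assms i part_ends[of "Suc m" "t i" "u i"] by (auto simp: sub_def PiE_def Pi_def)
    then show "\<exists>j<Suc m. x i \<in> {sub m i j<..sub m i (Suc j)}" by (rule Ioc_cover)
  qed
  then obtain f where f: "\<And>i. i \<in> {1..n} \<Longrightarrow> f i < Suc m \<and> x i \<in> {sub m i (f i)<..sub m i (Suc (f i))}"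
    by metis
  have "restrict f {1..n} \<in> idx m" using f by (auto simp: idx_def)
  moreover have "x \<in> J m (restrict f {1..n})" using f assms by (auto simp: J_def PiE_def)
  ultimately show ?thesis by blast
qed

lemma J_index_unique:
  assumes "\<phi> \<in> idx m" "\<psi> \<in> idx m" "x \<in> J m \<phi>" "x \<in> J m \<psi>"
  shows "\<phi> = \<psi>"
proof (rule PiE_ext)
  show "\<phi> \<in> PiE {1..n} (\<lambda>_. {..<Suc m})" "\<psi> \<in> PiE {1..n} (\<lambda>_. {..<Suc m})" using assms by (auto simp: idx_def)
  fix i assume i: "i \<in> {1..n}"
  show "\<phi> i = \<psi> i"
    using assms i by (intro Ioc_cover_unique[of "sub m i" "x i"] sub_less) (auto simp: J_def PiE_def Pi_def)
qed

text \<open>Subcells keep the order of the cells containing them, so \<open>box_sign_changes\<close>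
  is available for them with the same \<open>\<sigma>\<close>.\<close>

lemma subcells:
  assumes \<phi>: "\<phi> \<in> idx m"
  shows "gaussian_cells M a n (\<lambda>i. sub m i (\<phi> i)) (\<lambda>i. sub m i (Suc (\<phi> i))) \<sigma>"
proof (intro gaussian_cells.intro cells.intro)
  show "gaussian_series M a" by (rule gaussian_series_axioms)
  fix i assume i: "i \<in> {1..n}"
  note b = sub_bounds[OF i] idx_le[OF \<phi> i]
  show "-1 < sub m i (\<phi> i) \<and> sub m i (\<phi> i) < sub m i (Suc (\<phi> i)) \<and> sub m i (Suc (\<phi> i)) < 1"
    using b(1)[of "\<phi> i" m] b(1)[of "Suc (\<phi> i)" m] b(2) cell[OF i] sub_less[OF i, of m "\<phi> i"] by auto
  fix j assume j: "j \<in> {1..n}" "i \<noteq> j"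
  note b' = sub_bounds[OF j(1)] idx_le[OF \<phi> j(1)]
  show "(sub m i (Suc (\<phi> i)) \<le> sub m j (\<phi> j) \<and> \<sigma> i j = 1) \<or> (sub m j (Suc (\<phi> j)) \<le> sub m i (\<phi> i) \<and> \<sigma> i j = -1)"
    using order[OF i j] b(1)[of "\<phi> i" m] b(1)[of "Suc (\<phi> i)" m] b(2) b'(1)[of "\<phi> j" m] b'(1)[of "Suc (\<phi> j)" m] b'(2) by auto
qed

lemma sigma_bound: "i \<in> {1..n} \<Longrightarrow> j \<in> {1..n} \<Longrightarrow> i \<noteq> j \<Longrightarrow> \<bar>\<sigma> i j\<bar> \<le> 1"
  using order[of i j] by auto

text \<open>The closed cells keep away from -1 and 1, so one radius \<open>r\<close> serves for
  \<open>kernel_bound\<close>. The constant dominates the step functions of the refinement.\<close>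

lemma pfl_ent_bound:
  "\<exists>C. \<forall>e v. (\<forall>i\<in>{1..n}. t i \<le> e i \<and> e i \<le> u i \<and> t i \<le> v i \<and> v i \<le> u i) \<longrightarrow> \<bar>pfl (ent \<sigma> {1..n} e v) (pf_rows n)\<bar> \<le> C"
proof -
  define r where "r = Max (insert 0 ((\<lambda>i. max \<bar>t i\<bar> \<bar>u i\<bar>) ` {1..n}))"
  have r0: "0 \<le> r" unfolding r_def by (intro Max_ge) auto
  have r1: "r < 1" unfolding r_def
  proof (subst Max_less_iff)
    show "\<forall>x\<in>insert 0 ((\<lambda>i. max \<bar>t i\<bar> \<bar>u i\<bar>) ` {1..n}). x < 1"
    proof
      fix x assume "x \<in> insert 0 ((\<lambda>i. max \<bar>t i\<bar> \<bar>u i\<bar>) ` {1..n})"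
      then consider "x = 0" | i where "i \<in> {1..n}" "x = max \<bar>t i\<bar> \<bar>u i\<bar>" by blast
      then show "x < 1"
      proof cases
        case 2 then show ?thesis using cell[OF 2(1)] by (simp add: abs_less_iff)
      qed simp
    qed
  qed auto
  have ri: "\<bar>x\<bar> \<le> r" if "i \<in> {1..n}" "t i \<le> x" "x \<le> u i" for x i
  proof -
    have "max \<bar>t i\<bar> \<bar>u i\<bar> \<le> r" unfolding r_def using that by (intro Max_ge) auto
    then show ?thesis using that by (auto simp: abs_le_iff max_def split: if_splits)
  qed
  obtain C where C: "C \<ge> 2" "\<And>x y. \<bar>x\<bar> \<le> r \<Longrightarrow> \<bar>y\<bar> \<le> r \<Longrightarrow> \<bar>k11 x y\<bar> \<le> C \<and> \<bar>k12 x y\<bar> \<le> C"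
    using kernel_bound[OF r0 r1] by blast
  have "C \<ge> 1" using C(1) by simp
  from pfl_bound[OF this, of "pf_rows n"]
  obtain D where "\<forall>b. (\<forall>p\<in>set (pf_rows n). \<forall>q\<in>set (pf_rows n). p \<noteq> q \<longrightarrow> \<bar>b p q\<bar> \<le> C) \<longrightarrow> distinct (pf_rows n) \<longrightarrow> \<bar>pfl b (pf_rows n)\<bar> \<le> D"
    by (rule exE)
  then have D: "\<bar>pfl b (pf_rows n)\<bar> \<le> D" if "\<forall>p\<in>set (pf_rows n). \<forall>q\<in>set (pf_rows n). p \<noteq> q \<longrightarrow> \<bar>b p q\<bar> \<le> C" for b
    using distinct_rows that by simp
  show ?thesis
  proof (intro exI allI impI)
    fix e v assume ev: "\<forall>i\<in>{1..n}. t i \<le> e i \<and> e i \<le> u i \<and> t i \<le> v i \<and> v i \<le> u i"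
    show "\<bar>pfl (ent \<sigma> {1..n} e v) (pf_rows n)\<bar> \<le> D"
    proof (intro D ballI impI)
      fix p q assume pq: "p \<in> set (pf_rows n)" "q \<in> set (pf_rows n)" "p \<noteq> q"
      have P: "\<bar>pt e v p\<bar> \<le> r" if "p \<in> set (pf_rows n)" for p
        using that ev ri[of "fst p"] by (auto simp: set_rows mem_Times_iff pt_def)
      have x1: "pt e v p \<in> {-1<..<1}" "pt e v q \<in> {-1<..<1}" using P[OF pq(1)] P[OF pq(2)] r1 by (auto simp: abs_le_iff)
      have as: "\<bar>arcsin (c_fun (pt e v p) (pt e v q))\<bar> \<le> pi / 2"
        using arcsin_bounded[of "c_fun (pt e v p) (pt e v q)"] c_fun_pos[OF x1] c_fun_le_1[OF x1] by auto
      have ps: "\<bar>psign \<sigma> p q\<bar> \<le> 1"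
        using sigma_bound[of "fst p" "fst q"] pq by (auto simp: psign_def set_rows mem_Times_iff)
      have "\<bar>psign \<sigma> p q\<bar> * \<bar>arcsin (c_fun (pt e v p) (pt e v q))\<bar> \<le> 1 * (pi / 2)"
        using as ps by (intro mult_mono) auto
      then have "\<bar>psign \<sigma> p q * arcsin (c_fun (pt e v p) (pt e v q))\<bar> \<le> C"
        using C(1) pi_less_4 by (simp add: abs_mult)
      then show "\<bar>ent \<sigma> {1..n} e v p q\<bar> \<le> C"
        using C(2)[OF P[OF pq(1)] P[OF pq(2)]] C(2)[OF P[OF pq(2)] P[OF pq(1)]] by (auto simp: ent_def)
    qed
  qed
qed

text \<open>By \<open>box_sign_changes\<close> on each product of subcells, the expected product of
  sign change counts is the integral of a step function \<open>R m\<close>. These step functions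
  converge boundedly to the density, while the products of counts stay below the product of the
  numbers of zeros and eventually equal it.\<close>

lemma cell_moment:
  shows "\<And>x. x \<in> Box \<Longrightarrow> 0 \<le> dens x"
    and "integrable \<Lambda> (\<lambda>x. dens x * indicator Box x)"
    and "(\<integral>\<^sup>+\<omega>. (\<Prod>i = 1..n. num_points (real_zeros a) {t i<..u i} \<omega>) \<partial>M) = ennreal (\<integral>x. dens x * indicator Box x \<partial>\<Lambda>)"
proof -
  let ?C = "\<lambda>m \<omega> i. changes (gf \<omega>) (sub m i) (Suc m)"
  define Q where "Q m \<phi> x \<longleftrightarrow> (\<forall>k\<in>{1..n}. sub m k (\<phi> k) < x k \<and> x k < sub m k (Suc (\<phi> k))) \<and>
    (\<integral>\<omega>. (\<Prod>i\<in>{1..n}. (1 - sgn (gf \<omega> (sub m i (\<phi> i))) * sgn (gf \<omega> (sub m i (Suc (\<phi> i))))) / 2) \<partial>M) =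
      (\<Prod>k\<in>{1..n}. sub m k (Suc (\<phi> k)) - sub m k (\<phi> k)) * ((1 / pi) ^ n * pfl (ent \<sigma> {1..n} x (\<lambda>i. sub m i (Suc (\<phi> i)))) (pf_rows n))" for m \<phi> x
  have ex: "\<exists>x. Q m \<phi> x" if "\<phi> \<in> idx m" for m \<phi>
    unfolding Q_def by (rule gaussian_cells.box_sign_changes[OF subcells[OF that]]) blast
  define \<xi> where "\<xi> m \<phi> = (SOME x. Q m \<phi> x)" for m \<phi>
  have \<xi>all: "(\<forall>k\<in>{1..n}. sub m k (\<phi> k) < \<xi> m \<phi> k \<and> \<xi> m \<phi> k < sub m k (Suc (\<phi> k))) \<and>
    (\<integral>\<omega>. (\<Prod>i\<in>{1..n}. (1 - sgn (gf \<omega> (sub m i (\<phi> i))) * sgn (gf \<omega> (sub m i (Suc (\<phi> i))))) / 2) \<partial>M) =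
      (\<Prod>k\<in>{1..n}. sub m k (Suc (\<phi> k)) - sub m k (\<phi> k)) * ((1 / pi) ^ n * pfl (ent \<sigma> {1..n} (\<xi> m \<phi>) (\<lambda>i. sub m i (Suc (\<phi> i)))) (pf_rows n))" if "\<phi> \<in> idx m" for m \<phi>
  proof -
    have "Q m \<phi> (\<xi> m \<phi>)" unfolding \<xi>_def by (rule someI_ex[OF ex[OF that]])
    then show ?thesis unfolding Q_def .
  qed
  have \<xi>: "sub m k (\<phi> k) < \<xi> m \<phi> k \<and> \<xi> m \<phi> k < sub m k (Suc (\<phi> k))" if "\<phi> \<in> idx m" "k \<in> {1..n}" for m \<phi> k
    by (rule \<xi>all[OF that(1), THEN conjunct1, rule_format, OF that(2)])
  note \<xi>int = \<xi>all[THEN conjunct2]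
  define c where "c m \<phi> = (1 / pi) ^ n * pfl (ent \<sigma> {1..n} (\<xi> m \<phi>) (\<lambda>i. sub m i (Suc (\<phi> i)))) (pf_rows n)" for m \<phi>
  define R where "R m x = (\<Sum>\<phi>\<in>idx m. c m \<phi> * indicator (J m \<phi>) x)" for m x
  obtain C where C: "\<And>e v. (\<forall>i\<in>{1..n}. t i \<le> e i \<and> e i \<le> u i \<and> t i \<le> v i \<and> v i \<le> u i) \<Longrightarrow> \<bar>pfl (ent \<sigma> {1..n} e v) (pf_rows n)\<bar> \<le> C"
    using pfl_ent_bound by blast
  define C' where "C' = (1 / pi) ^ n * C"
  have cb: "\<bar>c m \<phi>\<bar> \<le> C'" if \<phi>: "\<phi> \<in> idx m" for m \<phi>
  proof -
    have "\<bar>pfl (ent \<sigma> {1..n} (\<xi> m \<phi>) (\<lambda>i. sub m i (Suc (\<phi> i)))) (pf_rows n)\<bar> \<le> C"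
    proof (intro C ballI)
      fix i assume i: "i \<in> {1..n}"
      show "t i \<le> \<xi> m \<phi> i \<and> \<xi> m \<phi> i \<le> u i \<and> t i \<le> sub m i (Suc (\<phi> i)) \<and> sub m i (Suc (\<phi> i)) \<le> u i"
        using \<xi>[OF \<phi> i] sub_bounds[OF i, of "\<phi> i" m] sub_bounds[OF i, of "Suc (\<phi> i)" m] idx_le[OF \<phi> i] by auto
    qed
    then show ?thesis unfolding c_def C'_def abs_mult by (intro mult_mono) auto
  qed
  \<comment> \<open>\<open>c m \<phi>\<close> is an expectation of nonnegative detectors divided by
    the volume of the subcell box; this nonnegativity passes to the density in the limit.\<close>
  have c0: "0 \<le> c m \<phi>" if \<phi>: "\<phi> \<in> idx m" for m \<phi>
  proof -
    have pos: "0 < (\<Prod>k\<in>{1..n}. sub m k (Suc (\<phi> k)) - sub m k (\<phi> k))" using sub_less by (intro prod_pos) auto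
    have "0 \<le> (\<Prod>k\<in>{1..n}. sub m k (Suc (\<phi> k)) - sub m k (\<phi> k)) * c m \<phi>"
      unfolding c_def \<xi>int[OF \<phi>, symmetric] using changes_term_bounds(1)
      by (intro Bochner_Integration.integral_nonneg prod_nonneg) blast
    then show ?thesis using pos by (simp add: zero_le_mult_iff)
  qed
  have R_in: "R m x = c m \<phi>" if "\<phi> \<in> idx m" "x \<in> J m \<phi>" for m \<phi> x
  proof -
    have "R m x = (\<Sum>\<psi>\<in>{\<phi>}. c m \<psi> * indicator (J m \<psi>) x)"
      unfolding R_def
    proof (intro sum.mono_neutral_right finite_idx ballI)
      show "{\<phi>} \<subseteq> idx m" using that by simp
      fix \<psi> assume "\<psi> \<in> idx m - {\<phi>}"
      then have "x \<notin> J m \<psi>" using J_index_unique[OF that(1) _ that(2)] by blast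
      then show "c m \<psi> * indicator (J m \<psi>) x = 0" by simp
    qed
    then show ?thesis using that by simp
  qed
  have R_out: "R m x = 0" if "x \<notin> Box" for m x
    unfolding R_def
  proof (intro sum.neutral ballI)
    fix \<psi> assume "\<psi> \<in> idx m"
    then have "x \<notin> J m \<psi>" using J_subset that by blast
    then show "c m \<psi> * indicator (J m \<psi>) x = 0" by simp
  qed
  have R_lim: "(\<lambda>m. R m x) \<longlonglongrightarrow> dens x * indicator Box x" for x
  proof (cases "x \<in> Box")
    case True
    have "\<forall>m. \<exists>\<phi>. \<phi> \<in> idx m \<and> x \<in> J m \<phi>" using Box_index[OF True] by blast
    then obtain \<phi> where \<phi>: "\<And>m. \<phi> m \<in> idx m \<and> x \<in> J m (\<phi> m)" by (auto dest!: choice)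
    have near: "\<bar>\<xi> m (\<phi> m) k - x k\<bar> \<le> (u k - t k) / real (Suc m) \<and> \<bar>sub m k (Suc (\<phi> m k)) - x k\<bar> \<le> (u k - t k) / real (Suc m)"
      if k: "k \<in> {1..n}" for m k
    proof -
      have "x k \<in> {sub m k (\<phi> m k)<..sub m k (Suc (\<phi> m k))}" using \<phi>[of m] k by (auto simp: J_def PiE_def Pi_def)
      then show ?thesis using \<xi>[of "\<phi> m" m k] \<phi>[of m] k sub_step[of m k "\<phi> m k"] by (auto simp: abs_le_iff)
    qed
    have z: "(\<lambda>m. (u k - t k) / real (Suc m)) \<longlonglongrightarrow> 0" for k by (rule LIMSEQ_Suc[OF lim_const_over_n])
    have l1: "(\<lambda>m. \<xi> m (\<phi> m) k) \<longlonglongrightarrow> x k" if k: "k \<in> {1..n}" for k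
      by (rule LIM_zero_cancel, rule Lim_null_comparison[OF _ z[of k]]) (use near[OF k] in auto)
    have l2: "(\<lambda>m. sub m k (Suc (\<phi> m k))) \<longlonglongrightarrow> x k" if k: "k \<in> {1..n}" for k
      by (rule LIM_zero_cancel, rule Lim_null_comparison[OF _ z[of k]]) (use near[OF k] in auto)
    have x1: "x k \<in> {-1<..<1} \<and> x k \<in> {-1<..<1}" if k: "k \<in> {1..n}" for k
    proof -
      have "x k \<in> {t k<..u k}" using True k by (auto simp: PiE_def Pi_def)
      then show ?thesis using cell[OF k] by auto
    qed
    have "(\<lambda>m. c m (\<phi> m)) \<longlonglongrightarrow> dens x"
      unfolding c_def dens_def by (intro tendsto_mult tendsto_const tendsto_pfl_ent l1 l2 x1)
    moreover have "R m x = c m (\<phi> m)" for m using \<phi>[of m] by (intro R_in) auto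
    ultimately show ?thesis using True by simp
  qed (simp add: R_out)
  have R_bound: "\<bar>R m x\<bar> \<le> C' * indicator Box x" for m x
  proof (cases "x \<in> Box")
    case True
    then obtain \<phi> where "\<phi> \<in> idx m" "x \<in> J m \<phi>" using Box_index by blast
    then show ?thesis using True R_in cb by simp
  qed (simp add: R_out)
  have R0: "0 \<le> R m x" for m x
    unfolding R_def by (intro sum_nonneg mult_nonneg_nonneg c0) auto
  show dens0: "0 \<le> dens x" if "x \<in> Box" for x
    using LIMSEQ_le_const[OF R_lim[of x], of 0] R0 that by auto
  have Rmeas [measurable]: "R m \<in> borel_measurable \<Lambda>" for m unfolding R_def[abs_def] by measurable
  have meas[measurable]: "(\<lambda>x. dens x * indicator Box x) \<in> borel_measurable \<Lambda>"
    by (rule borel_measurable_LIMSEQ_real[OF R_lim]) measurable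
  have iBox: "integrable \<Lambda> (\<lambda>x. C' * indicator Box x)"
    using emeasure_Box by (intro integrable_mult_right integrable_real_indicator) auto
  have A: "AE x in \<Lambda>. (\<lambda>m. R m x) \<longlonglongrightarrow> dens x * indicator Box x" "AE x in \<Lambda>. norm (R m x) \<le> C' * indicator Box x" for m
    unfolding real_norm_def by (rule AE_I2, rule R_lim, rule AE_I2, rule R_bound)
  have Slim: "(\<lambda>m. \<integral>x. R m x \<partial>\<Lambda>) \<longlonglongrightarrow> (\<integral>x. dens x * indicator Box x \<partial>\<Lambda>)"
    by (rule integral_dominated_convergence[OF meas Rmeas iBox A])
  show dint: "integrable \<Lambda> (\<lambda>x. dens x * indicator Box x)"
    by (rule integrable_dominated_convergence[OF meas Rmeas iBox A])
  have S: "(\<integral>\<omega>. (\<Prod>i\<in>{1..n}. ?C m \<omega> i) \<partial>M) = (\<integral>x. R m x \<partial>\<Lambda>)" for m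
  proof -
    have tb: "\<bar>\<Prod>i\<in>{1..n}. (1 - sgn (f i) * sgn (g i)) / (2::real)\<bar> \<le> 1" for f g
      unfolding abs_prod using changes_term_bounds by (intro prod_le_1) auto
    \<comment> \<open>Multiplying out the counts gives one term for each choice of one subcell in
      every cell.\<close>
    have "(\<integral>\<omega>. (\<Prod>i\<in>{1..n}. ?C m \<omega> i) \<partial>M) =
      (\<integral>\<omega>. (\<Sum>\<phi>\<in>idx m. \<Prod>i\<in>{1..n}. (1 - sgn (gf \<omega> (sub m i (\<phi> i))) * sgn (gf \<omega> (sub m i (Suc (\<phi> i))))) / 2) \<partial>M)"
      unfolding changes_def idx_def by (subst prod_sum_PiE) auto
    also have "\<dots> = (\<Sum>\<phi>\<in>idx m. \<integral>\<omega>. (\<Prod>i\<in>{1..n}. (1 - sgn (gf \<omega> (sub m i (\<phi> i))) * sgn (gf \<omega> (sub m i (Suc (\<phi> i))))) / 2) \<partial>M)"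
      by (intro Bochner_Integration.integral_sum integrable_const_bound[of _ 1]) (use tb in auto)
    also have "\<dots> = (\<Sum>\<phi>\<in>idx m. c m \<phi> * measure \<Lambda> (J m \<phi>))"
    proof (intro sum.cong refl)
      fix \<phi> assume \<phi>: "\<phi> \<in> idx m"
      have "measure \<Lambda> (J m \<phi>) = (\<Prod>i\<in>{1..n}. sub m i (Suc (\<phi> i)) - sub m i (\<phi> i))"
        unfolding measure_def emeasure_J using sub_less by (intro enn2real_ennreal prod_nonneg) (auto simp: less_imp_le)
      then show "(\<integral>\<omega>. (\<Prod>i\<in>{1..n}. (1 - sgn (gf \<omega> (sub m i (\<phi> i))) * sgn (gf \<omega> (sub m i (Suc (\<phi> i))))) / 2) \<partial>M) = c m \<phi> * measure \<Lambda> (J m \<phi>)"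
        unfolding \<xi>int[OF \<phi>] by (simp add: c_def)
    qed
    also have "\<dots> = (\<integral>x. R m x \<partial>\<Lambda>)"
    proof -
      have iJ: "integrable \<Lambda> (\<lambda>x. c m \<phi> * indicator (J m \<phi>) x)" for \<phi>
        by (intro integrable_mult_right integrable_real_indicator sets_J) (unfold emeasure_J, simp)
      show ?thesis unfolding R_def by (subst Bochner_Integration.integral_sum[OF iJ]) (simp add: sets.Int_space_eq2[OF sets_J] del: One_nat_def)
    qed
    finally show ?thesis .
  qed
  define P where "P \<omega> = (\<Prod>i = 1..n. num_points (real_zeros a) {t i<..u i} \<omega>)" for \<omega>
  have AEi: "AE \<omega> in M. \<forall>i\<in>{1..n}. (\<exists>N::nat. num_points (real_zeros a) {t i<..u i} \<omega> = ennreal (real N) \<and>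
     (\<forall>m. ?C m \<omega> i \<le> real N) \<and> (\<forall>\<^sub>F m in sequentially. ?C m \<omega> i = real N))"
    unfolding sub_def using cell by (intro AE_finite_allI AE_cell_count) auto
  \<comment> \<open>The products of counts are bounded by their limit. Fatou's lemma then gives one
    inequality and monotonicity the other, in place of an integrable bound for the number of
    zeros.\<close>
  have AEP: "AE \<omega> in M. (\<forall>m. ennreal (\<Prod>i\<in>{1..n}. ?C m \<omega> i) \<le> P \<omega>) \<and> P \<omega> = liminf (\<lambda>m. ennreal (\<Prod>i\<in>{1..n}. ?C m \<omega> i))"
    using AEi
  proof eventually_elim
    case (elim \<omega>)
    then obtain N :: "nat \<Rightarrow> nat" where N: "\<And>i. i \<in> {1..n} \<Longrightarrow> num_points (real_zeros a) {t i<..u i} \<omega> = ennreal (real (N i))"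
      "\<And>i m. i \<in> {1..n} \<Longrightarrow> ?C m \<omega> i \<le> real (N i)" "\<And>i. i \<in> {1..n} \<Longrightarrow> \<forall>\<^sub>F m in sequentially. ?C m \<omega> i = real (N i)"
      unfolding bchoice_iff by blast
    have P: "P \<omega> = ennreal (\<Prod>i\<in>{1..n}. real (N i))"
      unfolding P_def using N(1) by (simp add: prod_ennreal)
    have "\<forall>\<^sub>F m in sequentially. \<forall>i\<in>{1..n}. ?C m \<omega> i = real (N i)"
      using N(3) by (intro eventually_ball_finite) auto
    then have "\<forall>\<^sub>F m in sequentially. ennreal (\<Prod>i\<in>{1..n}. ?C m \<omega> i) = P \<omega>"
      by eventually_elim (simp add: P)
    then have "(\<lambda>m. ennreal (\<Prod>i\<in>{1..n}. ?C m \<omega> i)) \<longlonglongrightarrow> P \<omega>" by (rule tendsto_eventually)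
    then have "P \<omega> = liminf (\<lambda>m. ennreal (\<Prod>i\<in>{1..n}. ?C m \<omega> i))"
      by (intro lim_imp_Liminf[symmetric]) auto
    moreover have "ennreal (\<Prod>i\<in>{1..n}. ?C m \<omega> i) \<le> P \<omega>" for m
      unfolding P using N(2) changes_nonneg by (intro ennreal_leI prod_mono) auto
    ultimately show ?case by blast
  qed
  have nnS: "(\<integral>\<^sup>+\<omega>. ennreal (\<Prod>i\<in>{1..n}. ?C m \<omega> i) \<partial>M) = ennreal (\<integral>x. R m x \<partial>\<Lambda>)" for m
    unfolding S[symmetric]
  proof (rule nn_integral_eq_integral)
    have "(\<Prod>i\<in>{1..n}. ?C m \<omega> i) \<le> (\<Prod>i\<in>{1..n}. real (Suc m))" for \<omega>
      by (rule prod_mono) (intro conjI changes_nonneg changes_le)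
    then show "integrable M (\<lambda>\<omega>. \<Prod>i\<in>{1..n}. ?C m \<omega> i)"
      using changes_nonneg by (intro integrable_const_bound[of _ "\<Prod>i\<in>{1..n}. real (Suc m)"]) (auto simp: abs_prod simp del: prod_constant of_nat_Suc)
  qed (auto intro!: prod_nonneg changes_nonneg)
  have lim: "(\<lambda>m. \<integral>\<^sup>+\<omega>. ennreal (\<Prod>i\<in>{1..n}. ?C m \<omega> i) \<partial>M) \<longlonglongrightarrow> ennreal (\<integral>x. dens x * indicator Box x \<partial>\<Lambda>)"
    unfolding nnS by (intro tendsto_ennrealI Slim)
  have "(\<integral>\<^sup>+\<omega>. P \<omega> \<partial>M) = (\<integral>\<^sup>+\<omega>. liminf (\<lambda>m. ennreal (\<Prod>i\<in>{1..n}. ?C m \<omega> i)) \<partial>M)"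
    using AEP by (intro nn_integral_cong_AE) (auto elim: eventually_mono)
  also have "\<dots> \<le> liminf (\<lambda>m. \<integral>\<^sup>+\<omega>. ennreal (\<Prod>i\<in>{1..n}. ?C m \<omega> i) \<partial>M)"
    by (rule nn_integral_liminf) measurable
  also have "\<dots> = ennreal (\<integral>x. dens x * indicator Box x \<partial>\<Lambda>)"
    by (rule lim_imp_Liminf[OF _ lim]) auto
  finally have "(\<integral>\<^sup>+\<omega>. P \<omega> \<partial>M) \<le> ennreal (\<integral>x. dens x * indicator Box x \<partial>\<Lambda>)" .
  moreover have "ennreal (\<integral>x. dens x * indicator Box x \<partial>\<Lambda>) \<le> (\<integral>\<^sup>+\<omega>. P \<omega> \<partial>M)"
  proof (rule LIMSEQ_le_const2[OF lim], intro exI allI impI)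
    fix m
    show "(\<integral>\<^sup>+\<omega>. ennreal (\<Prod>i\<in>{1..n}. ?C m \<omega> i) \<partial>M) \<le> (\<integral>\<^sup>+\<omega>. P \<omega> \<partial>M)"
      using AEP by (intro nn_integral_mono_AE) (auto elim: eventually_mono)
  qed
  ultimately show "(\<integral>\<^sup>+\<omega>. (\<Prod>i = 1..n. num_points (real_zeros a) {t i<..u i} \<omega>) \<partial>M) = ennreal (\<integral>x. dens x * indicator Box x \<partial>\<Lambda>)"
    unfolding P_def by (rule antisym)
qed

end

section \<open>From cells to Borel sets\<close>

text \<open>With extended values an empty factor gives 0 even beside an infinite one; if no factor
  is empty, a single infinite one makes the product infinite.\<close>

lemma emeasure_count_PiE:
  assumes "finite I"
  shows "emeasure (count_space UNIV) (PiE I S) = (\<Prod>i\<in>I. emeasure (count_space UNIV) (S i))"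
proof (cases "\<exists>j\<in>I. S j = {}")
  case True
  then obtain j where j: "j \<in> I" "S j = {}" by blast
  then have "PiE I S = {}" by (auto simp: PiE_eq_empty_iff)
  moreover have "(\<Prod>i\<in>I. emeasure (count_space UNIV) (S i)) = 0"
    by (rule prod_zero[OF assms], rule bexI[OF _ j(1)]) (simp add: j(2))
  ultimately show ?thesis by simp
next
  case ne: False
  show ?thesis
  proof (cases "\<forall>i\<in>I. finite (S i)")
    case True
    then have "finite (PiE I S)" using assms by (intro finite_PiE) auto
    then show ?thesis using True assms by (simp add: card_PiE)
  next
    case False
    then obtain i where i: "i \<in> I" "infinite (S i)" by blast
    obtain f where f: "f \<in> PiE I S" using ne by (metis PiE_eq_empty_iff ex_in_conv)
    have "inj_on (\<lambda>y. f(i := y)) (S i)" by (rule inj_onI) (metis fun_upd_same)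
    moreover have "(\<lambda>y. f(i := y)) ` S i \<subseteq> PiE I S" using f i(1) by (auto simp: PiE_def Pi_def extensional_def)
    ultimately have inf: "infinite (PiE I S)" using i(2) by (metis finite_subset finite_imageD)
    have nz: "finite A \<Longrightarrow> (\<forall>k\<in>A. g k \<noteq> 0) \<Longrightarrow> prod g A \<noteq> 0" for g :: "'a \<Rightarrow> ennreal" and A
      by (induction A rule: finite_induct) auto
    have "(\<Prod>k\<in>I - {i}. emeasure (count_space UNIV) (S k)) \<noteq> 0"
      using ne assms by (intro nz) (auto simp: emeasure_count_space_eq_0)
    then have "(\<Prod>k\<in>I. emeasure (count_space UNIV) (S k)) = \<infinity>"
      using i assms by (simp add: prod.remove[of I i] ennreal_top_mult)
    then show ?thesis using inf by simp
  qed
qed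

text \<open>Boxes of half-open intervals are stable under intersection and fit the cells, so the
  Dynkin argument can start from this generator.\<close>

lemma sets_PiM_Ioc:
  assumes "finite I"
  shows "sets (PiM I (\<lambda>_. lborel :: real measure)) =
    sigma_sets (PiE I (\<lambda>_. UNIV)) {PiE I F |F. \<forall>i\<in>I. F i \<in> range (\<lambda>(a, b). {a<..b::real})}"
proof -
  let ?E = "range (\<lambda>(a, b). {a<..b::real})"
  have "sets (PiM I (\<lambda>_. lborel :: real measure)) = sets (PiM I (\<lambda>_. sigma UNIV ?E))"
    by (intro sets_PiM_cong refl) (metis borel_sigma_sets_Ioc sets_lborel)
  also have "\<dots> = sets (sigma (PiE I (\<lambda>_. UNIV)) {{f \<in> PiE I (\<lambda>_. UNIV). \<forall>i\<in>j. f i \<in> A i} |A j. j \<in> {I} \<and> A \<in> Pi j (\<lambda>_. ?E)})"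
  proof (rule sets_PiM_sigma)
    show "\<exists>S\<subseteq>?E. countable S \<and> UNIV = \<Union>S"
    proof (intro exI conjI)
      show "range (\<lambda>n::nat. {- real n<..real n}) \<subseteq> ?E" by auto
      have "\<exists>n::nat. x \<in> {- real n<..real n}" for x :: real
      proof -
        obtain n :: nat where "\<bar>x\<bar> < real n" using reals_Archimedean2 by blast
        then show ?thesis by (intro exI[of _ n]) auto
      qed
      then show "UNIV = \<Union>(range (\<lambda>n::nat. {- real n<..real n}))" by blast
    qed simp
  qed (use assms in auto)
  also have "{{f \<in> PiE I (\<lambda>_. UNIV). \<forall>i\<in>j. f i \<in> A i} |A j. j \<in> {I} \<and> A \<in> Pi j (\<lambda>_. ?E)} = {PiE I F |F. \<forall>i\<in>I. F i \<in> ?E}"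
  proof -
    have eq: "{f \<in> PiE I (\<lambda>_. UNIV). \<forall>i\<in>I. f i \<in> A i} = PiE I A" for A :: "'a \<Rightarrow> real set" by (auto simp: PiE_def)
    show ?thesis
    proof (intro set_eqI iffI; elim CollectE exE conjE)
      fix X A j assume "X = {f \<in> PiE I (\<lambda>_. UNIV). \<forall>i\<in>j. f i \<in> A i}" "j \<in> {I}" "A \<in> Pi j (\<lambda>_. ?E)"
      then have "X = PiE I A" "\<forall>i\<in>I. A i \<in> ?E" using eq[of A] unfolding Pi_def by simp_all
      then show "X \<in> {PiE I F |F. \<forall>i\<in>I. F i \<in> ?E}" by blast
    next
      fix X F assume "X = PiE I F" "\<forall>i\<in>I. F i \<in> ?E"
      then have "X = {f \<in> PiE I (\<lambda>_. UNIV). \<forall>i\<in>I. f i \<in> F i} \<and> I \<in> {I} \<and> F \<in> Pi I (\<lambda>_. ?E)" using eq[of F] unfolding Pi_def by simp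
      then show "X \<in> {{f \<in> PiE I (\<lambda>_. UNIV). \<forall>i\<in>j. f i \<in> A i} |A j. j \<in> {I} \<and> A \<in> Pi j (\<lambda>_. ?E)}"
        by (intro CollectI exI)
    qed
  qed
  also have "sets (sigma (PiE I (\<lambda>_. UNIV)) {PiE I F |F. \<forall>i\<in>I. F i \<in> ?E}) = sigma_sets (PiE I (\<lambda>_. UNIV)) {PiE I F |F. \<forall>i\<in>I. F i \<in> ?E}"
    by (rule sets_measure_of) (auto simp: PiE_def)
  finally show ?thesis .
qed

lemma measurable_completion_AE:
  assumes f: "f \<in> borel_measurable (completion M)" and AE: "AE \<omega> in M. f \<omega> = g \<omega>"
  shows "g \<in> borel_measurable (completion M)"
proof (rule measurableI)
  fix A :: "'b set" assume A: "A \<in> sets borel"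
  show "g -` A \<inter> space (completion M) \<in> sets (completion M)"
  proof (rule completion.in_sets_AE)
    show "f -` A \<inter> space (completion M) \<in> sets (completion M)" by (rule measurable_sets[OF f A])
    have "AE \<omega> in completion M. f \<omega> = g \<omega>" by (rule AE_completion[OF AE])
    then show "AE \<omega> in completion M. (\<omega> \<in> f -` A \<inter> space (completion M)) = (\<omega> \<in> g -` A \<inter> space (completion M))"
      by eventually_elim auto
  qed auto
qed auto

context gaussian_series
begin

definition regular :: "'w \<Rightarrow> bool" where
  "regular \<omega> \<longleftrightarrow> good \<omega> \<and> (\<forall>x\<in>{-1<..<1}. gf \<omega> x = 0 \<longrightarrow> gfd \<omega> x \<noteq> 0)"

lemma AE_regular: "AE \<omega> in M. regular \<omega>"
  using AE_good AE_simple_zeros by eventually_elim (simp add: regular_def)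

text \<open>Discarding a null set makes all numbers of points in compact subintervals finite.\<close>

definition Z :: "'w \<Rightarrow> real set" where
  "Z \<omega> = (if regular \<omega> then real_zeros a \<omega> else {})"

lemma AE_num_points_Z: "AE \<omega> in M. \<forall>B. num_points Z B \<omega> = num_points (real_zeros a) B \<omega>"
  using AE_regular by eventually_elim (simp add: num_points_def Z_def)

lemma finite_Z:
  assumes "-1 < \<alpha>" "\<beta> < 1"
  shows "finite (Z \<omega> \<inter> {\<alpha><..\<beta>})"
proof (cases "regular \<omega>")
  case True
  then have g: "good \<omega>" and s: "\<And>x. x \<in> {-1<..<1} \<Longrightarrow> gf \<omega> x = 0 \<Longrightarrow> gfd \<omega> x \<noteq> 0" by (auto simp: regular_def)
  have "finite {x \<in> {\<alpha>..\<beta>}. gf \<omega> x = 0}"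
  proof (rule finite_simple_zeros)
    fix x assume "x \<in> {\<alpha>..\<beta>}"
    then have x: "x \<in> {-1<..<1}" using assms by auto
    show "(gf \<omega> has_real_derivative gfd \<omega> x) (at x)" using x by (intro DERIV_gf' g) (auto simp: abs_less_iff)
    show "gf \<omega> x = 0 \<Longrightarrow> gfd \<omega> x \<noteq> 0" by (rule s[OF x])
  qed
  moreover have "Z \<omega> \<inter> {\<alpha><..\<beta>} \<subseteq> {x \<in> {\<alpha>..\<beta>}. gf \<omega> x = 0}"
    unfolding Z_def real_zeros_eq[OF g] by auto
  ultimately show ?thesis by (rule finite_subset[rotated])
qed (simp add: Z_def)

text \<open>Almost surely the number of zeros is the lower limit of measurable counts of sign
  changes; the exceptional null set accounts for the completion.\<close>

lemma measurable_num_points_cell: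
  assumes "-1 < \<alpha>" "\<beta> < 1"
  shows "num_points Z {\<alpha><..\<beta>} \<in> borel_measurable (completion M)"
proof (cases "\<alpha> < \<beta>")
  case True
  define f where "f \<omega> = liminf (\<lambda>m. ennreal (changes (gf \<omega>) (part \<alpha> \<beta> (Suc m)) (Suc m)))" for \<omega>
  have "f \<in> borel_measurable M" unfolding f_def by measurable
  then have "f \<in> borel_measurable (completion M)" by (rule measurable_completion)
  moreover have "AE \<omega> in M. f \<omega> = num_points Z {\<alpha><..\<beta>} \<omega>"
    using AE_cell_count[OF assms(1) True assms(2)] AE_num_points_Z
  proof eventually_elim
    case (elim \<omega>)
    then obtain N where N: "num_points (real_zeros a) {\<alpha><..\<beta>} \<omega> = ennreal (real N)"
      "\<forall>\<^sub>F m in sequentially. changes (gf \<omega>) (part \<alpha> \<beta> (Suc m)) (Suc m) = real N" by blast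
    have "\<forall>\<^sub>F m in sequentially. ennreal (changes (gf \<omega>) (part \<alpha> \<beta> (Suc m)) (Suc m)) = ennreal (real N)"
      using N(2) by eventually_elim simp
    then have "f \<omega> = ennreal (real N)"
      unfolding f_def by (intro lim_imp_Liminf tendsto_eventually) auto
    then show ?case using elim(2) N(1) by simp
  qed
  ultimately show ?thesis by (rule measurable_completion_AE)
next
  case False
  then have "num_points Z {\<alpha><..\<beta>} = (\<lambda>_. 0)" by (auto simp: num_points_def)
  then show ?thesis by simp
qed

end

section \<open>The mean measure of tuples of zeros\<close>

context gaussian_cells
begin

definition tup :: "'w \<Rightarrow> (nat \<Rightarrow> real) set" where
  "tup \<omega> = PiE {1..n} (\<lambda>i. Z \<omega> \<inter> {t i<..u i})"

lemma finite_tup: "finite (tup \<omega>)"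
  unfolding tup_def using cell by (intro finite_PiE finite_Z) auto

text \<open>Counting tuples with one zero in each cell, instead of multiplying numbers of zeros,
  gives a quantity that is additive in \<open>A\<close>, so its mean is a measure that can be
  compared with a density beyond product sets.\<close>

definition Nt :: "(nat \<Rightarrow> real) set \<Rightarrow> 'w \<Rightarrow> ennreal" where
  "Nt A \<omega> = emeasure (count_space UNIV) (tup \<omega> \<inter> A)"

definition h :: "(nat \<Rightarrow> real) \<Rightarrow> ennreal" where
  "h x = ennreal (dens x * indicator Box x)"

lemma measurable_h [measurable]: "h \<in> borel_measurable \<Lambda>"
  unfolding h_def[abs_def] using cell_moment(2) by measurable

text \<open>A box cuts every cell down to a smaller half-open cell, and the order of the cells
  persists. So \<open>cell_moment\<close> applies to the cut family, unless some cell becomes empty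
  and both sides are 0.\<close>

lemma Nt_box:
  fixes F :: "nat \<Rightarrow> real set"
  assumes F: "\<forall>i\<in>{1..n}. F i \<in> range (\<lambda>(a, b). {a<..b::real})"
  shows "Nt (PiE {1..n} F) \<in> borel_measurable (completion M)"
    and "(\<integral>\<^sup>+\<omega>. Nt (PiE {1..n} F) \<omega> \<partial>completion M) = emeasure (density \<Lambda> h) (PiE {1..n} F)"
    and "(\<integral>\<^sup>+\<omega>. Nt (PiE {1..n} F) \<omega> \<partial>completion M) < \<infinity>"
proof -
  have "\<forall>i\<in>{1..n}. \<exists>p. F i = {fst p<..snd p}" using F by (fastforce simp: image_iff)
  then obtain p where p: "\<And>i. i \<in> {1..n} \<Longrightarrow> F i = {fst (p i)<..snd (p i)}" unfolding bchoice_iff by blast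
  define t' where "t' i = max (t i) (fst (p i))" for i
  define u' where "u' i = min (u i) (snd (p i))" for i
  have cap: "{t i<..u i} \<inter> F i = {t' i<..u' i}" if "i \<in> {1..n}" for i
    unfolding p[OF that] t'_def u'_def by auto
  have A: "PiE {1..n} F \<in> sets \<Lambda>" using p by (intro sets_PiM_I_finite) auto
  have b1: "-1 < t' i" "u' i < 1" if "i \<in> {1..n}" for i using cell[OF that] by (auto simp: t'_def u'_def)
  have eq: "Nt (PiE {1..n} F) = (\<lambda>\<omega>. \<Prod>i = 1..n. num_points Z {t' i<..u' i} \<omega>)"
  proof
    fix \<omega>
    have "tup \<omega> \<inter> PiE {1..n} F = PiE {1..n} (\<lambda>i. Z \<omega> \<inter> {t' i<..u' i})"
      unfolding tup_def PiE_Int using cap by (intro PiE_cong) auto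
    then show "Nt (PiE {1..n} F) \<omega> = (\<Prod>i = 1..n. num_points Z {t' i<..u' i} \<omega>)"
      unfolding Nt_def num_points_def by (simp add: emeasure_count_PiE)
  qed
  show "Nt (PiE {1..n} F) \<in> borel_measurable (completion M)"
    unfolding eq using b1 by (intro borel_measurable_prod_ennreal measurable_num_points_cell) auto
  have R: "emeasure (density \<Lambda> h) (PiE {1..n} F) = (\<integral>\<^sup>+x. h x * indicator (PiE {1..n} F) x \<partial>\<Lambda>)"
    by (rule emeasure_density[OF measurable_h A])
  have BoxF: "Box \<inter> PiE {1..n} F = PiE {1..n} (\<lambda>i. {t' i<..u' i})"
    unfolding PiE_Int using cap by (intro PiE_cong) auto
  have L: "(\<integral>\<^sup>+\<omega>. Nt (PiE {1..n} F) \<omega> \<partial>completion M) = (\<integral>\<^sup>+\<omega>. (\<Prod>i = 1..n. num_points (real_zeros a) {t' i<..u' i} \<omega>) \<partial>M)"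
    unfolding eq nn_integral_completion using AE_num_points_Z
    by (intro nn_integral_cong_AE) (auto elim!: eventually_mono)
  have "(\<integral>\<^sup>+\<omega>. Nt (PiE {1..n} F) \<omega> \<partial>completion M) = emeasure (density \<Lambda> h) (PiE {1..n} F) \<and>
    (\<integral>\<^sup>+\<omega>. Nt (PiE {1..n} F) \<omega> \<partial>completion M) < \<infinity>"
  proof (cases "\<exists>i\<in>{1..n}. u' i \<le> t' i")
    case True
    then obtain i where i: "i \<in> {1..n}" "u' i \<le> t' i" by blast
    then have e: "{t' i<..u' i} = {}" by simp
    have "(\<Prod>i = 1..n. num_points (real_zeros a) {t' i<..u' i} \<omega>) = 0" for \<omega>
      using i(1) e by (intro prod_zero) (auto simp: num_points_def intro!: bexI[of _ i])
    then have 1: "(\<integral>\<^sup>+\<omega>. Nt (PiE {1..n} F) \<omega> \<partial>completion M) = 0" unfolding L by (simp only: nn_integral_const) simp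
    have "PiE {1..n} (\<lambda>i. {t' i<..u' i}) = {}" unfolding PiE_eq_empty_iff using i(1) e by blast
    then have "h x * indicator (PiE {1..n} F) x = 0" for x
      using BoxF by (auto simp: h_def indicator_def)
    then show ?thesis unfolding R 1 by (simp only: nn_integral_const) simp
  next
    case False
    interpret c: gaussian_cells M a n t' u' \<sigma>
    proof (intro gaussian_cells.intro cells.intro)
      show "gaussian_series M a" by (rule gaussian_series_axioms)
      fix i assume i: "i \<in> {1..n}"
      show "-1 < t' i \<and> t' i < u' i \<and> u' i < 1" using False i b1[OF i] by (auto simp: not_le)
      fix j assume j: "j \<in> {1..n}" "i \<noteq> j"
      show "(u' i \<le> t' j \<and> \<sigma> i j = 1) \<or> (u' j \<le> t' i \<and> \<sigma> i j = -1)"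
        using order[OF i j] by (auto simp: t'_def u'_def)
    qed
    have "(\<integral>\<^sup>+x. h x * indicator (PiE {1..n} F) x \<partial>\<Lambda>) = (\<integral>\<^sup>+x. ennreal (c.dens x * indicator c.Box x) \<partial>\<Lambda>)"
    proof (rule nn_integral_cong)
      fix x
      have "(x \<in> Box \<and> x \<in> PiE {1..n} F) \<longleftrightarrow> x \<in> c.Box" unfolding BoxF[symmetric] by blast
      then show "h x * indicator (PiE {1..n} F) x = ennreal (c.dens x * indicator c.Box x)"
        unfolding h_def c.dens_def dens_def indicator_def by auto
    qed
    also have "\<dots> = ennreal (\<integral>x. c.dens x * indicator c.Box x \<partial>\<Lambda>)"
      using c.cell_moment(1) by (intro nn_integral_eq_integral c.cell_moment(2)) (auto simp: indicator_def)
    finally show ?thesis unfolding R L c.cell_moment(3) by simp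
  qed
  then show "(\<integral>\<^sup>+\<omega>. Nt (PiE {1..n} F) \<omega> \<partial>completion M) = emeasure (density \<Lambda> h) (PiE {1..n} F)"
    "(\<integral>\<^sup>+\<omega>. Nt (PiE {1..n} F) \<omega> \<partial>completion M) < \<infinity>" by auto
qed

text \<open>The Dynkin step from boxes to measurable sets. Complements are obtained by subtraction,
  which is legitimate because the tuples are finite in number and their mean number is
  finite.\<close>

lemma Nt_moment:
  assumes "A \<in> sets \<Lambda>"
  shows "Nt A \<in> borel_measurable (completion M) \<and> (\<integral>\<^sup>+\<omega>. Nt A \<omega> \<partial>completion M) = emeasure (density \<Lambda> h) A"
proof -
  let ?\<Omega> = "PiE {1..n} (\<lambda>_. UNIV :: real set)"
  let ?G = "{PiE {1..n} F |F. \<forall>i\<in>{1..n}. F i \<in> range (\<lambda>(a, b). {a<..b::real})}"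
  have sets: "sets \<Lambda> = sigma_sets ?\<Omega> ?G" by (rule sets_PiM_Ioc) simp
  have sp: "space (density \<Lambda> h) = ?\<Omega>" by (simp add: space_PiM)
  have BoxG: "\<forall>i\<in>{1..n}. {t i<..u i} \<in> range (\<lambda>(a, b). {a<..b::real})" by auto
  have tup_Box: "tup \<omega> \<subseteq> Box" for \<omega> unfolding tup_def by (intro PiE_mono) auto
  have tup_\<Omega>: "tup \<omega> \<subseteq> ?\<Omega>" for \<omega> unfolding tup_def by (intro PiE_mono) auto
  have "tup \<omega> \<inter> ?\<Omega> = tup \<omega> \<inter> Box" for \<omega> using tup_Box tup_\<Omega> by blast
  then have Nt\<Omega>: "Nt ?\<Omega> = Nt Box" by (auto simp: Nt_def)
  have \<nu>\<Omega>: "emeasure (density \<Lambda> h) ?\<Omega> = emeasure (density \<Lambda> h) Box"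
  proof -
    have S: "?\<Omega> \<in> sets \<Lambda>" using sets.top[of \<Lambda>] by (simp add: space_PiM)
    have "h x * indicator ?\<Omega> x = h x * indicator Box x" for x
      by (auto simp: h_def indicator_def PiE_def)
    then show ?thesis by (simp add: emeasure_density[OF measurable_h S] emeasure_density[OF measurable_h sets_Box] del: One_nat_def)
  qed
  note tot = Nt_box[OF BoxG, folded Nt\<Omega> \<nu>\<Omega>]
  have IS: "Int_stable ?G"
    proof (rule Int_stableI)
      fix A B assume "A \<in> ?G" "B \<in> ?G"
      then obtain F F' where F: "A = PiE {1..n} F" "\<forall>i\<in>{1..n}. F i \<in> range (\<lambda>(a, b). {a<..b::real})"
        "B = PiE {1..n} F'" "\<forall>i\<in>{1..n}. F' i \<in> range (\<lambda>(a, b). {a<..b::real})" by blast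
      have "F i \<inter> F' i \<in> range (\<lambda>(a, b). {a<..b::real})" if i: "i \<in> {1..n}" for i
      proof -
        obtain a b where "F i = {a<..b}" using F(2)[rule_format, OF i] by auto
        moreover obtain c d where "F' i = {c<..d}" using F(4)[rule_format, OF i] by auto
        ultimately have "F i \<inter> F' i = (\<lambda>(a, b). {a<..b::real}) (max a c, min b d)" by auto
        then show ?thesis by (rule range_eqI)
      qed
      then show "A \<inter> B \<in> ?G" unfolding F(1,3) PiE_Int by blast
    qed
  have PW: "?G \<subseteq> Pow ?\<Omega>" by (auto simp: PiE_def)
  have "A \<in> sigma_sets ?\<Omega> ?G" using assms unfolding sets .
  from IS PW this show ?thesis
  proof (induction rule: sigma_sets_induct_disjoint)
    case (basic A)
    then obtain F where "A = PiE {1..n} F" "\<forall>i\<in>{1..n}. F i \<in> range (\<lambda>(a, b). {a<..b::real})" by blast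
    then show ?case using Nt_box(1,2)[of F] by simp
  next
    case empty
    have "Nt {} = (\<lambda>_. 0)" by (simp add: Nt_def fun_eq_iff)
    then show ?case by simp
  next
    case (compl A)
    have A: "A \<in> sets (density \<Lambda> h)" using compl(1) unfolding sets_density sets .
    have fin: "Nt B \<omega> \<noteq> \<infinity>" for B \<omega> using finite_tup by (simp add: Nt_def)
    have D: "Nt (?\<Omega> - A) = (\<lambda>\<omega>. Nt ?\<Omega> \<omega> - Nt A \<omega>)"
    proof
      fix \<omega>
      have "tup \<omega> \<inter> (?\<Omega> - A) = tup \<omega> \<inter> ?\<Omega> - tup \<omega> \<inter> A" by blast
      then show "Nt (?\<Omega> - A) \<omega> = Nt ?\<Omega> \<omega> - Nt A \<omega>"
        unfolding Nt_def using fin[of A \<omega>] tup_\<Omega>[of \<omega>] by (simp only:) (rule emeasure_Diff, auto simp: Nt_def)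
    qed
    have le: "Nt A \<omega> \<le> Nt ?\<Omega> \<omega>" for \<omega>
      unfolding Nt_def using tup_\<Omega>[of \<omega>] by (intro emeasure_mono) auto
    have finA: "emeasure (density \<Lambda> h) A \<noteq> \<infinity>"
    proof -
      have "emeasure (density \<Lambda> h) A \<le> emeasure (density \<Lambda> h) (space (density \<Lambda> h))" by (rule emeasure_space)
      then show ?thesis using tot(2,3) unfolding sp by (metis infinity_ennreal_def leD top.not_eq_extremum)
    qed
    have "(\<integral>\<^sup>+\<omega>. Nt (?\<Omega> - A) \<omega> \<partial>completion M) = (\<integral>\<^sup>+\<omega>. Nt ?\<Omega> \<omega> \<partial>completion M) - (\<integral>\<^sup>+\<omega>. Nt A \<omega> \<partial>completion M)"
      unfolding D using compl(2) tot(1) finA le by (intro nn_integral_diff) auto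
    also have "\<dots> = emeasure (density \<Lambda> h) (?\<Omega> - A)"
      using emeasure_compl[OF A finA] compl(2) tot(2) unfolding sp by simp
    finally have "(\<integral>\<^sup>+\<omega>. Nt (?\<Omega> - A) \<omega> \<partial>completion M) = emeasure (density \<Lambda> h) (?\<Omega> - A)" .
    moreover have "Nt (?\<Omega> - A) \<in> borel_measurable (completion M)"
      unfolding D using compl(2) tot(1) by (intro borel_measurable_minus_ennreal) auto
    ultimately show ?case by blast
  next
    case (union A)
    have A: "range A \<subseteq> sets (density \<Lambda> h)" using union(2) unfolding sets_density sets .
    have D: "Nt (\<Union>i. A i) = (\<lambda>\<omega>. \<Sum>i. Nt (A i) \<omega>)"
    proof
      fix \<omega>
      have "(\<Sum>i. emeasure (count_space UNIV) (tup \<omega> \<inter> A i)) = emeasure (count_space UNIV) (\<Union>i. tup \<omega> \<inter> A i)"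
        using union(1) by (intro suminf_emeasure) (auto simp: disjoint_family_on_def)
      then show "Nt (\<Union>i. A i) \<omega> = (\<Sum>i. Nt (A i) \<omega>)" unfolding Nt_def by simp
    qed
    have "(\<integral>\<^sup>+\<omega>. Nt (\<Union>i. A i) \<omega> \<partial>completion M) = (\<Sum>i. emeasure (density \<Lambda> h) (A i))"
      unfolding D using union(3) by (subst nn_integral_suminf) auto
    also have "\<dots> = emeasure (density \<Lambda> h) (\<Union>i. A i)" by (rule suminf_emeasure[OF A union(1)])
    finally have "(\<integral>\<^sup>+\<omega>. Nt (\<Union>i. A i) \<omega> \<partial>completion M) = emeasure (density \<Lambda> h) (\<Union>i. A i)" .
    moreover have "Nt (\<Union>i. A i) \<in> borel_measurable (completion M)"
      unfolding D using union(3) by (intro borel_measurable_suminf_order) auto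
    ultimately show ?case by blast
  qed
qed

end

text \<open>The entries with the true sign inside \<open>k22\<close> in place of a prescribed one,
  hence free of any choice of cells.\<close>

definition kent :: "(nat \<Rightarrow> real) \<Rightarrow> nat \<times> bool \<Rightarrow> nat \<times> bool \<Rightarrow> real" where
  "kent x p q =
    (if snd p then if snd q then k11 (x (fst p)) (x (fst q)) else k12 (x (fst p)) (x (fst q))
     else if snd q then - k12 (x (fst q)) (x (fst p)) else k22 (x (fst p)) (x (fst q)))"

definition rho :: "nat \<Rightarrow> (nat \<Rightarrow> real) \<Rightarrow> real" where
  "rho n x = (1 / pi) ^ n * pfl (kent x) (pf_rows n)"

text \<open>Once every cell is differentiated, prescribed signs survive only between rows with flag
  \<open>False\<close>, and on the box they are the true signs.\<close>

lemma (in gaussian_cells) dens_eq_rho: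
  assumes "x \<in> Box"
  shows "dens x = rho n x"
proof -
  have xi: "t i < x i \<and> x i \<le> u i" if "i \<in> {1..n}" for i using assms that by (auto simp: PiE_def Pi_def)
  have s: "sgn (x j - x i) = \<sigma> i j" if "i \<in> {1..n}" "j \<in> {1..n}" "i \<noteq> j" for i j
    using order[OF that] xi[OF that(1)] xi[OF that(2)] by auto
  have "pfl (ent \<sigma> {1..n} x x) (pf_rows n) = pfl (kent x) (pf_rows n)"
  proof (rule pfl_cong_nth)
    fix i j assume "i < length (pf_rows n)" "j < length (pf_rows n)"
    then have "fst (pf_rows n ! i) \<in> {1..n}" "fst (pf_rows n ! j) \<in> {1..n}"
      using nth_mem[of _ "pf_rows n"] unfolding set_rows by (auto simp: mem_Times_iff)
    then show "ent \<sigma> {1..n} x x (pf_rows n ! i) (pf_rows n ! j) = kent x (pf_rows n ! i) (pf_rows n ! j)"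
      using s[of "fst (pf_rows n ! i)" "fst (pf_rows n ! j)"]
      by (auto simp: ent_def kent_def pt_def psign_def k22_def)
  qed simp
  then show ?thesis by (simp add: dens_def rho_def)
qed

section \<open>Countable covers by rational cells and disjoint Borel sets\<close>

definition cell_sign :: "(nat \<Rightarrow> real) \<Rightarrow> (nat \<Rightarrow> real) \<Rightarrow> nat \<Rightarrow> nat \<Rightarrow> real" where
  "cell_sign t u i j = (if u i \<le> t j then 1 else -1)"

text \<open>Distinct coordinates can be separated by disjoint cells, and rational endpoints leave
  only countably many families of cells.\<close>

lemma rational_cells:
  assumes x: "x \<in> PiE {1..n} (\<lambda>_. {-1<..<1})" and inj: "inj_on x {1..n}"
  shows "\<exists>t\<in>PiE {1..n} (\<lambda>_. \<rat>). \<exists>u\<in>PiE {1..n} (\<lambda>_. \<rat>). cells n t u (cell_sign t u) \<and> x \<in> PiE {1..n} (\<lambda>i. {t i<..u i})"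
proof -
  have x1: "\<bar>x i\<bar> < 1" if "i \<in> {1..n}" for i using x that by (auto simp: PiE_def Pi_def abs_less_iff)
  \<comment> \<open>The minimum bounds the distance of each coordinate to the ends -1 and 1 and half
    of each gap between two coordinates; the element 1 keeps the set nonempty.\<close>
  define S where "S = insert 1 ((\<lambda>i. 1 - \<bar>x i\<bar>) ` {1..n} \<union> (\<lambda>(i, j). \<bar>x i - x j\<bar> / 2) ` {p \<in> {1..n} \<times> {1..n}. fst p \<noteq> snd p})"
  have finS: "finite S" unfolding S_def by (intro finite.insertI finite_UnI finite_imageI finite_Collect_conjI) auto
  have posS: "0 < s" if s: "s \<in> S" for s
  proof -
    consider "s = 1" | i where "i \<in> {1..n}" "s = 1 - \<bar>x i\<bar>"
      | i j where "i \<in> {1..n}" "j \<in> {1..n}" "i \<noteq> j" "s = \<bar>x i - x j\<bar> / 2"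
      using s unfolding S_def by auto
    then show ?thesis
    proof cases
      case 2 then show ?thesis using x1[of i] by simp
    next
      case 3
      then have "x i \<noteq> x j" using inj_onD[OF inj, of i j] by blast
      then show ?thesis using 3(4) by simp
    qed simp
  qed
  define \<delta> where "\<delta> = Min S"
  have "\<delta> \<in> S" unfolding \<delta>_def using finS by (intro Min_in) (auto simp: S_def)
  then have \<delta>: "0 < \<delta>" by (rule posS)
  have \<delta>le: "\<delta> \<le> s" if "s \<in> S" for s unfolding \<delta>_def using finS that by (rule Min_le)
  have \<delta>1: "\<delta> \<le> 1 - \<bar>x i\<bar>" if "i \<in> {1..n}" for i using that by (intro \<delta>le) (auto simp: S_def)
  have \<delta>2: "\<delta> \<le> \<bar>x i - x j\<bar> / 2" if "i \<in> {1..n}" "j \<in> {1..n}" "i \<noteq> j" for i j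
    unfolding \<delta>_def using that finS by (intro Min_le) (auto simp: S_def intro!: image_eqI[of _ _ "(i, j)"])
  have "\<exists>r\<in>\<rat>. x i - \<delta> < r \<and> r < x i" for i using \<delta> by (intro Rats_dense_in_real) auto
  then obtain t where t: "\<And>i. t i \<in> \<rat> \<and> x i - \<delta> < t i \<and> t i < x i" by metis
  have "\<exists>r\<in>\<rat>. x i < r \<and> r < x i + \<delta>" for i using \<delta> by (intro Rats_dense_in_real) auto
  then obtain u where u: "\<And>i. u i \<in> \<rat> \<and> x i < u i \<and> u i < x i + \<delta>" by metis
  let ?t = "restrict t {1..n}" and ?u = "restrict u {1..n}"
  have "cells n ?t ?u (cell_sign ?t ?u)"
  proof
    fix i assume i: "i \<in> {1..n}"
    show "-1 < ?t i \<and> ?t i < ?u i \<and> ?u i < 1"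
      using i t[of i] u[of i] \<delta>1[OF i] by (auto simp: abs_le_iff)
    fix j assume j: "j \<in> {1..n}" "i \<noteq> j"
    have "x i - x j \<ge> 2 * \<delta> \<or> x j - x i \<ge> 2 * \<delta>" using \<delta>2[OF i j] by (auto simp: abs_real_def split: if_splits)
    then show "(?u i \<le> ?t j \<and> cell_sign ?t ?u i j = 1) \<or> (?u j \<le> ?t i \<and> cell_sign ?t ?u i j = -1)"
      using i j t[of i] t[of j] u[of i] u[of j] by (auto simp: cell_sign_def)
  qed
  moreover have "x \<in> PiE {1..n} (\<lambda>i. {?t i<..?u i})"
    using x t u by (auto simp: PiE_def less_imp_le)
  moreover have "?t \<in> PiE {1..n} (\<lambda>_. \<rat>)" "?u \<in> PiE {1..n} (\<lambda>_. \<rat>)" using t u by auto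
  ultimately show ?thesis by blast
qed

lemma ex_rational_cells:
  obtains T U :: "nat \<Rightarrow> nat \<Rightarrow> real" where "\<And>m. cells n (T m) (U m) (cell_sign (T m) (U m))"
    "\<And>x. x \<in> PiE {1..n} (\<lambda>_. {-1<..<1}) \<Longrightarrow> inj_on x {1..n} \<Longrightarrow> \<exists>m. x \<in> PiE {1..n} (\<lambda>i. {T m i<..U m i})"
proof -
  define K where "K = {p \<in> PiE {1..n} (\<lambda>_. \<rat>) \<times> PiE {1..n} (\<lambda>_. \<rat>). cells n (fst p) (snd p) (cell_sign (fst p) (snd p))}"
  have c: "countable (PiE {1..n} (\<lambda>_. \<rat> :: real set))" by (intro countable_PiE) (auto simp: countable_rat)
  have cK: "countable K" unfolding K_def by (rule countable_subset[OF _ countable_SIGMA[OF c c]]) auto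
  have cov: "\<exists>p\<in>K. x \<in> PiE {1..n} (\<lambda>i. {fst p i<..snd p i})"
    if x: "x \<in> PiE {1..n} (\<lambda>_. {-1<..<1})" "inj_on x {1..n}" for x
  proof -
    obtain t u where "t \<in> PiE {1..n} (\<lambda>_. \<rat>)" "u \<in> PiE {1..n} (\<lambda>_. \<rat>)" "cells n t u (cell_sign t u)" "x \<in> PiE {1..n} (\<lambda>i. {t i<..u i})"
      using rational_cells[OF x] by blast
    then show ?thesis by (intro bexI[of _ "(t, u)"]) (auto simp: K_def)
  qed
  \<comment> \<open>A point with distinct coordinates, which shows that the family \<open>K\<close>
    is nonempty and can be enumerated.\<close>
  have "restrict (\<lambda>i. real i / real (n + 1)) {1..n} \<in> PiE {1..n} (\<lambda>_. {-1<..<1})"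
    by (auto simp: field_simps)
  moreover have "inj_on (restrict (\<lambda>i. real i / real (n + 1)) {1..n}) {1..n}"
    by (intro inj_onI) (simp add: field_simps)
  ultimately have "K \<noteq> {}" using cov by blast
  then have "range (from_nat_into K) = K" using cK by (rule range_from_nat_into)
  then have r: "from_nat_into K m \<in> K" "p \<in> K \<Longrightarrow> \<exists>m. p = from_nat_into K m" for m p by blast+
  show thesis
  proof (rule that[of "\<lambda>m. fst (from_nat_into K m)" "\<lambda>m. snd (from_nat_into K m)"])
    show "cells n (fst (from_nat_into K m)) (snd (from_nat_into K m)) (cell_sign (fst (from_nat_into K m)) (snd (from_nat_into K m)))" for m
      using r(1)[of m] by (simp add: K_def)
    fix x :: "nat \<Rightarrow> real" assume "x \<in> PiE {1..n} (\<lambda>_. {-1<..<1})" "inj_on x {1..n}"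
    then obtain p where p: "p \<in> K" "x \<in> PiE {1..n} (\<lambda>i. {fst p i<..snd p i})" using cov by blast
    then obtain m where "p = from_nat_into K m" using r(2) by blast
    then show "\<exists>m. x \<in> PiE {1..n} (\<lambda>i. {fst (from_nat_into K m) i<..snd (from_nat_into K m) i})" using p(2) by blast
  qed
qed

context gaussian_series
begin

lemma rho_nonneg_distinct:
  assumes "x \<in> open_cube n" "inj_on x {1..n}"
  shows "0 \<le> rho n x"
proof -
  obtain t u where tu: "cells n t u (cell_sign t u)" "x \<in> PiE {1..n} (\<lambda>i. {t i<..u i})" using rational_cells[OF assms] by blast
  interpret gaussian_cells M a n t u "cell_sign t u" by (intro gaussian_cells.intro gaussian_series_axioms tu(1))
  show ?thesis using cell_moment(1)[OF tu(2)] dens_eq_rho[OF tu(2)] by simp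
qed

text \<open>Disjointness of the \<open>B i\<close> keeps their product off the diagonals, so
  countably many cell boxes cover it. Made disjoint, these boxes cut it into pieces
  \<open>A m\<close> on which \<open>Nt_moment\<close> and \<open>dens_eq_rho\<close> apply, and
  both sides add up over the pieces.\<close>

lemma borel_moment:
  fixes B :: "nat \<Rightarrow> real set"
  assumes B: "\<And>i. i \<in> {1..n} \<Longrightarrow> B i \<in> sets borel" "\<And>i. i \<in> {1..n} \<Longrightarrow> B i \<subseteq> {-1<..<1}" and disj: "disjoint_family_on B {1..n}"
  shows "(\<lambda>\<omega>. \<Prod>i = 1..n. num_points Z (B i) \<omega>) \<in> borel_measurable (completion M)"
    and "(\<integral>\<^sup>+\<omega>. (\<Prod>i = 1..n. num_points Z (B i) \<omega>) \<partial>completion M) =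
      (\<integral>\<^sup>+x\<in>PiE {1..n} B. ennreal (rho n x) \<partial>(PiM {1..n} (\<lambda>_. lborel)))"
proof -
  let ?\<Lambda> = "PiM {1..n} (\<lambda>_. lborel :: real measure)"
  obtain T U :: "nat \<Rightarrow> nat \<Rightarrow> real" where TU: "\<And>m. cells n (T m) (U m) (cell_sign (T m) (U m))"
    "\<And>x. x \<in> PiE {1..n} (\<lambda>_. {-1<..<1}) \<Longrightarrow> inj_on x {1..n} \<Longrightarrow> \<exists>m. x \<in> PiE {1..n} (\<lambda>i. {T m i<..U m i})"
    by (rule ex_rational_cells[of n], rule that) assumption+
  define X where "X m = PiE {1..n} (\<lambda>i. {T m i<..U m i})" for m
  define A where "A m = PiE {1..n} B \<inter> disjointed X m" for m
  have gc: "gaussian_cells M a n (T m) (U m) (cell_sign (T m) (U m))" for m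
    by (intro gaussian_cells.intro gaussian_series_axioms TU(1))
  have X: "X m \<in> sets ?\<Lambda>" for m unfolding X_def by (intro sets_PiM_I_finite) auto
  have PB: "PiE {1..n} B \<in> sets ?\<Lambda>" using B(1) by (intro sets_PiM_I_finite) auto
  have A: "A m \<in> sets ?\<Lambda>" for m
    unfolding A_def disjointed_def using X by (intro sets.Int PB sets.Diff sets.finite_UN) auto
  have AX: "A m \<subseteq> X m" for m unfolding A_def using disjointed_subset[of X m] by blast
  have dA: "disjoint_family A"
    using disjoint_family_disjointed[of X] by (auto simp: A_def disjoint_family_on_def)
  have cover: "PiE {1..n} B \<subseteq> (\<Union>m. X m)"
  proof
    fix x assume x: "x \<in> PiE {1..n} B"
    have "x \<in> PiE {1..n} (\<lambda>_. {-1<..<1})" by (rule subsetD[OF PiE_mono x]) (rule B(2))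
    moreover have "inj_on x {1..n}"
    proof (rule inj_onI, rule ccontr)
      fix i j assume ij: "i \<in> {1..n}" "j \<in> {1..n}" "x i = x j" "i \<noteq> j"
      have "x i \<in> B i" "x j \<in> B j" using x ij by (auto simp: PiE_def Pi_def)
      then show False using disjoint_family_onD[OF disj ij(1,2,4)] ij(3) by auto
    qed
    ultimately show "x \<in> (\<Union>m. X m)" unfolding X_def using TU(2) by blast
  qed
  have UA: "(\<Union>m. A m) = PiE {1..n} B"
    unfolding A_def using cover UN_disjointed_eq[of X] by blast
  define N where "N m = gaussian_cells.Nt a n (T m) (U m) (A m)" for m
  have Nm: "N m \<in> borel_measurable (completion M)"
    and NI: "(\<integral>\<^sup>+\<omega>. N m \<omega> \<partial>completion M) = emeasure (density ?\<Lambda> (gaussian_cells.h n (T m) (U m) (cell_sign (T m) (U m)))) (A m)" for m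
    unfolding N_def using gaussian_cells.Nt_moment[OF gc A] by auto
  have hA: "gaussian_cells.h n (T m) (U m) (cell_sign (T m) (U m)) x * indicator (A m) x = ennreal (rho n x) * indicator (A m) x" for m x
  proof (cases "x \<in> A m")
    case True
    then have xB: "x \<in> PiE {1..n} (\<lambda>i. {T m i<..U m i})" using AX unfolding X_def by blast
    show ?thesis
      using xB gaussian_cells.dens_eq_rho[OF gc xB] by (simp add: gaussian_cells.h_def[OF gc] del: One_nat_def)
  qed simp
  have meas: "(\<lambda>x. ennreal (rho n x) * indicator (A m) x) \<in> borel_measurable ?\<Lambda>" for m
    unfolding hA[symmetric] using A by (intro borel_measurable_times_ennreal gaussian_cells.measurable_h[OF gc] borel_measurable_indicator)
  have D: "(\<Prod>i = 1..n. num_points Z (B i) \<omega>) = (\<Sum>m. N m \<omega>)" for \<omega>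
  proof -
    let ?P = "PiE {1..n} (\<lambda>i. Z \<omega> \<inter> B i)"
    have sub: "?P \<subseteq> PiE {1..n} B" by (intro PiE_mono) auto
    have "gaussian_cells.tup a n (T m) (U m) \<omega> \<inter> A m = ?P \<inter> disjointed X m" for m
    proof -
      have "gaussian_cells.tup a n (T m) (U m) \<omega> \<inter> PiE {1..n} B = ?P \<inter> X m"
        unfolding gaussian_cells.tup_def[OF gc] X_def PiE_Int by (intro PiE_cong) auto
      then show ?thesis unfolding A_def using disjointed_subset[of X m] by blast
    qed
    then have "(\<Sum>m. N m \<omega>) = (\<Sum>m. emeasure (count_space UNIV) (?P \<inter> disjointed X m))"
      unfolding N_def gaussian_cells.Nt_def[OF gc] by simp
    also have "\<dots> = emeasure (count_space UNIV) (\<Union>m. ?P \<inter> disjointed X m)"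
      using disjoint_family_disjointed[of X] by (intro suminf_emeasure) (auto simp: disjoint_family_on_def)
    also have "(\<Union>m. ?P \<inter> disjointed X m) = ?P"
      unfolding Int_UN_distrib[symmetric] UN_disjointed_eq by (rule Int_absorb2[OF subset_trans[OF sub cover]])
    finally show ?thesis by (simp add: emeasure_count_PiE num_points_def)
  qed
  show "(\<lambda>\<omega>. \<Prod>i = 1..n. num_points Z (B i) \<omega>) \<in> borel_measurable (completion M)"
    unfolding D using Nm by (rule borel_measurable_suminf_order)
  have "(\<integral>\<^sup>+\<omega>. (\<Prod>i = 1..n. num_points Z (B i) \<omega>) \<partial>completion M) = (\<Sum>m. \<integral>\<^sup>+\<omega>. N m \<omega> \<partial>completion M)"
    unfolding D using Nm by (rule nn_integral_suminf)
  also have "\<dots> = (\<Sum>m. \<integral>\<^sup>+x. ennreal (rho n x) * indicator (A m) x \<partial>?\<Lambda>)"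
    unfolding NI emeasure_density[OF gaussian_cells.measurable_h[OF gc] A] hA ..
  also have "\<dots> = (\<integral>\<^sup>+x. (\<Sum>m. ennreal (rho n x) * indicator (A m) x) \<partial>?\<Lambda>)"
    using meas by (rule nn_integral_suminf[symmetric])
  also have "\<dots> = (\<integral>\<^sup>+x\<in>PiE {1..n} B. ennreal (rho n x) \<partial>?\<Lambda>)"
    unfolding ennreal_suminf_cmult suminf_indicator[OF dA] UA ..
  finally show "(\<integral>\<^sup>+\<omega>. (\<Prod>i = 1..n. num_points Z (B i) \<omega>) \<partial>completion M) =
      (\<integral>\<^sup>+x\<in>PiE {1..n} B. ennreal (rho n x) \<partial>?\<Lambda>)" .
qed

lemma measurable_num_points:
  fixes B :: "real set"
  assumes "B \<in> sets borel" "B \<subseteq> {-1<..<1}"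
  shows "num_points (real_zeros a) B \<in> borel_measurable (completion M)"
proof (rule measurable_completion_AE)
  have "(\<lambda>\<omega>. \<Prod>i = 1..1. num_points Z ((\<lambda>_::nat. B) i) \<omega>) \<in> borel_measurable (completion M)"
    using assms by (intro borel_moment(1)) (auto simp: disjoint_family_on_def)
  then show "num_points Z B \<in> borel_measurable (completion M)" by simp
  show "AE \<omega> in M. num_points Z B \<omega> = num_points (real_zeros a) B \<omega>"
    using AE_num_points_Z by eventually_elim simp
qed

lemma borel_moment_zeros:
  fixes B :: "nat \<Rightarrow> real set"
  assumes "\<And>i. i \<in> {1..n} \<Longrightarrow> B i \<in> sets borel" "\<And>i. i \<in> {1..n} \<Longrightarrow> B i \<subseteq> {-1<..<1}" "disjoint_family_on B {1..n}"
  shows "(\<integral>\<^sup>+\<omega>. (\<Prod>i = 1..n. num_points (real_zeros a) (B i) \<omega>) \<partial>M) =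
      (\<integral>\<^sup>+x\<in>PiE {1..n} B. ennreal (rho n x) \<partial>(PiM {1..n} (\<lambda>_. lborel)))"
proof -
  have "(\<integral>\<^sup>+\<omega>. (\<Prod>i = 1..n. num_points (real_zeros a) (B i) \<omega>) \<partial>M) = (\<integral>\<^sup>+\<omega>. (\<Prod>i = 1..n. num_points Z (B i) \<omega>) \<partial>M)"
    using AE_num_points_Z by (intro nn_integral_cong_AE) (auto elim!: eventually_mono)
  then show ?thesis using borel_moment(2)[OF assms] by (simp only: nn_integral_completion)
qed

end

section \<open>The continuous density and its uniqueness\<close>

lemma pf_rows_map: "pf_rows n = map (\<lambda>p. ((p + 1) div 2, odd p)) [1..<2 * n + 1]"
  by (induction n) (simp_all add: pf_rows_def)

lemma rho_eq_pfaffian: "rho n t = (1 / pi) ^ n * pfaffian n (block_matrix (\<lambda>i j. kernel_K (t i) (t j)))"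
proof -
  have "block_matrix (\<lambda>i j. kernel_K (t i) (t j)) = (\<lambda>p q. kent t ((p + 1) div 2, odd p) ((q + 1) div 2, odd q))"
    by (intro ext) (simp add: block_matrix_def kent_def kernel_K_nth)
  then show ?thesis by (simp only: rho_def pfaffian_eq_pfl pf_rows_map pfl_map)
qed

lemma kent_skew: "kent x p q = - kent x q p"
  using k11_skew[of "x (fst p)" "x (fst q)"] k22_skew[of "x (fst p)" "x (fst q)"] by (auto simp: kent_def)

text \<open>Equal coordinates make the rows \<open>(i, True)\<close> and \<open>(j, True)\<close> of
  the kernel matrix equal.\<close>

lemma rho_coincident:
  assumes "i \<in> {1..n}" "j \<in> {1..n}" "i \<noteq> j" "x i = x j"
  shows "rho n x = 0"
proof -
  have "pfl (kent x) (pf_rows n) = 0"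
  proof (rule pfl_eq_rows_distinct)
    show "kent x p q = - kent x q p" for p q by (rule kent_skew)
    show "kent x (i, True) r = kent x (j, True) r" for r using assms by (simp add: kent_def)
  qed (use assms in \<open>auto simp: set_rows\<close>)
  then show ?thesis by (simp add: rho_def)
qed

lemma tendsto_coordinate_within: "((\<lambda>x. x k) \<longlongrightarrow> t k) (at t within S)" for t :: "nat \<Rightarrow> real"
proof -
  have "continuous_on UNIV (\<lambda>x :: nat \<Rightarrow> real. x k)" by (rule continuous_on_product_coordinates)
  then have "((\<lambda>x. x k) \<longlongrightarrow> t k) (at t)" unfolding continuous_on_def by simp
  then show ?thesis by (rule tendsto_within_subset) simp
qed

text \<open>All skew-symmetric ways of prescribing the signs; fixing the entries outside the index
  range at 0 makes the set finite.\<close>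

definition sign_patterns :: "nat \<Rightarrow> (nat \<Rightarrow> nat \<Rightarrow> real) set" where
  "sign_patterns n = {\<sigma>. (\<forall>i j. \<sigma> i j \<in> {-1, 0, 1}) \<and> (\<forall>i j. \<sigma> j i = - \<sigma> i j) \<and> (\<forall>i j. \<not> (i \<in> {1..n} \<and> j \<in> {1..n}) \<longrightarrow> \<sigma> i j = 0)}"

lemma finite_sign_patterns: "finite (sign_patterns n)"
proof (rule finite_surj)
  show "finite (PiE ({1..n} \<times> {1..n}) (\<lambda>_. {-1, 0, 1 :: real}))" by (intro finite_PiE) auto
  show "sign_patterns n \<subseteq> (\<lambda>s i j. if i \<in> {1..n} \<and> j \<in> {1..n} then s (i, j) else 0) ` PiE ({1..n} \<times> {1..n}) (\<lambda>_. {-1, 0, 1})"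
  proof
    fix \<sigma> assume \<sigma>: "\<sigma> \<in> sign_patterns n"
    have z: "\<sigma> i j = 0" if "\<not> (i \<in> {1..n} \<and> j \<in> {1..n})" for i j
      using \<sigma> that unfolding sign_patterns_def by blast
    show "\<sigma> \<in> (\<lambda>s i j. if i \<in> {1..n} \<and> j \<in> {1..n} then s (i, j) else 0) ` PiE ({1..n} \<times> {1..n}) (\<lambda>_. {-1, 0, 1})"
    proof (rule image_eqI)
      show "restrict (\<lambda>p. \<sigma> (fst p) (snd p)) ({1..n} \<times> {1..n}) \<in> PiE ({1..n} \<times> {1..n}) (\<lambda>_. {-1, 0, 1})"
        using \<sigma> unfolding sign_patterns_def by (intro restrict_PiE_iff[THEN iffD2]) blast
      show "\<sigma> = (\<lambda>i j. if i \<in> {1..n} \<and> j \<in> {1..n} then restrict (\<lambda>p. \<sigma> (fst p) (snd p)) ({1..n} \<times> {1..n}) (i, j) else 0)"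
        by (intro ext) (simp add: z)
    qed
  qed
qed

text \<open>Where two coordinates coincide, \<open>k22\<close> jumps; but for each of the finitely many
  patterns of signs the Pfaffian is continuous and vanishes there because two rows agree.\<close>

lemma rho_tendsto_0:
  assumes t: "t \<in> open_cube n" and ij: "i \<in> {1..n}" "j \<in> {1..n}" "i \<noteq> j" "t i = t j"
  shows "(rho n \<longlongrightarrow> 0) (at t within S)"
proof (rule Lim_null_comparison)
  let ?D = "\<lambda>\<sigma> x. (1 / pi) ^ n * pfl (ent \<sigma> {1..n} x x) (pf_rows n)"
  have tk: "t k \<in> {-1<..<1} \<and> t k \<in> {-1<..<1}" if "k \<in> {1..n}" for k using t that by (auto simp: PiE_def Pi_def)
  show "((\<lambda>x. \<Sum>\<sigma>\<in>sign_patterns n. \<bar>?D \<sigma> x\<bar>) \<longlongrightarrow> 0) (at t within S)"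
  proof (intro tendsto_null_sum tendsto_rabs_zero)
    fix \<sigma> assume \<sigma>: "\<sigma> \<in> sign_patterns n"
    have skew: "ent \<sigma> {1..n} t t p q = - ent \<sigma> {1..n} t t q p" if "p \<in> set (pf_rows n)" "q \<in> set (pf_rows n)" for p q
    proof -
      have "\<sigma> (fst p) (fst q) = - \<sigma> (fst q) (fst p)" using \<sigma> unfolding sign_patterns_def by blast
      then show ?thesis
        using k11_skew[of "pt t t p" "pt t t q"] c_fun_sym[of "pt t t p" "pt t t q"] that
        unfolding ent_def psign_def set_rows mem_Times_iff by auto
    qed
    \<comment> \<open>Cut off outside the rows in use, since the lemma on equal rows asks for skew
      symmetry at all labels.\<close>
    define b where "b p q = (if p \<in> set (pf_rows n) \<and> q \<in> set (pf_rows n) then ent \<sigma> {1..n} t t p q else 0)" for p q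
    have "pfl (ent \<sigma> {1..n} t t) (pf_rows n) = pfl b (pf_rows n)"
      by (rule pfl_cong_nth) (auto simp: b_def)
    also have "\<dots> = 0"
    proof (rule pfl_eq_rows_distinct)
      show "b p q = - b q p" for p q
      proof (cases "p \<in> set (pf_rows n) \<and> q \<in> set (pf_rows n)")
        case True
        then have "b p q = ent \<sigma> {1..n} t t p q" "b q p = ent \<sigma> {1..n} t t q p" by (simp_all add: b_def)
        then show ?thesis using skew[of p q] True by metis
      next
        case False
        then show ?thesis by (auto simp: b_def)
      qed
      have T: "(i, True) \<in> set (pf_rows n)" "(j, True) \<in> set (pf_rows n)" using ij by (auto simp: set_rows)
      show "b (i, True) r = b (j, True) r" for r
        using T ij by (simp add: b_def ent_def pt_def)
      show "(i, True) \<in> set (pf_rows n)" "(j, True) \<in> set (pf_rows n)" by (rule T)+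
    qed (use ij in simp)
    finally have 0: "?D \<sigma> t = 0" by simp
    have "(?D \<sigma> \<longlongrightarrow> ?D \<sigma> t) (at t within S)"
      by (intro tendsto_mult tendsto_const tendsto_pfl_ent tendsto_coordinate_within tk)
    then show "(?D \<sigma> \<longlongrightarrow> 0) (at t within S)" unfolding 0 .
  qed
  \<comment> \<open>The true signs at \<open>x\<close> form one of the patterns, so a finite sum
    that does not depend on the order of the coordinates dominates \<open>rho\<close>.\<close>
  have "\<bar>rho n x\<bar> \<le> (\<Sum>\<sigma>\<in>sign_patterns n. \<bar>?D \<sigma> x\<bar>)" for x
  proof -
    define \<sigma> where "\<sigma> i j = (if i \<in> {1..n} \<and> j \<in> {1..n} then sgn (x j - x i) else 0)" for i j
    have "\<sigma> \<in> sign_patterns n" unfolding sign_patterns_def \<sigma>_def by (auto simp: sgn_if)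
    moreover have "rho n x = ?D \<sigma> x"
    proof -
      have "pfl (kent x) (pf_rows n) = pfl (ent \<sigma> {1..n} x x) (pf_rows n)"
      proof (rule pfl_cong_nth)
        fix i j assume "i < length (pf_rows n)" "j < length (pf_rows n)"
        then have "fst (pf_rows n ! i) \<in> {1..n}" "fst (pf_rows n ! j) \<in> {1..n}"
          using nth_mem[of _ "pf_rows n"] unfolding set_rows by (auto simp: mem_Times_iff)
        then show "kent x (pf_rows n ! i) (pf_rows n ! j) = ent \<sigma> {1..n} x x (pf_rows n ! i) (pf_rows n ! j)"
          by (auto simp: ent_def kent_def pt_def psign_def k22_def \<sigma>_def)
      qed simp
      then show ?thesis by (simp add: rho_def)
    qed
    ultimately show ?thesis
      using member_le_sum[of \<sigma> "sign_patterns n" "\<lambda>\<sigma>. \<bar>?D \<sigma> x\<bar>"] finite_sign_patterns by simp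
  qed
  then show "\<forall>\<^sub>F x in at t within S. norm (rho n x) \<le> (\<Sum>\<sigma>\<in>sign_patterns n. \<bar>?D \<sigma> x\<bar>)" by simp
qed

text \<open>Off the diagonals the sign in \<open>k22\<close> is locally constant; on them the value
  and the limit are both 0.\<close>

lemma continuous_rho: "continuous_on (open_cube n) (rho n)"
  unfolding continuous_on_def
proof
  fix t assume t: "t \<in> open_cube n"
  have tk: "t k \<in> {-1<..<1}" if "k \<in> {1..n}" for k using t that by (auto simp: PiE_def Pi_def)
  show "(rho n \<longlongrightarrow> rho n t) (at t within open_cube n)"
  proof (cases "inj_on t {1..n}")
    case True
    have "((\<lambda>x. pfl (kent x) (pf_rows n)) \<longlongrightarrow> pfl (kent t) (pf_rows n)) (at t within open_cube n)"
    proof (rule tendsto_pfl[OF _ distinct_rows])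
      fix p q assume pq: "p \<in> set (pf_rows n)" "q \<in> set (pf_rows n)" "p \<noteq> q"
      then have f: "fst p \<in> {1..n}" "fst q \<in> {1..n}" by (auto simp: set_rows mem_Times_iff)
      show "((\<lambda>x. kent x p q) \<longlongrightarrow> kent t p q) (at t within open_cube n)"
      proof (cases "snd p \<or> snd q")
        case True
        then show ?thesis unfolding kent_def using f tk
          by (cases "snd p"; cases "snd q")
             (auto intro!: tendsto_k11 tendsto_k12 tendsto_minus tendsto_coordinate_within)
      next
        case False
        then have "fst p \<noteq> fst q" using pq(3) by (auto simp: prod_eq_iff)
        then have "t (fst p) \<noteq> t (fst q)" using \<open>inj_on t {1..n}\<close> f by (auto dest: inj_onD)
        then show ?thesis using False tk[OF f(1)] tk[OF f(2)]
          by (simp add: kent_def tendsto_k22 tendsto_coordinate_within)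
      qed
    qed
    then show ?thesis unfolding rho_def[abs_def] by (intro tendsto_mult tendsto_const)
  next
    case False
    then obtain i j where ij: "i \<in> {1..n}" "j \<in> {1..n}" "i \<noteq> j" "t i = t j" by (auto simp: inj_on_def)
    show ?thesis unfolding rho_coincident[OF ij] by (rule rho_tendsto_0[OF t ij])
  qed
qed

section \<open>Uniqueness of the continuous version\<close>

lemma open_real_infinite: "open S \<Longrightarrow> x \<in> S \<Longrightarrow> infinite S" for S :: "real set"
proof -
  assume "open S" "x \<in> S"
  then obtain e where e: "e > 0" "ball x e \<subseteq> S" by (meson open_contains_ball)
  have "infinite (ball x e)" unfolding ball_eq_greaterThanLessThan using e(1) by (intro infinite_Ioo) simp
  then show ?thesis using e(2) finite_subset by blast
qed

lemma distinct_choice: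
  assumes "finite I" "\<And>i. i \<in> I \<Longrightarrow> infinite (S i)"
  shows "\<exists>x. inj_on x I \<and> (\<forall>i\<in>I. x i \<in> S i)"
  using assms
proof (induction I rule: finite_induct)
  case (insert i I)
  then obtain x where x: "inj_on x I" "\<forall>k\<in>I. x k \<in> S k" by auto
  have "infinite (S i - x ` I)" using insert.prems[of i] insert.hyps(1) by simp
  then have "S i - x ` I \<noteq> {}" by (rule infinite_imp_nonempty)
  then obtain y where y: "y \<in> S i" "y \<notin> x ` I" by blast
  have "inj_on (x(i := y)) (insert i I)"
    using x(1) y(2) insert.hyps(2) by (auto simp: inj_on_def)
  moreover have "\<forall>k\<in>insert i I. (x(i := y)) k \<in> S k" using x(2) y(1) by auto
  ultimately show ?case by blast
qed simp

text \<open>Distinct points are picked in the sets and surrounded by balls of half the distance to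
  their neighbours. This supplies admissible test sets near any point, also near one with coincident
  coordinates.\<close>

lemma disjoint_open_subsets:
  fixes S :: "'i \<Rightarrow> real set"
  assumes I: "finite I" and S: "\<And>i. i \<in> I \<Longrightarrow> open (S i)" "\<And>i. i \<in> I \<Longrightarrow> S i \<noteq> {}"
  obtains B where "\<And>i. i \<in> I \<Longrightarrow> open (B i)" "\<And>i. i \<in> I \<Longrightarrow> B i \<noteq> {}" "\<And>i. i \<in> I \<Longrightarrow> B i \<subseteq> S i" "disjoint_family_on B I"
proof -
  have "infinite (S i)" if i: "i \<in> I" for i
  proof -
    obtain y where "y \<in> S i" using S(2)[OF i] by blast
    then show ?thesis by (rule open_real_infinite[OF S(1)[OF i]])
  qed
  then obtain x where x: "inj_on x I" "\<And>i. i \<in> I \<Longrightarrow> x i \<in> S i" using distinct_choice[OF I, of S] by blast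
  have "\<exists>d>0. \<forall>y\<in>x ` I. y \<noteq> x i \<longrightarrow> d \<le> dist (x i) y" for i using I by (intro finite_set_avoid) simp
  then have "\<forall>i. \<exists>d. d > 0 \<and> (\<forall>y\<in>x ` I. y \<noteq> x i \<longrightarrow> d \<le> dist (x i) y)" by blast
  from choice[OF this] obtain d where d: "\<And>i. d i > 0" "\<And>i y. y \<in> x ` I \<Longrightarrow> y \<noteq> x i \<Longrightarrow> d i \<le> dist (x i) y" by blast
  show thesis
  proof (rule that[of "\<lambda>i. S i \<inter> ball (x i) (d i / 2)"])
    fix i assume i: "i \<in> I"
    show "open (S i \<inter> ball (x i) (d i / 2))" using S(1)[OF i] by (intro open_Int open_ball)
    have "x i \<in> S i \<inter> ball (x i) (d i / 2)" using x(2)[OF i] d(1)[of i] by simp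
    then show "S i \<inter> ball (x i) (d i / 2) \<noteq> {}" by blast
    show "S i \<inter> ball (x i) (d i / 2) \<subseteq> S i" by blast
  next
    have "ball (x i) (d i / 2) \<inter> ball (x j) (d j / 2) = {}" if "i \<in> I" "j \<in> I" "i \<noteq> j" for i j
    proof -
      have "x i \<noteq> x j" using x(1) that by (auto dest: inj_onD)
      then have "d i \<le> dist (x i) (x j)" "d j \<le> dist (x i) (x j)"
        using d(2)[of "x j" i] d(2)[of "x i" j] that by (auto simp: dist_commute)
      then show ?thesis by (intro disjoint_ballI) simp
    qed
    then show "disjoint_family_on (\<lambda>i. S i \<inter> ball (x i) (d i / 2)) I"
      unfolding disjoint_family_on_def by blast
  qed
qed

lemma emeasure_PiM_open_box:
  fixes B :: "nat \<Rightarrow> real set"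
  assumes B: "\<And>i. i \<in> {1..n} \<Longrightarrow> open (B i)" "\<And>i. i \<in> {1..n} \<Longrightarrow> B i \<noteq> {}" "\<And>i. i \<in> {1..n} \<Longrightarrow> B i \<subseteq> {-1<..<1}"
  shows "emeasure (PiM {1..n} (\<lambda>_. lborel)) (PiE {1..n} B) \<noteq> 0" "emeasure (PiM {1..n} (\<lambda>_. lborel)) (PiE {1..n} B) \<noteq> \<infinity>"
proof -
  have e: "emeasure (PiM {1..n} (\<lambda>_. lborel)) (PiE {1..n} B) = (\<Prod>i\<in>{1..n}. emeasure lborel (B i))"
    using B(1) by (intro lborel_prod.emeasure_PiM) auto
  have b: "emeasure lborel (B i) \<noteq> 0 \<and> emeasure lborel (B i) < \<infinity>" if i: "i \<in> {1..n}" for i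
  proof
    obtain x r where xr: "r > 0" "ball x r \<subseteq> B i" using B(1,2)[OF i] by (meson ex_in_conv open_contains_ball)
    have "emeasure lborel (ball x r) \<le> emeasure lborel (B i)" using xr(2) B(1)[OF i] by (intro emeasure_mono) auto
    moreover have "emeasure lborel (ball x r) = ennreal (2 * r)" using xr(1) unfolding ball_eq_greaterThanLessThan by simp
    ultimately show "emeasure lborel (B i) \<noteq> 0" using xr(1) by auto
    have "emeasure lborel (B i) \<le> emeasure lborel {-1<..<1::real}" using B(3)[OF i] by (intro emeasure_mono) auto
    then show "emeasure lborel (B i) < \<infinity>" by (rule order_le_less_trans) simp
  qed
  have nz: "finite A \<Longrightarrow> (\<forall>k\<in>A. g k \<noteq> 0) \<Longrightarrow> prod g A \<noteq> 0" for g :: "nat \<Rightarrow> ennreal" and A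
    by (induction A rule: finite_induct) auto
  show "emeasure (PiM {1..n} (\<lambda>_. lborel)) (PiE {1..n} B) \<noteq> 0" unfolding e using b by (intro nz) auto
  have nt: "finite A \<Longrightarrow> (\<forall>k\<in>A. g k < \<infinity>) \<Longrightarrow> prod g A < \<infinity>" for g :: "nat \<Rightarrow> ennreal" and A
    by (induction A rule: finite_induct) (auto simp: ennreal_mult_less_top)
  have "(\<Prod>i\<in>{1..n}. emeasure lborel (B i)) < \<infinity>" using b by (intro nt) auto
  then show "emeasure (PiM {1..n} (\<lambda>_. lborel)) (PiE {1..n} B) \<noteq> \<infinity>" unfolding e by (metis less_irrefl)
qed

text \<open>If the inequality failed at \<open>t\<close>, continuity would keep the densities apart
  by constants \<open>c1 < c2\<close> near \<open>t\<close>. The defining identity can be tested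
  only on products of disjoint sets, so the test box lies close to \<open>t\<close> but need not
  contain it. Its measure is positive and finite, which contradicts the equality of the two
  integrals.\<close>

lemma correlation_function_le:
  assumes 1: "is_correlation_function M Zf n \<rho>" and 2: "is_correlation_function M Zf n \<rho>'" and t: "t \<in> open_cube n"
  shows "\<rho>' t \<le> \<rho> t"
proof (rule ccontr)
  let ?\<Lambda> = "PiM {1..n} (\<lambda>_. lborel :: real measure)"
  assume "\<not> \<rho>' t \<le> \<rho> t"
  then have "\<rho> t < \<rho>' t" by simp
  then obtain c1 where c1: "\<rho> t < c1" "c1 < \<rho>' t" using dense by blast
  then obtain c2 where c2: "c1 < c2" "c2 < \<rho>' t" using dense by blast
  have "0 \<le> \<rho> t" using 1 t unfolding is_correlation_function_def by blast
  then have c10: "0 < c1" using c1 by simp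
  have l1: "(\<rho> \<longlongrightarrow> \<rho> t) (at t within open_cube n)" and l2: "(\<rho>' \<longlongrightarrow> \<rho>' t) (at t within open_cube n)"
    using 1 2 t unfolding is_correlation_function_def continuous_on_def by blast+
  have "\<forall>\<^sub>F x in at t within open_cube n. \<rho> x < c1 \<and> c2 < \<rho>' x"
    using order_tendstoD(2)[OF l1 c1(1)] order_tendstoD(1)[OF l2 c2(2)] by (rule eventually_conj)
  then obtain W where W: "open W" "t \<in> W" "\<And>x. x \<in> W \<Longrightarrow> x \<noteq> t \<Longrightarrow> x \<in> open_cube n \<Longrightarrow> \<rho> x < c1 \<and> c2 < \<rho>' x"
    unfolding eventually_at_topological by blast
  have W': "\<rho> x < c1 \<and> c2 < \<rho>' x" if "x \<in> W" "x \<in> open_cube n" for x using W(3)[OF that(1) _ that(2)] c1 c2 by (cases "x = t") auto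
  have "openin (product_topology (\<lambda>_. euclidean) UNIV) W" using W(1) unfolding open_fun_def .
  from product_topology_open_contains_basis[OF this W(2)]
  obtain X where X: "t \<in> PiE UNIV X" "\<And>i. open (X i)" "PiE UNIV X \<subseteq> W" by auto
  have tX: "t i \<in> X i" for i using X(1) by auto
  have tc: "t i \<in> {-1<..<1}" if "i \<in> {1..n}" for i using t that by (auto simp: PiE_def Pi_def)
  obtain B where B: "\<And>i. i \<in> {1..n} \<Longrightarrow> open (B i)" "\<And>i. i \<in> {1..n} \<Longrightarrow> B i \<noteq> {}"
    "\<And>i. i \<in> {1..n} \<Longrightarrow> B i \<subseteq> X i \<inter> {-1<..<1}" "disjoint_family_on B {1..n}"
  proof (rule disjoint_open_subsets[of "{1..n}" "\<lambda>i. X i \<inter> {-1<..<1}"])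
    show "open (X i \<inter> {-1<..<1})" for i using X(2) by (intro open_Int) auto
    show "X i \<inter> {-1<..<1} \<noteq> {}" if "i \<in> {1..n}" for i using tX[of i] tc[OF that] by blast
  qed (simp, blast)
  have bnd: "\<rho> x < c1 \<and> c2 < \<rho>' x" if x: "x \<in> PiE {1..n} B" for x
  proof (rule W')
    show "x \<in> open_cube n" by (rule subsetD[OF PiE_mono x]) (use B(3) in blast)
    have "x i \<in> X i" for i
    proof (cases "i \<in> {1..n}")
      case True then show ?thesis using B(3)[OF True] x by (auto simp: PiE_def Pi_def)
    next
      case False
      \<comment> \<open>Off \<open>{1..n}\<close> both functions take the value
        \<open>undefined\<close>, so the neighbourhood of \<open>t\<close> imposes nothing new
        there.\<close>
      then have "x i = t i" using x t by (auto simp: PiE_def extensional_def)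
      then show ?thesis using tX by simp
    qed
    then show "x \<in> W" using X(3) by (auto simp: PiE_def Pi_def)
  qed
  let ?m = "emeasure ?\<Lambda> (PiE {1..n} B)"
  have mB: "?m \<noteq> 0" "?m \<noteq> \<infinity>" using B by (intro emeasure_PiM_open_box; blast)+
  have sB: "PiE {1..n} B \<in> sets ?\<Lambda>" using B(1) by (intro sets_PiM_I_finite) auto
  have H: "(\<forall>i\<in>{1..n}. B i \<in> sets borel \<and> B i \<subseteq> {-1<..<1}) \<and> disjoint_family_on B {1..n}"
    using B(1,3,4) by (auto intro: borel_open)
  have E: "(\<integral>\<^sup>+\<omega>. (\<Prod>i = 1..n. num_points Zf (B i) \<omega>) \<partial>M) = (\<integral>\<^sup>+x\<in>PiE {1..n} B. ennreal (\<rho> x) \<partial>?\<Lambda>)"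
    if "is_correlation_function M Zf n \<rho>" for \<rho>
    by (rule that[unfolded is_correlation_function_def, THEN conjunct2, THEN conjunct2, THEN conjunct2, THEN spec, THEN mp, OF H])
  have eq: "(\<integral>\<^sup>+x\<in>PiE {1..n} B. ennreal (\<rho>' x) \<partial>?\<Lambda>) = (\<integral>\<^sup>+x\<in>PiE {1..n} B. ennreal (\<rho> x) \<partial>?\<Lambda>)"
    using E[OF 1] E[OF 2] by (simp only:)
  have "ennreal c2 * ?m = (\<integral>\<^sup>+x. ennreal c2 * indicator (PiE {1..n} B) x \<partial>?\<Lambda>)"
    by (rule nn_integral_cmult_indicator[OF sB, symmetric])
  also have "\<dots> \<le> (\<integral>\<^sup>+x\<in>PiE {1..n} B. ennreal (\<rho>' x) \<partial>?\<Lambda>)"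
    using bnd by (intro nn_integral_mono) (auto simp: indicator_def less_imp_le intro!: ennreal_leI)
  also have "\<dots> \<le> (\<integral>\<^sup>+x. ennreal c1 * indicator (PiE {1..n} B) x \<partial>?\<Lambda>)"
    unfolding eq using bnd by (intro nn_integral_mono) (auto simp: indicator_def less_imp_le intro!: ennreal_leI)
  also have "\<dots> = ennreal c1 * ?m" by (rule nn_integral_cmult_indicator[OF sB])
  finally have "?m * ennreal c2 \<le> ?m * ennreal c1" unfolding mult.commute[of ?m] .
  then have "ennreal c2 \<le> ennreal c1"
    using mB by (subst (asm) ennreal_mult_le_mult_iff) (simp_all del: One_nat_def)
  then show False using c2(1) c10 by (simp add: ennreal_le_iff)
qed

lemma (in gaussian_series) is_correlation_function_rho: "is_correlation_function M (real_zeros a) n (rho n)"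
  unfolding is_correlation_function_def
proof (intro conjI ballI impI allI continuous_rho)
  fix x assume x: "x \<in> open_cube n"
  show "0 \<le> rho n x"
  proof (cases "inj_on x {1..n}")
    case True then show ?thesis by (rule rho_nonneg_distinct[OF x])
  next
    case False
    then obtain i j where "i \<in> {1..n}" "j \<in> {1..n}" "i \<noteq> j" "x i = x j" by (auto simp: inj_on_def)
    then show ?thesis by (simp only: rho_coincident)
  qed
next
  fix B :: "real set" assume "B \<in> sets borel" "B \<subseteq> {-1<..<1}"
  then show "num_points (real_zeros a) B \<in> borel_measurable (completion M)" by (rule measurable_num_points)
next
  fix B :: "nat \<Rightarrow> real set" assume "(\<forall>i\<in>{1..n}. B i \<in> sets borel \<and> B i \<subseteq> {-1<..<1}) \<and> disjoint_family_on B {1..n}"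
  then show "(\<integral>\<^sup>+\<omega>. (\<Prod>i = 1..n. num_points (real_zeros a) (B i) \<omega>) \<partial>M) =
      (\<integral>\<^sup>+x\<in>PiE {1..n} B. ennreal (rho n x) \<partial>(PiM {1..n} (\<lambda>_. lborel)))"
    by (intro borel_moment_zeros) blast+
qed

text \<open>Existence is stated together with the identity so that the latter is not vacuous;
  uniqueness comes from applying \<open>correlation_function_le\<close> in both directions.\<close>

theorem theorem2p1:
  fixes M :: "'w measure" and a :: "nat \<Rightarrow> 'w \<Rightarrow> real" and n :: nat
  assumes "prob_space M"
    and "prob_space.indep_vars M (\<lambda>_. borel) a UNIV"
    and "\<And>k. distributed M lborel (a k) (\<lambda>x. ennreal (std_normal_density x))"
    and "n \<ge> 1"
  shows "(\<exists>\<rho>. is_correlation_function M (real_zeros a) n \<rho>) \<and>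
    (\<forall>\<rho>. is_correlation_function M (real_zeros a) n \<rho> \<longrightarrow>
      (\<forall>t \<in> open_cube n.
        \<rho> t = (1 / pi) ^ n * pfaffian n (block_matrix (\<lambda>i j. kernel_K (t i) (t j)))))"
proof -
  interpret gaussian_series M a
    by (intro gaussian_series.intro gaussian_series_axioms.intro assms(1-3))
  show ?thesis
  proof (intro conjI allI impI ballI)
    show "\<exists>\<rho>. is_correlation_function M (real_zeros a) n \<rho>"
      using is_correlation_function_rho by blast
    fix \<rho> t assume \<rho>: "is_correlation_function M (real_zeros a) n \<rho>" and t: "t \<in> open_cube n"
    have "\<rho> t = rho n t"
      by (rule antisym[OF correlation_function_le[OF is_correlation_function_rho \<rho> t] correlation_function_le[OF \<rho> is_correlation_function_rho t]])
    then show "\<rho> t = (1 / pi) ^ n * pfaffian n (block_matrix (\<lambda>i j. kernel_K (t i) (t j)))"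
      by (simp only: rho_eq_pfaffian)
  qed
qed

end
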